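(* Let $F$ be a field of characteristic zero and, for $n\ge 0$, let $L_n:=L((1^n))$ in Deligne's category $\underline{\mathrm{Rep}}(S_0;F)$ (parameter $t=0$). The nontrivial block in $\underline{\mathrm{Rep}}(S_0;F)$ has indecomposable objects $L_0,L_1,L_2,\ldots$ and is described by the quiver with vertices $L_n$ ($n\ge0$) and arrows $$\alpha_n:L_n\to L_{n+1},\qquad \beta_n:L_{n+1}\to L_n\qquad (n\ge 0)$$ with relations: $\beta_0\alpha_0=0$, and $\alpha_n\alpha_{n-1}=0$, $\beta_{n-1}\beta_n=0$, $\beta_n\alpha_n=\alpha_{n-1}\beta_{n-1}$ for all $n>0$.
   Context: The category. For $t\in F$ and $n,m\ge 0$ let $P_{n,m}$ be the set of all set partitions of $\{1,\ldots,n,1',\ldots,m'\}$ ($P_{0,0}$ consists of the empty partition), and $FP_{n,m}$ the $F$-vector space with basis $P_{n,m}$. For $\pi\in P_{n,m}$, $\mu\in P_{m,l}$, let $\mu\star\pi$ be the partition of $\{1,\ldots,n,1'',\ldots,m'',1',\ldots,l'\}$ obtained by identifying the vertex $j'$ of $\pi$ with the vertex $j$ of $\mu$, renamed $j''$, and taking connected components of the glued graph; $\ell(\mu,\pi)$ is the number of parts of $\mu\star\pi$ consisting only of doubly primed elements, and $\mu\cdot\pi\in P_{n,l}$ is the restriction of $\mu\star\pi$ to $\{1,\ldots,n,1',\ldots,l'\}$. The category $\underline{\mathrm{Rep}}_0(S_t;F)$ has objects $[n]$ ($n\ge 0$), $\mathrm{Hom}([n],[m])=FP_{n,m}$, and bilinear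 composition with $\mu\circ\pi=t^{\ell(\mu,\pi)}\,\mu\cdot\pi$ (with $0^0=1$). Write $FP_n(t)=\mathrm{End}([n])$. $\underline{\mathrm{Rep}}(S_t;F)$ is the Karoubian (idempotent) completion of the additive envelope of $\underline{\mathrm{Rep}}_0(S_t;F)$; for idempotents $e\in FP_n(t)$, $f\in FP_m(t)$ it has objects $([n],e)$, $([m],f)$ with $\mathrm{Hom}(([n],e),([m],f))=f\,FP_{n,m}\,e$. The objects $L(\lambda)$. For $n\ge1$, identify $\sigma\in S_n$ with the partition $\{\{i,\sigma(i)'\}\mid 1\le i\le n\}$; the span of $P_{n,n}\setminus S_n$ is a two-sided ideal of $FP_n(t)$ with quotient $FS_n$. For a Young diagram $\lambda$ with $|\lambda|=n\ge 1$ boxes let $e_\lambda\in FP_n(t)$ be a primitive idempotent whose image in $FS_n$ is a primitive idempotent corresponding to the simple $S_n$-module $L_\lambda$ (such $e_\lambda$ exists and is unique up to conjugation; $L_{(n)}$ is the trivial module), and put $L(\lambda)=([n],e_\lambda)$; put $L(\varnothing)=([0],\mathrm{id}_0)$. Every nonzero indecomposable object is isomorphic to exactly one $L(\lambda)$. $(1^n)$ denotes the Young diagram with $n$ rows of length one ($(1^0)=\varnothing$). Blocks. Consider the weakest equivalence relation on isomorphism classes of indecomposable objects such that two indecomposables are equivalent whenever there is a nonzero morphism between them; its equivalence classes are the blocks; the word block also denotes the full subcategory whose objects are the direct sums of indecomposables in one class. A block is trivial if it contains only one indecomposable object up to isomorphism and the endomorphism ring of that object is $F$; otherwise it is nontrivial.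 The category $\underline{\mathrm{Rep}}(S_0;F)$ has exactly one nontrivial block. A block is described by a quiver with relations if its full subcategory on the indecomposables $L_n$ is isomorphic (with $L_n$ corresponding to the vertex $L_n$) to the $F$-linear path category of the quiver modulo the ideal generated by the relations. *)

theory Defs
  imports
    "HOL-Algebra.Ring"
    "HOL-Combinatorics.Permutations"
    "HOL-Library.Disjoint_Sets"
begin

section \<open>Linear categories\<close>

text \<open>
  Only the data are recorded. Hom sets of different pairs of objects need not be disjoint, so the
  operations take the objects as arguments; \<open>Comp C x y z g f\<close> is the composite of
  \<open>f : x \<rightarrow> y\<close> and \<open>g : y \<rightarrow> z\<close>.
\<close>

record ('f, 'o, 'm) lincat =
  Obj :: "'o set"
  Hom :: "'o \<Rightarrow> 'o \<Rightarrow> 'm set"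
  Comp :: "'o \<Rightarrow> 'o \<Rightarrow> 'o \<Rightarrow> 'm \<Rightarrow> 'm \<Rightarrow> 'm"
  Idn :: "'o \<Rightarrow> 'm"
  Zer :: "'o \<Rightarrow> 'o \<Rightarrow> 'm"
  Pls :: "'o \<Rightarrow> 'o \<Rightarrow> 'm \<Rightarrow> 'm \<Rightarrow> 'm"
  Scal :: "'o \<Rightarrow> 'o \<Rightarrow> 'f \<Rightarrow> 'm \<Rightarrow> 'm"

definition full_subcat :: "('f, 'o, 'm) lincat \<Rightarrow> 'o set \<Rightarrow> ('f, 'o, 'm) lincat" where
  "full_subcat C S = C\<lparr>Obj := S\<rparr>"

definition end_ring :: "('f, 'o, 'm) lincat \<Rightarrow> 'o \<Rightarrow> 'm ring" where
  "end_ring C x = \<lparr>carrier = Hom C x x, monoid.mult = Comp C x x x, one = Idn C x,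
                   zero = Zer C x x, add = Pls C x x\<rparr>"

definition isomorphic :: "('f, 'o, 'm) lincat \<Rightarrow> 'o \<Rightarrow> 'o \<Rightarrow> bool" where
  "isomorphic C x y \<longleftrightarrow>
     (\<exists>f\<in>Hom C x y. \<exists>g\<in>Hom C y x. Comp C x y x g f = Idn C x \<and> Comp C y x y f g = Idn C y)"

definition zero_object :: "('f, 'o, 'm) lincat \<Rightarrow> 'o \<Rightarrow> bool" where
  "zero_object C x \<longleftrightarrow> Idn C x = Zer C x x"

definition is_direct_sum :: "('f, 'o, 'm) lincat \<Rightarrow> 'o \<Rightarrow> 'o \<Rightarrow> 'o \<Rightarrow> bool" where
  "is_direct_sum C z x y \<longleftrightarrow>
     (\<exists>i\<in>Hom C x z. \<exists>j\<in>Hom C y z. \<exists>p\<in>Hom C z x. \<exists>q\<in>Hom C z y.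
        Comp C x z x p i = Idn C x \<and> Comp C y z y q j = Idn C y \<and>
        Comp C y z x p j = Zer C y x \<and> Comp C x z y q i = Zer C x y \<and>
        Pls C z z (Comp C z x z i p) (Comp C z y z j q) = Idn C z)"

definition indecomposable :: "('f, 'o, 'm) lincat \<Rightarrow> 'o \<Rightarrow> bool" where
  "indecomposable C z \<longleftrightarrow> z \<in> Obj C \<and> \<not> zero_object C z \<and>
     (\<forall>x\<in>Obj C. \<forall>y\<in>Obj C. is_direct_sum C z x y \<longrightarrow> zero_object C x \<or> zero_object C y)"

definition lincat_iso ::
    "('f, 'o, 'm) lincat \<Rightarrow> ('f, 'p, 'k) lincat \<Rightarrow> ('o \<Rightarrow> 'p) \<Rightarrow> ('o \<Rightarrow> 'o \<Rightarrow> 'm \<Rightarrow> 'k) \<Rightarrow> bool" where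
  "lincat_iso C D \<phi> \<Phi> \<longleftrightarrow>
     bij_betw \<phi> (Obj C) (Obj D) \<and>
     (\<forall>x\<in>Obj C. \<Phi> x x (Idn C x) = Idn D (\<phi> x)) \<and>
     (\<forall>x\<in>Obj C. \<forall>y\<in>Obj C.
        bij_betw (\<Phi> x y) (Hom C x y) (Hom D (\<phi> x) (\<phi> y)) \<and>
        (\<forall>f\<in>Hom C x y. \<forall>g\<in>Hom C x y.
           \<Phi> x y (Pls C x y f g) = Pls D (\<phi> x) (\<phi> y) (\<Phi> x y f) (\<Phi> x y g)) \<and>
        (\<forall>c. \<forall>f\<in>Hom C x y. \<Phi> x y (Scal C x y c f) = Scal D (\<phi> x) (\<phi> y) c (\<Phi> x y f))) \<and>
     (\<forall>x\<in>Obj C. \<forall>y\<in>Obj C. \<forall>z\<in>Obj C. \<forall>f\<in>Hom C x y. \<forall>g\<in>Hom C y z.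
        \<Phi> x z (Comp C x y z g f) = Comp D (\<phi> x) (\<phi> y) (\<phi> z) (\<Phi> y z g) (\<Phi> x y f))"


section \<open>Blocks\<close>

definition iso_class :: "('f, 'o, 'm) lincat \<Rightarrow> 'o \<Rightarrow> 'o set" where
  "iso_class C x = {y \<in> Obj C. isomorphic C x y}"

definition indec_classes :: "('f, 'o, 'm) lincat \<Rightarrow> 'o set set" where
  "indec_classes C = {iso_class C x |x. indecomposable C x}"

definition linked :: "('f, 'o, 'm) lincat \<Rightarrow> ('o set \<times> 'o set) set" where
  "linked C = {(X, Y). X \<in> indec_classes C \<and> Y \<in> indec_classes C \<and>
                       (\<exists>x\<in>X. \<exists>y\<in>Y. \<exists>f\<in>Hom C x y. f \<noteq> Zer C x y)}"

definition block_equiv :: "('f, 'o, 'm) lincat \<Rightarrow> ('o set \<times> 'o set) set" where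
  "block_equiv C = \<Inter>{E. equiv (indec_classes C) E \<and> linked C \<subseteq> E}"

definition is_block :: "('f, 'o, 'm) lincat \<Rightarrow> 'o set set \<Rightarrow> bool" where
  "is_block C B \<longleftrightarrow> B \<in> indec_classes C // block_equiv C"

definition trivial_block :: "('f, 'o, 'm) lincat \<Rightarrow> 'o set set \<Rightarrow> bool" where
  "trivial_block C B \<longleftrightarrow> is_block C B \<and>
     (\<exists>x\<in>Obj C. B = {iso_class C x} \<and> Hom C x x = range (\<lambda>c. Scal C x x c (Idn C x)))"

definition nontrivial_block :: "('f, 'o, 'm) lincat \<Rightarrow> 'o set set \<Rightarrow> bool" where
  "nontrivial_block C B \<longleftrightarrow> is_block C B \<and> \<not> trivial_block C B"


section \<open>Additive envelope and Karoubian completion\<close>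

text \<open>
  Objects of the additive envelope are lists (formal finite direct sums); a morphism is a matrix
  whose entry at row \<open>j\<close> and column \<open>i\<close> is a morphism from the \<open>i\<close>-th summand of the source to the
  \<open>j\<close>-th summand of the target. Entries outside the format are \<^const>\<open>undefined\<close>.
\<close>

definition mat_of :: "'o list \<Rightarrow> 'o list \<Rightarrow> (nat \<Rightarrow> nat \<Rightarrow> 'm) \<Rightarrow> nat \<Rightarrow> nat \<Rightarrow> 'm" where
  "mat_of xs ys a = (\<lambda>j i. if j < length ys \<and> i < length xs then a j i else undefined)"

definition additive_env :: "('f, 'o, 'm) lincat \<Rightarrow> ('f, 'o list, nat \<Rightarrow> nat \<Rightarrow> 'm) lincat" where
  "additive_env C = \<lparr>
     Obj = lists (Obj C),
     Hom = (\<lambda>xs ys. {mat_of xs ys a |a.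
              \<forall>j<length ys. \<forall>i<length xs. a j i \<in> Hom C (xs ! i) (ys ! j)}),
     Comp = (\<lambda>xs ys zs b a. mat_of xs zs (\<lambda>k i.
              foldr (\<lambda>j. Pls C (xs ! i) (zs ! k) (Comp C (xs ! i) (ys ! j) (zs ! k) (b k j) (a j i)))
                [0..<length ys] (Zer C (xs ! i) (zs ! k)))),
     Idn = (\<lambda>xs. mat_of xs xs (\<lambda>j i. if i = j then Idn C (xs ! i) else Zer C (xs ! i) (xs ! j))),
     Zer = (\<lambda>xs ys. mat_of xs ys (\<lambda>j i. Zer C (xs ! i) (ys ! j))),
     Pls = (\<lambda>xs ys a b. mat_of xs ys (\<lambda>j i. Pls C (xs ! i) (ys ! j) (a j i) (b j i))),
     Scal = (\<lambda>xs ys c a. mat_of xs ys (\<lambda>j i. Scal C (xs ! i) (ys ! j) c (a j i)))\<rparr>"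

definition karoubi :: "('f, 'o, 'm) lincat \<Rightarrow> ('f, 'o \<times> 'm, 'm) lincat" where
  "karoubi C = \<lparr>
     Obj = {(x, e). x \<in> Obj C \<and> e \<in> Hom C x x \<and> Comp C x x x e e = e},
     Hom = (\<lambda>(x, e) (y, f). {Comp C x y y f (Comp C x x y h e) |h. h \<in> Hom C x y}),
     Comp = (\<lambda>(x, _) (y, _) (z, _). Comp C x y z),
     Idn = snd,
     Zer = (\<lambda>(x, _) (y, _). Zer C x y),
     Pls = (\<lambda>(x, _) (y, _). Pls C x y),
     Scal = (\<lambda>(x, _) (y, _). Scal C x y)\<rparr>"


section \<open>Deligne's category\<close>

text \<open>\<open>Src i\<close>, \<open>Tgt i\<close>, \<open>Mid i\<close> are the vertices \<open>i\<close>, \<open>i'\<close>, \<open>i''\<close>.\<close>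

datatype vertex = Src nat | Mid nat | Tgt nat

type_synonym diagram = "vertex set set"

definition diagrams :: "nat \<Rightarrow> nat \<Rightarrow> diagram set" where
  "diagrams n m = {\<pi>. partition_on (Src ` {1..n} \<union> Tgt ` {1..m}) \<pi>}"

fun tgt_to_mid :: "vertex \<Rightarrow> vertex" where
  "tgt_to_mid (Src i) = Src i"
| "tgt_to_mid (Mid i) = Mid i"
| "tgt_to_mid (Tgt i) = Mid i"

fun src_to_mid :: "vertex \<Rightarrow> vertex" where
  "src_to_mid (Src i) = Mid i"
| "src_to_mid (Mid i) = Mid i"
| "src_to_mid (Tgt i) = Tgt i"

definition glued_parts :: "diagram \<Rightarrow> diagram \<Rightarrow> diagram" where
  "glued_parts \<mu> \<pi> = (\<lambda>B. tgt_to_mid ` B) ` \<pi> \<union> (\<lambda>B. src_to_mid ` B) ` \<mu>"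

definition glued :: "diagram \<Rightarrow> diagram \<Rightarrow> diagram" where
  "glued \<mu> \<pi> = \<Union>(glued_parts \<mu> \<pi>) // {(x, y). \<exists>B\<in>glued_parts \<mu> \<pi>. x \<in> B \<and> y \<in> B}\<^sup>*"

definition loops :: "diagram \<Rightarrow> diagram \<Rightarrow> nat" where
  "loops \<mu> \<pi> = card {B \<in> glued \<mu> \<pi>. B \<subseteq> range Mid}"

definition diagram_comp :: "diagram \<Rightarrow> diagram \<Rightarrow> diagram" where
  "diagram_comp \<mu> \<pi> = (\<lambda>B. B - range Mid) ` glued \<mu> \<pi> - {{}}"

definition id_diagram :: "nat \<Rightarrow> diagram" where
  "id_diagram n = (\<lambda>i. {Src i, Tgt i}) ` {1..n}"

text \<open>
  An element of \<open>FP\<^sub>n\<^sub>,\<^sub>m\<close> is its coefficient function on diagrams, which vanishes off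
  \<^term>\<open>diagrams n m\<close>. The object \<open>[n]\<close> is the number \<open>n\<close>.
\<close>

definition rep0 :: "'f::field_char_0 \<Rightarrow> ('f, nat, diagram \<Rightarrow> 'f) lincat" where
  "rep0 t = \<lparr>
     Obj = UNIV,
     Hom = (\<lambda>n m. {f. \<forall>\<pi>. f \<pi> \<noteq> 0 \<longrightarrow> \<pi> \<in> diagrams n m}),
     Comp = (\<lambda>n m l g f. \<lambda>\<rho>. \<Sum>\<mu>\<in>diagrams m l. \<Sum>\<pi>\<in>diagrams n m.
              if diagram_comp \<mu> \<pi> = \<rho> then g \<mu> * f \<pi> * t ^ loops \<mu> \<pi> else 0),
     Idn = (\<lambda>n \<pi>. if \<pi> = id_diagram n then 1 else 0),
     Zer = (\<lambda>n m \<pi>. 0),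
     Pls = (\<lambda>n m f g \<pi>. f \<pi> + g \<pi>),
     Scal = (\<lambda>n m c f \<pi>. c * f \<pi>)\<rparr>"

type_synonym 'f rep_mor = "nat \<Rightarrow> nat \<Rightarrow> diagram \<Rightarrow> 'f"
type_synonym 'f rep_obj = "nat list \<times> 'f rep_mor"

definition rep_S :: "'f::field_char_0 \<Rightarrow> ('f, 'f rep_obj, 'f rep_mor) lincat" where
  "rep_S t = karoubi (additive_env (rep0 t))"

text \<open>The object \<open>([n], e)\<close>, with \<open>e\<close> viewed as a matrix of format 1 by 1.\<close>

definition obj_of :: "nat \<Rightarrow> (diagram \<Rightarrow> 'f) \<Rightarrow> 'f rep_obj" where
  "obj_of n e = ([n], mat_of [n] [n] (\<lambda>_ _. e))"


section \<open>The objects attached to Young diagrams\<close>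

definition idempotent :: "('a, 'b) ring_scheme \<Rightarrow> 'a \<Rightarrow> bool" where
  "idempotent R e \<longleftrightarrow> e \<in> carrier R \<and> e \<otimes>\<^bsub>R\<^esub> e = e"

definition primitive_idempotent :: "('a, 'b) ring_scheme \<Rightarrow> 'a \<Rightarrow> bool" where
  "primitive_idempotent R e \<longleftrightarrow> idempotent R e \<and> e \<noteq> \<zero>\<^bsub>R\<^esub> \<and>
     (\<forall>f g. idempotent R f \<and> idempotent R g \<and> f \<otimes>\<^bsub>R\<^esub> g = \<zero>\<^bsub>R\<^esub> \<and> g \<otimes>\<^bsub>R\<^esub> f = \<zero>\<^bsub>R\<^esub> \<and>
            e = f \<oplus>\<^bsub>R\<^esub> g \<longrightarrow> f = \<zero>\<^bsub>R\<^esub> \<or> g = \<zero>\<^bsub>R\<^esub>)"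

definition group_algebra :: "nat \<Rightarrow> ((nat \<Rightarrow> nat) \<Rightarrow> 'f::field_char_0) ring" where
  "group_algebra n = \<lparr>
     carrier = {x. \<forall>\<sigma>. x \<sigma> \<noteq> 0 \<longrightarrow> \<sigma> permutes {1..n}},
     monoid.mult = (\<lambda>x y \<rho>. \<Sum>\<sigma> | \<sigma> permutes {1..n}. \<Sum>\<tau> | \<tau> permutes {1..n}.
              if \<sigma> \<circ> \<tau> = \<rho> then x \<sigma> * y \<tau> else 0),
     one = (\<lambda>\<rho>. if \<rho> = id then 1 else 0),
     zero = (\<lambda>\<rho>. 0),
     add = (\<lambda>x y \<rho>. x \<rho> + y \<rho>)\<rparr>"

definition perm_diagram :: "nat \<Rightarrow> (nat \<Rightarrow> nat) \<Rightarrow> diagram" where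
  "perm_diagram n \<sigma> = (\<lambda>i. {Src i, Tgt (\<sigma> i)}) ` {1..n}"

text \<open>
  The quotient map from \<open>FP\<^sub>n(t)\<close> onto \<open>FS\<^sub>n\<close>: it forgets the coefficients of all diagrams that are
  not permutations.
\<close>

definition to_group_algebra :: "nat \<Rightarrow> (diagram \<Rightarrow> 'f) \<Rightarrow> (nat \<Rightarrow> nat) \<Rightarrow> 'f::field_char_0" where
  "to_group_algebra n x = (\<lambda>\<sigma>. if \<sigma> permutes {1..n} then x (perm_diagram n \<sigma>) else 0)"

text \<open>A Young diagram is the list of its row lengths.\<close>

definition young_diagram :: "nat list \<Rightarrow> bool" where
  "young_diagram la \<longleftrightarrow> sorted_wrt (\<ge>) la \<and> 0 \<notin> set la"

text \<open>
  \<open>box_of la i\<close> is the box (row, column), both counted from 0, of the number \<open>i \<in> {1..|\<lambda>|}\<close> in the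
  standard tableau filled row by row.
\<close>

definition box_of :: "nat list \<Rightarrow> nat \<Rightarrow> nat \<times> nat" where
  "box_of la i = (THE (r, c). r < length la \<and> c < la ! r \<and> i = sum_list (take r la) + c + 1)"

definition row_group :: "nat list \<Rightarrow> (nat \<Rightarrow> nat) set" where
  "row_group la = {\<sigma>. \<sigma> permutes {1..sum_list la} \<and>
                      (\<forall>i\<in>{1..sum_list la}. fst (box_of la (\<sigma> i)) = fst (box_of la i))}"

definition column_group :: "nat list \<Rightarrow> (nat \<Rightarrow> nat) set" where
  "column_group la = {\<sigma>. \<sigma> permutes {1..sum_list la} \<and>
                         (\<forall>i\<in>{1..sum_list la}. snd (box_of la (\<sigma> i)) = snd (box_of la i))}"

definition young_symmetrizer :: "nat list \<Rightarrow> (nat \<Rightarrow> nat) \<Rightarrow> 'f::field_char_0" where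
  "young_symmetrizer la =
     (\<lambda>\<sigma>. if \<sigma> \<in> row_group la then 1 else 0)
       \<otimes>\<^bsub>group_algebra (sum_list la)\<^esub>
     (\<lambda>\<sigma>. if \<sigma> \<in> column_group la then of_int (sign \<sigma>) else 0)"

definition left_ideal :: "('a, 'b) ring_scheme \<Rightarrow> 'a \<Rightarrow> 'a set" where
  "left_ideal R a = {x \<otimes>\<^bsub>R\<^esub> a |x. x \<in> carrier R}"

definition left_module_iso :: "('a, 'b) ring_scheme \<Rightarrow> 'a set \<Rightarrow> 'a set \<Rightarrow> bool" where
  "left_module_iso R M N \<longleftrightarrow>
     (\<exists>\<phi>. bij_betw \<phi> M N \<and> (\<forall>x\<in>M. \<forall>y\<in>M. \<phi> (x \<oplus>\<^bsub>R\<^esub> y) = \<phi> x \<oplus>\<^bsub>R\<^esub> \<phi> y) \<and>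
          (\<forall>r\<in>carrier R. \<forall>x\<in>M. \<phi> (r \<otimes>\<^bsub>R\<^esub> x) = r \<otimes>\<^bsub>R\<^esub> \<phi> x))"

text \<open>
  \<open>e\<^sub>\<lambda>\<close>: the simple module \<open>L\<^sub>\<lambda>\<close> is the left ideal generated by the Young symmetrizer (this is the
  trivial module for a single row), and a primitive idempotent \<open>e\<close> of \<open>FS\<^sub>n\<close> corresponds to the
  module \<open>FS\<^sub>n e\<close>.
\<close>

definition is_e :: "'f::field_char_0 \<Rightarrow> nat list \<Rightarrow> (diagram \<Rightarrow> 'f) \<Rightarrow> bool" where
  "is_e t la e \<longleftrightarrow>
     (let n = sum_list la; A = group_algebra n; e' = to_group_algebra n e in
        primitive_idempotent (end_ring (rep0 t) n) e \<and>
        primitive_idempotent A e' \<and>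
        left_module_iso A (left_ideal A e') (left_ideal A (young_symmetrizer la)))"

text \<open>
  \<open>L(\<lambda>)\<close> depends, up to isomorphism only, on the choice of \<open>e\<^sub>\<lambda>\<close>; the predicate holds for every
  admissible choice.
\<close>

definition is_L :: "'f::field_char_0 \<Rightarrow> nat list \<Rightarrow> 'f rep_obj \<Rightarrow> bool" where
  "is_L t la X \<longleftrightarrow> young_diagram la \<and>
     (if la = [] then X = obj_of 0 (Idn (rep0 t) 0)
      else \<exists>e. is_e t la e \<and> X = obj_of (sum_list la) e)"


section \<open>Quivers with relations\<close>

record ('v, 'a) quiver =
  verts :: "'v set"
  arrows :: "'a set"
  source :: "'a \<Rightarrow> 'v"
  target :: "'a \<Rightarrow> 'v"

text \<open>
  A path is the list of its arrows in the order in which the composite is written: the last arrow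
  of the list is the first one to be followed.
\<close>

fun is_path :: "('v, 'a) quiver \<Rightarrow> 'v \<Rightarrow> 'a list \<Rightarrow> 'v \<Rightarrow> bool" where
  "is_path Q u [] v \<longleftrightarrow> u \<in> verts Q \<and> u = v"
| "is_path Q u (a # p) v \<longleftrightarrow> a \<in> arrows Q \<and> target Q a = v \<and> is_path Q u p (source Q a)"

definition path_cat :: "('v, 'a) quiver \<Rightarrow> ('f::field_char_0, 'v, 'a list \<Rightarrow> 'f) lincat" where
  "path_cat Q = \<lparr>
     Obj = verts Q,
     Hom = (\<lambda>u v. {f. finite {p. f p \<noteq> 0} \<and> (\<forall>p. f p \<noteq> 0 \<longrightarrow> is_path Q u p v)}),
     Comp = (\<lambda>u v w g f p. \<Sum>k\<le>length p. g (take k p) * f (drop k p)),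
     Idn = (\<lambda>u p. if p = [] then 1 else 0),
     Zer = (\<lambda>u v p. 0),
     Pls = (\<lambda>u v f g p. f p + g p),
     Scal = (\<lambda>u v c f p. c * f p)\<rparr>"

inductive ideal_gen :: "('f, 'o, 'm) lincat \<Rightarrow> ('o \<times> 'o \<times> 'm) set \<Rightarrow> 'o \<Rightarrow> 'o \<Rightarrow> 'm \<Rightarrow> bool"
  for C R where
  gen: "(x, y, r) \<in> R \<Longrightarrow> ideal_gen C R x y r"
| zer: "x \<in> Obj C \<Longrightarrow> y \<in> Obj C \<Longrightarrow> ideal_gen C R x y (Zer C x y)"
| pls: "ideal_gen C R x y f \<Longrightarrow> ideal_gen C R x y g \<Longrightarrow> ideal_gen C R x y (Pls C x y f g)"
| scal: "ideal_gen C R x y f \<Longrightarrow> ideal_gen C R x y (Scal C x y c f)"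
| left: "ideal_gen C R x y f \<Longrightarrow> z \<in> Obj C \<Longrightarrow> g \<in> Hom C y z \<Longrightarrow> ideal_gen C R x z (Comp C x y z g f)"
| right: "ideal_gen C R x y f \<Longrightarrow> w \<in> Obj C \<Longrightarrow> g \<in> Hom C w x \<Longrightarrow> ideal_gen C R w y (Comp C w x y f g)"

definition coset :: "('f, 'o, 'm) lincat \<Rightarrow> ('o \<Rightarrow> 'o \<Rightarrow> 'm \<Rightarrow> bool) \<Rightarrow> 'o \<Rightarrow> 'o \<Rightarrow> 'm \<Rightarrow> 'm set" where
  "coset C I x y f = {Pls C x y f h |h. I x y h}"

text \<open>
  Operations on cosets are unions over all representatives; when \<open>I\<close> is an ideal all members of such
  a union coincide.
\<close>

definition quotient_cat ::
    "('f, 'o, 'm) lincat \<Rightarrow> ('o \<Rightarrow> 'o \<Rightarrow> 'm \<Rightarrow> bool) \<Rightarrow> ('f, 'o, 'm set) lincat" where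
  "quotient_cat C I = \<lparr>
     Obj = Obj C,
     Hom = (\<lambda>x y. coset C I x y ` Hom C x y),
     Comp = (\<lambda>x y z G F. \<Union>g\<in>G. \<Union>f\<in>F. coset C I x z (Comp C x y z g f)),
     Idn = (\<lambda>x. coset C I x x (Idn C x)),
     Zer = (\<lambda>x y. coset C I x y (Zer C x y)),
     Pls = (\<lambda>x y F G. \<Union>f\<in>F. \<Union>g\<in>G. coset C I x y (Pls C x y f g)),
     Scal = (\<lambda>x y c F. \<Union>f\<in>F. coset C I x y (Scal C x y c f))\<rparr>"

definition quiver_cat ::
    "('v, 'a) quiver \<Rightarrow> ('v \<times> 'v \<times> ('a list \<Rightarrow> 'f)) set \<Rightarrow> ('f::field_char_0, 'v, ('a list \<Rightarrow> 'f) set) lincat" where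
  "quiver_cat Q R = quotient_cat (path_cat Q) (ideal_gen (path_cat Q) R)"

text \<open>
  The family \<open>L\<close>, indexed by the vertices, is a list of representatives of the isomorphism classes
  in the block \<open>B\<close>, and the full subcategory on \<open>L\<close> is presented by \<open>Q\<close> and \<open>R\<close>, with the vertex
  \<open>v\<close> corresponding to \<open>L v\<close>.
\<close>

definition described_by ::
    "('f::field_char_0, 'o, 'm) lincat \<Rightarrow> 'o set set \<Rightarrow> ('v \<Rightarrow> 'o) \<Rightarrow>
     ('v, 'a) quiver \<Rightarrow> ('v \<times> 'v \<times> ('a list \<Rightarrow> 'f)) set \<Rightarrow> bool" where
  "described_by C B L Q R \<longleftrightarrow>
     bij_betw (\<lambda>v. iso_class C (L v)) (verts Q) B \<and>
     (\<exists>\<Phi>. lincat_iso (quiver_cat Q R) (full_subcat C (L ` verts Q)) L \<Phi>)"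


section \<open>The quiver with vertices \<open>L\<^sub>n\<close>\<close>

datatype arrow = Alpha nat | Beta nat

definition line_quiver :: "(nat, arrow) quiver" where
  "line_quiver = \<lparr>
     verts = UNIV,
     arrows = UNIV,
     source = (\<lambda>a. case a of Alpha n \<Rightarrow> n | Beta n \<Rightarrow> n + 1),
     target = (\<lambda>a. case a of Alpha n \<Rightarrow> n + 1 | Beta n \<Rightarrow> n)\<rparr>"

definition path_elem :: "'a list \<Rightarrow> 'a list \<Rightarrow> 'f::field_char_0" where
  "path_elem p = (\<lambda>q. if q = p then 1 else 0)"

text \<open>A triple \<open>(u, v, r)\<close> is the relation \<open>r = 0\<close> between morphisms \<open>u \<rightarrow> v\<close>.\<close>

definition line_relations :: "(nat \<times> nat \<times> (arrow list \<Rightarrow> 'f::field_char_0)) set" where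
  "line_relations =
     {(0, 0, path_elem [Beta 0, Alpha 0])}
     \<union> {(n - 1, n + 1, path_elem [Alpha n, Alpha (n - 1)]) |n. n > 0}
     \<union> {(n + 1, n - 1, path_elem [Beta (n - 1), Beta n]) |n. n > 0}
     \<union> {(n, n, \<lambda>p. path_elem [Beta n, Alpha n] p - path_elem [Alpha (n - 1), Beta (n - 1)] p) |n. n > 0}"

end

theory Submission
  imports Defs "HOL.Vector_Spaces"
begin

text \<open>
  Let \<open>\<Lambda>\<^sub>n\<close> be \<open>[n]\<close> cut out by the antisymmetrizer \<open>alt n\<close>. A primitive idempotent \<open>x\<close> lifting the
  sign idempotent satisfies \<open>alt n * x * alt n = alt n + d xi n\<close> with \<open>xi n\<close> nilpotent, so \<open>L\<^sub>n\<close> is isomorphic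
  to \<open>\<Lambda>\<^sub>n\<close>. Antisymmetrizing a diagram on both sides leaves only multiples of \<open>alt n\<close>, of
  \<open>al n : \<Lambda>\<^sub>n \<rightarrow> \<Lambda>\<^sub>n\<^sub>+\<^sub>1\<close>, of its transpose \<open>be n\<close> and of \<open>xi (n + 1) = al n * be n\<close>; at parameter 0
  their products are those of the quiver, up to rescaling \<open>be\<close>.

  An indecomposable \<open>X\<close> not isomorphic to any \<open>\<Lambda>\<^sub>j\<close> has no nonzero morphisms to \<open>\<Lambda>\<^sub>i\<close>: the composites
  of a component \<open>\<phi> : [m] \<rightarrow> \<Lambda>\<^sub>i\<close> of such a morphism with morphisms \<open>\<Lambda>\<^sub>i \<rightarrow> [m]\<close> are multiples of \<open>xi i\<close>,
  and every \<open>\<phi>\<close> with this property is of the form \<open>al (i - 1) * a + be i * b\<close>. (Induction on \<open>m\<close>: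
  merging strands reduces this to diagrams of injections, where wedging with a strand inverts the
  contraction \<open>cap\<close>.) Since \<open>al\<close> and \<open>be\<close> generate a nilpotent ideal, iterating the factorization gives
  zero. Transposition takes care of the morphisms from \<open>\<Lambda>\<^sub>i\<close> to \<open>X\<close>.
\<close>

text \<open>Over the group S_N with permutation representation \<open>V\<close>,
  \<open>\<Lambda>\<^sub>n\<close> is the n-th exterior power of \<open>V\<close>, \<open>al\<close>
  is wedging with the sum of the basis vectors, and \<open>be\<close> is contraction with the sum of
  the coordinates. The identity behind the quiver is
  \<open>(n + 1) * be n * al n + n * xi n = t * alt n\<close>: for t = 0 the two operations
  anticommute up to normalization, and no identity term survives. The obstacle is that the block
  must be closed under all nonzero morphisms, which concerns arbitrary indecomposables. These are
  accessible only through not splitting: the endomorphism ring of \<open>\<Lambda>\<^sub>i\<close>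
  is local with maximal ideal spanned by \<open>xi i\<close>, so a composite
  \<open>\<Lambda>\<^sub>i \<rightarrow> X \<rightarrow> \<Lambda>\<^sub>i\<close> outside that
  ideal would be invertible and split \<open>\<Lambda>\<^sub>i\<close> off \<open>X\<close>. What
  remains is an acyclicity statement of Koszul type: contraction is exact on maps because a single
  strand has coordinate sum 1, so wedging with it is a contracting homotopy.\<close>

text \<open>
  Two labels suffice: a diagram is determined by the two-valued labellings of its vertices that are
  constant on its parts, and gluing diagrams amounts to composing these relations between labellings.
\<close>

primrec label :: "(nat \<Rightarrow> bool) \<Rightarrow> (nat \<Rightarrow> bool) \<Rightarrow> (nat \<Rightarrow> bool) \<Rightarrow> vertex \<Rightarrow> bool" where
  "label x y z (Src i) = x i"
| "label x y z (Mid i) = y i"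
| "label x y z (Tgt i) = z i"

definition fits :: "diagram \<Rightarrow> (nat \<Rightarrow> bool) \<Rightarrow> (nat \<Rightarrow> bool) \<Rightarrow> bool" where
  "fits \<pi> x z \<longleftrightarrow> (\<forall>B\<in>\<pi>. \<forall>u\<in>B. \<forall>v\<in>B. label x (\<lambda>_. False) z u = label x (\<lambda>_. False) z v)"

lemma fitsD:
  "fits \<pi> x z \<Longrightarrow> B \<in> \<pi> \<Longrightarrow> u \<in> B \<Longrightarrow> v \<in> B \<Longrightarrow> label x (\<lambda>_. False) z u = label x (\<lambda>_. False) z v"
  unfolding fits_def by (drule(1) bspec)+

definition verts_of :: "nat \<Rightarrow> nat \<Rightarrow> vertex set" where
  "verts_of n m = Src ` {1..n} \<union> Tgt ` {1..m}"

lemma diagrams_iff: "\<pi> \<in> diagrams n m \<longleftrightarrow> partition_on (verts_of n m) \<pi>"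
  by (simp add: diagrams_def verts_of_def)

lemma finite_diagrams [simp]: "finite (diagrams n m)"
  unfolding diagrams_def by (simp add: finitely_many_partition_on)

lemma label_cong_verts:
  assumes "u \<in> verts_of n m" shows "label x y z u = label x y' z u"
  using assms by (auto simp: verts_of_def)

lemma fitsI_indicator:
  assumes "\<pi> \<in> diagrams n m" and "\<And>B. B \<in> \<pi> \<Longrightarrow> B \<subseteq> A \<or> B \<inter> A = {}"
  shows "fits \<pi> (\<lambda>i. Src i \<in> A) (\<lambda>i. Tgt i \<in> A)"
proof -
  have *: "label (\<lambda>i. Src i \<in> A) (\<lambda>_. False) (\<lambda>i. Tgt i \<in> A) u \<longleftrightarrow> u \<in> A" if "u \<in> verts_of n m" for u
    using that by (auto simp: verts_of_def)
  have "u \<in> verts_of n m" if "B \<in> \<pi>" "u \<in> B" for B u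
    using assms(1) that by (auto simp: diagrams_iff partition_on_def)
  with * assms(2) show ?thesis unfolding fits_def by blast
qed

text \<open>The indicator labelling of the part \<open>B\<close> fits \<open>\<pi>\<close>, hence
  \<open>\<rho>\<close>, and it is not constant on a set that meets \<open>B\<close> without lying
  in \<open>B\<close>.\<close>

lemma diagram_le_if_fits:
  assumes \<pi>: "\<pi> \<in> diagrams n m" and \<rho>: "\<rho> \<in> diagrams n m"
    and le: "\<And>x z. fits \<pi> x z \<Longrightarrow> fits \<rho> x z"
    and B: "B \<in> \<pi>" "C \<in> \<rho>" "B \<inter> C \<noteq> {}"
  shows "C \<subseteq> B"
proof
  fix v assume v: "v \<in> C"
  from B obtain u where u: "u \<in> B" "u \<in> C" by auto
  have "fits \<rho> (\<lambda>i. Src i \<in> B) (\<lambda>i. Tgt i \<in> B)"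
  proof (rule le, rule fitsI_indicator[OF \<pi>])
    show "B' \<subseteq> B \<or> B' \<inter> B = {}" if "B' \<in> \<pi>" for B'
      using partition_onD2[OF \<pi>[unfolded diagrams_iff]] that B(1) by (auto simp: disjoint_def)
  qed
  with u v B have "label (\<lambda>i. Src i \<in> B) (\<lambda>_. False) (\<lambda>i. Tgt i \<in> B) u =
      label (\<lambda>i. Src i \<in> B) (\<lambda>_. False) (\<lambda>i. Tgt i \<in> B) v"
    unfolding fits_def by blast
  moreover have "u \<in> verts_of n m" "v \<in> verts_of n m"
    using \<rho> B u v by (auto simp: diagrams_iff partition_on_def)
  ultimately show "v \<in> B" using u by (auto simp: verts_of_def)
qed

text \<open>Refinement in both directions. Identities between diagrams are reduced to comparing
  labellings by this rule.\<close>

lemma diagram_eqI: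
  assumes \<pi>: "\<pi> \<in> diagrams n m" and \<rho>: "\<rho> \<in> diagrams n m"
    and eq: "\<And>x z. fits \<pi> x z \<longleftrightarrow> fits \<rho> x z"
  shows "\<pi> = \<rho>"
proof -
  have *: "\<pi> \<subseteq> \<rho>" if \<pi>: "\<pi> \<in> diagrams n m" and \<rho>: "\<rho> \<in> diagrams n m"
    and eq: "\<And>x z. fits \<pi> x z \<longleftrightarrow> fits \<rho> x z" for \<pi> \<rho>
  proof
    fix B assume B: "B \<in> \<pi>"
    with \<pi> have "B \<noteq> {}" "B \<subseteq> verts_of n m" by (auto simp: diagrams_iff partition_on_def)
    with \<rho> obtain C where C: "C \<in> \<rho>" "B \<inter> C \<noteq> {}" by (fastforce simp: diagrams_iff partition_on_def)
    have "C \<subseteq> B" by (rule diagram_le_if_fits[OF \<pi> \<rho> _ B C]) (simp add: eq)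
    moreover have "B \<subseteq> C"
      by (rule diagram_le_if_fits[OF \<rho> \<pi> _ C(1) B]) (use C eq in auto)
    ultimately show "B \<in> \<rho>" using C by simp
  qed
  show ?thesis using *[OF \<pi> \<rho> eq] *[OF \<rho> \<pi>] eq by blast
qed

definition linked_in :: "diagram \<Rightarrow> vertex \<Rightarrow> vertex \<Rightarrow> bool" where
  "linked_in \<pi> u v \<longleftrightarrow> (\<exists>B\<in>\<pi>. u \<in> B \<and> v \<in> B)"

lemma linked_in_iff:
  assumes \<pi>: "\<pi> \<in> diagrams n m" and u: "u \<in> verts_of n m" and v: "v \<in> verts_of n m"
  shows "linked_in \<pi> u v \<longleftrightarrow>
    (\<forall>x z. fits \<pi> x z \<longrightarrow> label x (\<lambda>_. False) z u = label x (\<lambda>_. False) z v)" (is "?l \<longleftrightarrow> ?r")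
proof
  show "?l \<Longrightarrow> ?r" by (auto simp: linked_in_def fits_def)
next
  assume r: ?r
  from \<pi> u obtain B where B: "B \<in> \<pi>" "u \<in> B" by (auto simp: diagrams_iff partition_on_def)
  have "fits \<pi> (\<lambda>i. Src i \<in> B) (\<lambda>i. Tgt i \<in> B)"
  proof (rule fitsI_indicator[OF \<pi>])
    show "B' \<subseteq> B \<or> B' \<inter> B = {}" if "B' \<in> \<pi>" for B'
      using partition_onD2[OF \<pi>[unfolded diagrams_iff]] that B(1) by (auto simp: disjoint_def)
  qed
  with r have "label (\<lambda>i. Src i \<in> B) (\<lambda>_. False) (\<lambda>i. Tgt i \<in> B) u =
      label (\<lambda>i. Src i \<in> B) (\<lambda>_. False) (\<lambda>i. Tgt i \<in> B) v" by blast
  with B u v have "v \<in> B" by (auto simp: verts_of_def)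
  with B show ?l by (auto simp: linked_in_def)
qed

text \<open>The closure is taken among all vertices and cut down afterwards; being reflexive, it
  makes every vertex not mentioned in \<open>Q\<close> a singleton part.\<close>

definition gen_diagram :: "nat \<Rightarrow> nat \<Rightarrow> (vertex \<times> vertex) set \<Rightarrow> diagram" where
  "gen_diagram n m Q = verts_of n m // ((Q \<union> Q\<inverse>)\<^sup>* \<inter> verts_of n m \<times> verts_of n m)"

lemma equiv_gen: "equiv V ((Q \<union> Q\<inverse>)\<^sup>* \<inter> V \<times> V)"
proof (rule equivI)
  have "sym ((Q \<union> Q\<inverse>)\<^sup>*)" by (simp add: sym_Un_converse sym_rtrancl)
  then show "sym ((Q \<union> Q\<inverse>)\<^sup>* \<inter> V \<times> V)" by (auto simp: sym_def)
  show "trans ((Q \<union> Q\<inverse>)\<^sup>* \<inter> V \<times> V)"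
    by (rule transI) auto
qed (auto simp: refl_on_def)

lemma gen_diagram_in [simp, intro]: "gen_diagram n m Q \<in> diagrams n m"
  unfolding diagrams_iff gen_diagram_def by (rule partition_on_quotient[OF equiv_gen])

text \<open>Labellings only test equalities, so respecting the generators amounts to respecting the
  closure. The concrete diagrams \<open>fnd\<close>, \<open>std\<close>, \<open>hole\<close> and
  \<open>merged\<close> are accessed through this rule.\<close>

lemma fits_gen_diagram:
  assumes Q: "Q \<subseteq> verts_of n m \<times> verts_of n m"
  shows "fits (gen_diagram n m Q) x z \<longleftrightarrow>
    (\<forall>(u, v)\<in>Q. label x (\<lambda>_. False) z u = label x (\<lambda>_. False) z v)" (is "?l \<longleftrightarrow> ?r")
proof
  assume l: ?l
  show ?r
  proof clarify
    fix u v assume uv: "(u, v) \<in> Q"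
    let ?r = "(Q \<union> Q\<inverse>)\<^sup>* \<inter> verts_of n m \<times> verts_of n m"
    have "?r `` {u} \<in> gen_diagram n m Q" using uv Q by (auto simp: gen_diagram_def quotient_def)
    moreover have "u \<in> ?r `` {u}" "v \<in> ?r `` {u}" using uv Q by auto
    ultimately show "label x (\<lambda>_. False) z u = label x (\<lambda>_. False) z v"
      by (rule fitsD[OF l])
  qed
next
  assume r: ?r
  have *: "label x (\<lambda>_. False) z u = label x (\<lambda>_. False) z v" if "(u, v) \<in> (Q \<union> Q\<inverse>)\<^sup>*" for u v
    using that by induction (use r in auto)
  show ?l unfolding fits_def gen_diagram_def
    by (auto simp: quotient_def) (metis *)+
qed

lemma tgt_to_mid_eq [simp]:
  "tgt_to_mid u = Src i \<longleftrightarrow> u = Src i" "tgt_to_mid u = Mid i \<longleftrightarrow> u = Mid i \<or> u = Tgt i"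
  "tgt_to_mid u \<noteq> Tgt i" by (cases u; auto)+

lemma src_to_mid_eq [simp]:
  "src_to_mid u = Tgt i \<longleftrightarrow> u = Tgt i" "src_to_mid u = Mid i \<longleftrightarrow> u = Mid i \<or> u = Src i"
  "src_to_mid u \<noteq> Src i" by (cases u; auto)+

section \<open>Gluing two diagrams\<close>

context
  fixes \<mu> \<pi> :: diagram and n m l :: nat
  assumes \<pi>: "\<pi> \<in> diagrams n m" and \<mu>: "\<mu> \<in> diagrams m l"
begin

definition glue_rel :: "(vertex \<times> vertex) set" where
  "glue_rel = {(x, y). \<exists>B\<in>glued_parts \<mu> \<pi>. x \<in> B \<and> y \<in> B}"

lemma sym_glue_rel: "sym (glue_rel\<^sup>*)"
  by (rule sym_rtrancl) (auto simp: glue_rel_def sym_def)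

lemma part_verts: "B \<in> \<pi> \<Longrightarrow> u \<in> B \<Longrightarrow> u \<in> verts_of n m" "B \<in> \<mu> \<Longrightarrow> u \<in> B \<Longrightarrow> u \<in> verts_of m l"
  using \<pi> \<mu> by (auto simp: diagrams_iff partition_on_def)

lemma Union_glued_parts: "\<Union>(glued_parts \<mu> \<pi>) = Src ` {1..n} \<union> Mid ` {1..m} \<union> Tgt ` {1..l}"
proof -
  have "\<Union>\<pi> = verts_of n m" "\<Union>\<mu> = verts_of m l"
    using \<pi> \<mu> by (auto simp: diagrams_iff partition_on_def)
  moreover have "\<Union>(glued_parts \<mu> \<pi>) = tgt_to_mid ` (\<Union>\<pi>) \<union> src_to_mid ` (\<Union>\<mu>)"
    by (auto simp: glued_parts_def)
  ultimately show ?thesis by (simp add: verts_of_def image_Un image_image) blast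
qed

lemma glue_rel_verts: "(u, v) \<in> glue_rel\<^sup>* \<Longrightarrow> u \<in> \<Union>(glued_parts \<mu> \<pi>) \<Longrightarrow> v \<in> \<Union>(glued_parts \<mu> \<pi>)"
  by (induction rule: rtrancl_induct) (auto simp: glue_rel_def)

lemma glued_eq: "glued \<mu> \<pi> = {glue_rel\<^sup>* `` {v} |v. v \<in> Src ` {1..n} \<union> Mid ` {1..m} \<union> Tgt ` {1..l}}"
  by (auto simp: glued_def quotient_def Union_glued_parts glue_rel_def)

text \<open>Both labellings assign the same \<open>y\<close> to the identified middle vertices, so
  equality propagates along every step of the glued graph.\<close>

lemma label_glue:
  assumes "fits \<pi> x y" "fits \<mu> y z" "(u, v) \<in> glue_rel\<^sup>*"
  shows "label x y z u = label x y z v"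
  using assms(3)
proof (induction rule: rtrancl_induct)
  case (step v w)
  have "label x y z v = label x y z w"
  proof -
    from step obtain B where B: "B \<in> glued_parts \<mu> \<pi>" "v \<in> B" "w \<in> B" by (auto simp: glue_rel_def)
    then consider B' where "B' \<in> \<pi>" "B = tgt_to_mid ` B'" | B' where "B' \<in> \<mu>" "B = src_to_mid ` B'"
      by (auto simp: glued_parts_def)
    then show ?thesis
    proof cases
      case 1
      have *: "label x y z (tgt_to_mid u) = label x (\<lambda>_. False) y u" if "u \<in> B'" for u
        using part_verts(1)[OF 1(1) that] by (auto simp: verts_of_def)
      from B 1 obtain v' w' where vw: "v' \<in> B'" "w' \<in> B'" "v = tgt_to_mid v'" "w = tgt_to_mid w'" by blast
      show ?thesis unfolding vw(3,4) *[OF vw(1)] *[OF vw(2)] by (rule fitsD[OF assms(1) 1(1) vw(1,2)])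
    next
      case 2
      have *: "label x y z (src_to_mid u) = label y (\<lambda>_. False) z u" if "u \<in> B'" for u
        using part_verts(2)[OF 2(1) that] by (auto simp: verts_of_def)
      from B 2 obtain v' w' where vw: "v' \<in> B'" "w' \<in> B'" "v = src_to_mid v'" "w = src_to_mid w'" by blast
      show ?thesis unfolding vw(3,4) *[OF vw(1)] *[OF vw(2)] by (rule fitsD[OF assms(2) 2(1) vw(1,2)])
    qed
  qed
  with step show ?case by simp
qed simp

lemma fits_of_label_glue:
  assumes "\<And>u v. (u, v) \<in> glue_rel \<Longrightarrow> label x y z u = label x y z v"
  shows "fits \<pi> x y" "fits \<mu> y z"
proof -
  show "fits \<pi> x y" unfolding fits_def
  proof clarify
    fix B u v assume B: "B \<in> \<pi>" "u \<in> B" "v \<in> B"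
    then have "(tgt_to_mid u, tgt_to_mid v) \<in> glue_rel" unfolding glue_rel_def glued_parts_def by blast
    from assms[OF this] part_verts(1)[OF B(1,2)] part_verts(1)[OF B(1,3)]
    show "label x (\<lambda>_. False) y u = label x (\<lambda>_. False) y v" by (auto simp: verts_of_def)
  qed
  show "fits \<mu> y z" unfolding fits_def
  proof clarify
    fix B u v assume B: "B \<in> \<mu>" "u \<in> B" "v \<in> B"
    then have "(src_to_mid u, src_to_mid v) \<in> glue_rel" unfolding glue_rel_def glued_parts_def by blast
    from assms[OF this] part_verts(2)[OF B(1,2)] part_verts(2)[OF B(1,3)]
    show "label y (\<lambda>_. False) z u = label y (\<lambda>_. False) z v" by (auto simp: verts_of_def)
  qed
qed

lemma diagram_comp_in: "diagram_comp \<mu> \<pi> \<in> diagrams n l"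
proof -
  let ?V = "\<Union>(glued_parts \<mu> \<pi>)"
  have "glue_rel\<^sup>* `` {v} = (glue_rel\<^sup>* \<inter> ?V \<times> ?V) `` {v}" if "v \<in> ?V" for v
    using that glue_rel_verts[OF _ that] by blast
  then have "glued \<mu> \<pi> = ?V // (glue_rel\<^sup>* \<inter> ?V \<times> ?V)"
    unfolding glued_def glue_rel_def[symmetric] quotient_def by simp
  moreover have "equiv ?V (glue_rel\<^sup>* \<inter> ?V \<times> ?V)"
  proof (rule equivI)
    show "sym (glue_rel\<^sup>* \<inter> ?V \<times> ?V)" using sym_glue_rel by (auto simp: sym_def)
    show "trans (glue_rel\<^sup>* \<inter> ?V \<times> ?V)" by (rule transI) auto
  qed (auto simp: refl_on_def)
  ultimately have "partition_on ?V (glued \<mu> \<pi>)" by (simp add: partition_on_quotient)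
  then have "partition_on (?V - range Mid) (diagram_comp \<mu> \<pi>)"
    unfolding diagram_comp_def by (rule partition_on_transform) (auto simp: disjnt_def)
  moreover have "?V - range Mid = verts_of n l" unfolding Union_glued_parts verts_of_def by auto
  ultimately show ?thesis by (simp add: diagrams_iff)
qed

lemma fits_comp: "fits (diagram_comp \<mu> \<pi>) x z \<longleftrightarrow> (\<exists>y. fits \<pi> x y \<and> fits \<mu> y z)"
proof
  assume r: "fits (diagram_comp \<mu> \<pi>) x z"
  \<comment> \<open>\<open>g\<close> is constant on components: true iff the component contains an
    outer vertex labelled true. A closed component has no outer vertex and gets false.\<close>
  define g where "g v \<longleftrightarrow> (\<exists>w \<in> verts_of n l. (v, w) \<in> glue_rel\<^sup>* \<and> label x (\<lambda>_. False) z w)" for v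
  define y where "y j \<longleftrightarrow> g (Mid j)" for j
  have g_rel: "g u = g v" if "(u, v) \<in> glue_rel" for u v
  proof -
    have "(u, v) \<in> glue_rel\<^sup>*" "(v, u) \<in> glue_rel\<^sup>*" using that sym_glue_rel by (auto dest: symD)
    then show ?thesis unfolding g_def by (meson rtrancl_trans)
  qed
  have g_lab: "g u = label x y z u" if u: "u \<in> \<Union>(glued_parts \<mu> \<pi>)" for u
  proof (cases "u \<in> verts_of n l")
    case True
    have "label x (\<lambda>_. False) z u = label x (\<lambda>_. False) z w" if "w \<in> verts_of n l" "(u, w) \<in> glue_rel\<^sup>*" for w
    proof -
      have "glue_rel\<^sup>* `` {u} \<in> glued \<mu> \<pi>" using u unfolding glued_eq Union_glued_parts by blast
      then have "glue_rel\<^sup>* `` {u} - range Mid \<in> diagram_comp \<mu> \<pi>"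
        unfolding diagram_comp_def using True by (auto simp: verts_of_def)
      moreover have "u \<in> glue_rel\<^sup>* `` {u} - range Mid" "w \<in> glue_rel\<^sup>* `` {u} - range Mid"
        using True that by (auto simp: verts_of_def)
      ultimately show ?thesis by (rule fitsD[OF r])
    qed
    moreover have "label x y z u = label x (\<lambda>_. False) z u" using True by (rule label_cong_verts)
    ultimately show ?thesis unfolding g_def using True by blast
  next
    case False
    then obtain j where "u = Mid j" using u unfolding Union_glued_parts verts_of_def by auto
    then show ?thesis by (simp add: y_def)
  qed
  have "label x y z u = label x y z v" if "(u, v) \<in> glue_rel" for u v
    using g_rel[OF that] g_lab[of u] g_lab[of v] that by (auto simp: glue_rel_def)
  from fits_of_label_glue[OF this] show "\<exists>y. fits \<pi> x y \<and> fits \<mu> y z" by blast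
next
  assume "\<exists>y. fits \<pi> x y \<and> fits \<mu> y z"
  then obtain y where y: "fits \<pi> x y" "fits \<mu> y z" by blast
  show "fits (diagram_comp \<mu> \<pi>) x z" unfolding fits_def
  proof clarify
    fix B u v assume B: "B \<in> diagram_comp \<mu> \<pi>" "u \<in> B" "v \<in> B"
    then obtain w where w: "(w, u) \<in> glue_rel\<^sup>*" "(w, v) \<in> glue_rel\<^sup>*"
      unfolding diagram_comp_def glued_eq by auto
    have "u \<in> verts_of n l" "v \<in> verts_of n l"
      using B diagram_comp_in by (auto simp: diagrams_iff partition_on_def)
    then show "label x (\<lambda>_. False) z u = label x (\<lambda>_. False) z v"
      using label_glue[OF y w(1)] label_glue[OF y w(2)] label_cong_verts by metis
  qed
qed

text \<open>The indicator of a closed component is a nonzero middle labelling compatible with zero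
  outer labels; conversely, the component of a middle vertex labelled true by such a labelling is
  closed.\<close>

lemma loops_eq_0_iff:
  "loops \<mu> \<pi> = 0 \<longleftrightarrow>
    (\<forall>y. fits \<pi> (\<lambda>_. False) y \<and> fits \<mu> y (\<lambda>_. False) \<longrightarrow> (\<forall>j\<in>{1..m}. \<not> y j))"
proof -
  have "finite (glued \<mu> \<pi>)" unfolding glued_eq by simp
  then have "loops \<mu> \<pi> = 0 \<longleftrightarrow> \<not> (\<exists>B\<in>glued \<mu> \<pi>. B \<subseteq> range Mid)" unfolding loops_def by auto
  also have "\<dots> \<longleftrightarrow> (\<forall>y. fits \<pi> (\<lambda>_. False) y \<and> fits \<mu> y (\<lambda>_. False) \<longrightarrow> (\<forall>j\<in>{1..m}. \<not> y j))"
    (is "\<not> ?L \<longleftrightarrow> ?R")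
  proof -
    have False if L: ?L and R: ?R
    proof -
      from L obtain v where v: "v \<in> Src ` {1..n} \<union> Mid ` {1..m} \<union> Tgt ` {1..l}"
        and sub: "glue_rel\<^sup>* `` {v} \<subseteq> range Mid" unfolding glued_eq by blast
      from v sub obtain j where j: "v = Mid j" "j \<in> {1..m}" by auto
      define y where "y k \<longleftrightarrow> (v, Mid k) \<in> glue_rel\<^sup>*" for k
      have lab: "label (\<lambda>_. False) y (\<lambda>_. False) u \<longleftrightarrow> (v, u) \<in> glue_rel\<^sup>*" for u
        using sub by (cases u) (auto simp: y_def)
      have "label (\<lambda>_. False) y (\<lambda>_. False) u = label (\<lambda>_. False) y (\<lambda>_. False) u'"
        if "(u, u') \<in> glue_rel" for u u'
      proof -
        have "(u, u') \<in> glue_rel\<^sup>*" "(u', u) \<in> glue_rel\<^sup>*" using that sym_glue_rel by (auto dest: symD)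
        then show ?thesis unfolding lab by (meson rtrancl_trans)
      qed
      from fits_of_label_glue[OF this] R j have "\<not> y j" by blast
      then show False using j by (simp add: y_def)
    qed
    moreover have ?L if "\<not> ?R"
    proof -
      from that obtain y j where y: "fits \<pi> (\<lambda>_. False) y" "fits \<mu> y (\<lambda>_. False)"
        and j: "j \<in> {1..m}" "y j" by blast
      have "glue_rel\<^sup>* `` {Mid j} \<subseteq> range Mid"
      proof
        fix u assume "u \<in> glue_rel\<^sup>* `` {Mid j}"
        with label_glue[OF y] j(2) have "label (\<lambda>_. False) y (\<lambda>_. False) u" by force
        then show "u \<in> range Mid" by (cases u) auto
      qed
      moreover have "glue_rel\<^sup>* `` {Mid j} \<in> glued \<mu> \<pi>" using j unfolding glued_eq by blast
      ultimately show ?L by blast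
    qed
    ultimately show ?thesis by blast
  qed
  finally show ?thesis .
qed

end

lemma fits_const [simp]: "fits \<pi> (\<lambda>_. False) (\<lambda>_. False)"
proof -
  have "label (\<lambda>_. False) (\<lambda>_. False) (\<lambda>_. False) u = False" for u by (cases u) auto
  then show ?thesis by (simp add: fits_def)
qed

lemma fits_cong:
  assumes "\<pi> \<in> diagrams n m" "\<And>i. i \<in> {1..n} \<Longrightarrow> x i = x' i" "\<And>i. i \<in> {1..m} \<Longrightarrow> z i = z' i"
  shows "fits \<pi> x z \<longleftrightarrow> fits \<pi> x' z'"
proof -
  have "label x (\<lambda>_. False) z u = label x' (\<lambda>_. False) z' u" if "B \<in> \<pi>" "u \<in> B" for B u
  proof -
    have "u \<in> verts_of n m" using assms(1) that by (auto simp: diagrams_iff partition_on_def)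
    then show ?thesis using assms(2,3) by (auto simp: verts_of_def)
  qed
  then show ?thesis unfolding fits_def by metis
qed

section \<open>Associativity of the product at parameter zero\<close>

lemma diagram_comp_assoc:
  assumes d: "\<pi> \<in> diagrams n m" "\<mu> \<in> diagrams m l" "\<nu> \<in> diagrams l k"
  shows "diagram_comp (diagram_comp \<nu> \<mu>) \<pi> = diagram_comp \<nu> (diagram_comp \<mu> \<pi>)"
proof (rule diagram_eqI)
  show "diagram_comp (diagram_comp \<nu> \<mu>) \<pi> \<in> diagrams n k"
    by (rule diagram_comp_in[OF d(1) diagram_comp_in[OF d(2,3)]])
  show "diagram_comp \<nu> (diagram_comp \<mu> \<pi>) \<in> diagrams n k"
    by (rule diagram_comp_in[OF diagram_comp_in[OF d(1,2)] d(3)])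
  show "fits (diagram_comp (diagram_comp \<nu> \<mu>) \<pi>) x z = fits (diagram_comp \<nu> (diagram_comp \<mu> \<pi>)) x z" for x z
    unfolding fits_comp[OF d(1) diagram_comp_in[OF d(2,3)]] fits_comp[OF diagram_comp_in[OF d(1,2)] d(3)]
      fits_comp[OF d(2,3)] fits_comp[OF d(1,2)] by blast
qed

text \<open>Since \<open>0 ^ loops\<close> depends only on whether \<open>loops\<close> vanishes, no
  count is required. Both sides say that no nonzero pair of inner labellings is compatible with zero
  outer labels, a condition that does not see the bracketing.\<close>

lemma loops_comp_assoc:
  assumes d: "\<pi> \<in> diagrams n m" "\<mu> \<in> diagrams m l" "\<nu> \<in> diagrams l k"
  shows "loops \<nu> \<mu> = 0 \<and> loops (diagram_comp \<nu> \<mu>) \<pi> = 0 \<longleftrightarrow>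
         loops \<mu> \<pi> = 0 \<and> loops \<nu> (diagram_comp \<mu> \<pi>) = 0"
proof -
  let ?F = "\<lambda>_. False"
  have cong2: "fits \<mu> y z = fits \<mu> ?F z" if "\<forall>j\<in>{1..m}. \<not> y j" for y z
    by (rule fits_cong[OF d(2)]) (use that in auto)
  have cong3: "fits \<mu> y z = fits \<mu> y ?F" if "\<forall>j\<in>{1..l}. \<not> z j" for y z
    by (rule fits_cong[OF d(2)]) (use that in auto)
  let ?all = "\<forall>y w. fits \<pi> ?F y \<and> fits \<mu> y w \<and> fits \<nu> w ?F \<longrightarrow>
      (\<forall>j\<in>{1..m}. \<not> y j) \<and> (\<forall>j\<in>{1..l}. \<not> w j)"
  have "loops \<nu> \<mu> = 0 \<and> loops (diagram_comp \<nu> \<mu>) \<pi> = 0 \<longleftrightarrow> ?all"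
  proof
    assume L: "loops \<nu> \<mu> = 0 \<and> loops (diagram_comp \<nu> \<mu>) \<pi> = 0"
    show ?all
    proof clarify
      fix y w assume yw: "fits \<pi> ?F y" "fits \<mu> y w" "fits \<nu> w ?F"
      then have y: "\<forall>j\<in>{1..m}. \<not> y j"
        using L unfolding loops_eq_0_iff[OF d(1) diagram_comp_in[OF d(2,3)]] fits_comp[OF d(2,3)] by blast
      with yw have "fits \<mu> ?F w" using cong2 by blast
      with yw y L show "(\<forall>j\<in>{1..m}. \<not> y j) \<and> (\<forall>j\<in>{1..l}. \<not> w j)"
        unfolding loops_eq_0_iff[OF d(2,3)] by blast
    qed
  next
    assume A: ?all
    have "loops \<nu> \<mu> = 0" unfolding loops_eq_0_iff[OF d(2,3)] using A fits_const by blast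
    moreover have "loops (diagram_comp \<nu> \<mu>) \<pi> = 0"
      unfolding loops_eq_0_iff[OF d(1) diagram_comp_in[OF d(2,3)]] fits_comp[OF d(2,3)] using A by blast
    ultimately show "loops \<nu> \<mu> = 0 \<and> loops (diagram_comp \<nu> \<mu>) \<pi> = 0" ..
  qed
  moreover have "loops \<mu> \<pi> = 0 \<and> loops \<nu> (diagram_comp \<mu> \<pi>) = 0 \<longleftrightarrow> ?all"
  proof
    assume L: "loops \<mu> \<pi> = 0 \<and> loops \<nu> (diagram_comp \<mu> \<pi>) = 0"
    show ?all
    proof clarify
      fix y w assume yw: "fits \<pi> ?F y" "fits \<mu> y w" "fits \<nu> w ?F"
      then have w: "\<forall>j\<in>{1..l}. \<not> w j"
        using L unfolding loops_eq_0_iff[OF diagram_comp_in[OF d(1,2)] d(3)] fits_comp[OF d(1,2)] by blast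
      with yw have "fits \<mu> y ?F" using cong3 by blast
      with yw w L show "(\<forall>j\<in>{1..m}. \<not> y j) \<and> (\<forall>j\<in>{1..l}. \<not> w j)"
        unfolding loops_eq_0_iff[OF d(1,2)] by blast
    qed
  next
    assume A: ?all
    have "loops \<mu> \<pi> = 0" unfolding loops_eq_0_iff[OF d(1,2)] using A fits_const by blast
    moreover have "loops \<nu> (diagram_comp \<mu> \<pi>) = 0"
      unfolding loops_eq_0_iff[OF diagram_comp_in[OF d(1,2)] d(3)] fits_comp[OF d(1,2)] using A by blast
    ultimately show "loops \<mu> \<pi> = 0 \<and> loops \<nu> (diagram_comp \<mu> \<pi>) = 0" ..
  qed
  ultimately show ?thesis by blast
qed

definition valid :: "diagram \<Rightarrow> bool" where
  "valid \<pi> \<longleftrightarrow> (\<exists>n m. \<pi> \<in> diagrams n m)"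

lemma valid_diagrams: "\<pi> \<in> diagrams n m \<Longrightarrow> valid \<pi>"
  by (auto simp: valid_def)

text \<open>The union of the parts is the vertex set, which determines both sizes. So source and
  target can be read off a diagram, and one partial product on all diagrams makes sense.\<close>

lemma diagrams_unique:
  assumes "\<pi> \<in> diagrams n m" "\<pi> \<in> diagrams n' m'"
  shows "n = n'" "m = m'"
proof -
  have eq: "verts_of n m = verts_of n' m'" using assms by (auto simp: diagrams_iff partition_on_def)
  have "{1..n} = Src -` verts_of n m" "{1..m} = Tgt -` verts_of n m" for n m
    by (auto simp: verts_of_def)
  then have "{1..n} = {1..n'}" "{1..m} = {1..m'}" using eq by metis+
  then show "n = n'" "m = m'" by (metis card_atLeastAtMost diff_Suc_1)+
qed

text \<open>Composition at \<open>t = 0\<close>: a product with a closed component vanishes.\<close>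

definition pcomp :: "diagram \<Rightarrow> diagram \<Rightarrow> diagram option" where
  "pcomp \<mu> \<pi> = (if (\<exists>n m l. \<pi> \<in> diagrams n m \<and> \<mu> \<in> diagrams m l) \<and> loops \<mu> \<pi> = 0
     then Some (diagram_comp \<mu> \<pi>) else None)"

lemma pcomp_valid: "pcomp \<mu> \<pi> = Some \<rho> \<Longrightarrow> valid \<rho>"
  by (auto simp: pcomp_def valid_def split: if_splits intro: diagram_comp_in)

lemma pcomp_eq:
  assumes "\<pi> \<in> diagrams n m" "\<mu> \<in> diagrams m l"
  shows "pcomp \<mu> \<pi> = (if loops \<mu> \<pi> = 0 then Some (diagram_comp \<mu> \<pi>) else None)"
  using assms by (auto simp: pcomp_def)

lemma pcomp_None:
  assumes "\<pi> \<in> diagrams n m" "\<mu> \<in> diagrams m' l" "m \<noteq> m'"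
  shows "pcomp \<mu> \<pi> = None"
  using assms diagrams_unique unfolding pcomp_def by metis

text \<open>\<open>None\<close> acts as a zero: it stands for a mismatch of sizes as well as for a
  closed component, and either of them in one bracketing forces \<open>None\<close> in the
  other.\<close>

lemma pcomp_assoc:
  "Option.bind (pcomp \<nu> \<mu>) (\<lambda>\<sigma>. pcomp \<sigma> \<pi>) = Option.bind (pcomp \<mu> \<pi>) (pcomp \<nu>)"
proof (cases "\<exists>n m l k. \<pi> \<in> diagrams n m \<and> \<mu> \<in> diagrams m l \<and> \<nu> \<in> diagrams l k")
  case True
  then obtain n m l k where d: "\<pi> \<in> diagrams n m" "\<mu> \<in> diagrams m l" "\<nu> \<in> diagrams l k" by blast
  show ?thesis
    using loops_comp_assoc[OF d] diagram_comp_assoc[OF d]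
    by (auto simp: pcomp_eq[OF d(1,2)] pcomp_eq[OF d(2,3)] pcomp_eq[OF d(1) diagram_comp_in[OF d(2,3)]]
        pcomp_eq[OF diagram_comp_in[OF d(1,2)] d(3)])
next
  case F: False
  have "Option.bind (pcomp \<nu> \<mu>) (\<lambda>\<sigma>. pcomp \<sigma> \<pi>) = None"
  proof (cases "\<exists>m l k. \<mu> \<in> diagrams m l \<and> \<nu> \<in> diagrams l k")
    case True
    then obtain m l k where d: "\<mu> \<in> diagrams m l" "\<nu> \<in> diagrams l k" by blast
    have "pcomp (diagram_comp \<nu> \<mu>) \<pi> = None"
      using F d diagrams_unique[OF diagram_comp_in[OF d]] by (auto simp: pcomp_def) 
    then show ?thesis by (auto simp: pcomp_eq[OF d])
  qed (auto simp: pcomp_def)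
  moreover have "Option.bind (pcomp \<mu> \<pi>) (pcomp \<nu>) = None"
  proof (cases "\<exists>n m l. \<pi> \<in> diagrams n m \<and> \<mu> \<in> diagrams m l")
    case True
    then obtain n m l where d: "\<pi> \<in> diagrams n m" "\<mu> \<in> diagrams m l" by blast
    have "pcomp \<nu> (diagram_comp \<mu> \<pi>) = None"
      using F d diagrams_unique[OF diagram_comp_in[OF d]] by (auto simp: pcomp_def)
    then show ?thesis by (auto simp: pcomp_eq[OF d])
  qed (auto simp: pcomp_def)
  ultimately show ?thesis by simp
qed

section \<open>The partition algebroid at parameter zero\<close>

text \<open>
  All spaces \<open>FP\<^sub>n\<^sub>,\<^sub>m\<close> are collected in one non-unital ring, in which the product of
  non-composable diagrams is zero.
\<close>

typedef (overloaded) 'f pal = "{f :: diagram \<Rightarrow> 'f::field_char_0. finite {\<pi>. f \<pi> \<noteq> 0} \<and> (\<forall>\<pi>. f \<pi> \<noteq> 0 \<longrightarrow> valid \<pi>)}"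
  morphisms coef Pal
  by (rule exI[of _ "\<lambda>_. 0"]) simp

setup_lifting type_definition_pal

lemma finite_coef [simp]: "finite {\<pi>. coef a \<pi> \<noteq> 0}"
  using coef[of a] by simp

lemma coef_valid: "coef a \<pi> \<noteq> 0 \<Longrightarrow> valid \<pi>"
  using coef[of a] by simp

lemma pal_eqI: "(\<And>\<pi>. coef a \<pi> = coef b \<pi>) \<Longrightarrow> a = b"
  using coef_inject by blast

instantiation pal :: (field_char_0) ab_group_add
begin

lift_definition zero_pal :: "'a pal" is "\<lambda>_. 0" by simp

lift_definition plus_pal :: "'a pal \<Rightarrow> 'a pal \<Rightarrow> 'a pal" is "\<lambda>f g \<pi>. f \<pi> + g \<pi>"
proof (clarsimp, intro conjI allI impI)
  fix f g :: "diagram \<Rightarrow> 'a"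
  assume "finite {\<pi>. f \<pi> \<noteq> 0}" "finite {\<pi>. g \<pi> \<noteq> 0}"
  then have "finite ({\<pi>. f \<pi> \<noteq> 0} \<union> {\<pi>. g \<pi> \<noteq> 0})" by simp
  then show "finite {\<pi>. f \<pi> + g \<pi> \<noteq> 0}" by (rule rev_finite_subset) auto
  show "valid \<pi>" if "\<forall>\<pi>. f \<pi> \<noteq> 0 \<longrightarrow> valid \<pi>" "\<forall>\<pi>. g \<pi> \<noteq> 0 \<longrightarrow> valid \<pi>" "f \<pi> + g \<pi> \<noteq> 0" for \<pi>
    using that by (cases "f \<pi> = 0") auto
qed

lift_definition uminus_pal :: "'a pal \<Rightarrow> 'a pal" is "\<lambda>f \<pi>. - f \<pi>" by simp

definition minus_pal :: "'a pal \<Rightarrow> 'a pal \<Rightarrow> 'a pal" where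
  "minus_pal a b = a + - b"

instance
proof
  have c: "coef 0 \<pi> = 0" "coef (a + b) \<pi> = coef a \<pi> + coef b \<pi>" "coef (- a) \<pi> = - coef a \<pi>"
    for a b :: "'a pal" and \<pi> by (transfer, simp)+
  fix a b c :: "'a pal"
  show "a + b + c = a + (b + c)" by (rule pal_eqI) (simp only: c add.assoc)
  show "a + b = b + a" by (rule pal_eqI) (simp only: c add.commute)
  show "0 + a = a" by (rule pal_eqI) (simp only: c add_0_left)
  show "- a + a = 0" by (rule pal_eqI) (simp only: c left_minus)
  show "a - b = a + - b" by (simp add: minus_pal_def)
qed

end

lemma coef_zero [simp]: "coef 0 \<pi> = 0" by transfer simp
lemma coef_add [simp]: "coef (a + b) \<pi> = coef a \<pi> + coef b \<pi>" by transfer simp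
lemma coef_uminus [simp]: "coef (- a) \<pi> = - coef a \<pi>" by transfer simp

lemma coef_sum [simp]: "coef (sum f A) \<pi> = (\<Sum>i\<in>A. coef (f i) \<pi>)"
  by (induction A rule: infinite_finite_induct) auto

lift_definition scl :: "'f::field_char_0 \<Rightarrow> 'f pal \<Rightarrow> 'f pal" is "\<lambda>c f \<pi>. c * f \<pi>" by simp

lemma coef_scl [simp]: "coef (scl c a) \<pi> = c * coef a \<pi>" by transfer simp

interpretation pal: vector_space scl
  by standard (auto intro!: pal_eqI simp: algebra_simps)

lift_definition bs :: "diagram \<Rightarrow> 'f::field_char_0 pal" is "\<lambda>\<pi> \<rho>. if \<rho> = \<pi> \<and> valid \<pi> then 1 else 0"
  by simp

lemma coef_bs: "coef (bs \<pi>) \<rho> = (if \<rho> = \<pi> \<and> valid \<pi> then 1 else 0)" by transfer simp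

lemma pal_expand: "a = (\<Sum>\<pi> | coef a \<pi> \<noteq> 0. scl (coef a \<pi>) (bs \<pi>))"
proof (rule pal_eqI)
  fix \<rho>
  have "coef (\<Sum>\<pi> | coef a \<pi> \<noteq> 0. scl (coef a \<pi>) (bs \<pi>)) \<rho> =
      (\<Sum>\<pi> | coef a \<pi> \<noteq> 0. if \<rho> = \<pi> then coef a \<rho> else 0)"
    unfolding coef_sum by (rule sum.cong) (auto simp: coef_bs coef_valid)
  also have "\<dots> = coef a \<rho>" by (simp add: sum.delta)
  finally show "coef a \<rho> = coef (\<Sum>\<pi> | coef a \<pi> \<noteq> 0. scl (coef a \<pi>) (bs \<pi>)) \<rho>" ..
qed

lemma pal_induct [case_names zero add basis]:
  assumes "P 0" "\<And>a b. P a \<Longrightarrow> P b \<Longrightarrow> P (a + b)" "\<And>c \<pi>. valid \<pi> \<Longrightarrow> P (scl c (bs \<pi>))"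
  shows "P a"
proof -
  have "P (\<Sum>\<pi>\<in>S. scl (coef a \<pi>) (bs \<pi>))" if "finite S" "S \<subseteq> {\<pi>. coef a \<pi> \<noteq> 0}" for S
    using that by induction (auto intro!: assms intro: coef_valid)
  from this[of "{\<pi>. coef a \<pi> \<noteq> 0}"] show ?thesis using pal_expand[of a] by simp
qed

instantiation pal :: (field_char_0) times
begin

lift_definition times_pal :: "'a pal \<Rightarrow> 'a pal \<Rightarrow> 'a pal" is
  "\<lambda>g f \<rho>. \<Sum>\<mu> | g \<mu> \<noteq> 0. \<Sum>\<pi> | f \<pi> \<noteq> 0. if pcomp \<mu> \<pi> = Some \<rho> then g \<mu> * f \<pi> else 0"
proof (clarsimp, intro conjI allI impI)
  fix g f :: "diagram \<Rightarrow> 'a"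
  let ?h = "\<lambda>\<rho>. \<Sum>\<mu> | g \<mu> \<noteq> 0. \<Sum>\<pi> | f \<pi> \<noteq> 0. if pcomp \<mu> \<pi> = Some \<rho> then g \<mu> * f \<pi> else 0"
  assume fin: "finite {\<pi>. g \<pi> \<noteq> 0}" "finite {\<pi>. f \<pi> \<noteq> 0}"
  have *: "\<exists>\<mu> \<pi>. g \<mu> \<noteq> 0 \<and> f \<pi> \<noteq> 0 \<and> pcomp \<mu> \<pi> = Some \<rho>" if "?h \<rho> \<noteq> 0" for \<rho>
  proof (rule ccontr)
    assume "\<not> ?thesis"
    then have "?h \<rho> = 0" by (intro sum.neutral ballI) auto
    with that show False by simp
  qed
  have "finite ((\<lambda>(\<mu>, \<pi>). the (pcomp \<mu> \<pi>)) ` ({\<pi>. g \<pi> \<noteq> 0} \<times> {\<pi>. f \<pi> \<noteq> 0}))" using fin by simp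
  then show "finite {\<rho>. ?h \<rho> \<noteq> 0}"
    by (rule rev_finite_subset) (use * in \<open>force simp: image_iff\<close>)
  show "valid \<rho>" if "?h \<rho> \<noteq> 0" for \<rho> using *[OF that] pcomp_valid by blast
qed

instance ..

end

text \<open>The product is defined by sums over supports; enlarging these to common finite sets
  makes bilinearity a termwise check.\<close>

lemma coef_times:
  assumes "finite S" "{\<mu>. coef g \<mu> \<noteq> 0} \<subseteq> S" "finite T" "{\<mu>. coef f \<mu> \<noteq> 0} \<subseteq> T"
  shows "coef (g * f) \<rho> = (\<Sum>\<mu>\<in>S. \<Sum>\<pi>\<in>T. if pcomp \<mu> \<pi> = Some \<rho> then coef g \<mu> * coef f \<pi> else 0)"
proof -
  have "coef (g * f) \<rho> = (\<Sum>\<mu> | coef g \<mu> \<noteq> 0. \<Sum>\<pi> | coef f \<pi> \<noteq> 0. if pcomp \<mu> \<pi> = Some \<rho> then coef g \<mu> * coef f \<pi> else 0)"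
    by transfer simp
  also have "\<dots> = (\<Sum>\<mu> | coef g \<mu> \<noteq> 0. \<Sum>\<pi>\<in>T. if pcomp \<mu> \<pi> = Some \<rho> then coef g \<mu> * coef f \<pi> else 0)"
    by (rule sum.cong[OF refl], rule sum.mono_neutral_left) (use assms in auto)
  also have "\<dots> = (\<Sum>\<mu>\<in>S. \<Sum>\<pi>\<in>T. if pcomp \<mu> \<pi> = Some \<rho> then coef g \<mu> * coef f \<pi> else 0)"
    by (rule sum.mono_neutral_left) (use assms in \<open>auto intro!: sum.neutral split: if_splits\<close>)
  finally show ?thesis .
qed

lemma pal_distrib_right: "(a + b) * c = a * c + b * (c :: 'f::field_char_0 pal)"
proof (rule pal_eqI)
  fix \<rho>
  let ?S = "{\<pi>. coef a \<pi> \<noteq> 0} \<union> {\<pi>. coef b \<pi> \<noteq> 0}" and ?T = "{\<pi>. coef c \<pi> \<noteq> 0}"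
  have S: "finite ?S" by simp
  have T: "finite ?T" by simp
  have *: "coef (x * c) \<rho> = (\<Sum>\<mu>\<in>?S. \<Sum>\<pi>\<in>?T. if pcomp \<mu> \<pi> = Some \<rho> then coef x \<mu> * coef c \<pi> else 0)"
    if "{\<mu>. coef x \<mu> \<noteq> 0} \<subseteq> ?S" for x
    by (rule coef_times[OF S that T order_refl])
  show "coef ((a + b) * c) \<rho> = coef (a * c + b * c) \<rho>"
    unfolding coef_add
    by (subst (1 2 3) *) (auto simp: algebra_simps simp flip: sum.distrib intro!: sum.cong)
qed

lemma pal_distrib_left: "c * (a + b) = c * a + c * (b :: 'f::field_char_0 pal)"
proof (rule pal_eqI)
  fix \<rho>
  let ?S = "{\<pi>. coef a \<pi> \<noteq> 0} \<union> {\<pi>. coef b \<pi> \<noteq> 0}" and ?T = "{\<pi>. coef c \<pi> \<noteq> 0}"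
  have S: "finite ?S" by simp
  have T: "finite ?T" by simp
  have *: "coef (c * x) \<rho> = (\<Sum>\<mu>\<in>?T. \<Sum>\<pi>\<in>?S. if pcomp \<mu> \<pi> = Some \<rho> then coef c \<mu> * coef x \<pi> else 0)"
    if "{\<mu>. coef x \<mu> \<noteq> 0} \<subseteq> ?S" for x
    by (rule coef_times[OF T order_refl S that])
  show "coef (c * (a + b)) \<rho> = coef (c * a + c * b) \<rho>"
    unfolding coef_add
    by (subst (1 2 3) *) (auto simp: algebra_simps simp flip: sum.distrib intro!: sum.cong)
qed

lemma scl_mult_left: "scl c a * b = scl c (a * b)"
proof (rule pal_eqI)
  fix \<rho>
  have "coef (scl c a * b) \<rho> = (\<Sum>\<mu>\<in>{\<pi>. coef a \<pi> \<noteq> 0}. \<Sum>\<pi>\<in>{\<pi>. coef b \<pi> \<noteq> 0}.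
      if pcomp \<mu> \<pi> = Some \<rho> then coef (scl c a) \<mu> * coef b \<pi> else 0)"
    by (rule coef_times) auto
  also have "\<dots> = coef (scl c (a * b)) \<rho>"
    unfolding coef_scl coef_times[OF finite_coef order_refl finite_coef order_refl]
    by (auto simp: sum_distrib_left mult.assoc intro!: sum.cong)
  finally show "coef (scl c a * b) \<rho> = coef (scl c (a * b)) \<rho>" .
qed

lemma scl_mult_right: "a * scl c b = scl c (a * b)"
proof (rule pal_eqI)
  fix \<rho>
  have "coef (a * scl c b) \<rho> = (\<Sum>\<mu>\<in>{\<pi>. coef a \<pi> \<noteq> 0}. \<Sum>\<pi>\<in>{\<pi>. coef b \<pi> \<noteq> 0}.
      if pcomp \<mu> \<pi> = Some \<rho> then coef a \<mu> * coef (scl c b) \<pi> else 0)"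
    by (rule coef_times) auto
  also have "\<dots> = coef (scl c (a * b)) \<rho>"
    unfolding coef_scl coef_times[OF finite_coef order_refl finite_coef order_refl]
    by (auto simp: sum_distrib_left mult.left_commute intro!: sum.cong)
  finally show "coef (a * scl c b) \<rho> = coef (scl c (a * b)) \<rho>" .
qed

definition obs :: "diagram option \<Rightarrow> 'f::field_char_0 pal" where
  "obs x = (case x of None \<Rightarrow> 0 | Some \<pi> \<Rightarrow> bs \<pi>)"

lemma bs_times_bs:
  assumes "valid \<mu>" "valid \<pi>"
  shows "bs \<mu> * bs \<pi> = (obs (pcomp \<mu> \<pi>) :: 'f::field_char_0 pal)"
proof (rule pal_eqI)
  fix \<rho>
  have "coef (bs \<mu> * bs \<pi> :: 'f pal) \<rho> = (\<Sum>\<mu>'\<in>{\<mu>}. \<Sum>\<pi>'\<in>{\<pi>}.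
      if pcomp \<mu>' \<pi>' = Some \<rho> then coef (bs \<mu> :: 'f pal) \<mu>' * coef (bs \<pi>) \<pi>' else 0)"
    by (rule coef_times) (auto simp: coef_bs split: if_splits)
  also have "\<dots> = coef (obs (pcomp \<mu> \<pi>)) \<rho>"
    using assms pcomp_valid[of \<mu> \<pi>] by (auto simp: coef_bs obs_def split: option.splits)
  finally show "coef (bs \<mu> * bs \<pi> :: 'f pal) \<rho> = coef (obs (pcomp \<mu> \<pi>)) \<rho>" .
qed

lemma pal_zero_mult: "0 * a = (0 :: 'f::field_char_0 pal)" "a * 0 = (0 :: 'f::field_char_0 pal)"
  using scl_mult_left[of 0 0 a] scl_mult_right[of a 0 0] by simp_all

text \<open>By trilinearity associativity is a statement about basis diagrams, where it is
  \<open>pcomp_assoc\<close>.\<close>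

instance pal :: (field_char_0) ring
proof
  fix a b c :: "'a pal"
  show "(a + b) * c = a * c + b * c" by (rule pal_distrib_right)
  show "a * (b + c) = a * b + a * c" by (rule pal_distrib_left)
  have B: "bs \<nu> * bs \<mu> * bs \<pi> = bs \<nu> * (bs \<mu> * bs \<pi> :: 'a pal)"
    if v: "valid \<nu>" "valid \<mu>" "valid \<pi>" for \<nu> \<mu> \<pi>
  proof -
    have l: "obs x * bs \<pi> = (obs (Option.bind x (\<lambda>\<sigma>. pcomp \<sigma> \<pi>)) :: 'a pal)" if "\<forall>\<sigma>. x = Some \<sigma> \<longrightarrow> valid \<sigma>" for x
      using that v by (cases x) (auto simp: obs_def[of "None"] obs_def[of "Some _"] pal_zero_mult bs_times_bs)
    have r: "bs \<nu> * obs x = (obs (Option.bind x (pcomp \<nu>)) :: 'a pal)" if "\<forall>\<sigma>. x = Some \<sigma> \<longrightarrow> valid \<sigma>" for x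
      using that v by (cases x) (auto simp: obs_def[of "None"] obs_def[of "Some _"] pal_zero_mult bs_times_bs)
    show ?thesis
      by (simp add: bs_times_bs v l r pcomp_valid pcomp_assoc)
  qed
  show "a * b * c = a * (b * c)"
  proof (induction a rule: pal_induct)
    case (basis k \<nu>)
    show ?case
    proof (induction b rule: pal_induct)
      case (basis k' \<mu>)
      show ?case
      proof (induction c rule: pal_induct)
        case (basis k'' \<pi>)
        then show ?case
          using B[OF \<open>valid \<nu>\<close> \<open>valid \<mu>\<close> \<open>valid \<pi>\<close>] by (simp add: scl_mult_left scl_mult_right)
      qed (simp_all add: pal_zero_mult pal_distrib_left)
    qed (simp_all add: pal_zero_mult pal_distrib_left pal_distrib_right)
  qed (simp_all add: pal_zero_mult pal_distrib_right)
qed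

lemma bs_mult:
  assumes "\<pi> \<in> diagrams n m" "\<mu> \<in> diagrams m l"
  shows "bs \<mu> * bs \<pi> = (if loops \<mu> \<pi> = 0 then bs (diagram_comp \<mu> \<pi>) else 0 :: 'f::field_char_0 pal)"
  using assms by (subst bs_times_bs) (auto simp: valid_diagrams pcomp_eq obs_def)

lemma bs_mult_neq:
  assumes "\<pi> \<in> diagrams n m" "\<mu> \<in> diagrams m' l" "m \<noteq> m'"
  shows "bs \<mu> * bs \<pi> = (0 :: 'f::field_char_0 pal)"
  using assms by (subst bs_times_bs) (auto simp: valid_diagrams pcomp_None obs_def)

text \<open>The rule by which explicit products are computed: relations between labellings are
  composed, and the last assumption excludes closed components.\<close>

lemma bs_multI:
  assumes "\<pi> \<in> diagrams n m" "\<mu> \<in> diagrams m l" "\<rho> \<in> diagrams n l"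
    and "\<And>x z. fits \<rho> x z \<longleftrightarrow> (\<exists>y. fits \<pi> x y \<and> fits \<mu> y z)"
    and "\<And>y j. fits \<pi> (\<lambda>_. False) y \<Longrightarrow> fits \<mu> y (\<lambda>_. False) \<Longrightarrow> j \<in> {1..m} \<Longrightarrow> \<not> y j"
  shows "bs \<mu> * bs \<pi> = (bs \<rho> :: 'f::field_char_0 pal)"
proof -
  have "loops \<mu> \<pi> = 0" using assms(5) unfolding loops_eq_0_iff[OF assms(1,2)] by blast
  moreover have "diagram_comp \<mu> \<pi> = \<rho>"
    by (rule diagram_eqI[OF diagram_comp_in[OF assms(1,2)] assms(3)])
      (simp add: fits_comp[OF assms(1,2)] assms(4))
  ultimately show ?thesis by (simp add: bs_mult[OF assms(1,2)])
qed

text \<open>The labelling \<open>y\<close> witnesses a closed component, which contributes the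
  factor t = 0.\<close>

lemma bs_mult_0I:
  assumes "\<pi> \<in> diagrams n m" "\<mu> \<in> diagrams m l"
    and "fits \<pi> (\<lambda>_. False) y" "fits \<mu> y (\<lambda>_. False)" "j \<in> {1..m}" "y j"
  shows "bs \<mu> * bs \<pi> = (0 :: 'f::field_char_0 pal)"
proof -
  have "loops \<mu> \<pi> \<noteq> 0" using assms(3-) unfolding loops_eq_0_iff[OF assms(1,2)] by blast
  then show ?thesis by (simp add: bs_mult[OF assms(1,2)])
qed

subsection \<open>Homs\<close>

definition hm :: "nat \<Rightarrow> nat \<Rightarrow> 'f::field_char_0 pal set" where
  "hm n m = {a. \<forall>\<pi>. coef a \<pi> \<noteq> 0 \<longrightarrow> \<pi> \<in> diagrams n m}"

lemma hm_0 [simp]: "0 \<in> hm n m" by (simp add: hm_def)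

lemma hm_add [simp]: "a \<in> hm n m \<Longrightarrow> b \<in> hm n m \<Longrightarrow> a + b \<in> hm n m"
  by (auto simp: hm_def) (metis add.right_neutral)

lemma hm_uminus [simp]: "a \<in> hm n m \<Longrightarrow> - a \<in> hm n m" by (auto simp: hm_def)

lemma hm_diff [simp]: "a \<in> hm n m \<Longrightarrow> b \<in> hm n m \<Longrightarrow> a - b \<in> hm n m"
  using hm_add[of a n m "- b"] by simp

lemma hm_scl [simp]: "a \<in> hm n m \<Longrightarrow> scl c a \<in> hm n m" by (auto simp: hm_def)

lemma hm_sum [intro]: "(\<And>i. i \<in> A \<Longrightarrow> f i \<in> hm n m) \<Longrightarrow> sum f A \<in> hm n m"
  by (induction A rule: infinite_finite_induct) auto

lemma hm_bs [simp]: "\<pi> \<in> diagrams n m \<Longrightarrow> bs \<pi> \<in> hm n m"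
  by (auto simp: hm_def coef_bs)

lemma hm_expand:
  assumes "a \<in> hm n m" shows "a = (\<Sum>\<pi>\<in>diagrams n m. scl (coef a \<pi>) (bs \<pi>))"
proof -
  have "a = (\<Sum>\<pi> | coef a \<pi> \<noteq> 0. scl (coef a \<pi>) (bs \<pi>))" by (rule pal_expand)
  also have "\<dots> = (\<Sum>\<pi>\<in>diagrams n m. scl (coef a \<pi>) (bs \<pi>))"
    by (rule sum.mono_neutral_left) (use assms in \<open>auto simp: hm_def\<close>)
  finally show ?thesis .
qed

lemma hm_induct [consumes 1, case_names zero add basis]:
  assumes "a \<in> hm n m" "P 0" "\<And>a b. a \<in> hm n m \<Longrightarrow> b \<in> hm n m \<Longrightarrow> P a \<Longrightarrow> P b \<Longrightarrow> P (a + b)"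
    "\<And>c \<pi>. \<pi> \<in> diagrams n m \<Longrightarrow> P (scl c (bs \<pi>))"
  shows "P a"
proof -
  have "(\<Sum>\<pi>\<in>S. scl (coef a \<pi>) (bs \<pi>)) \<in> hm n m \<and> P (\<Sum>\<pi>\<in>S. scl (coef a \<pi>) (bs \<pi>))"
    if "finite S" "S \<subseteq> diagrams n m" for S
    using that by induction (auto intro!: assms)
  from this[of "diagrams n m"] show ?thesis using hm_expand[OF assms(1)] by simp
qed

lemma hm_mult [intro]:
  assumes "b \<in> hm m l" "a \<in> hm n m" shows "b * a \<in> hm n l"
  using assms(1)
proof (induction rule: hm_induct)
  case (basis c \<mu>)
  show ?case using assms(2)
  proof (induction rule: hm_induct)
    case (basis d \<pi>)
    then show ?case using \<open>\<mu> \<in> diagrams m l\<close>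
      by (simp add: scl_mult_left scl_mult_right bs_mult diagram_comp_in)
  qed (simp_all add: distrib_left)
qed (simp_all add: distrib_right)

subsection \<open>Diagrams of maps\<close>

text \<open>\<open>fnd n m g\<close> connects the vertex \<open>j'\<close> with the vertex \<open>g j\<close>.\<close>

definition fnd :: "nat \<Rightarrow> nat \<Rightarrow> (nat \<Rightarrow> nat) \<Rightarrow> diagram" where
  "fnd n m g = gen_diagram n m ((\<lambda>j. (Tgt j, Src (g j))) ` {1..m})"

definition fn :: "nat \<Rightarrow> nat \<Rightarrow> (nat \<Rightarrow> nat) \<Rightarrow> 'f::field_char_0 pal" where
  "fn n m g = bs (fnd n m g)"

lemma fnd_in [simp]: "fnd n m g \<in> diagrams n m" by (simp add: fnd_def)

lemma fn_hm [simp]: "fn n m g \<in> hm n m" by (simp add: fn_def)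

lemma fits_fnd:
  assumes "g \<in> {1..m} \<rightarrow> {1..n}"
  shows "fits (fnd n m g) x y \<longleftrightarrow> (\<forall>j\<in>{1..m}. y j = x (g j))"
  unfolding fnd_def using assms by (subst fits_gen_diagram) (auto simp: verts_of_def)

lemma fnd_cong: "(\<And>j. j \<in> {1..m} \<Longrightarrow> g j = h j) \<Longrightarrow> fnd n m g = fnd n m h"
  unfolding fnd_def by (rule arg_cong[where f="gen_diagram n m"], rule image_cong) auto

lemma fn_cong: "(\<And>j. j \<in> {1..m} \<Longrightarrow> g j = h j) \<Longrightarrow> fn n m g = fn n m h"
  unfolding fn_def using fnd_cong by metis

text \<open>Contravariant because \<open>g\<close> sends targets to sources. No closed component
  arises, since \<open>g\<close> ties every middle vertex to a source.\<close>

lemma fn_mult: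
  assumes g: "g \<in> {1..m} \<rightarrow> {1..n}" and h: "h \<in> {1..l} \<rightarrow> {1..m}"
  shows "fn m l h * fn n m g = fn n l (g \<circ> h)"
  unfolding fn_def
proof (rule bs_multI[OF fnd_in fnd_in fnd_in])
  have gh: "g \<circ> h \<in> {1..l} \<rightarrow> {1..n}" using g h by (auto simp: Pi_iff)
  show "fits (fnd n l (g \<circ> h)) x z \<longleftrightarrow> (\<exists>y. fits (fnd n m g) x y \<and> fits (fnd m l h) y z)" for x z
    unfolding fits_fnd[OF g] fits_fnd[OF h] fits_fnd[OF gh]
    by (rule iffI, rule exI[of _ "x \<circ> g"]) (use h in \<open>auto simp: Pi_iff\<close>)
qed (use g in \<open>auto simp: fits_fnd\<close>)

text \<open>The labelling that marks the single source \<open>g j\<close> tells the two diagrams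
  apart.\<close>

lemma fnd_inj:
  assumes g: "g \<in> {1..m} \<rightarrow> {1..n}" and h: "h \<in> {1..m} \<rightarrow> {1..n}"
    and eq: "fnd n m g = fnd n m h" and j: "j \<in> {1..m}"
  shows "g j = h j"
proof -
  have "fits (fnd n m g) (\<lambda>i. i = g j) (\<lambda>k. g k = g j)" unfolding fits_fnd[OF g] by simp
  then have "fits (fnd n m h) (\<lambda>i. i = g j) (\<lambda>k. g k = g j)" by (simp add: eq)
  then show ?thesis unfolding fits_fnd[OF h] using j by (metis (mono_tags))
qed

lemma id_diagram_eq: "id_diagram n = fnd n n id"
proof (rule diagram_eqI)
  show "id_diagram n \<in> diagrams n n"
    unfolding diagrams_iff id_diagram_def verts_of_def by (rule partition_onI) (auto simp: disjnt_def)
  show "fits (id_diagram n) x y = fits (fnd n n id) x y" for x y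
    by (subst fits_fnd) (auto simp: fits_def id_diagram_def)
qed simp

definition ident :: "nat \<Rightarrow> 'f::field_char_0 pal" where "ident n = fn n n id"

lemma ident_hm [simp]: "ident n \<in> hm n n" by (simp add: ident_def)

lemma fits_id: "fits (fnd n n id) x y \<longleftrightarrow> (\<forall>j\<in>{1..n}. y j = x j)"
  by (subst fits_fnd) auto

lemma ident_left [simp]: assumes "a \<in> hm n m" shows "ident m * a = a"
  using assms
proof (induction rule: hm_induct)
  case (basis c \<pi>)
  have "bs (fnd m m id) * bs \<pi> = (bs \<pi> :: 'a pal)"
  proof (rule bs_multI[OF basis fnd_in basis])
    show "fits \<pi> x z \<longleftrightarrow> (\<exists>y. fits \<pi> x y \<and> fits (fnd m m id) y z)" for x z
      unfolding fits_id using fits_cong[OF basis, of x x _ z] by blast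
  qed (auto simp: fits_id)
  then show ?case by (simp only: scl_mult_right fn_def ident_def)
qed (simp_all add: distrib_left)

lemma ident_right [simp]: assumes "a \<in> hm n m" shows "a * ident n = a"
  using assms
proof (induction rule: hm_induct)
  case (basis c \<pi>)
  have "bs \<pi> * bs (fnd n n id) = (bs \<pi> :: 'a pal)"
  proof (rule bs_multI[OF fnd_in basis basis])
    show "fits \<pi> x z \<longleftrightarrow> (\<exists>y. fits (fnd n n id) x y \<and> fits \<pi> y z)" for x z
      unfolding fits_id using fits_cong[OF basis, of x _ z z] by blast
  qed (auto simp: fits_id)
  then show ?case by (simp only: scl_mult_left fn_def ident_def)
qed (simp_all add: distrib_right)

lemma ident_fn [simp]: "ident m * fn n m g = fn n m g" "fn n m g * ident n = fn n m g"
  by (rule ident_left[OF fn_hm], rule ident_right[OF fn_hm])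

lemma ident_ident [simp]: "ident n * ident n = ident n"
  by (rule ident_left[OF ident_hm])

subsection \<open>Transposition\<close>

primrec flip :: "vertex \<Rightarrow> vertex" where
  "flip (Src i) = Tgt i"
| "flip (Tgt i) = Src i"
| "flip (Mid i) = Mid i"

lemma flip_flip [simp]: "flip (flip u) = u" by (cases u) auto

definition flipd :: "diagram \<Rightarrow> diagram" where
  "flipd \<pi> = (\<lambda>B. flip ` B) ` \<pi>"

lemma flipd_flipd [simp]: "flipd (flipd \<pi>) = \<pi>"
  by (simp add: flipd_def image_image)

lemma flipd_in [simp]: assumes "\<pi> \<in> diagrams n m" shows "flipd \<pi> \<in> diagrams m n"
proof -
  have inj: "inj flip" by (metis flip_flip injI)
  then have "partition_on (flip ` verts_of n m) ((`) flip ` \<pi> - {{}})"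
    using assms unfolding diagrams_iff by (intro partition_on_inj_image) (auto intro: inj_on_subset)
  moreover have "flip ` verts_of n m = verts_of m n" by (auto simp: verts_of_def image_Un image_image)
  moreover have "(`) flip ` \<pi> - {{}} = flipd \<pi>"
    using assms by (auto simp: flipd_def diagrams_iff partition_on_def)
  ultimately show ?thesis by (simp add: diagrams_iff)
qed

lemma label_flip: "label x (\<lambda>_. False) z (flip u) = label z (\<lambda>_. False) x u"
  by (cases u) auto

lemma fits_flipd [simp]: "fits (flipd \<pi>) x z = fits \<pi> z x"
  by (simp add: fits_def flipd_def label_flip)

lemma valid_flipd [simp]: "valid (flipd \<pi>) = valid \<pi>"
  unfolding valid_def using flipd_in flipd_flipd by metis

text \<open>The anti-involution that turns diagrams upside down; it transfers statements about
  morphisms into \<open>\<Lambda>\<^sub>i\<close> to morphisms out of it.\<close>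

lift_definition tr :: "'f::field_char_0 pal \<Rightarrow> 'f pal" is "\<lambda>f \<pi>. f (flipd \<pi>)"
proof (clarsimp, intro conjI allI impI)
  fix f :: "diagram \<Rightarrow> 'f"
  assume "finite {\<pi>. f \<pi> \<noteq> 0}"
  then have "finite (flipd ` {\<pi>. f \<pi> \<noteq> 0})" by simp
  then show "finite {\<pi>. f (flipd \<pi>) \<noteq> 0}"
    by (rule rev_finite_subset) (metis (mono_tags) flipd_flipd image_eqI mem_Collect_eq subsetI)
qed auto

lemma coef_tr [simp]: "coef (tr a) \<pi> = coef a (flipd \<pi>)" by transfer simp

lemma tr_tr [simp]: "tr (tr a) = a" by (rule pal_eqI) simp
lemma tr_add [simp]: "tr (a + b) = tr a + tr b" by (rule pal_eqI) simp
lemma tr_0 [simp]: "tr 0 = 0" by (rule pal_eqI) simp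
lemma tr_scl [simp]: "tr (scl c a) = scl c (tr a)" by (rule pal_eqI) simp
lemma tr_sum [simp]: "tr (sum f A) = (\<Sum>i\<in>A. tr (f i))" by (rule pal_eqI) simp
lemma tr_bs [simp]: "tr (bs \<pi>) = bs (flipd \<pi>)"
  by (rule pal_eqI) (auto simp: coef_bs)

lemma tr_hm [simp]: "a \<in> hm n m \<Longrightarrow> tr a \<in> hm m n"
  unfolding hm_def using flipd_in flipd_flipd by (auto, metis)

lemma flipd_comp:
  assumes d: "\<pi> \<in> diagrams n m" "\<mu> \<in> diagrams m l"
  shows "diagram_comp (flipd \<pi>) (flipd \<mu>) = flipd (diagram_comp \<mu> \<pi>)"
  by (rule diagram_eqI[OF diagram_comp_in[OF flipd_in[OF d(2)] flipd_in[OF d(1)]] flipd_in[OF diagram_comp_in[OF d]]])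
    (auto simp: fits_comp[OF flipd_in[OF d(2)] flipd_in[OF d(1)]] fits_comp[OF d])

text \<open>Turning a glued pair upside down reverses the factors and preserves closed
  components.\<close>

lemma tr_mult: "tr (b * a) = tr a * tr (b :: 'f::field_char_0 pal)"
proof (induction a rule: pal_induct)
  case (basis c \<pi>)
  then obtain n m where \<pi>: "\<pi> \<in> diagrams n m" by (auto simp: valid_def)
  show ?case
  proof (induction b rule: pal_induct)
    case (basis d \<mu>)
    then obtain m' l where \<mu>: "\<mu> \<in> diagrams m' l" by (auto simp: valid_def)
    have "tr (bs \<mu> * bs \<pi>) = bs (flipd \<pi>) * (bs (flipd \<mu>) :: 'f pal)"
    proof (cases "m = m'")
      case True
      with \<mu> have \<mu>: "\<mu> \<in> diagrams m l" by simp
      have "loops (flipd \<pi>) (flipd \<mu>) = 0 \<longleftrightarrow> loops \<mu> \<pi> = 0"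
        unfolding loops_eq_0_iff[OF \<pi> \<mu>] loops_eq_0_iff[OF flipd_in[OF \<mu>] flipd_in[OF \<pi>]] by auto
      then show ?thesis
        by (simp add: bs_mult[OF \<pi> \<mu>] bs_mult[OF flipd_in[OF \<mu>] flipd_in[OF \<pi>]] flipd_comp[OF \<pi> \<mu>])
    next
      case False
      then show ?thesis by (simp add: bs_mult_neq[OF \<pi> \<mu>] bs_mult_neq[OF flipd_in[OF \<mu>] flipd_in[OF \<pi>]])
    qed
    then show ?case by (simp add: scl_mult_left scl_mult_right ac_simps)
  qed (simp_all add: distrib_left distrib_right)
qed (simp_all add: distrib_left distrib_right)

declare One_nat_def [simp del]

subsection \<open>Antisymmetrizers\<close>

abbreviation pinv :: "(nat \<Rightarrow> nat) \<Rightarrow> nat \<Rightarrow> nat" where "pinv \<sigma> \<equiv> inv_into UNIV \<sigma>"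

definition sg :: "(nat \<Rightarrow> nat) \<Rightarrow> 'f::field_char_0" where
  "sg \<sigma> = of_int (sign \<sigma>)"

lemma sg_sq [simp]: "sg \<sigma> * sg \<sigma> = (1 :: 'f::field_char_0)"
  by (auto simp: sg_def sign_def)

lemma sg_id [simp]: "sg id = 1" by (simp add: sg_def)

lemma sg_comp:
  assumes "\<sigma> permutes {1..n::nat}" "\<tau> permutes {1..n}"
  shows "sg (\<sigma> \<circ> \<tau>) = sg \<sigma> * sg \<tau>"
  using assms by (simp add: sg_def sign_compose permutation_permutes[of _] exI[of _ "{1..n}"] permutes_imp_permutation[of "{1..n}"])

lemma sg_inv: "\<sigma> permutes {1..n::nat} \<Longrightarrow> sg (pinv \<sigma>) = sg \<sigma>"
  by (simp add: sg_def sign_inverse permutes_imp_permutation[of "{1..n}"])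

lemma sg_transpose: "a \<noteq> b \<Longrightarrow> sg (transpose a b) = -1"
  by (simp add: sg_def sign_swap_id)

lemma permutes_Pi: "\<sigma> permutes {1..n::nat} \<Longrightarrow> \<sigma> \<in> {1..n} \<rightarrow> {1..n}"
  by (metis Pi_I permutes_in_image)

lemma permutes_mono: "\<sigma> permutes {1..n::nat} \<Longrightarrow> n \<le> m \<Longrightarrow> \<sigma> permutes {1..m}"
  by (rule permutes_subset) auto

lemma transpose_permutes: "a \<in> {1..n::nat} \<Longrightarrow> b \<in> {1..n} \<Longrightarrow> transpose a b permutes {1..n}"
  by (rule permutes_swap_id)

lemma fn_perm_mult:
  "\<sigma> permutes {1..n} \<Longrightarrow> \<tau> permutes {1..n} \<Longrightarrow> fn n n \<sigma> * fn n n \<tau> = fn n n (\<tau> \<circ> \<sigma>)"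
  by (simp add: fn_mult permutes_Pi)

lemma fits_perm: "\<sigma> permutes {1..n} \<Longrightarrow> fits (fnd n n \<sigma>) x y \<longleftrightarrow> (\<forall>j\<in>{1..n}. y j = x (\<sigma> j))"
  by (rule fits_fnd) (rule permutes_Pi)

lemma tr_fn_perm:
  assumes \<sigma>: "\<sigma> permutes {1..n}" shows "tr (fn n n \<sigma>) = fn n n (pinv \<sigma>)"
proof -
  have "flipd (fnd n n \<sigma>) = fnd n n (pinv \<sigma>)"
  proof (rule diagram_eqI[OF flipd_in[OF fnd_in] fnd_in])
    fix x y :: "nat \<Rightarrow> bool"
    have "(\<forall>j\<in>{1..n}. x j = y (\<sigma> j)) \<longleftrightarrow> (\<forall>j\<in>{1..n}. y j = x (pinv \<sigma> j))"
      using permutes_in_image[OF \<sigma>] permutes_in_image[OF permutes_inv[OF \<sigma>]] permutes_inverses[OF \<sigma>] by metis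
    then show "fits (flipd (fnd n n \<sigma>)) x y = fits (fnd n n (pinv \<sigma>)) x y"
      unfolding fits_flipd fits_perm[OF \<sigma>] fits_perm[OF permutes_inv[OF \<sigma>]] .
  qed
  then show ?thesis by (simp add: fn_def)
qed

text \<open>Normalized to be idempotent, using characteristic zero. Antisymmetrizing only the first
  \<open>m\<close> of \<open>n\<close> strands serves the coset decomposition \<open>alt_Suc\<close>
  and the passage through \<open>cap\<close>.\<close>

definition alt_in :: "nat \<Rightarrow> nat \<Rightarrow> 'f::field_char_0 pal" where
  "alt_in n m = scl (1 / fact m) (\<Sum>\<sigma> | \<sigma> permutes {1..m}. scl (sg \<sigma>) (fn n n \<sigma>))"

abbreviation alt :: "nat \<Rightarrow> 'f::field_char_0 pal" where "alt n \<equiv> alt_in n n"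

lemma alt_in_hm [simp]: "alt_in n m \<in> hm n n"
  unfolding alt_in_def by (intro hm_scl hm_sum) simp

text \<open>Left multiplication by \<open>fn n n \<tau>\<close> composes the permutations in the sum
  with \<open>\<tau>\<close> on the right, so the sum is merely reindexed and the sign comes
  out.\<close>

lemma fn_alt:
  assumes "\<tau> permutes {1..n}"
  shows "fn n n \<tau> * alt n = scl (sg \<tau>) (alt n :: 'a::field_char_0 pal)"
proof -
  have "fn n n \<tau> * (\<Sum>\<sigma> | \<sigma> permutes {1..n}. scl (sg \<sigma>) (fn n n \<sigma>)) =
     (\<Sum>\<sigma> | \<sigma> permutes {1..n}. scl (sg \<sigma>) (fn n n (\<sigma> \<circ> \<tau>)) :: 'a pal)"
    by (auto simp: sum_distrib_left scl_mult_right fn_perm_mult[OF assms] intro!: sum.cong)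
  also have "\<dots> = (\<Sum>\<sigma> | \<sigma> permutes {1..n}. scl (sg (\<sigma> \<circ> \<tau>) * sg \<tau>) (fn n n (\<sigma> \<circ> \<tau>)))"
    by (rule sum.cong) (auto simp: sg_comp[OF _ assms] mult.assoc)
  also have "\<dots> = (\<Sum>\<sigma> | \<sigma> permutes {1..n}. scl (sg \<sigma> * sg \<tau>) (fn n n \<sigma>))"
    by (rule sum_permutations_compose_right[OF assms, symmetric])
  also have "\<dots> = scl (sg \<tau>) (\<Sum>\<sigma> | \<sigma> permutes {1..n}. scl (sg \<sigma>) (fn n n \<sigma>))"
    by (simp add: pal.scale_sum_right mult.commute)
  finally show ?thesis unfolding alt_in_def scl_mult_right by (simp add: mult.commute)
qed

lemma tr_alt [simp]: "tr (alt n) = (alt n :: 'a::field_char_0 pal)"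
proof -
  have "tr (alt n :: 'a pal) = scl (1 / fact n) (\<Sum>\<sigma> | \<sigma> permutes {1..n}. scl (sg (pinv \<sigma>)) (fn n n (pinv \<sigma>)))"
    by (auto simp: alt_in_def tr_fn_perm sg_inv intro!: sum.cong)
  also have "\<dots> = alt n"
    unfolding alt_in_def by (subst sum_permutations_inverse[symmetric]) (rule refl)
  finally show ?thesis .
qed

lemma alt_fn:
  assumes "\<tau> permutes {1..n}"
  shows "alt n * fn n n \<tau> = scl (sg \<tau>) (alt n :: 'a::field_char_0 pal)"
proof -
  have "tr (alt n * fn n n \<tau>) = tr (scl (sg \<tau>) (alt n :: 'a pal))"
    by (simp add: tr_mult tr_fn_perm[OF assms] fn_alt[OF permutes_inv[OF assms]] sg_inv[OF assms])
  then show ?thesis by (metis tr_tr)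
qed

lemma card_permutes [simp]: "card {\<sigma>. \<sigma> permutes {1..n::nat}} = fact n"
  by (subst card_permutations[OF refl]) auto

lemma alt_alt_in [simp]:
  assumes "m \<le> n" shows "alt n * alt_in n m = (alt n :: 'a::field_char_0 pal)"
proof -
  have "alt n * alt_in n m =
      scl (1 / fact m) (\<Sum>\<sigma> | \<sigma> permutes {1..m}. scl (sg \<sigma>) (alt n * fn n n \<sigma>) :: 'a pal)"
    by (simp add: alt_in_def[of n m] scl_mult_right sum_distrib_left)
  also have "\<dots> = scl (1 / fact m) (\<Sum>\<sigma> | \<sigma> permutes {1..m}. alt n)"
    by (intro arg_cong[where f="scl _"] sum.cong refl) (use assms in \<open>simp add: alt_fn permutes_mono\<close>)
  also have "\<dots> = alt n" by (simp add: pal.sum_constant_scale)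
  finally show ?thesis .
qed

lemma alt_in_alt [simp]:
  assumes "m \<le> n" shows "alt_in n m * alt n = (alt n :: 'a::field_char_0 pal)"
proof -
  have "alt_in n m * alt n =
      scl (1 / fact m) (\<Sum>\<sigma> | \<sigma> permutes {1..m}. scl (sg \<sigma>) (fn n n \<sigma> * alt n) :: 'a pal)"
    by (simp add: alt_in_def[of n m] scl_mult_left sum_distrib_right)
  also have "\<dots> = scl (1 / fact m) (\<Sum>\<sigma> | \<sigma> permutes {1..m}. alt n)"
    by (intro arg_cong[where f="scl _"] sum.cong refl) (use assms in \<open>simp add: fn_alt permutes_mono\<close>)
  also have "\<dots> = alt n" by (simp add: pal.sum_constant_scale)
  finally show ?thesis .
qed

lemma ident_alt [simp]: "ident n * alt_in n m = alt_in n m" "alt_in n m * ident n = alt_in n m"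
  by (rule ident_left[OF alt_in_hm], rule ident_right[OF alt_in_hm])

lemma alt_mult_alt_in [simp]: "m \<le> n \<Longrightarrow> alt n * (alt_in n m * a) = alt n * a"
  by (simp flip: mult.assoc)

lemma pal_eq_neg_imp_0: assumes "a = - (a :: 'f::field_char_0 pal)" shows "a = 0"
proof (rule pal_eqI)
  fix \<pi>
  have "coef a \<pi> = - coef a \<pi>" using assms by (metis coef_uminus)
  then show "coef a \<pi> = coef 0 \<pi>" by simp
qed

text \<open>The transposition is absorbed by \<open>x\<close> and changes the sign of
  \<open>alt n\<close>; 2 is invertible.\<close>

lemma alt_eq_0:
  fixes x :: "'a::field_char_0 pal"
  assumes "fn n n (transpose a b) * x = x" "a \<noteq> b" "a \<in> {1..n}" "b \<in> {1..n}"
  shows "alt n * x = 0"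
proof -
  have "alt n * x = alt n * fn n n (transpose a b) * x" by (simp add: assms(1) mult.assoc)
  also have "\<dots> = - (alt n * x)"
    by (simp add: alt_fn[OF transpose_permutes[OF assms(3,4)]] sg_transpose[OF assms(2)] scl_mult_left)
  finally show ?thesis by (rule pal_eq_neg_imp_0)
qed

text \<open>The coset decomposition of the symmetric group on \<open>n + 1\<close> letters.\<close>

lemma alt_Suc:
  "scl (of_nat (Suc n)) (alt (Suc n)) = alt_in (Suc n) n *
     (ident (Suc n) - (\<Sum>b\<in>{1..n}. fn (Suc n) (Suc n) (transpose (Suc n) b)) :: 'a::field_char_0 pal)"
proof -
  let ?f = "\<lambda>\<sigma>. scl (sg \<sigma>) (fn (Suc n) (Suc n) \<sigma>) :: 'a pal"
  let ?t = "\<lambda>b. transpose (Suc n) b"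
  have ins: "{1..Suc n} = insert (Suc n) {1..n}" by auto
  have "(\<Sum>\<sigma> | \<sigma> permutes {1..Suc n}. ?f \<sigma>) =
      (\<Sum>b\<in>{1..Suc n}. \<Sum>q | q permutes {1..n}. ?f (?t b \<circ> q))"
    unfolding ins by (rule sum_over_permutations_insert) auto
  also have "\<dots> = (\<Sum>b\<in>{1..Suc n}. \<Sum>q | q permutes {1..n}. ?f q * ?f (?t b))"
  proof (intro sum.cong refl)
    fix b q assume b: "b \<in> {1..Suc n}" and "q \<in> {q. q permutes {1..n}}"
    then have q: "q permutes {1..Suc n}" by (auto intro: permutes_mono)
    have t: "?t b permutes {1..Suc n}" using b by (intro transpose_permutes) auto
    show "?f (?t b \<circ> q) = ?f q * ?f (?t b)"
      by (simp add: sg_comp[OF t q] fn_perm_mult[OF q t] scl_mult_left scl_mult_right mult.commute)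
  qed
  also have "\<dots> = (\<Sum>q | q permutes {1..n}. ?f q) * (\<Sum>b\<in>{1..Suc n}. ?f (?t b))"
    unfolding sum_product by (rule sum.swap)
  also have "(\<Sum>b\<in>{1..Suc n}. ?f (?t b)) = ?f (?t (Suc n)) + (\<Sum>b\<in>{1..n}. ?f (?t b))"
    unfolding ins by (subst sum.insert) auto
  also have "?f (?t (Suc n)) = ident (Suc n)" by (simp add: transpose_same ident_def)
  also have "(\<Sum>b\<in>{1..n}. ?f (?t b)) = - (\<Sum>b\<in>{1..n}. fn (Suc n) (Suc n) (?t b))"
    by (auto simp: sg_transpose sum_negf[symmetric] intro!: sum.cong)
  finally show ?thesis
    by (simp add: alt_in_def scl_mult_left fact_Suc del: of_nat_Suc)
qed

text \<open>Permuting the ends of a diagram permutes its labellings. The inverse occurs because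
  \<open>fn m m \<sigma>\<close> gives the outer target labels \<open>z = y \<circ> \<sigma>\<close>
  in terms of the inner labels \<open>y\<close>, and this has to be solved for
  \<open>y\<close>.\<close>

lemma bs_conj:
  assumes \<sigma>: "\<sigma> permutes {1..m}" and \<tau>: "\<tau> permutes {1..n}" and \<pi>: "\<pi> \<in> diagrams n m" and \<rho>: "\<rho> \<in> diagrams n m"
    and eq: "\<And>x z. fits \<rho> x z \<longleftrightarrow> fits \<pi> (x \<circ> \<tau>) (z \<circ> pinv \<sigma>)"
  shows "fn m m \<sigma> * bs \<pi> * fn n n \<tau> = bs \<rho>"
proof -
  let ?\<pi>1 = "diagram_comp \<pi> (fnd n n \<tau>)"
  have \<pi>1: "?\<pi>1 \<in> diagrams n m" by (rule diagram_comp_in[OF fnd_in \<pi>])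
  have f1: "fits ?\<pi>1 x z \<longleftrightarrow> fits \<pi> (x \<circ> \<tau>) z" for x z
    unfolding fits_comp[OF fnd_in \<pi>] fits_perm[OF \<tau>]
    using fits_cong[OF \<pi>, of _ "x \<circ> \<tau>" z z] by (metis comp_apply)
  have "bs \<pi> * bs (fnd n n \<tau>) = (bs ?\<pi>1 :: 'a pal)"
    by (rule bs_multI[OF fnd_in \<pi> \<pi>1])
      (auto simp: f1 fits_comp[OF fnd_in \<pi>] fits_perm[OF \<tau>])
  moreover have "bs (fnd m m \<sigma>) * bs ?\<pi>1 = (bs \<rho> :: 'a pal)"
  proof (rule bs_multI[OF \<pi>1 fnd_in \<rho>])
    fix x z
    have "fits \<pi> (x \<circ> \<tau>) (z \<circ> pinv \<sigma>) \<longleftrightarrow> fits \<pi> (x \<circ> \<tau>) y"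
      if "\<forall>j\<in>{1..m}. z j = y (\<sigma> j)" for y
      by (rule fits_cong[OF \<pi> refl])
        (use that permutes_in_image[OF permutes_inv[OF \<sigma>]] permutes_inverses[OF \<sigma>] in auto)
    moreover have "\<forall>j\<in>{1..m}. z j = (z \<circ> pinv \<sigma>) (\<sigma> j)" using permutes_inverses[OF \<sigma>] by simp
    ultimately show "fits \<rho> x z \<longleftrightarrow> (\<exists>y. fits ?\<pi>1 x y \<and> fits (fnd m m \<sigma>) y z)"
      unfolding eq f1 fits_perm[OF \<sigma>] by blast
  next
    fix y j assume "fits (fnd m m \<sigma>) y (\<lambda>_. False)" "j \<in> {1..m}"
    then show "\<not> y j" unfolding fits_perm[OF \<sigma>]
      using permutes_in_image[OF permutes_inv[OF \<sigma>]] permutes_inverses[OF \<sigma>] by metis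
  qed
  ultimately show ?thesis by (simp add: fn_def mult.assoc)
qed

lemma bs_conj_left:
  assumes "\<sigma> permutes {1..m}" "\<pi> \<in> diagrams n m" "\<rho> \<in> diagrams n m"
    "\<And>x z. fits \<rho> x z \<longleftrightarrow> fits \<pi> x (z \<circ> pinv \<sigma>)"
  shows "fn m m \<sigma> * bs \<pi> = (bs \<rho> :: 'a::field_char_0 pal)"
proof -
  have "fn m m \<sigma> * bs \<pi> * fn n n id = (bs \<rho> :: 'a pal)"
    using assms(4) by (intro bs_conj assms permutes_id) (simp_all add: comp_id)
  moreover have "fn m m \<sigma> * bs \<pi> * ident n = (fn m m \<sigma> * bs \<pi> :: 'a pal)"
    by (rule ident_right[OF hm_mult[OF fn_hm hm_bs[OF assms(2)]]])
  ultimately show ?thesis by (simp add: ident_def)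
qed

lemma alt_bs_0:
  assumes \<pi>: "\<pi> \<in> diagrams n m" and ab: "a \<noteq> b" "a \<in> {1..m}" "b \<in> {1..m}"
    and "\<And>x z. fits \<pi> x z \<Longrightarrow> fits \<pi> x (z \<circ> transpose a b)"
  shows "alt m * bs \<pi> = 0"
proof (rule alt_eq_0[OF bs_conj_left[OF _ \<pi> \<pi>] ab])
  show "transpose a b permutes {1..m}" by (rule transpose_permutes) fact+
  show "fits \<pi> x z \<longleftrightarrow> fits \<pi> x (z \<circ> pinv (transpose a b))" for x z
    using assms(5)[of x z] assms(5)[of x "z \<circ> transpose a b"] by (auto simp: comp_assoc)
qed

lemma fits_transpose_if_linked:
  assumes "\<pi> \<in> diagrams n m" "a \<in> {1..m}" "b \<in> {1..m}" "linked_in \<pi> (Tgt a) (Tgt b)" "fits \<pi> x z"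
  shows "fits \<pi> x (z \<circ> transpose a b)"
proof -
  have "z a = z b" using assms(4) fitsD[OF assms(5), of _ "Tgt a" "Tgt b"] unfolding linked_in_def by auto
  then have "z \<circ> transpose a b = z" by (auto simp: transpose_def fun_eq_iff)
  then show ?thesis using assms(5) by simp
qed

definition single :: "diagram \<Rightarrow> vertex \<Rightarrow> bool" where
  "single \<pi> u \<longleftrightarrow> (\<forall>v. linked_in \<pi> u v \<longrightarrow> v = u)"

lemma fits_single_upd:
  assumes "single \<pi> (Tgt a)" "fits \<pi> x z" shows "fits \<pi> x (z(a := v))"
  unfolding fits_def
proof (intro ballI)
  fix B u w assume B: "B \<in> \<pi>" "u \<in> B" "w \<in> B"
  show "label x (\<lambda>_. False) (z(a := v)) u = label x (\<lambda>_. False) (z(a := v)) w"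
  proof (cases "Tgt a \<in> B")
    case True
    then have "u = Tgt a" "w = Tgt a" using assms(1) B unfolding single_def linked_in_def by blast+
    then show ?thesis by simp
  next
    case False
    have "label x (\<lambda>_. False) (z(a := v)) u = label x (\<lambda>_. False) z u" if "u \<in> B" for u
      using that False by (cases u) auto
    then show ?thesis using fitsD[OF assms(2) B] B by simp
  qed
qed

lemma fits_transpose_if_single:
  assumes "single \<pi> (Tgt a)" "single \<pi> (Tgt b)" "fits \<pi> x z"
  shows "fits \<pi> x (z \<circ> transpose a b)"
proof -
  have "z \<circ> transpose a b = z(a := z b, b := z a)" by (auto simp: transpose_def fun_eq_iff)
  then show ?thesis using fits_single_upd[OF assms(2) fits_single_upd[OF assms(1,3)]] by simp
qed

text \<open>Two targets in one part, or two isolated targets, can be interchanged without changing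
  the diagram, so antisymmetrization kills it.\<close>

lemma alt_bs_0':
  assumes \<pi>: "\<pi> \<in> diagrams n m" and ab: "a \<noteq> b" "a \<in> {1..m}" "b \<in> {1..m}"
    and "linked_in \<pi> (Tgt a) (Tgt b) \<or> single \<pi> (Tgt a) \<and> single \<pi> (Tgt b)"
  shows "alt m * bs \<pi> = 0"
  using alt_bs_0[OF \<pi> ab] fits_transpose_if_linked[OF \<pi> ab(2,3)] fits_transpose_if_single[of \<pi> a b] assms(5)
  by blast

lemma linked_flipd: "linked_in (flipd \<pi>) (flip u) (flip v) \<longleftrightarrow> linked_in \<pi> u v"
proof -
  have inj: "inj flip" by (metis flip_flip injI)
  show ?thesis unfolding linked_in_def flipd_def by (auto simp: inj_image_mem_iff[OF inj])
qed

lemma single_flipd: "single (flipd \<pi>) (flip u) \<longleftrightarrow> single \<pi> u"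
  unfolding single_def using linked_flipd by (metis flip_flip)

lemma bs_alt_0':
  assumes \<pi>: "\<pi> \<in> diagrams n m" and ab: "a \<noteq> b" "a \<in> {1..n}" "b \<in> {1..n}"
    and "linked_in \<pi> (Src a) (Src b) \<or> single \<pi> (Src a) \<and> single \<pi> (Src b)"
  shows "bs \<pi> * alt n = (0 :: 'a::field_char_0 pal)"
proof -
  have "alt n * bs (flipd \<pi>) = (0 :: 'a pal)"
    using alt_bs_0'[OF flipd_in[OF \<pi>] ab] assms(5)
      linked_flipd[of \<pi> "Src a" "Src b"] single_flipd[of \<pi> "Src a"] single_flipd[of \<pi> "Src b"] by simp
  then have "tr (alt n * bs (flipd \<pi>)) = (0 :: 'a pal)" by simp
  then show ?thesis by (simp add: tr_mult)
qed

subsection \<open>Standard diagrams\<close>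

text \<open>Parallel strands \<open>1, ..., k\<close>, all other vertices isolated: the
  representative, up to permutations at both ends, of the partial injections of rank
  \<open>k\<close>.\<close>

definition std :: "nat \<Rightarrow> nat \<Rightarrow> nat \<Rightarrow> diagram" where
  "std n m k = gen_diagram n m ((\<lambda>j. (Tgt j, Src j)) ` {1..k})"

lemma std_in [simp]: "std n m k \<in> diagrams n m" by (simp add: std_def)

lemma fits_std: "k \<le> n \<Longrightarrow> k \<le> m \<Longrightarrow> fits (std n m k) x y \<longleftrightarrow> (\<forall>j\<in>{1..k}. y j = x j)"
  unfolding std_def by (subst fits_gen_diagram) (auto simp: verts_of_def)

lemma fnd_id: "fnd n k id = std n k k" by (simp add: fnd_def std_def)

lemma flipd_std [simp]: "k \<le> n \<Longrightarrow> k \<le> m \<Longrightarrow> flipd (std n m k) = std m n k"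
  by (rule diagram_eqI[OF flipd_in[OF std_in] std_in]) (auto simp: fits_std)

text \<open>The condition on the maximum says that every middle vertex lies on a strand of one of
  the two factors, which excludes closed components.\<close>

lemma std_mult:
  assumes "k \<le> n" "k \<le> m" "k' \<le> m" "k' \<le> l" "max k k' = m"
  shows "bs (std m l k') * bs (std n m k) = bs (std n l (min k k'))"
proof (rule bs_multI[OF std_in std_in std_in])
  fix x z
  show "fits (std n l (min k k')) x z \<longleftrightarrow> (\<exists>y. fits (std n m k) x y \<and> fits (std m l k') y z)"
  proof -
    have "\<exists>y. (\<forall>j\<in>{1..k}. y j = x j) \<and> (\<forall>j\<in>{1..k'}. z j = y j)" if l: "\<forall>j\<in>{1..min k k'}. z j = x j"
    proof (intro exI conjI ballI)
      fix j assume "j \<in> {1..k'}"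
      then show "z j = (if j \<le> k then x j else z j)" using l by simp
    qed simp
    then have "(\<forall>j\<in>{1..min k k'}. z j = x j) \<longleftrightarrow> (\<exists>y. (\<forall>j\<in>{1..k}. y j = x j) \<and> (\<forall>j\<in>{1..k'}. z j = y j))"
      by auto
    moreover have "min k k' \<le> n" "min k k' \<le> l" using assms by auto
    ultimately show ?thesis using assms by (simp add: fits_std)
  qed
qed (use assms in \<open>auto simp: fits_std max_def split: if_splits\<close>)

definition U :: "nat \<Rightarrow> 'f::field_char_0 pal" where "U n = bs (std n (Suc n) n)"
definition cap :: "nat \<Rightarrow> 'f::field_char_0 pal" where "cap n = bs (std (Suc n) n n)"

lemma U_hm [simp]: "U n \<in> hm n (Suc n)" and cap_hm [simp]: "cap n \<in> hm (Suc n) n"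
  by (simp_all add: U_def cap_def)

lemma ident_U [simp]: "ident (Suc n) * U n = U n" "U n * ident n = U n"
  by (rule ident_left[OF U_hm], rule ident_right[OF U_hm])

lemma ident_cap [simp]: "ident n * cap n = cap n" "cap n * ident (Suc n) = cap n"
  by (rule ident_left[OF cap_hm], rule ident_right[OF cap_hm])

lemma tr_U [simp]: "tr (U n) = cap n" and tr_cap [simp]: "tr (cap n) = U n"
  by (simp_all add: U_def cap_def)

lemma cap_fn: "cap n = fn (Suc n) n id" by (simp add: cap_def fn_def fnd_id)

text \<open>The middle vertex \<open>Suc n\<close> is isolated on both sides. For a general
  parameter the product is t times the identity, and this is how the value of t enters the relations
  of the quiver.\<close>

lemma cap_U [simp]: "cap n * U n = 0"
  unfolding cap_def U_def
  by (rule bs_mult_0I[OF std_in std_in, where y="\<lambda>j. j = Suc n" and j="Suc n"]) (auto simp: fits_std)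

lemma cap_perm:
  assumes "\<sigma> permutes {1..n}"
  shows "cap n * fn (Suc n) (Suc n) \<sigma> = fn n n \<sigma> * cap n"
  using permutes_Pi[OF assms] permutes_Pi[OF permutes_mono[OF assms, of "Suc n"]]
  unfolding cap_fn by (subst (1 2) fn_mult) auto

text \<open>Permutations of the first \<open>n\<close> strands commute with dropping the last
  one.\<close>

lemma cap_alt_in: "cap n * alt_in (Suc n) n = alt n * cap n"
  by (auto simp: alt_in_def scl_mult_left scl_mult_right sum_distrib_left sum_distrib_right cap_perm
      intro!: arg_cong[where f="scl _"] sum.cong)

definition hole :: "nat \<Rightarrow> nat \<Rightarrow> diagram" where
  "hole n b = gen_diagram n n ((\<lambda>j. (Tgt j, Src j)) ` ({1..n} - {b}))"

lemma hole_in [simp]: "hole n b \<in> diagrams n n" by (simp add: hole_def)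

lemma fits_hole: "fits (hole n b) x y \<longleftrightarrow> (\<forall>j\<in>{1..n} - {b}. y j = x j)"
  unfolding hole_def by (subst fits_gen_diagram) (auto simp: verts_of_def)

text \<open>The transposition moves the new isolated vertex to position \<open>b\<close> and strand
  \<open>b\<close> to the last position, where it is dropped: strand \<open>b\<close> is
  cut.\<close>

lemma cap_transpose_U:
  assumes b: "b \<in> {1..n}"
  shows "cap n * fn (Suc n) (Suc n) (transpose (Suc n) b) * U n = (bs (hole n b) :: 'a::field_char_0 pal)"
proof -
  let ?t = "transpose (Suc n) b"
  have t: "?t \<in> {1..Suc n} \<rightarrow> {1..Suc n}" using b by (auto simp: transpose_def)
  then have t': "?t \<in> {1..n} \<rightarrow> {1..Suc n}" by auto
  have "cap n * fn (Suc n) (Suc n) ?t = (fn (Suc n) n ?t :: 'a pal)"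
    unfolding cap_fn by (subst fn_mult) (use t in auto)
  moreover have "fn (Suc n) n ?t * U n = (bs (hole n b) :: 'a pal)"
    unfolding fn_def U_def
  proof (rule bs_multI[OF std_in fnd_in hole_in])
    fix x z
    \<comment> \<open>The last middle vertex is free in \<open>U n\<close> and is read off as target
      \<open>b\<close>; this dictates the middle labelling \<open>x(Suc n := z b)\<close>.\<close>
    show "fits (hole n b) x z \<longleftrightarrow> (\<exists>y. fits (std n (Suc n) n) x y \<and> fits (fnd (Suc n) n ?t) y z)"
      unfolding fits_hole fits_fnd[OF t']
      by (rule iffI, rule exI[of _ "x(Suc n := z b)"]) (use b in \<open>auto simp: fits_std transpose_def split: if_splits\<close>)
  next
    fix y j assume "fits (std n (Suc n) n) (\<lambda>_. False) y" "fits (fnd (Suc n) n ?t) y (\<lambda>_. False)" "j \<in> {1..Suc n}"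
    then show "\<not> y j" unfolding fits_fnd[OF t'] using b by (cases "j = Suc n") (auto simp: fits_std dest: bspec[of _ _ b])
  qed
  ultimately show ?thesis by simp
qed

text \<open>All positions of the cut are conjugate; after antisymmetrization on both sides, where
  the sign occurs twice, they give the same element.\<close>

lemma hole_conj:
  assumes b: "b \<in> {1..n}"
  shows "fn n n (transpose b n) * bs (std n n (n - 1)) * fn n n (transpose b n) = bs (hole n b)"
proof (rule bs_conj[OF _ _ std_in hole_in])
  show t: "transpose b n permutes {1..n}" using b by (intro transpose_permutes) auto
  show t: "transpose b n permutes {1..n}" by fact
  fix x z :: "nat \<Rightarrow> bool"
  have "(\<forall>j\<in>{1..n} - {b}. z j = x j) \<longleftrightarrow> (\<forall>j\<in>{1..n-1}. z (transpose b n j) = x (transpose b n j))"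
    (is "?l \<longleftrightarrow> ?r")
  proof
    show "?l \<Longrightarrow> ?r" using b by (auto simp: transpose_def)
    assume r: ?r
    show ?l
    proof
      fix j assume j: "j \<in> {1..n} - {b}"
      show "z j = x j"
      proof (cases "j = n")
        case True
        then have "b \<in> {1..n-1}" using j b by auto
        from bspec[OF r this] True show ?thesis by simp
      next
        case False
        then have "j \<in> {1..n-1}" using j b by auto
        from bspec[OF r this] False j show ?thesis by simp
      qed
    qed
  qed
  then show "fits (hole n b) x z \<longleftrightarrow> fits (std n n (n - 1)) (x \<circ> transpose b n) (z \<circ> pinv (transpose b n))"
    by (simp add: fits_hole fits_std)
qed

section \<open>The exterior powers\<close>

definition al :: "nat \<Rightarrow> 'f::field_char_0 pal" where "al n = alt (Suc n) * U n * alt n"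
definition be :: "nat \<Rightarrow> 'f::field_char_0 pal" where "be n = alt n * cap n * alt (Suc n)"
text \<open>Set to zero at \<open>0\<close>, where there is no lower exterior power to factor
  through; statements about \<open>xi\<close> then hold uniformly in \<open>n\<close>.\<close>

definition xi :: "nat \<Rightarrow> 'f::field_char_0 pal" where "xi n = (if n = 0 then 0 else al (n - 1) * be (n - 1))"

lemma tr_al [simp]: "tr (al n) = be n" and tr_be [simp]: "tr (be n) = al n"
  by (simp_all add: al_def be_def tr_mult mult.assoc)

text \<open>The larger antisymmetrizer on the right absorbs the smaller one on the left.\<close>

lemma be_eq: "be n = cap n * alt (Suc n)"
  by (simp add: be_def cap_alt_in[symmetric] mult.assoc)

lemma al_eq: "al n = alt (Suc n) * U n"
proof -
  have "tr (be n) = tr (cap n * alt (Suc n))" by (simp only: be_eq)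
  then show ?thesis by (simp add: tr_mult)
qed

lemma al_hm [simp]: "al n \<in> hm n (Suc n)" and be_hm [simp]: "be n \<in> hm (Suc n) n"
  unfolding al_eq be_eq by (intro hm_mult[of _ "Suc n"]; simp)+

lemma alt_al [simp]: "alt (Suc n) * al n = al n" and al_alt [simp]: "al n * alt n = al n"
  by (simp_all add: al_def mult.assoc)

lemma alt_be [simp]: "alt n * be n = be n" and be_alt [simp]: "be n * alt (Suc n) = be n"
  by (simp_all add: be_def mult.assoc)

lemma alt_al' [simp]: "alt (Suc n) * (al n * a) = al n * a" and alt_be' [simp]: "alt n * (be n * a) = be n * a"
  by (simp_all flip: mult.assoc)

text \<open>\<open>U (Suc n) * U n\<close> creates two isolated targets, which antisymmetrization
  kills.\<close>

lemma al_al [simp]: "al (Suc n) * al n = (0 :: 'a::field_char_0 pal)"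
proof -
  have "U (Suc n) * U n = (bs (std n (Suc (Suc n)) n) :: 'a pal)"
    unfolding U_def by (subst std_mult) auto
  then have "al (Suc n) * al n = alt (Suc (Suc n)) * (bs (std n (Suc (Suc n)) n) :: 'a pal)"
    unfolding al_eq[of n] al_eq[of "Suc n"] mult.assoc[symmetric]
    by (metis al_alt al_eq mult.assoc)
  also have "\<dots> = 0"
    by (rule alt_bs_0[OF std_in, where a="Suc n" and b="Suc (Suc n)"]) (auto simp: fits_std transpose_def)
  finally show ?thesis .
qed

lemma be_be [simp]: "be n * be (Suc n) = (0 :: 'a::field_char_0 pal)"
proof -
  have "be n * be (Suc n) = (tr (al (Suc n) * al n) :: 'a pal)" by (simp only: tr_mult tr_al)
  then show ?thesis by simp
qed

text \<open>The antisymmetrizers between \<open>U\<close> and \<open>cap\<close> are absorbed, so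
  \<open>xi (Suc n)\<close> is the antisymmetrization of the identity with one strand cut.\<close>

lemma al_be: "al n * be n = alt (Suc n) * bs (std (Suc n) (Suc n) n) * alt (Suc n)"
proof -
  have "al n * be n = alt (Suc n) * (U n * cap n) * alt (Suc n)"
    by (metis al_def al_eq be_def mult.assoc alt_in_alt order_refl be_eq)
  also have "U n * cap n = (bs (std (Suc n) (Suc n) n) :: 'a pal)"
    unfolding U_def cap_def by (subst std_mult) auto
  finally show ?thesis .
qed

lemma alt_0: "alt 0 = ident 0" and alt_1: "alt (Suc 0) = ident (Suc 0)"
  by (simp_all add: alt_in_def permutes_sing One_nat_def ident_def)

lemma be_al_0 [simp]: "be 0 * al 0 = (0 :: 'a::field_char_0 pal)"
proof -
  have "al 0 = (U 0 :: 'a pal)" "be 0 = (cap 0 :: 'a pal)" by (simp_all add: al_eq be_eq alt_0 alt_1)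
  then show ?thesis by simp
qed

text \<open>The contraction of a wedge product. Among the coset representatives of
  \<open>alt_Suc\<close> the identity contributes \<open>cap * U = 0\<close>, and each of the
  \<open>n + 1\<close> transpositions cuts one strand and contributes the antisymmetrized cut with
  sign -1.\<close>

lemma be_al_Suc:
  "scl (of_nat (Suc (Suc n))) (be (Suc n) * al (Suc n)) = - scl (of_nat (Suc n)) (al n * be n :: 'a::field_char_0 pal)"
proof -
  let ?n = "Suc n"
  have "scl (of_nat (Suc ?n)) (be ?n * al ?n :: 'a pal) = scl (of_nat (Suc ?n)) (cap ?n * alt (Suc ?n) * U ?n * alt ?n)"
    by (metis al_alt al_def al_eq be_alt be_eq mult.assoc)
  also have "\<dots> = cap ?n * scl (of_nat (Suc ?n)) (alt (Suc ?n)) * U ?n * alt ?n"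
    by (simp only: scl_mult_left scl_mult_right)
  also have "\<dots> = alt ?n * (cap ?n * (ident (Suc ?n) - (\<Sum>b\<in>{1..?n}. fn (Suc ?n) (Suc ?n) (transpose (Suc ?n) b))) * U ?n) * alt ?n"
    unfolding alt_Suc by (simp only: mult.assoc[symmetric] cap_alt_in)
  also have "cap ?n * (ident (Suc ?n) - (\<Sum>b\<in>{1..?n}. fn (Suc ?n) (Suc ?n) (transpose (Suc ?n) b))) * U ?n
      = - (\<Sum>b\<in>{1..?n}. bs (hole ?n b) :: 'a pal)"
    by (simp add: right_diff_distrib left_diff_distrib sum_distrib_left sum_distrib_right cap_transpose_U
        del: sum.cl_ivl_Suc)
  also have "alt ?n * - (\<Sum>b\<in>{1..?n}. bs (hole ?n b)) * alt ?n = - (\<Sum>b\<in>{1..?n}. alt ?n * bs (hole ?n b) * alt ?n :: 'a pal)"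
    by (simp add: sum_distrib_left sum_distrib_right del: sum.cl_ivl_Suc)
  also have "\<dots> = - (\<Sum>b\<in>{1..?n}. al n * be n)"
  proof (intro arg_cong[where f=uminus] sum.cong refl)
    fix b assume b: "b \<in> {1..?n}"
    then have t: "transpose b ?n permutes {1..?n}" by (intro transpose_permutes) auto
    have "alt ?n * bs (hole ?n b) * alt ?n =
        (alt ?n * fn ?n ?n (transpose b ?n)) * bs (std ?n ?n n) * (fn ?n ?n (transpose b ?n) * alt ?n)"
      unfolding hole_conj[OF b, simplified, symmetric] by (simp only: mult.assoc)
    also have "\<dots> = al n * be n"
      by (simp add: alt_fn[OF t] fn_alt[OF t] scl_mult_left scl_mult_right al_be)
    finally show "alt ?n * bs (hole ?n b) * alt ?n = al n * be n" .
  qed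
  also have "(\<Sum>b\<in>{1..?n}. al n * be n) = scl (of_nat ?n) (al n * be n :: 'a pal)"
    by (simp add: pal.sum_constant_scale)
  finally show ?thesis .
qed

section \<open>Diagrams up to permutations and antisymmetrization\<close>

lemma extend_to_permutation:
  assumes "inj_on f {1..k::nat}" "f ` {1..k} \<subseteq> {1..n}"
  obtains \<sigma> where "\<sigma> permutes {1..n}" "\<And>j. j \<in> {1..k} \<Longrightarrow> \<sigma> j = f j"
proof -
  have kn: "k \<le> n" using card_inj_on_le[OF assms] by simp
  have "card ({1..n} - {1..k}) = card ({1..n} - f ` {1..k})"
    using assms kn by (simp add: card_Diff_subset card_image)
  then obtain h where h: "bij_betw h ({1..n} - {1..k}) ({1..n} - f ` {1..k})"
    using finite_same_card_bij by blast
  define \<sigma> where "\<sigma> j = (if j \<in> {1..k} then f j else if j \<in> {1..n} then h j else j)" for j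
  have "bij_betw \<sigma> ({1..k} \<union> ({1..n} - {1..k})) (f ` {1..k} \<union> ({1..n} - f ` {1..k}))"
  proof (rule bij_betw_combine)
    show "bij_betw \<sigma> {1..k} (f ` {1..k})"
      by (rule bij_betw_cong[THEN iffD1, OF _ inj_on_imp_bij_betw[OF assms(1)]]) (auto simp: \<sigma>_def)
    show "bij_betw \<sigma> ({1..n} - {1..k}) ({1..n} - f ` {1..k})"
      by (rule bij_betw_cong[THEN iffD1, OF _ h]) (auto simp: \<sigma>_def)
  qed auto
  moreover have "{1..k} \<union> ({1..n} - {1..k}) = {1..n}" "f ` {1..k} \<union> ({1..n} - f ` {1..k}) = {1..n}"
    using kn assms(2) by auto
  ultimately have "bij_betw \<sigma> {1..n} {1..n}" by simp
  then have "\<sigma> permutes {1..n}" by (rule bij_imp_permutes) (use kn in \<open>auto simp: \<sigma>_def\<close>)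
  then show thesis by (rule that) (auto simp: \<sigma>_def)
qed

lemma linked_sym: "linked_in \<pi> u v \<Longrightarrow> linked_in \<pi> v u"
  by (auto simp: linked_in_def)

lemma linked_trans:
  assumes "\<pi> \<in> diagrams n m" "linked_in \<pi> u v" "linked_in \<pi> v w" shows "linked_in \<pi> u w"
proof -
  obtain B C where B: "B \<in> \<pi>" "u \<in> B" "v \<in> B" and C: "C \<in> \<pi>" "v \<in> C" "w \<in> C"
    using assms(2,3) by (auto simp: linked_in_def)
  have "B = C" using partition_onD2[OF assms(1)[unfolded diagrams_iff]] B C by (auto simp: disjoint_def)
  with B C show ?thesis by (auto simp: linked_in_def)
qed

lemma linked_verts:
  assumes "\<pi> \<in> diagrams n m" "linked_in \<pi> u v" shows "u \<in> verts_of n m" "v \<in> verts_of n m"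
  using assms by (auto simp: linked_in_def diagrams_iff partition_on_def)

lemma linked_fits: "linked_in \<pi> u v \<Longrightarrow> fits \<pi> x z \<Longrightarrow> label x (\<lambda>_. False) z u = label x (\<lambda>_. False) z v"
  unfolding linked_in_def using fitsD by blast

lemma fits_iff_linked:
  "fits \<pi> x z \<longleftrightarrow> (\<forall>u v. linked_in \<pi> u v \<longrightarrow> label x (\<lambda>_. False) z u = label x (\<lambda>_. False) z v)"
  unfolding fits_def linked_in_def by blast

text \<open>Every part has at most one vertex at each end, so the parts that are not isolated
  vertices are strands, and \<open>g\<close> follows a strand from its target to its source.\<close>

lemma separated_diagram:
  assumes \<pi>: "\<pi> \<in> diagrams n m"
    and T: "\<And>a b. a \<in> {1..m} \<Longrightarrow> b \<in> {1..m} \<Longrightarrow> linked_in \<pi> (Tgt a) (Tgt b) \<Longrightarrow> a = b"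
    and S: "\<And>a b. a \<in> {1..n} \<Longrightarrow> b \<in> {1..n} \<Longrightarrow> linked_in \<pi> (Src a) (Src b) \<Longrightarrow> a = b"
  obtains g where "g ` {j \<in> {1..m}. \<not> single \<pi> (Tgt j)} = {i \<in> {1..n}. \<not> single \<pi> (Src i)}"
    "inj_on g {j \<in> {1..m}. \<not> single \<pi> (Tgt j)}"
    "\<And>x z. fits \<pi> x z \<longleftrightarrow> (\<forall>j\<in>{j \<in> {1..m}. \<not> single \<pi> (Tgt j)}. z j = x (g j))"
proof -
  let ?B = "{j \<in> {1..m}. \<not> single \<pi> (Tgt j)}"
  define g where "g j = (SOME i. linked_in \<pi> (Tgt j) (Src i))" for j
  have g: "linked_in \<pi> (Tgt j) (Src (g j))" if jB: "j \<in> ?B" for j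
  proof -
    from jB obtain v where v: "linked_in \<pi> (Tgt j) v" "v \<noteq> Tgt j" by (auto simp: single_def)
    then obtain i where "v = Src i" using linked_verts(2)[OF \<pi> v(1)] T jB v unfolding verts_of_def by blast
    with v show ?thesis unfolding g_def by (metis someI)
  qed
  have uniq: "i = g j \<and> j \<in> ?B" if "linked_in \<pi> (Tgt j) (Src i)" for i j
  proof -
    have j: "j \<in> ?B" using that linked_verts(1)[OF \<pi> that] by (auto simp: single_def verts_of_def)
    have l: "linked_in \<pi> (Src i) (Src (g j))" using linked_trans[OF \<pi> linked_sym[OF that] g[OF j]] .
    then have "i \<in> {1..n}" "g j \<in> {1..n}" using linked_verts[OF \<pi> l] by (auto simp: verts_of_def)
    then show ?thesis using S[OF _ _ l] j by auto
  qed
  have "g ` ?B = {i \<in> {1..n}. \<not> single \<pi> (Src i)}"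
  proof (rule Set.set_eqI, rule iffI)
    fix i assume "i \<in> g ` ?B"
    then obtain j where j: "j \<in> ?B" "i = g j" by auto
    show "i \<in> {i \<in> {1..n}. \<not> single \<pi> (Src i)}"
      using linked_sym[OF g[OF j(1)]] linked_verts(2)[OF \<pi> g[OF j(1)]] j by (auto simp: single_def verts_of_def)
  next
    fix i assume i: "i \<in> {i \<in> {1..n}. \<not> single \<pi> (Src i)}"
    then obtain v where v: "linked_in \<pi> (Src i) v" "v \<noteq> Src i" by (auto simp: single_def)
    then obtain j where "v = Tgt j" using linked_verts(2)[OF \<pi> v(1)] S i v unfolding verts_of_def by blast
    then show "i \<in> g ` ?B" using uniq[of j i] linked_sym v by blast
  qed
  moreover have "inj_on g ?B"
  proof (rule inj_onI)
    fix j j' assume j: "j \<in> ?B" "j' \<in> ?B" "g j = g j'"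
    have "linked_in \<pi> (Tgt j) (Tgt j')" using linked_trans[OF \<pi> g[OF j(1)]] linked_sym[OF g[OF j(2)]] j(3) by simp
    then show "j = j'" using T j by blast
  qed
  moreover have "fits \<pi> x z \<longleftrightarrow> (\<forall>j\<in>?B. z j = x (g j))" for x z
  proof
    assume f: "fits \<pi> x z"
    show "\<forall>j\<in>?B. z j = x (g j)" using linked_fits[OF g f] by simp
  next
    assume r: "\<forall>j\<in>?B. z j = x (g j)"
    show "fits \<pi> x z" unfolding fits_iff_linked
    proof (intro allI impI)
      fix u v assume l: "linked_in \<pi> u v"
      have ST: "z j = x i" if "linked_in \<pi> (Tgt j) (Src i)" for i j using uniq[OF that] r by blast
      from linked_verts[OF \<pi> l] consider
          a b where "u = Tgt a" "v = Tgt b" "a \<in> {1..m}" "b \<in> {1..m}"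
        | a b where "u = Src a" "v = Src b" "a \<in> {1..n}" "b \<in> {1..n}"
        | a b where "u = Tgt a" "v = Src b" | a b where "u = Src a" "v = Tgt b"
        by (cases u; cases v) (auto simp: verts_of_def)
      then show "label x (\<lambda>_. False) z u = label x (\<lambda>_. False) z v"
      proof cases
        case 1 then show ?thesis using T[OF 1(3,4)] l by auto
      next
        case 2 then show ?thesis using S[OF 2(3,4)] l by auto
      next
        case 3
        have "z a = x b" by (rule ST) (use l 3 in simp)
        then show ?thesis using 3 by simp
      next
        case 4
        have "z b = x a" by (rule ST) (use linked_sym[OF l] 4 in simp)
        then show ?thesis using 4 by simp
      qed
    qed
  qed
  ultimately show thesis by (rule that)
qed

lemma partial_injection_std:
  assumes \<pi>: "\<pi> \<in> diagrams n m" and B: "B \<subseteq> {1..m}" "inj_on g B" "g ` B \<subseteq> {1..n}"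
    and f: "\<And>x z. fits \<pi> x z \<longleftrightarrow> (\<forall>j\<in>B. z j = x (g j))"
  obtains \<sigma> \<tau> where "\<sigma> permutes {1..m}" "\<tau> permutes {1..n}"
    "bs \<pi> = (fn m m \<sigma> * bs (std n m (card B)) * fn n n \<tau> :: 'f::field_char_0 pal)"
proof -
  let ?k = "card B"
  have fB: "finite B" using B(1) finite_subset by blast
  then obtain h where h: "bij_betw h {1..?k} B" using ex_bij_betw_nat_finite_1 by blast
  have h1: "inj_on h {1..?k}" "h ` {1..?k} \<subseteq> {1..m}" using h B(1) by (auto simp: bij_betw_def)
  have h2: "inj_on (g \<circ> h) {1..?k}" "(g \<circ> h) ` {1..?k} \<subseteq> {1..n}"
    using h B comp_inj_on[of h "{1..?k}" g] unfolding bij_betw_def image_comp[symmetric] by simp_all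
  from extend_to_permutation[OF h1] obtain \<rho> where \<rho>: "\<rho> permutes {1..m}" "\<And>j. j \<in> {1..?k} \<Longrightarrow> \<rho> j = h j" by blast
  from extend_to_permutation[OF h2] obtain \<tau> where \<tau>: "\<tau> permutes {1..n}" "\<And>j. j \<in> {1..?k} \<Longrightarrow> \<tau> j = (g \<circ> h) j" by blast
  have k: "?k \<le> n" "?k \<le> m" using card_inj_on_le[OF h1] card_inj_on_le[OF h2] by auto
  \<comment> \<open>\<open>\<rho>\<close> and \<open>\<tau>\<close> move the standard strand
    \<open>j\<close> to the target \<open>h j\<close> and the source \<open>g (h j)\<close>.\<close>
  have "fn m m (pinv \<rho>) * bs (std n m ?k) * fn n n \<tau> = (bs \<pi> :: 'f pal)"
  proof (rule bs_conj[OF permutes_inv[OF \<rho>(1)] \<tau>(1) std_in \<pi>])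
    fix x z :: "nat \<Rightarrow> bool"
    have "(\<forall>j\<in>h ` {1..?k}. z j = x (g j)) \<longleftrightarrow> (\<forall>j\<in>{1..?k}. z (h j) = x (g (h j)))"
      by (rule ball_simps)
    then have "(\<forall>j\<in>B. z j = x (g j)) \<longleftrightarrow> (\<forall>j\<in>{1..?k}. z (h j) = x (g (h j)))"
      unfolding bij_betw_imp_surj_on[OF h] .
    also have "\<dots> \<longleftrightarrow> (\<forall>j\<in>{1..?k}. (z \<circ> \<rho>) j = (x \<circ> \<tau>) j)" using \<rho>(2) \<tau>(2) by auto
    finally show "fits \<pi> x z = fits (std n m ?k) (x \<circ> \<tau>) (z \<circ> pinv (pinv \<rho>))"
      unfolding f using k by (simp add: fits_std permutes_inv_inv[OF \<rho>(1)])
  qed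
  then show thesis using that permutes_inv[OF \<rho>(1)] \<tau>(1) by metis
qed

lemma at_most_one_outside:
  assumes "\<And>a b. a \<in> A - B \<Longrightarrow> b \<in> A - B \<Longrightarrow> a = b" "finite A" "B \<subseteq> A"
  shows "card A \<le> Suc (card B)"
proof -
  have "card (A - B) \<le> 1"
    using assms(1,2) by (metis One_nat_def card_le_Suc0_iff_eq finite_Diff)
  then show ?thesis using assms(2,3) by (simp add: card_Diff_subset finite_subset)
qed

text \<open>Two linked or two isolated vertices at one end give zero. Otherwise at most one vertex
  at each end is isolated, whence the bounds on the rank \<open>k\<close>, and the permutations at
  the ends contribute signs only. The last conjunct, that full rank occurs only for permutations, is
  what \<open>alt_nonperm_alt\<close> builds on.\<close>

lemma alt_bs_alt_cases:
  assumes \<pi>: "\<pi> \<in> diagrams n m"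
  shows "alt m * bs \<pi> * alt n = (0 :: 'f::field_char_0 pal) \<or>
    (\<exists>k c. k \<le> n \<and> k \<le> m \<and> n \<le> Suc k \<and> m \<le> Suc k \<and>
      alt m * bs \<pi> * alt n = scl c (alt m * bs (std n m k) * alt n :: 'f pal) \<and>
      (k = n \<and> k = m \<longrightarrow> (\<exists>\<sigma>. \<sigma> permutes {1..n} \<and> bs \<pi> = (fn n n \<sigma> :: 'f pal))))"
proof -
  let ?T = "\<lambda>a b. linked_in \<pi> (Tgt a) (Tgt b) \<or> single \<pi> (Tgt a) \<and> single \<pi> (Tgt b)"
  let ?S = "\<lambda>a b. linked_in \<pi> (Src a) (Src b) \<or> single \<pi> (Src a) \<and> single \<pi> (Src b)"
  consider a b where "a \<noteq> b" "a \<in> {1..m}" "b \<in> {1..m}" "?T a b"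
    | a b where "a \<noteq> b" "a \<in> {1..n}" "b \<in> {1..n}" "?S a b"
    | "\<forall>a\<in>{1..m}. \<forall>b\<in>{1..m}. ?T a b \<longrightarrow> a = b" "\<forall>a\<in>{1..n}. \<forall>b\<in>{1..n}. ?S a b \<longrightarrow> a = b"
  proof (cases "\<forall>a\<in>{1..m}. \<forall>b\<in>{1..m}. ?T a b \<longrightarrow> a = b")
    case T: True
    show ?thesis
    proof (cases "\<forall>a\<in>{1..n}. \<forall>b\<in>{1..n}. ?S a b \<longrightarrow> a = b")
      case True
      show ?thesis by (rule that(3)[OF T True])
    next
      case False
      then obtain a b where "a \<in> {1..n}" "b \<in> {1..n}" "?S a b" "a \<noteq> b" by (auto simp only: ball_simps bex_simps not_imp)
      then show ?thesis by (intro that(2))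
    qed
  next
    case False
    then obtain a b where "a \<in> {1..m}" "b \<in> {1..m}" "?T a b" "a \<noteq> b" by (auto simp only: ball_simps bex_simps not_imp)
    then show ?thesis by (intro that(1))
  qed
  then show ?thesis
  proof cases
    case 1
    then show ?thesis using alt_bs_0'[OF \<pi> 1, where 'a='f] by simp
  next
    case 2
    then show ?thesis using bs_alt_0'[OF \<pi> 2, where 'a='f] by (simp add: mult.assoc)
  next
    case 3
    let ?B = "{j \<in> {1..m}. \<not> single \<pi> (Tgt j)}" and ?C = "{i \<in> {1..n}. \<not> single \<pi> (Src i)}"
    obtain g where g: "g ` ?B = ?C" "inj_on g ?B" "\<And>x z. fits \<pi> x z \<longleftrightarrow> (\<forall>j\<in>?B. z j = x (g j))"
    proof (rule separated_diagram[OF \<pi>])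
      show "a = b" if "a \<in> {1..m}" "b \<in> {1..m}" "linked_in \<pi> (Tgt a) (Tgt b)" for a b
        by (rule 3(1)[rule_format, OF that(1,2) disjI1[OF that(3)]])
      show "a = b" if "a \<in> {1..n}" "b \<in> {1..n}" "linked_in \<pi> (Src a) (Src b)" for a b
        by (rule 3(2)[rule_format, OF that(1,2) disjI1[OF that(3)]])
    qed (rule that)
    have "g ` ?B \<subseteq> {1..n}" using g(1) by auto
    from partial_injection_std[OF \<pi> _ g(2) this g(3), where 'f='f] obtain \<sigma> \<tau> where st:
      "\<sigma> permutes {1..m}" "\<tau> permutes {1..n}"
      "bs \<pi> = (fn m m \<sigma> * bs (std n m (card ?B)) * fn n n \<tau> :: 'f pal)" by blast
    have "card {1..m} \<le> Suc (card ?B)"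
    proof (rule at_most_one_outside)
      show "a = b" if "a \<in> {1..m} - ?B" "b \<in> {1..m} - ?B" for a b
        by (rule 3(1)[rule_format]) (use that in simp_all)
    qed auto
    moreover have "card {1..n} \<le> Suc (card ?C)"
    proof (rule at_most_one_outside)
      show "a = b" if "a \<in> {1..n} - ?C" "b \<in> {1..n} - ?C" for a b
        by (rule 3(2)[rule_format]) (use that in simp_all)
    qed auto
    moreover have "card ?C = card ?B" using card_image[OF g(2)] g(1) by simp
    moreover have "card ?B \<le> card {1..m}" "card ?C \<le> card {1..n}" by (intro card_mono; auto)+
    moreover have "alt m * bs \<pi> * alt n = scl (sg \<sigma> * sg \<tau>) (alt m * bs (std n m (card ?B)) * alt n :: 'f pal)"
    proof -
      have "alt m * bs \<pi> * alt n = (alt m * fn m m \<sigma>) * bs (std n m (card ?B)) * (fn n n \<tau> * alt n :: 'f pal)"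
        by (simp only: st(3) mult.assoc)
      then show ?thesis by (simp add: alt_fn[OF st(1)] fn_alt[OF st(2)] scl_mult_left scl_mult_right mult.commute)
    qed
    moreover have "\<exists>\<sigma>. \<sigma> permutes {1..n} \<and> bs \<pi> = (fn n n \<sigma> :: 'f pal)" if "card ?B = n" "card ?B = m"
    proof -
      have mn: "m = n" using that by simp
      have "bs (std n n n) = (ident n :: 'f pal)" by (simp add: ident_def fn_def fnd_id)
      then have "bs \<pi> = (fn n n (\<tau> \<circ> \<sigma>) :: 'f pal)"
        using st that unfolding mn by (simp add: fn_perm_mult)
      moreover have "\<tau> \<circ> \<sigma> permutes {1..n}" using st mn permutes_compose by blast
      ultimately show ?thesis by blast
    qed
    ultimately show ?thesis by (intro disjI2 exI[of _ "card ?B"] exI[of _ "sg \<sigma> * sg \<tau>"]) auto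
  qed
qed

lemma alt_std_alt: "alt n * bs (std n n n) * alt n = (alt n :: 'f::field_char_0 pal)"
proof -
  have "bs (std n n n) = (ident n :: 'f pal)" by (simp add: ident_def fn_def fnd_id)
  then show ?thesis by simp
qed

lemma alt_std_alt_xi:
  "alt (Suc n) * bs (std (Suc n) (Suc n) n) * alt (Suc n) = (xi (Suc n) :: 'f::field_char_0 pal)"
  by (simp add: xi_def al_be)

definition hom_span :: "nat \<Rightarrow> nat \<Rightarrow> 'f::field_char_0 pal set" where
  "hom_span n m = (if m = n then {scl c (alt n) + scl d (xi n) |c d. True}
     else if m = Suc n then {scl c (al n) |c. True}
     else if n = Suc m then {scl c (be m) |c. True} else {0})"

lemma hom_span_0: "0 \<in> hom_span n m"
  unfolding hom_span_def by (auto intro: exI[of _ 0])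

lemma hom_span_scl: "a \<in> hom_span n m \<Longrightarrow> scl c a \<in> hom_span n m"
  by (auto simp: hom_span_def pal.scale_right_distrib split: if_splits) blast+

lemma hom_span_add: "a \<in> hom_span n m \<Longrightarrow> b \<in> hom_span n m \<Longrightarrow> a + b \<in> hom_span n m"
proof (cases "m = n")
  case True
  assume "a \<in> hom_span n m" "b \<in> hom_span n m"
  then obtain c d c' d' where "a = scl c (alt n) + scl d (xi n)" "b = scl c' (alt n) + scl d' (xi n)"
    using True by (auto simp: hom_span_def)
  then have "a + b = scl (c + c') (alt n) + scl (d + d') (xi n)" by (simp add: pal.scale_left_distrib)
  then show ?thesis using True by (auto simp: hom_span_def)
next
  case False
  assume "a \<in> hom_span n m" "b \<in> hom_span n m"
  with False show ?thesis
    by (auto simp: hom_span_def pal.scale_left_distrib[symmetric] split: if_splits)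
qed

text \<open>The bounds on the rank leave four shapes of standard diagrams, and their
  antisymmetrizations are \<open>alt\<close>, \<open>al\<close>, \<open>be\<close> and
  \<open>xi\<close>.\<close>

lemma alt_mult_alt_in_span:
  assumes "a \<in> hm n m" shows "alt m * a * alt n \<in> hom_span n m"
  using assms
proof (induction rule: hm_induct)
  case (add a b)
  then show ?case by (simp add: distrib_left distrib_right hom_span_add)
next
  case (basis c \<pi>)
  have "alt m * bs \<pi> * alt n \<in> (hom_span n m :: 'a pal set)"
    using alt_bs_alt_cases[OF basis, where 'f='a]
  proof (elim disjE exE conjE)
    fix k c
    assume k: "k \<le> n" "k \<le> m" "n \<le> Suc k" "m \<le> Suc k"
      and eq: "alt m * bs \<pi> * alt n = scl c (alt m * bs (std n m k) * alt n :: 'a pal)"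
    have "alt m * bs (std n m k) * alt n \<in> (hom_span n m :: 'a pal set)"
    proof -
      consider "n = k" "m = k" | "n = k" "m = Suc k" | "n = Suc k" "m = k" | "n = Suc k" "m = Suc k"
        using k by linarith
      then show ?thesis
      proof cases
        case 1
        have "scl 1 (alt k) + scl 0 (xi k) \<in> (hom_span k k :: 'a pal set)"
          unfolding hom_span_def by (simp only: if_True simp_thms) blast
        then show ?thesis unfolding 1 alt_std_alt by simp
      next
        case 2
        have "scl 1 (al k) \<in> (hom_span k (Suc k) :: 'a pal set)"
          unfolding hom_span_def by (simp only: if_True if_False simp_thms n_not_Suc_n Suc_n_not_n) blast
        then show ?thesis unfolding 2 by (simp add: al_def U_def)
      next
        case 3
        have "scl 1 (be k) \<in> (hom_span (Suc k) k :: 'a pal set)"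
          unfolding hom_span_def
          by (auto intro!: exI[of _ 1])
        then show ?thesis unfolding 3 by (simp add: be_def cap_def)
      next
        case 4
        have "scl 0 (alt (Suc k)) + scl 1 (xi (Suc k)) \<in> (hom_span (Suc k) (Suc k) :: 'a pal set)"
          unfolding hom_span_def by (simp only: if_True simp_thms) blast
        then show ?thesis unfolding 4 by (simp add: alt_std_alt_xi)
      qed
    qed
    then show ?thesis unfolding eq by (rule hom_span_scl)
  qed (simp add: hom_span_0)
  then show ?case by (simp add: scl_mult_left scl_mult_right hom_span_scl)
qed (simp add: hom_span_0)

text \<open>A diagram that is not a permutation cannot have full rank, so a nonzero
  antisymmetrization has rank \<open>n - 1\<close> and is a multiple of \<open>xi n\<close>.\<close>

lemma alt_nonperm_alt:
  assumes \<pi>: "\<pi> \<in> diagrams n n" and np: "\<And>\<sigma>. \<sigma> permutes {1..n} \<Longrightarrow> \<pi> \<noteq> fnd n n \<sigma>"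
  shows "\<exists>d. alt n * bs \<pi> * alt n = scl d (xi n :: 'f::field_char_0 pal)"
  using alt_bs_alt_cases[OF \<pi>, where 'f='f]
proof (elim disjE exE conjE)
  fix k c
  assume k: "k \<le> n" "n \<le> Suc k"
    and eq: "alt n * bs \<pi> * alt n = scl c (alt n * bs (std n n k) * alt n :: 'f pal)"
    and perm: "k = n \<and> k = n \<longrightarrow> (\<exists>\<sigma>. \<sigma> permutes {1..n} \<and> bs \<pi> = (fn n n \<sigma> :: 'f pal))"
  have "k \<noteq> n"
  proof
    assume "k = n"
    with perm obtain \<sigma> where \<sigma>: "\<sigma> permutes {1..n}" "bs \<pi> = (fn n n \<sigma> :: 'f pal)" by blast
    then have "coef (bs \<pi> :: 'f pal) \<pi> = coef (bs (fnd n n \<sigma>)) \<pi>" by (simp add: fn_def)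
    then have "\<pi> = fnd n n \<sigma>" using valid_diagrams[OF \<pi>] by (auto simp: coef_bs split: if_splits)
    with np \<sigma> show False by blast
  qed
  with k have "n = Suc k" by simp
  then have "alt n * bs \<pi> * alt n = scl c (xi n :: 'f pal)" using eq by (simp add: alt_std_alt_xi)
  then show ?thesis by blast
qed (auto intro: exI[of _ 0])

subsection \<open>The algebra of the exterior powers\<close>

lemma xi_hm [simp]: "xi n \<in> hm n n"
  unfolding xi_def by (cases n) (simp_all add: hm_mult[OF al_hm be_hm])

lemma be_al: "be n * al n = scl (- (of_nat n / of_nat (Suc n))) (xi n :: 'f::field_char_0 pal)"
proof (cases n)
  case 0 then show ?thesis by (simp add: xi_def)
next
  case (Suc k)
  have nz: "(of_nat (Suc n) :: 'f) \<noteq> 0" by (rule of_nat_neq_0)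
  have "scl (of_nat (Suc n)) (be n * al n) = - scl (of_nat n) (xi n :: 'f pal)"
    using be_al_Suc[of k, where 'a='f] Suc by (simp add: xi_def)
  then have "scl (1 / of_nat (Suc n)) (scl (of_nat (Suc n)) (be n * al n)) =
      scl (1 / of_nat (Suc n)) (- scl (of_nat n) (xi n :: 'f pal))" by simp
  then show ?thesis using nz by (simp del: of_nat_Suc)
qed

lemma al_xi [simp]: "al n * xi n = (0 :: 'f::field_char_0 pal)"
  by (cases n) (simp_all add: xi_def, simp flip: mult.assoc)

lemma xi_al [simp]: "xi (Suc n) * al n = (0 :: 'f::field_char_0 pal)"
proof -
  have "xi (Suc n) * al n = al n * (be n * al n :: 'f pal)" by (simp add: xi_def mult.assoc)
  then show ?thesis by (simp add: be_al scl_mult_right)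
qed

lemma xi_xi [simp]: "xi n * xi n = (0 :: 'f::field_char_0 pal)"
proof (cases n)
  case (Suc k)
  then have "xi n * xi n = xi (Suc k) * al k * (be k :: 'f pal)" by (simp add: xi_def mult.assoc)
  then show ?thesis by simp
qed (simp add: xi_def)

lemma alt_xi [simp]: "alt n * xi n = xi n" and xi_alt [simp]: "xi n * alt n = xi n"
  by (cases n; simp add: xi_def mult.assoc)+

text \<open>Up to a positive factor, the coefficient at the diagram with the last strand cut counts
  the pairs of permutations that carry this diagram to itself. There is no cancellation, because
  such a pair satisfies \<open>\<sigma> \<circ> \<tau> = id\<close> and so has sign 1; the pair of
  identities is one of them.\<close>

lemma xi_Suc_neq_0: "xi (Suc n) \<noteq> (0 :: 'f::field_char_0 pal)"
proof -
  let ?n = "Suc n" and ?\<rho> = "std (Suc n) (Suc n) n"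
  let ?P = "{\<sigma>. \<sigma> permutes {1..?n}}"
  have diag: "fn ?n ?n \<sigma> * bs ?\<rho> * fn ?n ?n \<tau> = (bs (gen_diagram ?n ?n ((\<lambda>j. (Tgt (pinv \<sigma> j), Src (\<tau> j))) ` {1..n})) :: 'f pal)"
    if "\<sigma> \<in> ?P" "\<tau> \<in> ?P" for \<sigma> \<tau>
  proof (rule bs_conj[OF _ _ std_in gen_diagram_in])
    show st: "\<sigma> permutes {1..?n}" "\<tau> permutes {1..?n}" using that by auto
    then have "(\<lambda>j. (Tgt (pinv \<sigma> j), Src (\<tau> j))) ` {1..n} \<subseteq> verts_of ?n ?n \<times> verts_of ?n ?n"
      using permutes_in_image[of \<tau> "{1..?n}"] permutes_in_image[OF permutes_inv, of \<sigma> "{1..?n}"]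
      by (auto simp: verts_of_def image_iff)
    from fits_gen_diagram[OF this]
    show "fits (gen_diagram ?n ?n ((\<lambda>j. (Tgt (pinv \<sigma> j), Src (\<tau> j))) ` {1..n})) x z =
       fits ?\<rho> (x \<circ> \<tau>) (z \<circ> pinv \<sigma>)" for x z
      by (auto simp: fits_std)
  qed
  have eq: "gen_diagram ?n ?n ((\<lambda>j. (Tgt (pinv \<sigma> j), Src (\<tau> j))) ` {1..n}) = ?\<rho> \<Longrightarrow> sg \<sigma> * sg \<tau> = (1::'f)"
    if "\<sigma> \<in> ?P" "\<tau> \<in> ?P" for \<sigma> \<tau>
  proof -
    let ?g = "gen_diagram ?n ?n ((\<lambda>j. (Tgt (pinv \<sigma> j), Src (\<tau> j))) ` {1..n})"
    assume e: "?g = ?\<rho>"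
    have s: "\<sigma> permutes {1..?n}" and t: "\<tau> permutes {1..?n}" using that by auto
    have sub: "(\<lambda>j. (Tgt (pinv \<sigma> j), Src (\<tau> j))) ` {1..n} \<subseteq> verts_of ?n ?n \<times> verts_of ?n ?n"
      using permutes_in_image[OF t] permutes_in_image[OF permutes_inv[OF s]]
      by (auto simp: verts_of_def image_iff)
    have "pinv \<sigma> j = \<tau> j" if j: "j \<in> {1..n}" for j
    proof -
      have "fits ?\<rho> (\<lambda>i. i = \<tau> j) (\<lambda>i. i = \<tau> j)" by (simp add: fits_std)
      then have "fits ?g (\<lambda>i. i = \<tau> j) (\<lambda>i. i = \<tau> j)" by (simp only: e)
      then show ?thesis using j unfolding fits_gen_diagram[OF sub] by auto
    qed
    then have fixed: "(\<sigma> \<circ> \<tau>) j = j" if "j \<in> {1..n}" for j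
      using that permutes_inverses(1)[OF s] by (metis comp_apply)
    have "\<sigma> \<circ> \<tau> permutes {?n}"
      by (rule permutes_superset[OF permutes_compose[OF t s]]) (use fixed in auto)
    then have "\<sigma> \<circ> \<tau> = id" by (simp add: permutes_sing)
    then have "sg (\<sigma> \<circ> \<tau>) = (1::'f)" by simp
    then show ?thesis by (simp add: sg_comp[OF s t])
  qed
  let ?g = "\<lambda>\<sigma> \<tau>. gen_diagram ?n ?n ((\<lambda>j. (Tgt (pinv \<sigma> j), Src (\<tau> j))) ` {1..n})"
  have "xi ?n = alt ?n * bs ?\<rho> * (alt ?n :: 'f pal)" by (simp add: alt_std_alt_xi)
  also have "\<dots> = scl (1 / fact ?n * (1 / fact ?n)) (\<Sum>\<sigma>\<in>?P. \<Sum>\<tau>\<in>?P. scl (sg \<sigma> * sg \<tau>) (fn ?n ?n \<sigma> * bs ?\<rho> * fn ?n ?n \<tau>))"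
    unfolding alt_in_def scl_mult_left scl_mult_right pal.scale_scale sum_distrib_right[of _ _ "bs ?\<rho>"] sum_product
    by (simp only: mult.commute[of "sg _" "sg _"])
  also have "\<dots> = scl (1 / fact ?n * (1 / fact ?n)) (\<Sum>\<sigma>\<in>?P. \<Sum>\<tau>\<in>?P. scl (sg \<sigma> * sg \<tau>) (bs (?g \<sigma> \<tau>)))"
    by (intro arg_cong[where f="scl _"] sum.cong refl) (simp add: diag)
  finally have "coef (xi ?n :: 'f pal) ?\<rho> = 1 / fact ?n * (1 / fact ?n) *
      (\<Sum>\<sigma>\<in>?P. \<Sum>\<tau>\<in>?P. sg \<sigma> * sg \<tau> * coef (bs (?g \<sigma> \<tau>)) ?\<rho>)" by (simp only: coef_scl coef_sum)
  also have "(\<Sum>\<sigma>\<in>?P. \<Sum>\<tau>\<in>?P. sg \<sigma> * sg \<tau> * coef (bs (?g \<sigma> \<tau>) :: 'f pal) ?\<rho>) =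
      (\<Sum>\<sigma>\<in>?P. \<Sum>\<tau>\<in>?P. if ?g \<sigma> \<tau> = ?\<rho> then 1 else 0)"
    using eq by (intro sum.cong refl) (auto simp: coef_bs valid_diagrams[OF std_in])
  also have "\<dots> = (\<Sum>p\<in>?P \<times> ?P. if ?g (fst p) (snd p) = ?\<rho> then 1 else 0)"
    by (simp add: sum.cartesian_product split_beta)
  also have "\<dots> = of_nat (card {p \<in> ?P \<times> ?P. ?g (fst p) (snd p) = ?\<rho>})"
    by (simp add: finite_permutations flip: sum.inter_filter)
  finally have c: "coef (xi ?n :: 'f pal) ?\<rho> = 1 / fact ?n * (1 / fact ?n) * of_nat (card {p \<in> ?P \<times> ?P. ?g (fst p) (snd p) = ?\<rho>})" .
  have "(id, id) \<in> {p \<in> ?P \<times> ?P. ?g (fst p) (snd p) = ?\<rho>}"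
    by (simp add: permutes_id std_def)
  moreover have "finite {p \<in> ?P \<times> ?P. ?g (fst p) (snd p) = ?\<rho>}"
    by (rule finite_subset[of _ "?P \<times> ?P"]) (auto intro: finite_permutations)
  ultimately have "card {p \<in> ?P \<times> ?P. ?g (fst p) (snd p) = ?\<rho>} \<noteq> 0"
    by (simp only: card_eq_0_iff) blast
  with c have "coef (xi ?n :: 'f pal) ?\<rho> \<noteq> 0" by (simp del: of_nat_Suc fact_Suc)
  then show ?thesis by auto
qed

section \<open>Homs into exterior powers\<close>

subsection \<open>Merging strands\<close>

definition merged :: "nat \<Rightarrow> nat \<Rightarrow> nat \<Rightarrow> diagram" where
  "merged m a b = gen_diagram m m (insert (Src a, Src b) ((\<lambda>j. (Tgt j, Src j)) ` {1..m}))"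

definition J :: "nat \<Rightarrow> nat \<Rightarrow> nat \<Rightarrow> 'f::field_char_0 pal" where "J m a b = bs (merged m a b)"

lemma merged_in [simp]: "merged m a b \<in> diagrams m m" by (simp add: merged_def)

lemma J_hm [simp]: "J m a b \<in> hm m m" by (simp add: J_def)

lemma fits_merged:
  assumes "a \<in> {1..m}" "b \<in> {1..m}"
  shows "fits (merged m a b) x z \<longleftrightarrow> x a = x b \<and> (\<forall>j\<in>{1..m}. z j = x j)"
  unfolding merged_def using assms by (subst fits_gen_diagram) (auto simp: verts_of_def)

lemma J_commute_sym:
  assumes "a \<in> {1..m}" "b \<in> {1..m}" shows "J m a b = J m b a"
proof -
  have "merged m a b = merged m b a"
    by (rule diagram_eqI[OF merged_in merged_in]) (auto simp: fits_merged[OF assms] fits_merged[OF assms(2,1)])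
  then show ?thesis by (simp add: J_def)
qed

lemma bs_J:
  assumes \<pi>: "\<pi> \<in> diagrams m i" and ab: "a \<in> {1..m}" "b \<in> {1..m}" and l: "linked_in \<pi> (Src a) (Src b)"
  shows "bs \<pi> * J m a b = (bs \<pi> :: 'f::field_char_0 pal)"
  unfolding J_def
proof (rule bs_multI[OF merged_in \<pi> \<pi>])
  fix x z
  have "x a = x b" if "fits \<pi> x z" using linked_fits[OF l that] by simp
  then show "fits \<pi> x z \<longleftrightarrow> (\<exists>y. fits (merged m a b) x y \<and> fits \<pi> y z)"
    unfolding fits_merged[OF ab]
    using fits_cong[OF \<pi>, of x _ z z] by metis
qed (simp add: fits_merged[OF ab])

lemma linked_merged: "a \<in> {1..m} \<Longrightarrow> b \<in> {1..m} \<Longrightarrow> linked_in (merged m a b) (Src a) (Src b)"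
  by (subst linked_in_iff[OF merged_in]) (auto simp: fits_merged verts_of_def)

lemma J_idem: "a \<in> {1..m} \<Longrightarrow> b \<in> {1..m} \<Longrightarrow> J m a b * J m a b = (J m a b :: 'f::field_char_0 pal)"
  using bs_J[OF merged_in _ _ linked_merged, of a m b, where 'f='f] by (simp add: J_def)

lemma J_J:
  assumes ab: "a \<in> {1..m}" "b \<in> {1..m}" and cd: "c \<in> {1..m}" "d \<in> {1..m}"
  shows "J m a b * J m c d =
    (bs (gen_diagram m m (insert (Src a, Src b) (insert (Src c, Src d) ((\<lambda>j. (Tgt j, Src j)) ` {1..m})))) :: 'f::field_char_0 pal)"
  unfolding J_def
proof (rule bs_multI[OF merged_in merged_in gen_diagram_in])
  fix x z :: "nat \<Rightarrow> bool"
  have "x a = x b \<and> x c = x d \<and> (\<forall>j\<in>{1..m}. z j = x j) \<longleftrightarrow>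
    (\<exists>y. (x c = x d \<and> (\<forall>j\<in>{1..m}. y j = x j)) \<and> (y a = y b \<and> (\<forall>j\<in>{1..m}. z j = y j)))" (is "?l \<longleftrightarrow> ?r")
  proof
    show "?l \<Longrightarrow> ?r" by (intro exI[of _ x]) simp
    assume ?r
    then obtain y where y: "x c = x d" "\<forall>j\<in>{1..m}. y j = x j" "y a = y b" "\<forall>j\<in>{1..m}. z j = y j" by blast
    then show ?l using y(2)[rule_format, OF ab(1)] y(2)[rule_format, OF ab(2)] by simp
  qed
  then show "fits (gen_diagram m m (insert (Src a, Src b) (insert (Src c, Src d) ((\<lambda>j. (Tgt j, Src j)) ` {1..m})))) x z =
    (\<exists>y. fits (merged m c d) x y \<and> fits (merged m a b) y z)"
    unfolding fits_merged[OF ab] fits_merged[OF cd]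
    by (subst fits_gen_diagram) (use assms in \<open>auto simp: verts_of_def\<close>)
qed (simp add: fits_merged[OF ab] fits_merged[OF cd])

lemma J_commute:
  assumes "a \<in> {1..m}" "b \<in> {1..m}" "c \<in> {1..m}" "d \<in> {1..m}"
  shows "J m a b * J m c d = (J m c d * J m a b :: 'f::field_char_0 pal)"
  using assms by (simp only: J_J insert_commute)

text \<open>Both products merge all three strands.\<close>

lemma J_J_common:
  assumes abc: "a \<in> {1..m}" "b \<in> {1..m}" "c \<in> {1..m}"
  shows "J m a b * J m c b = (J m c b * J m a c :: 'f::field_char_0 pal)"
proof -
  let ?g = "\<lambda>a b c d. gen_diagram m m (insert (Src a, Src b) (insert (Src c, Src d) ((\<lambda>j. (Tgt j, Src j)) ` {1..m})))"
  have f: "fits (?g a b c d) x z \<longleftrightarrow> x a = x b \<and> x c = x d \<and> (\<forall>j\<in>{1..m}. z j = x j)"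
    if "a \<in> {1..m}" "b \<in> {1..m}" "c \<in> {1..m}" "d \<in> {1..m}" for a b c d x z
    by (subst fits_gen_diagram) (use that in \<open>auto simp: verts_of_def\<close>)
  have "?g a b c b = ?g c b a c"
    by (rule diagram_eqI[OF gen_diagram_in gen_diagram_in]) (use abc in \<open>auto simp: f\<close>)
  then show ?thesis using abc by (simp add: J_J)
qed

text \<open>Expanding the product of the factors \<open>1 - \<Sum>a<b. J m a b\<close> gives the sum
  of all merges of the first \<open>r\<close> strands weighted by the Moebius function of the
  lattice of set partitions. Over S_N, \<open>eps m m\<close> is the projection to tensors of
  pairwise distinct basis vectors.\<close>

primrec eps :: "nat \<Rightarrow> nat \<Rightarrow> 'f::field_char_0 pal" where
  "eps m 0 = ident m"
| "eps m (Suc r) = (ident m - (\<Sum>a\<in>{1..r}. J m a (Suc r))) * eps m r"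

lemma eps_hm [simp]: "eps m r \<in> hm m m"
  by (induction r) (auto intro!: hm_mult[of _ m m] hm_diff hm_sum)

lemma ident_eps [simp]: "ident m * eps m r = eps m r" "eps m r * ident m = eps m r"
  by (rule ident_left[OF eps_hm], rule ident_right[OF eps_hm])

lemma ident_J [simp]: "ident m * J m a b = J m a b" "J m a b * ident m = J m a b"
  by (rule ident_left[OF J_hm], rule ident_right[OF J_hm])

text \<open>Induction on \<open>r\<close>. A merge of old strands commutes with the new factor. If
  \<open>b = Suc r\<close>, the summand \<open>c = a\<close> of the new factor cancels
  \<open>J m a b\<close>, and in the other summands \<open>J_J_common\<close> exposes the merge
  \<open>J m a c\<close> of old strands.\<close>

lemma J_eps:
  assumes "1 \<le> a" "a < b" "b \<le> r" "r \<le> m"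
  shows "J m a b * eps m r = (0 :: 'f::field_char_0 pal)"
  using assms
proof (induction r arbitrary: a b)
  case (Suc r)
  let ?e = "eps m r :: 'f pal"
  have expand: "J m a b * eps m (Suc r) = J m a b * ?e - (\<Sum>c\<in>{1..r}. J m a b * J m c (Suc r) * ?e)"
    by (simp add: left_diff_distrib right_diff_distrib sum_distrib_left sum_distrib_right mult.assoc)
  show ?case
  proof (cases "b \<le> r")
    case True
    have 0: "J m a b * ?e = 0" using Suc True by simp
    have "J m a b * J m c (Suc r) * ?e = 0" if "c \<in> {1..r}" for c
    proof -
      have "J m a b * J m c (Suc r) = (J m c (Suc r) * J m a b :: 'f pal)"
        by (rule J_commute) (use Suc.prems that in auto)
      then show ?thesis using 0 by (simp add: mult.assoc)
    qed
    then show ?thesis unfolding expand using 0 by simp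
  next
    case False
    then have b: "b = Suc r" using Suc.prems by simp
    have "J m a b * J m c (Suc r) * ?e = (if c = a then J m a b * ?e else 0)" if c: "c \<in> {1..r}" for c
    proof (cases "c = a")
      case True
      then show ?thesis using Suc.prems by (simp add: b J_idem)
    next
      case False
      have "J m a c * ?e = 0"
      proof (cases "a < c")
        case True
        then show ?thesis using Suc.prems c by (intro Suc.IH) auto
      next
        case F: False
        have "J m c a * ?e = 0" using False F Suc.prems c by (intro Suc.IH) auto
        moreover have "J m a c = (J m c a :: 'f pal)" by (rule J_commute_sym) (use Suc.prems c in auto)
        ultimately show ?thesis by simp
      qed
      moreover have "J m a b * J m c (Suc r) = (J m c b * J m a c :: 'f pal)"
        unfolding b by (rule J_J_common) (use Suc.prems c b in auto)
      ultimately show ?thesis using False by (simp add: mult.assoc)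
    qed
    then have "(\<Sum>c\<in>{1..r}. J m a b * J m c (Suc r) * ?e) = (\<Sum>c\<in>{1..r}. if c = a then J m a b * ?e else 0)"
      by (rule sum.cong[OF refl])
    also have "\<dots> = J m a b * ?e" using Suc.prems b by (simp add: sum.delta)
    finally show ?thesis unfolding expand by simp
  qed
qed simp

lemma J_eps':
  assumes "a \<in> {1..m}" "b \<in> {1..m}" "a \<noteq> b"
  shows "J m a b * eps m m = (0 :: 'f::field_char_0 pal)"
proof (cases "a < b")
  case True then show ?thesis using assms by (intro J_eps) auto
next
  case False
  then have "J m b a * eps m m = (0 :: 'f pal)" using assms by (intro J_eps) auto
  then show ?thesis using J_commute_sym[OF assms(1,2)] by metis
qed

lemma J_perm:
  assumes ab: "a \<in> {1..m}" "b \<in> {1..m}" and \<sigma>: "\<sigma> permutes {1..m}"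
  shows "J m a b * fn m m \<sigma> = (fn m m \<sigma> * J m (\<sigma> a) (\<sigma> b) :: 'f::field_char_0 pal)"
proof -
  have sab: "\<sigma> a \<in> {1..m}" "\<sigma> b \<in> {1..m}" using ab permutes_in_image[OF \<sigma>] by auto
  let ?t = "pinv \<sigma>"
  have t: "?t permutes {1..m}" by (rule permutes_inv[OF \<sigma>])
  have "fn m m ?t * bs (merged m a b) * fn m m \<sigma> = (bs (merged m (\<sigma> a) (\<sigma> b)) :: 'f pal)"
  proof (rule bs_conj[OF t \<sigma> merged_in merged_in])
    fix x z :: "nat \<Rightarrow> bool"
    have "(\<forall>j\<in>{1..m}. z (\<sigma> j) = x (\<sigma> j)) \<longleftrightarrow> (\<forall>j\<in>{1..m}. z j = x j)"
      by (metis permutes_in_image[OF \<sigma>] permutes_inverses(1)[OF \<sigma>])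
    then show "fits (merged m (\<sigma> a) (\<sigma> b)) x z = fits (merged m a b) (x \<circ> \<sigma>) (z \<circ> pinv ?t)"
      by (simp add: fits_merged[OF ab] fits_merged[OF sab] permutes_inv_inv[OF \<sigma>])
  qed
  then have "fn m m \<sigma> * (fn m m ?t * J m a b * fn m m \<sigma>) = (fn m m \<sigma> * J m (\<sigma> a) (\<sigma> b) :: 'f pal)"
    by (simp add: J_def)
  moreover have "fn m m \<sigma> * fn m m ?t = (ident m :: 'f pal)"
    by (simp add: fn_perm_mult[OF \<sigma> t] ident_def permutes_inv_o[OF \<sigma>])
  ultimately show ?thesis by (simp add: mult.assoc[symmetric])
qed

text \<open>A diagram with two linked sources absorbs their merge; moved past the permutation, the
  merge meets \<open>eps\<close> and vanishes.\<close>

lemma linked_perm_eps: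
  assumes \<pi>: "\<pi> \<in> diagrams m i" and ab: "a \<in> {1..m}" "b \<in> {1..m}" "a \<noteq> b"
    and l: "linked_in \<pi> (Src a) (Src b)" and \<sigma>: "\<sigma> permutes {1..m}"
  shows "bs \<pi> * fn m m \<sigma> * eps m m = (0 :: 'f::field_char_0 pal)"
proof -
  have "bs \<pi> * fn m m \<sigma> * eps m m = bs \<pi> * (J m a b * fn m m \<sigma>) * (eps m m :: 'f pal)"
    using bs_J[OF \<pi> ab(1,2) l, where 'f='f] by (simp flip: mult.assoc)
  also have "\<dots> = bs \<pi> * fn m m \<sigma> * (J m (\<sigma> a) (\<sigma> b) * eps m m)"
    by (simp add: J_perm[OF ab(1,2) \<sigma>] mult.assoc)
  also have "J m (\<sigma> a) (\<sigma> b) * eps m m = (0 :: 'f pal)"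
    by (rule J_eps') (use ab permutes_in_image[OF \<sigma>] permutes_inj[OF \<sigma>] in \<open>auto dest: injD\<close>)
  finally show ?thesis by simp
qed

lemma J_U:
  assumes ab: "a \<in> {1..m}" "b \<in> {1..m}"
  shows "J (Suc m) a b * U m = (U m * J m a b :: 'f::field_char_0 pal)"
proof -
  have ab': "a \<in> {1..Suc m}" "b \<in> {1..Suc m}" using ab by auto
  let ?g = "gen_diagram m (Suc m) (insert (Src a, Src b) ((\<lambda>j. (Tgt j, Src j)) ` {1..m}))"
  have g: "fits ?g x z \<longleftrightarrow> x a = x b \<and> (\<forall>j\<in>{1..m}. z j = x j)" for x z
    by (subst fits_gen_diagram) (use ab in \<open>auto simp: verts_of_def\<close>)
  have s: "fits (std m (Suc m) m) x z \<longleftrightarrow> (\<forall>j\<in>{1..m}. z j = x j)" for x z by (simp add: fits_std)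
  have "J (Suc m) a b * U m = (bs ?g :: 'f pal)"
    unfolding J_def U_def
  proof (rule bs_multI[OF std_in merged_in gen_diagram_in])
    fix x z :: "nat \<Rightarrow> bool"
    show "fits ?g x z = (\<exists>y. fits (std m (Suc m) m) x y \<and> fits (merged (Suc m) a b) y z)"
    proof
      assume l: "fits ?g x z"
      then have "z a = z b" using ab unfolding g by simp
      with l show "\<exists>y. fits (std m (Suc m) m) x y \<and> fits (merged (Suc m) a b) y z"
        unfolding g s fits_merged[OF ab'] by (intro exI[of _ z]) simp
    next
      assume "\<exists>y. fits (std m (Suc m) m) x y \<and> fits (merged (Suc m) a b) y z"
      then show "fits ?g x z" using ab unfolding g s fits_merged[OF ab'] by auto
    qed
  qed (simp add: fits_merged[OF ab'])
  moreover have "U m * J m a b = (bs ?g :: 'f pal)"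
    unfolding J_def U_def
  proof (rule bs_multI[OF merged_in std_in gen_diagram_in])
    fix x z :: "nat \<Rightarrow> bool"
    show "fits ?g x z = (\<exists>y. fits (merged m a b) x y \<and> fits (std m (Suc m) m) y z)"
    proof
      assume "fits ?g x z"
      then show "\<exists>y. fits (merged m a b) x y \<and> fits (std m (Suc m) m) y z"
        unfolding g s fits_merged[OF ab] by (intro exI[of _ x]) simp
    next
      assume "\<exists>y. fits (merged m a b) x y \<and> fits (std m (Suc m) m) y z"
      then show "fits ?g x z" unfolding g s fits_merged[OF ab] by auto
    qed
  qed (simp add: fits_merged[OF ab])
  ultimately show ?thesis by simp
qed

lemma eps_U: "r \<le> m \<Longrightarrow> eps (Suc m) r * U m = (U m * eps m r :: 'f::field_char_0 pal)"
proof (induction r)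
  case (Suc r)
  have "eps (Suc m) (Suc r) * U m =
      (ident (Suc m) - (\<Sum>a\<in>{1..r}. J (Suc m) a (Suc r))) * (U m * eps m r :: 'f pal)"
    using Suc by (simp add: mult.assoc)
  also have "\<dots> = (ident (Suc m) - (\<Sum>a\<in>{1..r}. J (Suc m) a (Suc r))) * U m * eps m r"
    by (simp add: mult.assoc)
  also have "(ident (Suc m) - (\<Sum>a\<in>{1..r}. J (Suc m) a (Suc r))) * U m =
      U m * (ident m - (\<Sum>a\<in>{1..r}. J m a (Suc r)) :: 'f pal)"
    using Suc.prems by (simp add: left_diff_distrib right_diff_distrib sum_distrib_left sum_distrib_right J_U)
  finally show ?case by (simp add: mult.assoc)
qed simp

text \<open>Merging the new isolated vertex with strand \<open>a\<close> doubles that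
  strand.\<close>

lemma J_U_last:
  assumes a: "a \<in> {1..m}"
  shows "J (Suc m) a (Suc m) * U m = (fn m (Suc m) (id(Suc m := a)) :: 'f::field_char_0 pal)"
  unfolding J_def U_def fn_def
proof (rule bs_multI[OF std_in merged_in fnd_in])
  have a': "a \<in> {1..Suc m}" "Suc m \<in> {1..Suc m}" using a by auto
  have g: "id(Suc m := a) \<in> {1..Suc m} \<rightarrow> {1..m}" using a by auto
  have s: "fits (std m (Suc m) m) x z \<longleftrightarrow> (\<forall>j\<in>{1..m}. z j = x j)" for x z by (simp add: fits_std)
  fix x z :: "nat \<Rightarrow> bool"
  show "fits (fnd m (Suc m) (id(Suc m := a))) x z = (\<exists>y. fits (std m (Suc m) m) x y \<and> fits (merged (Suc m) a (Suc m)) y z)"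
  proof
    assume l: "fits (fnd m (Suc m) (id(Suc m := a))) x z"
    then have z: "z j = x j" if "j \<in> {1..m}" for j using that unfolding fits_fnd[OF g] by auto
    moreover have "z (Suc m) = x a" using l unfolding fits_fnd[OF g] by auto
    ultimately show "\<exists>y. fits (std m (Suc m) m) x y \<and> fits (merged (Suc m) a (Suc m)) y z"
      unfolding s fits_merged[OF a'] using a by (intro exI[of _ z]) simp
  next
    assume "\<exists>y. fits (std m (Suc m) m) x y \<and> fits (merged (Suc m) a (Suc m)) y z"
    then obtain y where y: "\<forall>j\<in>{1..m}. y j = x j" "y a = y (Suc m)" "\<forall>j\<in>{1..Suc m}. z j = y j"
      unfolding s fits_merged[OF a'] by blast
    show "fits (fnd m (Suc m) (id(Suc m := a))) x z" unfolding fits_fnd[OF g]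
    proof
      fix j assume j: "j \<in> {1..Suc m}"
      show "z j = x ((id(Suc m := a)) j)"
      proof (cases "j = Suc m")
        case True
        then show ?thesis using y(3)[rule_format, OF j] y(1)[rule_format, OF a] y(2) by simp
      next
        case False
        then have "j \<in> {1..m}" using j by auto
        then show ?thesis using y(3)[rule_format, OF j] y(1)[rule_format, of j] False by simp
      qed
    qed
  qed
next
  fix y j
  assume "fits (merged (Suc m) a (Suc m)) y (\<lambda>_. False)" "j \<in> {1..Suc m}"
  then show "\<not> y j" using a by (subst (asm) fits_merged) auto
qed

lemma eps_Suc_U:
  "eps (Suc m) (Suc m) * U m = (U m - (\<Sum>a\<in>{1..m}. fn m (Suc m) (id(Suc m := a)))) * (eps m m :: 'f::field_char_0 pal)"
proof -
  have "eps (Suc m) (Suc m) * U m =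
     (ident (Suc m) - (\<Sum>a\<in>{1..m}. J (Suc m) a (Suc m))) * (U m * eps m m :: 'f pal)"
    by (simp add: mult.assoc eps_U)
  also have "\<dots> = (ident (Suc m) - (\<Sum>a\<in>{1..m}. J (Suc m) a (Suc m))) * U m * eps m m" by (simp add: mult.assoc)
  also have "(ident (Suc m) - (\<Sum>a\<in>{1..m}. J (Suc m) a (Suc m))) * U m =
     (U m - (\<Sum>a\<in>{1..m}. fn m (Suc m) (id(Suc m := a))) :: 'f pal)"
    by (simp add: left_diff_distrib sum_distrib_right J_U_last)
  finally show ?thesis .
qed

subsection \<open>The test morphisms\<close>

text \<open>Up to the factor \<open>(m - i)!\<close>, this is the projection to the first
  \<open>i\<close> strands summed over the permutations of the strands \<open>i, ..., m\<close>; see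
  \<open>alt_id_Psi\<close>.\<close>

definition Xi :: "nat \<Rightarrow> nat \<Rightarrow> 'f::field_char_0 pal" where
  "Xi i m = (\<Sum>j\<in>{i..m}. alt i * fn m i (id(i := j)))"

definition incl :: "nat \<Rightarrow> nat \<Rightarrow> 'f::field_char_0 pal" where "incl i m = bs (std i m i)"

lemma incl_hm [simp]: "incl i m \<in> hm i m" by (simp add: incl_def)

lemma alt_fn_eq_0:
  assumes g: "g \<in> {1..i} \<rightarrow> {1..m}" and ab: "a \<in> {1..i}" "b \<in> {1..i}" "a \<noteq> b" "g a = g b"
  shows "alt i * fn m i g = (0 :: 'f::field_char_0 pal)"
  unfolding fn_def
proof (rule alt_bs_0'[OF fnd_in ab(3,1,2)])
  have "linked_in (fnd m i g) (Tgt a) (Tgt b)"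
    by (subst linked_in_iff[OF fnd_in]) (use ab in \<open>auto simp: fits_fnd[OF g] verts_of_def\<close>)
  then show "linked_in (fnd m i g) (Tgt a) (Tgt b) \<or> single (fnd m i g) (Tgt a) \<and> single (fnd m i g) (Tgt b)" ..
qed

text \<open>A merge of two strands dies under \<open>alt\<close>, so only the identity in each
  factor of \<open>eps\<close> survives.\<close>

lemma alt_eps: "r \<le> i \<Longrightarrow> alt i * eps i r = (alt i :: 'f::field_char_0 pal)"
proof (induction r)
  case (Suc r)
  have "alt i * J i a (Suc r) = (0 :: 'f pal)" if a: "a \<in> {1..r}" for a
    unfolding J_def
  proof (rule alt_bs_0'[OF merged_in, of a "Suc r"])
    have "linked_in (merged i a (Suc r)) (Tgt a) (Tgt (Suc r))"
      by (subst linked_in_iff[OF merged_in]) (use a Suc.prems in \<open>auto simp: fits_merged verts_of_def\<close>)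
    then show "linked_in (merged i a (Suc r)) (Tgt a) (Tgt (Suc r)) \<or> single (merged i a (Suc r)) (Tgt a) \<and> single (merged i a (Suc r)) (Tgt (Suc r))" ..
  qed (use a Suc.prems in auto)
  then have "alt i * (ident i - (\<Sum>a\<in>{1..r}. J i a (Suc r))) = (alt i :: 'f pal)"
    by (simp add: right_diff_distrib sum_distrib_left)
  then show ?case using Suc by (simp flip: mult.assoc)
qed simp

lemma Xi_self: "1 \<le> i \<Longrightarrow> Xi i i = (alt i :: 'f::field_char_0 pal)"
  by (simp add: Xi_def ident_def[symmetric] fun_upd_idem)

lemma id_upd_Pi: "j \<in> {1..m} \<Longrightarrow> i \<le> Suc m \<Longrightarrow> id(i := j) \<in> {1..i} \<rightarrow> {1..m}"
  by (auto simp: le_Suc_eq)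

text \<open>The summands that avoid the new strand factor through \<open>cap m\<close>; the
  remaining one has \<open>j = Suc m\<close>.\<close>

lemma Xi_Suc:
  assumes "1 \<le> i" "i \<le> m"
  shows "Xi i (Suc m) = Xi i m * cap m + alt i * (fn (Suc m) i (id(i := Suc m)) :: 'f::field_char_0 pal)"
proof -
  have "fn m i (id(i := j)) * cap m = (fn (Suc m) i (id(i := j)) :: 'f pal)" if "j \<in> {i..m}" for j
    unfolding cap_fn using assms that by (subst fn_mult[OF _ id_upd_Pi]) auto
  then have "Xi i m * cap m = (\<Sum>j\<in>{i..m}. alt i * fn (Suc m) i (id(i := j)) :: 'f pal)"
    by (simp add: Xi_def sum_distrib_right mult.assoc)
  then show ?thesis using assms by (simp add: Xi_def)
qed

text \<open>Origin of the factor \<open>Suc m\<close>: \<open>cap m\<close> undoes each of the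
  \<open>m\<close> doublings and yields \<open>m\<close> copies of \<open>Xi i m\<close>. The
  summand \<open>j = Suc m\<close> turns the doublings into one more copy, since those with
  \<open>a < i\<close> repeat a strand and die under \<open>alt\<close>. On \<open>U m\<close>, the
  part through \<open>cap\<close> vanishes and the other one leaves target \<open>i\<close>
  isolated.\<close>

lemma Xi_step:
  assumes i: "1 \<le> i" "i \<le> m"
  shows "Xi i (Suc m) * (U m - (\<Sum>a\<in>{1..m}. fn m (Suc m) (id(Suc m := a)))) =
    alt i * U (i - 1) * fn m (i - 1) id - scl (of_nat (Suc m)) (Xi i m :: 'f::field_char_0 pal)"
proof -
  let ?F = "fn (Suc m) i (id(i := Suc m)) :: 'f pal"
  let ?d = "\<lambda>a. fn m (Suc m) (id(Suc m := a)) :: 'f pal"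
  have U: "?F * U m = U (i - 1) * fn m (i - 1) id"
  proof -
    have g: "id(i := Suc m) \<in> {1..i} \<rightarrow> {1..Suc m}" using i by auto
    have "?F * U m = bs (std m i (i - 1))"
      unfolding fn_def U_def
    proof (rule bs_multI[OF std_in fnd_in std_in])
      fix x z :: "nat \<Rightarrow> bool"
      show "fits (std m i (i - 1)) x z = (\<exists>y. fits (std m (Suc m) m) x y \<and> fits (fnd (Suc m) i (id(i := Suc m))) y z)"
      proof
        assume "fits (std m i (i - 1)) x z"
        then have r: "\<forall>j\<in>{1..i-1}. z j = x j" using i by (simp add: fits_std)
        then show "\<exists>y. fits (std m (Suc m) m) x y \<and> fits (fnd (Suc m) i (id(i := Suc m))) y z"
          unfolding fits_fnd[OF g] using i by (intro exI[of _ "x(Suc m := z i)"]) (auto simp: fits_std)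
      next
        assume "\<exists>y. fits (std m (Suc m) m) x y \<and> fits (fnd (Suc m) i (id(i := Suc m))) y z"
        then obtain y where y: "\<forall>j\<in>{1..m}. y j = x j" "\<forall>j\<in>{1..i}. z j = y ((id(i := Suc m)) j)"
          unfolding fits_fnd[OF g] by (auto simp: fits_std)
        have "z j = x j" if "j \<in> {1..i-1}" for j
        proof -
          have j: "j \<in> {1..m}" "j \<in> {1..i}" "j \<noteq> i" using that i by auto
          show ?thesis using y(1)[rule_format, OF j(1)] y(2)[rule_format, OF j(2)] j(3) by simp
        qed
        then show "fits (std m i (i - 1)) x z" using i by (simp add: fits_std)
      qed
    next
      fix y j assume "fits (std m (Suc m) m) (\<lambda>_. False) y" "fits (fnd (Suc m) i (id(i := Suc m))) y (\<lambda>_. False)" "j \<in> {1..Suc m}"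
      then show "\<not> y j" unfolding fits_fnd[OF g]
        using i by (cases "j = Suc m") (auto simp: fits_std dest: bspec[of _ _ i])
    qed
    also have "bs (std m i (i - 1)) = U (i - 1) * (fn m (i - 1) id :: 'f pal)"
    proof -
      have si: "Suc (i - 1) = i" using i by simp
      have "bs (std (i - 1) i (i - 1)) * bs (std m (i - 1) (i - 1)) = (bs (std m i (min (i - 1) (i - 1))) :: 'f pal)"
        by (rule std_mult) (use i in auto)
      then show ?thesis unfolding U_def fn_def fnd_id si by simp
    qed
    finally show ?thesis .
  qed
  have d1: "cap m * ?d a = ident m" if "a \<in> {1..m}" for a
    unfolding cap_fn ident_def using that
    by (subst fn_mult) (auto intro!: fn_cong)
  have d2: "?F * ?d a = fn m i (id(i := a))" if "a \<in> {1..m}" for a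
    using that i by (subst fn_mult) (auto intro!: fn_cong)
  have "Xi i (Suc m) * U m = alt i * U (i - 1) * (fn m (i - 1) id :: 'f pal)"
    unfolding Xi_Suc[OF i] distrib_right mult.assoc U cap_U by simp
  moreover have "Xi i (Suc m) * (\<Sum>a\<in>{1..m}. ?d a) = (\<Sum>a\<in>{1..m}. Xi i m + alt i * fn m i (id(i := a)))"
  proof -
    have "Xi i m * ident m = (Xi i m :: 'f pal)"
      by (simp add: Xi_def sum_distrib_right mult.assoc)
    then show ?thesis
      unfolding Xi_Suc[OF i] sum_distrib_left
      by (intro sum.cong refl) (simp add: distrib_right mult.assoc d1 d2)
  qed
  moreover have "(\<Sum>a\<in>{1..m}. alt i * fn m i (id(i := a))) = (Xi i m :: 'f pal)"
    unfolding Xi_def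
  proof (rule sum.mono_neutral_right)
    show "\<forall>a\<in>{1..m} - {i..m}. alt i * fn m i (id(i := a)) = (0 :: 'f pal)"
    proof
      fix a assume a: "a \<in> {1..m} - {i..m}"
      show "alt i * fn m i (id(i := a)) = (0 :: 'f pal)"
        by (rule alt_fn_eq_0[OF id_upd_Pi, where a=a and b=i]) (use a i in auto)
    qed
  qed (use i in auto)
  ultimately show ?thesis
    by (simp add: right_diff_distrib sum.distrib pal.sum_constant_scale pal.scale_left_distrib add.commute)
qed

text \<open>The value of the pairing on the test morphisms, an endomorphism of
  \<open>\<Lambda>\<^sub>i\<close>. The pairing detects something as long as its coefficient at
  \<open>alt i\<close> is nonzero.\<close>

definition wt :: "nat \<Rightarrow> nat \<Rightarrow> 'f::field_char_0 pal" where
  "wt i m = Xi i m * eps m m * incl i m * alt i"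

lemma wt_self: "1 \<le> i \<Longrightarrow> wt i i = (alt i :: 'f::field_char_0 pal)"
proof -
  have "incl i i = (ident i :: 'f pal)" by (simp add: incl_def ident_def fn_def fnd_id)
  then show "1 \<le> i \<Longrightarrow> ?thesis" by (simp add: wt_def Xi_self alt_eps)
qed

text \<open>\<open>alt i * U (i - 1)\<close> is \<open>al (i - 1)\<close>, which carries an
  antisymmetrizer on its right; so the rest may be antisymmetrized and is a multiple of
  \<open>be (i - 1)\<close>.\<close>

lemma alt_U_mult_alt:
  assumes i: "1 \<le> i" and y: "y \<in> hm i (i - 1)"
  shows "\<exists>d. alt i * U (i - 1) * y * alt i = scl d (xi i :: 'f::field_char_0 pal)"
proof -
  obtain k where k: "i = Suc k" using i by (cases i) auto
  have "alt i * U (i - 1) * y * alt i = al k * (alt k * y * alt (Suc k))"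
    unfolding k by (simp add: al_eq[symmetric] mult.assoc) (simp flip: mult.assoc)
  moreover have "alt k * y * alt (Suc k) \<in> hom_span (Suc k) k"
    using y k by (intro alt_mult_alt_in_span) simp
  then obtain c where "alt k * y * alt (Suc k) = scl c (be k)" by (auto simp: hom_span_def)
  ultimately show ?thesis using k by (auto simp: scl_mult_right xi_def)
qed

text \<open>By \<open>Xi_step\<close> each added strand multiplies the coefficient at
  \<open>alt i\<close> by \<open>- (m + 1)\<close>, so it equals
  \<open>(-1)^(m - i) * m! / i!\<close>; the other term factors through the exterior power below and
  is a multiple of \<open>xi i\<close>.\<close>

lemma wt_eq:
  assumes i: "1 \<le> i" and m: "i \<le> m"
  shows "\<exists>c d. c \<noteq> 0 \<and> wt i m = scl c (alt i) + scl d (xi i :: 'f::field_char_0 pal)"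
  using m
proof (induction m rule: dec_induct)
  case base
  show ?case using wt_self[OF i, where 'f='f] by (intro exI[of _ 1] exI[of _ 0]) simp
next
  case (step m)
  then obtain c d where c: "c \<noteq> 0" "wt i m = scl c (alt i) + scl d (xi i :: 'f pal)" by blast
  have "incl i (Suc m) = U m * (incl i m :: 'f pal)"
    unfolding incl_def U_def using step by (subst std_mult) auto
  then have "wt i (Suc m) = Xi i (Suc m) * (eps (Suc m) (Suc m) * U m) * incl i m * (alt i :: 'f pal)"
    unfolding wt_def by (simp only: mult.assoc)
  also have "\<dots> = (Xi i (Suc m) * (U m - (\<Sum>a\<in>{1..m}. fn m (Suc m) (id(Suc m := a))))) * eps m m * incl i m * alt i"
    unfolding eps_Suc_U by (simp only: mult.assoc)
  also have "\<dots> = alt i * U (i - 1) * (fn m (i - 1) id * eps m m * incl i m) * alt i - scl (of_nat (Suc m)) (wt i m)"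
    unfolding Xi_step[OF i step(1)] wt_def by (simp only: left_diff_distrib scl_mult_left mult.assoc)
  finally have w: "wt i (Suc m) = alt i * U (i - 1) * (fn m (i - 1) id * eps m m * incl i m) * alt i - scl (of_nat (Suc m)) (wt i m :: 'f pal)" .
  have "fn m (i - 1) id * eps m m * incl i m \<in> (hm i (i - 1) :: 'f pal set)"
    by (rule hm_mult[OF hm_mult[OF fn_hm eps_hm] incl_hm])
  from alt_U_mult_alt[OF i this] obtain d' where
    d': "alt i * U (i - 1) * (fn m (i - 1) id * eps m m * incl i m) * alt i = scl d' (xi i :: 'f pal)" by blast
  have "wt i (Suc m) = scl (- of_nat (Suc m) * c) (alt i) + scl (d' - of_nat (Suc m) * d) (xi i :: 'f pal)"
    unfolding w d' c(2)
    by (simp only: pal.scale_right_distrib pal.scale_scale pal.scale_left_diff_distrib pal.scale_minus_left mult_minus_left) simp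
  moreover have "- of_nat (Suc m) * c \<noteq> 0" using c(1) of_nat_neq_0[of m, where 'a='f] by (simp del: of_nat_Suc)
  ultimately show ?case by blast
qed

subsection \<open>Radical morphisms and the left kernel of the composition pairing\<close>

text \<open>Morphisms to the \<open>i\<close>-th exterior power that factor through the neighbouring exterior powers.\<close>

definition rad :: "nat \<Rightarrow> nat \<Rightarrow> 'f::field_char_0 pal set" where
  "rad m i = {(if i = 0 then 0 else al (i - 1) * a) + be i * b |a b. a \<in> hm m (i - 1) \<and> b \<in> hm m (Suc i)}"

lemma radI: "a \<in> hm m (i - 1) \<Longrightarrow> b \<in> hm m (Suc i) \<Longrightarrow> (if i = 0 then 0 else al (i - 1) * a) + be i * b \<in> rad m i"
  unfolding rad_def by blast

lemma rad_be: "b \<in> hm m (Suc i) \<Longrightarrow> be i * b \<in> rad m i"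
  using radI[of 0 m i b] by (cases "i = 0") simp_all

lemma rad_al: "1 \<le> i \<Longrightarrow> a \<in> hm m (i - 1) \<Longrightarrow> al (i - 1) * a \<in> rad m i"
  using radI[of a m i 0] by simp

lemma rad_0: "0 \<in> rad m i"
  using rad_be[of 0 m i] by simp

lemma rad_add: assumes "x \<in> rad m i" "y \<in> rad m i" shows "x + y \<in> rad m i"
proof -
  obtain a b a' b' where ab: "a \<in> hm m (i - 1)" "b \<in> hm m (Suc i)" "a' \<in> hm m (i - 1)" "b' \<in> hm m (Suc i)"
    "x = (if i = 0 then 0 else al (i - 1) * a) + be i * b" "y = (if i = 0 then 0 else al (i - 1) * a') + be i * b'"
    using assms unfolding rad_def by blast
  then have "x + y = (if i = 0 then 0 else al (i - 1) * (a + a')) + be i * (b + b')"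
    by (simp add: distrib_left)
  then show ?thesis using radI[OF hm_add[OF ab(1,3)] hm_add[OF ab(2,4)]] by simp
qed

lemma rad_scl: assumes "x \<in> rad m i" shows "scl c x \<in> rad m i"
proof -
  obtain a b where ab: "a \<in> hm m (i - 1)" "b \<in> hm m (Suc i)" "x = (if i = 0 then 0 else al (i - 1) * a) + be i * b"
    using assms unfolding rad_def by blast
  then have "scl c x = (if i = 0 then 0 else al (i - 1) * scl c a) + be i * scl c b"
    by (simp add: pal.scale_right_distrib scl_mult_right)
  then show ?thesis using radI[OF hm_scl[OF ab(1)] hm_scl[OF ab(2)], of c c] by simp
qed

lemma rad_sum: "(\<And>j. j \<in> A \<Longrightarrow> f j \<in> rad m i) \<Longrightarrow> sum f A \<in> rad m i"
  by (induction A rule: infinite_finite_induct) (auto simp: rad_0 rad_add)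

lemma rad_mult: assumes "x \<in> rad m i" "y \<in> hm n m" shows "x * y \<in> rad n i"
proof -
  obtain a b where ab: "a \<in> hm m (i - 1)" "b \<in> hm m (Suc i)" "x = (if i = 0 then 0 else al (i - 1) * a) + be i * b"
    using assms unfolding rad_def by blast
  then have "x * y = (if i = 0 then 0 else al (i - 1) * (a * y)) + be i * (b * y)"
    by (simp add: distrib_right mult.assoc)
  then show ?thesis using radI[OF hm_mult[OF ab(1) assms(2)] hm_mult[OF ab(2) assms(2)]] by simp
qed

text \<open>The factor between the neighbouring exterior powers may be antisymmetrized and becomes a
  multiple of \<open>be (i - 1)\<close> or \<open>al i\<close>; both \<open>al * be\<close> and
  \<open>be * al\<close> are multiples of \<open>xi i\<close>.\<close>

lemma rad_endo: assumes "x \<in> rad i i" shows "\<exists>d. x * alt i = scl d (xi i :: 'f::field_char_0 pal)"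
proof -
  obtain a b where ab: "a \<in> hm i (i - 1)" "b \<in> hm i (Suc i)" "x = (if i = 0 then 0 else al (i - 1) * a) + be i * b"
    using assms unfolding rad_def by blast
  have "\<exists>d. be i * b * alt i = scl d (xi i)"
  proof -
    have "be i * b * alt i = be i * (alt (Suc i) * b * alt i)"
      by (metis be_alt mult.assoc)
    moreover obtain c where "alt (Suc i) * b * alt i = scl c (al i)"
      using alt_mult_alt_in_span[OF ab(2)] by (auto simp: hom_span_def)
    ultimately have "be i * b * alt i = scl (c * - (of_nat i / of_nat (Suc i))) (xi i)"
      by (simp only: scl_mult_right be_al pal.scale_scale)
    then show ?thesis by blast
  qed
  then obtain d where d: "be i * b * alt i = scl d (xi i)" by blast
  show ?thesis
  proof (cases "i = 0")
    case True
    then show ?thesis using ab(3) d by auto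
  next
    case False
    then obtain d' where "alt i * U (i - 1) * a * alt i = scl d' (xi i)"
      using alt_U_mult_alt[of i a] ab(1) by auto
    moreover have "alt i * U (i - 1) = (al (i - 1) :: 'f pal)" using False by (simp add: al_eq)
    ultimately have "x * alt i = scl (d' + d) (xi i)"
      using ab(3) d False by (simp add: distrib_right pal.scale_left_distrib)
    then show ?thesis by blast
  qed
qed

text \<open>The pairing by composition takes values in the endomorphisms of
  \<open>\<Lambda>\<^sub>i\<close>; vanishing means vanishing modulo \<open>xi i\<close>, that is,
  in the residue field of this local ring.\<close>

definition left_ker :: "nat \<Rightarrow> nat \<Rightarrow> 'f::field_char_0 pal set" where
  "left_ker m i = {\<phi> \<in> hm m i. alt i * \<phi> = \<phi> \<and> (\<forall>\<psi>\<in>hm i m. \<exists>d. \<phi> * \<psi> * alt i = scl d (xi i))}"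

lemma left_ker_mult:
  assumes "\<phi> \<in> left_ker m i" "\<rho> \<in> hm n m" shows "\<phi> * \<rho> \<in> left_ker n i"
proof -
  have "\<exists>d. \<phi> * \<rho> * \<psi> * alt i = scl d (xi i)" if "\<psi> \<in> hm i n" for \<psi>
    using assms(1) hm_mult[OF assms(2) that] unfolding left_ker_def mult.assoc[of \<phi> \<rho> \<psi>] by blast
  moreover have "alt i * (\<phi> * \<rho>) = \<phi> * \<rho>"
    using assms(1) by (simp add: left_ker_def flip: mult.assoc)
  ultimately show ?thesis using assms hm_mult unfolding left_ker_def by blast
qed

subsection \<open>Morphisms given by injections\<close>

definition inj_gens :: "nat \<Rightarrow> nat \<Rightarrow> 'f::field_char_0 pal set" where
  "inj_gens m i = {alt i * fn m i g |g. g \<in> {1..i} \<rightarrow> {1..m} \<and> inj_on g {1..i}}"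

lemma span_inj_gens_perm:
  assumes "f \<in> pal.span (inj_gens m i)" and \<tau>: "\<tau> permutes {1..m}"
  shows "f * fn m m \<tau> \<in> pal.span (inj_gens m i :: 'f::field_char_0 pal set)"
  using assms(1)
proof (induction rule: pal.span_induct_alt)
  case (step c x y)
  from step(1) obtain g where g: "x = alt i * fn m i g" "g \<in> {1..i} \<rightarrow> {1..m}" "inj_on g {1..i}"
    unfolding inj_gens_def by blast
  have "x * fn m m \<tau> = alt i * fn m i (\<tau> \<circ> g)"
    unfolding g(1) mult.assoc by (subst fn_mult[OF permutes_Pi[OF \<tau>] g(2)]) simp
  moreover have "\<tau> \<circ> g \<in> {1..i} \<rightarrow> {1..m}" using g(2) permutes_Pi[OF \<tau>] by (auto simp: Pi_iff)
  moreover have "inj_on (\<tau> \<circ> g) {1..i}"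
    using g(3) permutes_inj[OF \<tau>] by (intro comp_inj_on) (auto intro: inj_on_subset)
  ultimately have "x * fn m m \<tau> \<in> inj_gens m i" unfolding inj_gens_def by blast
  then show ?case using step(2)
    by (simp add: distrib_right scl_mult_left pal.span_add pal.span_scale pal.span_base)
qed (simp add: pal.span_zero)

definition Psi :: "nat \<Rightarrow> nat \<Rightarrow> 'f::field_char_0 pal" where
  "Psi i m = (\<Sum>\<tau> | \<tau> permutes {i..m}. fn m m \<tau>)"

lemma Psi_hm [simp]: "Psi i m \<in> hm m m" unfolding Psi_def by (intro hm_sum) simp

lemma permutes_interval: "1 \<le> i \<Longrightarrow> \<tau> permutes {i..m::nat} \<Longrightarrow> \<tau> permutes {1..m}"
  by (rule permutes_subset) auto

lemma fn_Psi:
  assumes i: "1 \<le> i" and \<tau>: "\<tau> permutes {i..m}"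
  shows "fn m m \<tau> * Psi i m = (Psi i m :: 'f::field_char_0 pal)"
proof -
  have "fn m m \<tau> * Psi i m = (\<Sum>\<sigma> | \<sigma> permutes {i..m}. fn m m (\<sigma> \<circ> \<tau>) :: 'f pal)"
    unfolding Psi_def sum_distrib_left
    by (intro sum.cong refl fn_perm_mult permutes_interval[OF i]) (use \<tau> in auto)
  also have "\<dots> = Psi i m"
    unfolding Psi_def by (rule sum_permutations_compose_right[OF \<tau>, symmetric])
  finally show ?thesis .
qed

text \<open>The transposition of \<open>g p\<close> and \<open>g q\<close> is absorbed by
  \<open>Psi\<close>; carried through \<open>fn m i g\<close> it becomes the transposition of
  \<open>p\<close> and \<open>q\<close>, which changes the sign of \<open>alt i\<close>.\<close>

lemma alt_fn_Psi_eq_0: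
  assumes i: "1 \<le> i" and g: "g \<in> {1..i} \<rightarrow> {1..m}" and pq: "p \<in> {1..i}" "q \<in> {1..i}" "p \<noteq> q"
    and ge: "i \<le> g p" "i \<le> g q" and inj: "inj_on g {1..i}"
  shows "alt i * fn m i g * Psi i m = (0 :: 'f::field_char_0 pal)"
proof -
  let ?t = "transpose (g p) (g q)"
  have gm: "g p \<in> {i..m}" "g q \<in> {i..m}" using g pq ge by auto
  have t: "?t permutes {i..m}" by (rule permutes_swap_id[OF gm])
  have pqt: "transpose p q permutes {1..i}" by (rule transpose_permutes[OF pq(1,2)])
  have X: "fn m i g * fn m m ?t = fn i i (transpose p q) * (fn m i g :: 'f pal)"
  proof -
    have "fn m i g * fn m m ?t = (fn m i (?t \<circ> g) :: 'f pal)"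
      by (rule fn_mult[OF permutes_Pi[OF permutes_interval[OF i t]] g])
    also have "\<dots> = fn m i (g \<circ> transpose p q)"
    proof (rule fn_cong)
      fix j assume j: "j \<in> {1..i}"
      show "(?t \<circ> g) j = (g \<circ> transpose p q) j"
      proof (cases "j = p \<or> j = q")
        case False
        then have "g j \<noteq> g p" "g j \<noteq> g q" using inj_onD[OF inj _ j] pq by blast+
        then show ?thesis using False by simp
      qed auto
    qed
    also have "\<dots> = fn i i (transpose p q) * fn m i g"
      by (rule fn_mult[OF g permutes_Pi[OF pqt], symmetric])
    finally show ?thesis .
  qed
  have "alt i * fn m i g * (fn m m ?t * Psi i m) = alt i * (fn m i g * fn m m ?t) * (Psi i m :: 'f pal)"
    by (simp only: mult.assoc)
  also have "\<dots> = (alt i * fn i i (transpose p q)) * fn m i g * Psi i m"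
    unfolding X by (simp only: mult.assoc)
  finally have "alt i * fn m i g * (fn m m ?t * Psi i m) = (alt i * fn i i (transpose p q)) * fn m i g * (Psi i m :: 'f pal)" .
  then have "alt i * fn m i g * Psi i m = - (alt i * fn m i g * (Psi i m :: 'f pal))"
    unfolding fn_Psi[OF i t] alt_fn[OF pqt] by (simp add: sg_transpose[OF pq(3)] scl_mult_left)
  then show ?thesis by (rule pal_eq_neg_imp_0)
qed

lemma cap_alt_fn:
  assumes g: "g \<in> {1..Suc k} \<rightarrow> {1..m}"
  shows "cap k * (alt (Suc k) * fn m (Suc k) g) =
    scl (1 / fact (Suc k)) (\<Sum>h | h permutes {1..Suc k}. scl (sg h) (fn m k (g \<circ> h) :: 'f::field_char_0 pal))"
proof -
  have "cap k * (fn (Suc k) (Suc k) h * fn m (Suc k) g) = (fn m k (g \<circ> h) :: 'f pal)" if h: "h permutes {1..Suc k}" for h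
  proof -
    have gh: "g \<circ> h \<in> {1..Suc k} \<rightarrow> {1..m}" using g permutes_Pi[OF h] by (auto simp: Pi_iff)
    have "fn (Suc k) (Suc k) h * fn m (Suc k) g = (fn m (Suc k) (g \<circ> h) :: 'f pal)"
      by (rule fn_mult[OF g permutes_Pi[OF h]])
    then show ?thesis unfolding cap_fn by (simp add: fn_mult[OF gh])
  qed
  then have "scl (1 / fact (Suc k)) (\<Sum>h | h permutes {1..Suc k}. scl (sg h) (cap k * (fn (Suc k) (Suc k) h * fn m (Suc k) g))) =
      scl (1 / fact (Suc k)) (\<Sum>h | h permutes {1..Suc k}. scl (sg h) (fn m k (g \<circ> h) :: 'f pal))"
    by (intro arg_cong[where f="scl _"] sum.cong refl) simp
  then show ?thesis
    by (simp add: alt_in_def scl_mult_left scl_mult_right sum_distrib_left sum_distrib_right del: fact_Suc)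
qed

text \<open>
  Averaging over the permutations of the strands \<open>i, \<dots>, m\<close> detects one coefficient of the image
  under \<open>cap\<close>.
\<close>

lemma alt_fn_Psi:
  assumes g: "g \<in> {1..Suc k} \<rightarrow> {1..m}" and inj: "inj_on g {1..Suc k}"
  shows "alt (Suc k) * fn m (Suc k) g * Psi (Suc k) m =
    scl (fact (Suc k) * coef (cap k * (alt (Suc k) * fn m (Suc k) g)) (fnd m k id))
      (alt (Suc k) * fn m (Suc k) id * Psi (Suc k) m :: 'f::field_char_0 pal)"
proof -
  have km: "Suc k \<le> m" using card_inj_on_le[OF inj, of "{1..m}"] g by auto
  have coef_eq: "fact (Suc k) * coef (cap k * (alt (Suc k) * fn m (Suc k) g)) (fnd m k id) =
      (\<Sum>h | h permutes {1..Suc k}. if \<forall>j\<in>{1..k}. g (h j) = j then sg h else 0 :: 'f)"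
  proof -
    have "coef (fn m k (g \<circ> h)) (fnd m k id) = (if \<forall>j\<in>{1..k}. g (h j) = j then 1 else 0 :: 'f)"
      if h: "h permutes {1..Suc k}" for h
    proof -
      have gh: "g \<circ> h \<in> {1..k} \<rightarrow> {1..m}"
        using g permutes_Pi[OF h] by (auto simp: Pi_iff)
      have "fnd m k id = fnd m k (g \<circ> h) \<longleftrightarrow> (\<forall>j\<in>{1..k}. g (h j) = j)"
        using fnd_inj[OF _ gh, of id] fnd_cong[of k id "g \<circ> h" m] km by fastforce
      then show ?thesis by (auto simp: fn_def coef_bs valid_diagrams[OF fnd_in])
    qed
    then show ?thesis unfolding cap_alt_fn[OF g] by (auto simp del: fact_Suc intro!: sum.cong)
  qed
  show ?thesis
  proof (cases "\<exists>h0. h0 permutes {1..Suc k} \<and> (\<forall>j\<in>{1..k}. g (h0 j) = j)")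
    case True
    then obtain h0 where h0: "h0 permutes {1..Suc k}" "\<forall>j\<in>{1..k}. g (h0 j) = j" by blast
    \<comment> \<open>As \<open>g\<close> is injective, the matching permutation is unique, and a
      single sign survives in the sum.\<close>
    have uniq: "(\<forall>j\<in>{1..k}. g (h j) = j) \<longleftrightarrow> h = h0" if h: "h permutes {1..Suc k}" for h
    proof
      assume r: "\<forall>j\<in>{1..k}. g (h j) = j"
      have eq: "h j = h0 j" if j: "j \<in> {1..k}" for j
      proof (rule inj_onD[OF inj])
        show "g (h j) = g (h0 j)" using r h0(2) j by simp
        have "j \<in> {1..Suc k}" using j by auto
        then show "h j \<in> {1..Suc k}" "h0 j \<in> {1..Suc k}"
          using permutes_in_image[OF h] permutes_in_image[OF h0(1)] by blast+
      qed
      have "pinv h0 \<circ> h permutes {Suc k}"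
      proof (rule permutes_superset[OF permutes_compose[OF h permutes_inv[OF h0(1)]]])
        fix x assume "x \<in> {1..Suc k} - {Suc k}"
        then have "x \<in> {1..k}" by auto
        from eq[OF this] show "(pinv h0 \<circ> h) x = x" using permutes_inverses(2)[OF h0(1)] by simp
      qed
      then have "pinv h0 \<circ> h = id" by (simp add: permutes_sing)
      then have "h0 \<circ> (pinv h0 \<circ> h) = h0" by simp
      then show "h = h0" by (simp add: comp_assoc[symmetric] permutes_inv_o[OF h0(1)])
    qed (use h0 in simp)
    have "(\<Sum>h | h permutes {1..Suc k}. if \<forall>j\<in>{1..k}. g (h j) = j then sg h else 0 :: 'f) =
        (\<Sum>h | h permutes {1..Suc k}. if h = h0 then sg h else 0)"
      using uniq by (intro sum.cong refl if_cong) auto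
    also have "\<dots> = sg h0" using h0(1) by (simp add: sum.delta finite_permutations)
    finally have c: "fact (Suc k) * coef (cap k * (alt (Suc k) * fn m (Suc k) g)) (fnd m k id) = (sg h0 :: 'f)"
      unfolding coef_eq .
    let ?j = "g (h0 (Suc k))"
    have h0i: "h0 (Suc k) \<in> {1..Suc k}" using permutes_in_image[OF h0(1)] by auto
    have jm: "?j \<in> {1..m}" using g h0i by auto
    \<comment> \<open>The remaining strand goes outside \<open>{1..k}\<close>, so a transposition
      inside \<open>{Suc k..m}\<close>, which \<open>Psi\<close> absorbs, takes it to
      \<open>Suc k\<close>.\<close>
    have jk: "?j \<notin> {1..k}"
    proof
      assume j: "?j \<in> {1..k}"
      have "h0 ?j = h0 (Suc k)"
      proof (rule inj_onD[OF inj _ _ h0i])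
        show "g (h0 ?j) = g (h0 (Suc k))" using h0(2) j by simp
        show "h0 ?j \<in> {1..Suc k}" using permutes_in_image[OF h0(1), of ?j] j by auto
      qed
      then have "?j = Suc k" using permutes_inj[OF h0(1)] by (auto dest: injD)
      with j show False by simp
    qed
    have t: "transpose (Suc k) ?j permutes {Suc k..m}" using jm jk km by (intro permutes_swap_id) auto
    have "alt (Suc k) * fn m (Suc k) g = scl (sg h0) (alt (Suc k) * fn (Suc k) (Suc k) h0 * fn m (Suc k) g :: 'f pal)"
      by (simp add: alt_fn[OF h0(1)] scl_mult_left)
    also have "\<dots> = scl (sg h0) (alt (Suc k) * fn m (Suc k) (g \<circ> h0))"
      by (simp add: mult.assoc fn_mult[OF g permutes_Pi[OF h0(1)]])
    also have "fn m (Suc k) (g \<circ> h0) = (fn m (Suc k) (transpose (Suc k) ?j \<circ> id) :: 'f pal)"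
    proof (rule fn_cong)
      fix j assume "j \<in> {1..Suc k}"
      then show "(g \<circ> h0) j = (transpose (Suc k) ?j \<circ> id) j"
        using h0(2) jk by (cases "j = Suc k") (auto simp: transpose_def)
    qed
    also have "\<dots> = fn m (Suc k) id * fn m m (transpose (Suc k) ?j)"
      by (rule fn_mult[OF permutes_Pi[OF permutes_interval[OF _ t]], symmetric]) (use km in auto)
    finally have "alt (Suc k) * fn m (Suc k) g * Psi (Suc k) m =
       scl (sg h0) (alt (Suc k) * fn m (Suc k) id * (fn m m (transpose (Suc k) ?j) * Psi (Suc k) m) :: 'f pal)"
      by (simp only: scl_mult_left mult.assoc)
    then show ?thesis unfolding c using fn_Psi[OF _ t, where 'f='f] by simp
  next
    case False
    \<comment> \<open>If only one argument had a value above \<open>k\<close>, redirecting it to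
      \<open>Suc k\<close> would turn \<open>g\<close> into a permutation, and the inverse of that
      permutation would match \<open>g\<close> with the identity on \<open>{1..k}\<close>.\<close>
    have "\<exists>p q. p \<in> {1..Suc k} \<and> q \<in> {1..Suc k} \<and> p \<noteq> q \<and> Suc k \<le> g p \<and> Suc k \<le> g q"
    proof (rule ccontr)
      assume no: "\<not> ?thesis"
      have "\<exists>p0\<in>{1..Suc k}. Suc k \<le> g p0"
      proof (rule ccontr)
        assume none: "\<not> ?thesis"
        have "g p \<in> {1..k}" if "p \<in> {1..Suc k}" for p
        proof -
          have "\<not> Suc k \<le> g p" using none that by blast
          then show ?thesis using funcset_mem[OF g that] by simp
        qed
        then have "g ` {1..Suc k} \<subseteq> {1..k}" by blast
        from card_inj_on_le[OF inj this] show False by simp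
      qed
      then obtain p0 where p0: "p0 \<in> {1..Suc k}" "Suc k \<le> g p0" by blast
      have less: "g p \<in> {1..k}" if "p \<in> {1..Suc k}" "p \<noteq> p0" for p
      proof -
        have "\<not> Suc k \<le> g p" using no p0 that by blast
        then show ?thesis using funcset_mem[OF g that(1)] by simp
      qed
      define u where "u = g(p0 := Suc k)"
      have "inj_on u {1..Suc k}"
      proof (rule inj_onI)
        fix a b assume "a \<in> {1..Suc k}" "b \<in> {1..Suc k}" "u a = u b"
        then show "a = b" using less[of a] less[of b] inj_onD[OF inj, of a b]
          by (auto simp: u_def split: if_splits)
      qed
      moreover have "u ` {1..Suc k} \<subseteq> {1..Suc k}" using less by (force simp: u_def)
      ultimately obtain \<sigma> where \<sigma>: "\<sigma> permutes {1..Suc k}" "\<And>j. j \<in> {1..Suc k} \<Longrightarrow> \<sigma> j = u j"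
        by (rule extend_to_permutation) blast
      have "g (pinv \<sigma> j) = j" if j: "j \<in> {1..k}" for j
      proof -
        have j': "j \<in> {1..Suc k}" using j by auto
        have p: "pinv \<sigma> j \<in> {1..Suc k}" using permutes_in_image[OF permutes_inv[OF \<sigma>(1)]] j' by blast
        have "u (pinv \<sigma> j) = j" using \<sigma>(2)[OF p] permutes_inverses(1)[OF \<sigma>(1)] by simp
        moreover have "pinv \<sigma> j \<noteq> p0" using calculation j by (auto simp: u_def)
        ultimately show ?thesis by (simp add: u_def)
      qed
      then show False using False permutes_inv[OF \<sigma>(1)] by blast
    qed
    then obtain p q where pq: "p \<in> {1..Suc k}" "q \<in> {1..Suc k}" "p \<noteq> q" "Suc k \<le> g p" "Suc k \<le> g q" by blast
    have "(\<Sum>h | h permutes {1..Suc k}. if \<forall>j\<in>{1..k}. g (h j) = j then sg h else 0 :: 'f) = 0"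
      using False by (intro sum.neutral) auto
    then show ?thesis unfolding coef_eq using alt_fn_Psi_eq_0[OF _ g pq inj, where 'f='f] by simp
  qed
qed

lemma span_inj_gens_Psi:
  assumes "f \<in> pal.span (inj_gens m (Suc k))"
  shows "f * Psi (Suc k) m = scl (fact (Suc k) * coef (cap k * f) (fnd m k id))
      (alt (Suc k) * fn m (Suc k) id * Psi (Suc k) m :: 'f::field_char_0 pal)"
  using assms
proof (induction rule: pal.span_induct_alt)
  case (step c x y)
  from step(1) obtain g where g: "x = alt (Suc k) * fn m (Suc k) g" "g \<in> {1..Suc k} \<rightarrow> {1..m}" "inj_on g {1..Suc k}"
    unfolding inj_gens_def by blast
  show ?case
    by (simp add: distrib_right distrib_left scl_mult_left scl_mult_right step(2) g(1)
        alt_fn_Psi[OF g(2,3)] pal.scale_left_distrib mult.left_commute ring_distribs id_def del: fact_Suc)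
qed simp

text \<open>On the first \<open>i\<close> strands a permutation of \<open>{i..m}\<close> is seen
  only through its value at \<open>i\<close>, and each value is taken by \<open>(m - i)!\<close>
  permutations.\<close>

lemma alt_id_Psi:
  assumes "1 \<le> i" "i \<le> m"
  shows "alt i * fn m i id * Psi i m = scl (fact (m - i)) (Xi i m :: 'f::field_char_0 pal)"
proof -
  have ins: "{i..m} = insert i {Suc i..m}" using assms by auto
  have "fn m i id * Psi i m = (\<Sum>\<tau> | \<tau> permutes {i..m}. fn m i id * fn m m \<tau> :: 'f pal)"
    by (simp add: Psi_def sum_distrib_left)
  also have "\<dots> = (\<Sum>\<tau> | \<tau> permutes {i..m}. fn m i (id(i := \<tau> i)))"
  proof (rule sum.cong[OF refl])
    fix \<tau> assume "\<tau> \<in> {\<tau>. \<tau> permutes {i..m}}"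
    then have \<tau>: "\<tau> permutes {i..m}" by simp
    have "fn m i id * fn m m \<tau> = (fn m i (\<tau> \<circ> id) :: 'f pal)"
      by (rule fn_mult[OF permutes_Pi[OF permutes_interval[OF assms(1) \<tau>]]]) (use assms in auto)
    also have "\<dots> = fn m i (id(i := \<tau> i))"
      by (rule fn_cong) (use permutes_not_in[OF \<tau>] in auto)
    finally show "fn m i id * fn m m \<tau> = (fn m i (id(i := \<tau> i)) :: 'f pal)" .
  qed
  also have "\<dots> = (\<Sum>b\<in>{i..m}. \<Sum>q | q permutes {Suc i..m}. fn m i (id(i := (transpose i b \<circ> q) i)))"
    unfolding ins by (rule sum_over_permutations_insert) auto
  also have "\<dots> = (\<Sum>b\<in>{i..m}. \<Sum>q | q permutes {Suc i..m}. fn m i (id(i := b)))"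
  proof (intro sum.cong refl)
    fix b q assume "q \<in> {q. q permutes {Suc i..m}}"
    then have "q i = i" using permutes_not_in[of q "{Suc i..m}" i] by simp
    then show "fn m i (id(i := (transpose i b \<circ> q) i)) = (fn m i (id(i := b)) :: 'f pal)" by simp
  qed
  also have "\<dots> = scl (fact (m - i)) (\<Sum>b\<in>{i..m}. fn m i (id(i := b)))"
    by (simp add: pal.sum_constant_scale card_permutations[OF refl] pal.scale_sum_right)
  finally show ?thesis
    by (simp add: mult.assoc scl_mult_right Xi_def sum_distrib_left)
qed

lemma span_inj_gens_cap:
  assumes "f \<in> pal.span (inj_gens m (Suc k))"
  shows "cap k * f \<in> pal.span {fn m k g |g. g \<in> {1..k} \<rightarrow> {1..m} \<and> inj_on g {1..k}} "
  using assms
proof (induction rule: pal.span_induct_alt)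
  case (step c x y)
  from step(1) obtain g where g: "x = alt (Suc k) * fn m (Suc k) g" "g \<in> {1..Suc k} \<rightarrow> {1..m}" "inj_on g {1..Suc k}"
    unfolding inj_gens_def by blast
  have "fn m k (g \<circ> h) \<in> {fn m k g |g. g \<in> {1..k} \<rightarrow> {1..m} \<and> inj_on g {1..k}}"
    if h: "h permutes {1..Suc k}" for h
  proof -
    have hk: "h j \<in> {1..Suc k}" if "j \<in> {1..k}" for j
      using permutes_in_image[OF h, of j] that by auto
    then have "g \<circ> h \<in> {1..k} \<rightarrow> {1..m}" using g(2) by (auto simp: Pi_iff)
    moreover have "inj_on (g \<circ> h) {1..k}"
      by (rule comp_inj_on[OF inj_on_subset[OF permutes_inj[OF h]] inj_on_subset[OF g(3)]]) (use hk in auto)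
    ultimately show ?thesis by blast
  qed
  then have "cap k * x \<in> pal.span {fn m k g |g. g \<in> {1..k} \<rightarrow> {1..m} \<and> inj_on g {1..k}}"
    unfolding g(1) cap_alt_fn[OF g(2)]
    by (intro pal.span_scale pal.span_sum pal.span_base) blast
  then show ?case using step(2)
    by (simp only: distrib_left scl_mult_right pal.span_add pal.span_scale)
qed (simp add: pal.span_zero)

text \<open>Permutations act transitively on the injections, so every coefficient of
  \<open>a\<close> is the coefficient of some translate of \<open>a\<close> at the standard
  injection.\<close>

lemma span_fn_coef_0:
  assumes a: "a \<in> pal.span {fn m k g |g. g \<in> {1..k} \<rightarrow> {1..m} \<and> inj_on g {1..k}}"
    and 0: "\<And>\<tau>. \<tau> permutes {1..m} \<Longrightarrow> coef (a * fn m m \<tau>) (fnd m k id) = 0" and km: "k \<le> m"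
  shows "a = (0 :: 'f::field_char_0 pal)"
proof (rule pal_eqI)
  fix \<rho>
  let ?G = "{fn m k g |g. g \<in> {1..k} \<rightarrow> {1..m} \<and> inj_on g {1..k}} :: 'f pal set"
  have shift: "coef (a * fn m m (pinv \<tau>)) (fnd m k id) = coef a (fnd m k \<tau>)" if \<tau>: "\<tau> permutes {1..m}" for \<tau>
    using a
  proof (induction rule: pal.span_induct_alt)
    case (step c x y)
    then obtain g where g: "x = fn m k g" "g \<in> {1..k} \<rightarrow> {1..m}" by blast
    have t: "pinv \<tau> permutes {1..m}" by (rule permutes_inv[OF \<tau>])
    have tk: "\<tau> \<in> {1..k} \<rightarrow> {1..m}" using permutes_Pi[OF \<tau>] km by auto
    have tg: "pinv \<tau> \<circ> g \<in> {1..k} \<rightarrow> {1..m}" using permutes_Pi[OF t] g(2) by (auto simp: Pi_iff)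
    have "fnd m k id = fnd m k (pinv \<tau> \<circ> g) \<longleftrightarrow> (\<forall>j\<in>{1..k}. j = pinv \<tau> (g j))"
      using fnd_inj[OF _ tg, of id] fnd_cong[of k id "pinv \<tau> \<circ> g" m] km by fastforce
    also have "\<dots> \<longleftrightarrow> (\<forall>j\<in>{1..k}. \<tau> j = g j)"
      using permutes_inverses[OF \<tau>] by metis
    also have "\<dots> \<longleftrightarrow> fnd m k \<tau> = fnd m k g"
      using fnd_inj[OF tk g(2)] fnd_cong[of k \<tau> g m] by blast
    finally have "coef (x * fn m m (pinv \<tau>)) (fnd m k id) = coef x (fnd m k \<tau>)"
      unfolding g(1) fn_mult[OF permutes_Pi[OF t] g(2)] by (simp add: fn_def coef_bs valid_diagrams[OF fnd_in])
    then show ?case using step(2) by (simp only: distrib_right scl_mult_left coef_add coef_scl)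
  qed simp
  show "coef a \<rho> = coef 0 \<rho>"
  proof (cases "\<exists>g. g \<in> {1..k} \<rightarrow> {1..m} \<and> inj_on g {1..k} \<and> \<rho> = fnd m k g")
    case True
    then obtain g where g: "g \<in> {1..k} \<rightarrow> {1..m}" "inj_on g {1..k}" "\<rho> = fnd m k g" by blast
    then have "g ` {1..k} \<subseteq> {1..m}" by auto
    from extend_to_permutation[OF g(2) this] obtain \<tau> where
      \<tau>: "\<tau> permutes {1..m}" "\<And>j. j \<in> {1..k} \<Longrightarrow> \<tau> j = g j" by blast
    then have "\<rho> = fnd m k \<tau>" unfolding g(3) by (intro fnd_cong) simp
    then show ?thesis using shift[OF \<tau>(1)] 0[OF permutes_inv[OF \<tau>(1)]] by simp
  next
    case False
    have "coef a \<rho> = 0" using a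
    proof (induction rule: pal.span_induct_alt)
      case (step c x y)
      then show ?case using False by (auto simp: fn_def coef_bs)
    qed simp
    then show ?thesis by simp
  qed
qed

subsection \<open>The contracting homotopy\<close>

text \<open>
  Wedging with the first strand: on morphisms given by maps, \<open>hext\<close> adds a target vertex that is
  linked to the first source vertex.
\<close>

definition diagram_map :: "nat \<Rightarrow> nat \<Rightarrow> diagram \<Rightarrow> nat \<Rightarrow> nat" where
  "diagram_map m i \<pi> = (SOME g. g \<in> {1..i} \<rightarrow> {1..m} \<and> fnd m i g = \<pi>)"

definition hext :: "nat \<Rightarrow> nat \<Rightarrow> 'f::field_char_0 pal \<Rightarrow> 'f pal" where
  "hext m i f = (\<Sum>\<pi>\<in>diagrams m i. scl (coef f \<pi>) (fn m (Suc i) ((diagram_map m i \<pi>)(Suc i := 1))))"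

lemma hext_hm [simp]: "hext m i f \<in> hm m (Suc i)"
  unfolding hext_def by (intro hm_sum) simp

lemma hext_add: "hext m i (f + g) = hext m i f + hext m i g"
  by (simp add: hext_def pal.scale_left_distrib sum.distrib)

lemma hext_scl: "hext m i (scl c f) = scl c (hext m i f)"
  by (simp add: hext_def pal.scale_sum_right)

lemma hext_0 [simp]: "hext m i 0 = 0" by (simp add: hext_def)

lemma hext_fn:
  assumes g: "g \<in> {1..i} \<rightarrow> {1..m}"
  shows "hext m i (fn m i g) = (fn m (Suc i) (g(Suc i := 1)) :: 'f::field_char_0 pal)"
proof -
  have "diagram_map m i (fnd m i g) \<in> {1..i} \<rightarrow> {1..m} \<and> fnd m i (diagram_map m i (fnd m i g)) = fnd m i g"
    unfolding diagram_map_def by (rule someI[of _ g]) (use g in auto)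
  then have eq: "diagram_map m i (fnd m i g) j = g j" if "j \<in> {1..i}" for j
    using fnd_inj[OF _ g _ that] by blast
  have "hext m i (fn m i g) = (\<Sum>\<pi>\<in>diagrams m i. if \<pi> = fnd m i g then fn m (Suc i) ((diagram_map m i \<pi>)(Suc i := 1)) else 0 :: 'f pal)"
    unfolding hext_def by (intro sum.cong refl) (auto simp: fn_def coef_bs valid_diagrams[OF fnd_in])
  also have "\<dots> = fn m (Suc i) ((diagram_map m i (fnd m i g))(Suc i := 1))" by (simp add: sum.delta)
  also have "\<dots> = fn m (Suc i) (g(Suc i := 1))" by (rule fn_cong) (use eq in auto)
  finally show ?thesis .
qed

definition fn_span :: "nat \<Rightarrow> nat \<Rightarrow> 'f::field_char_0 pal set" where
  "fn_span m i = pal.span {fn m i g |g. g \<in> {1..i} \<rightarrow> {1..m}}"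

lemma fn_span_induct [consumes 1, case_names zero add fn]:
  assumes "f \<in> fn_span m i" "P 0" "\<And>a b. P a \<Longrightarrow> P b \<Longrightarrow> P (a + b)"
    "\<And>c g. g \<in> {1..i} \<rightarrow> {1..m} \<Longrightarrow> P (scl c (fn m i g))"
  shows "P f"
  using assms(1) unfolding fn_span_def
  by (induction rule: pal.span_induct_alt) (use assms in auto)

lemma upd_Pi: "g \<in> {1..i} \<rightarrow> {1..m} \<Longrightarrow> 1 \<le> m \<Longrightarrow> g(Suc i := 1) \<in> {1..Suc i} \<rightarrow> {1..m::nat}"
  by (auto simp: Pi_iff le_Suc_eq)

lemma cap_hext:
  assumes "f \<in> fn_span m i" and m: "1 \<le> m"
  shows "cap i * hext m i f = (f :: 'f::field_char_0 pal)"
  using assms(1)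
proof (induction rule: fn_span_induct)
  case (fn c g)
  have "fn (Suc i) i id * fn m (Suc i) (g(Suc i := 1)) = (fn m i (g(Suc i := 1) \<circ> id) :: 'f pal)"
    by (rule fn_mult[OF upd_Pi[OF fn m]]) auto
  also have "\<dots> = fn m i g" by (rule fn_cong) auto
  finally show ?case by (simp add: hext_scl hext_fn[OF fn] scl_mult_right cap_fn)
qed (simp_all add: hext_add distrib_left)

text \<open>Contraction of an old position instead of the added one: the added strand takes over
  position \<open>b\<close>, which leaves the wedge product with the contraction of \<open>f\<close>
  at \<open>b\<close>.\<close>

lemma cap_transpose_hext:
  assumes "f \<in> fn_span m (Suc k)" and m: "1 \<le> m" and b: "b \<in> {1..Suc k}"
  shows "cap (Suc k) * fn (Suc (Suc k)) (Suc (Suc k)) (transpose (Suc (Suc k)) b) * hext m (Suc k) f =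
    fn (Suc k) (Suc k) (transpose b (Suc k)) * hext m k (cap k * (fn (Suc k) (Suc k) (transpose b (Suc k)) * f :: 'f::field_char_0 pal))"
  using assms(1)
proof (induction rule: fn_span_induct)
  case (fn c g)
  let ?i = "Suc k" and ?t = "transpose b (Suc k)" and ?T = "transpose (Suc (Suc k)) b"
  have t: "?t permutes {1..?i}" by (rule transpose_permutes) (use b in auto)
  have T: "?T permutes {1..Suc ?i}" by (rule transpose_permutes) (use b in auto)
  have T': "?T \<in> {1..?i} \<rightarrow> {1..Suc ?i}" using permutes_Pi[OF T] by auto
  have gt: "g \<circ> ?t \<in> {1..?i} \<rightarrow> {1..m}" using fn permutes_Pi[OF t] by (auto simp: Pi_iff)
  then have gt': "g \<circ> ?t \<in> {1..k} \<rightarrow> {1..m}" by auto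
  have "cap ?i * fn (Suc ?i) (Suc ?i) ?T = (fn (Suc ?i) ?i (?T \<circ> id) :: 'f pal)"
    unfolding cap_fn by (rule fn_mult[OF permutes_Pi[OF T]]) auto
  then have "cap ?i * fn (Suc ?i) (Suc ?i) ?T * fn m (Suc ?i) (g(Suc ?i := 1)) = (fn m ?i (g(Suc ?i := 1) \<circ> ?T) :: 'f pal)"
    by (simp add: fn_mult[OF upd_Pi[OF fn m] T'])
  also have "\<dots> = fn m ?i ((g \<circ> ?t)(?i := 1) \<circ> ?t)"
    by (rule fn_cong) (use b in \<open>auto simp: transpose_def\<close>)
  also have "\<dots> = fn ?i ?i ?t * fn m ?i ((g \<circ> ?t)(?i := 1))"
    by (rule fn_mult[OF upd_Pi[OF gt' m] permutes_Pi[OF t], symmetric])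
  also have "fn m ?i ((g \<circ> ?t)(?i := 1)) = hext m k (fn m k (g \<circ> ?t))"
    by (rule hext_fn[OF gt', symmetric])
  also have "fn m k (g \<circ> ?t) = cap k * (fn ?i ?i ?t * (fn m ?i g :: 'f pal))"
  proof -
    have "cap k * fn m ?i (g \<circ> ?t) = (fn m k (g \<circ> ?t \<circ> id) :: 'f pal)"
      unfolding cap_fn by (rule fn_mult[OF gt]) auto
    then show ?thesis by (simp add: fn_mult[OF fn permutes_Pi[OF t]])
  qed
  finally show ?case by (simp only: hext_scl hext_fn[OF fn] scl_mult_right)
qed (simp_all add: hext_add distrib_left)

text \<open>On the kernel of \<open>cap\<close>, wedging with the first strand is inverse to contraction.\<close>

lemma be_hext:
  assumes f: "f \<in> fn_span m i" and m: "1 \<le> m" and af: "alt i * f = f"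
    and c: "i = 0 \<or> cap (i - 1) * f = 0"
  shows "scl (of_nat (Suc i)) (be i * hext m i f) = (f :: 'f::field_char_0 pal)"
proof -
  \<comment> \<open>The Koszul homotopy formula: contracting the wedge gives \<open>f\<close> minus
    terms in which an old position is contracted. Antisymmetry of \<open>f\<close> moves that
    position to the last one, where \<open>cap\<close> gives zero.\<close>
  have z: "cap i * fn (Suc i) (Suc i) (transpose (Suc i) b) * hext m i f = 0" if b: "b \<in> {1..i}" for b
  proof -
    from b obtain k where k: "i = Suc k" by (cases i) auto
    have t: "transpose b (Suc k) permutes {1..Suc k}" by (rule transpose_permutes) (use b k in auto)
    have "fn (Suc k) (Suc k) (transpose b (Suc k)) * f = scl (sg (transpose b (Suc k))) f"
      using arg_cong[OF af, of "\<lambda>x. fn i i (transpose b i) * x"] fn_alt[OF t, where 'a='f] k af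
      by (simp add: scl_mult_left flip: mult.assoc)
    then have "cap k * (fn (Suc k) (Suc k) (transpose b (Suc k)) * f) = 0"
      using c k by (simp add: scl_mult_right)
    then show ?thesis
      using cap_transpose_hext[of f m k b] f m b unfolding k by simp
  qed
  have "scl (of_nat (Suc i)) (be i * hext m i f) = cap i * scl (of_nat (Suc i)) (alt (Suc i)) * hext m i f"
    by (simp only: be_eq scl_mult_left scl_mult_right mult.assoc)
  also have "\<dots> = alt i * (cap i * (ident (Suc i) - (\<Sum>b\<in>{1..i}. fn (Suc i) (Suc i) (transpose (Suc i) b))) * hext m i f)"
    unfolding alt_Suc by (simp only: mult.assoc[symmetric] cap_alt_in)
  also have "cap i * (ident (Suc i) - (\<Sum>b\<in>{1..i}. fn (Suc i) (Suc i) (transpose (Suc i) b))) * hext m i f = f"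
    by (simp add: left_diff_distrib right_diff_distrib sum_distrib_left sum_distrib_right z cap_hext[OF f m])
  finally show ?thesis by (simp add: af)
qed

lemma be_hext_rad:
  assumes "f \<in> fn_span m i" "1 \<le> m" "alt i * f = f" "i = 0 \<or> cap (i - 1) * f = 0"
  shows "f \<in> (rad m i :: 'f::field_char_0 pal set)"
  using rad_scl[OF rad_be[OF hext_hm[of m i f]], of "of_nat (Suc i)"] be_hext[OF assms] by simp

lemma span_inj_gens_fn_span: assumes "f \<in> pal.span (inj_gens m i)" shows "f \<in> fn_span m i"
  using assms
proof (induction rule: pal.span_induct_alt)
  case base
  then show ?case by (simp add: fn_span_def pal.span_zero)
next
  case (step c x y)
  from step(1) obtain g where g: "x = alt i * fn m i g" "g \<in> {1..i} \<rightarrow> {1..m}"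
    unfolding inj_gens_def by blast
  have "fn i i h * fn m i g \<in> {fn m i g |g. g \<in> {1..i} \<rightarrow> {1..m}}" if h: "h permutes {1..i}" for h
    using fn_mult[OF g(2) permutes_Pi[OF h]] g(2) permutes_Pi[OF h] by (auto simp: Pi_iff)
  then have "x \<in> fn_span m i"
    unfolding fn_span_def g(1) alt_in_def scl_mult_left sum_distrib_right
    by (intro pal.span_scale pal.span_sum pal.span_base) blast
  then show ?case using step(2) by (simp add: fn_span_def pal.span_add pal.span_scale)
qed

lemma span_inj_gens_alt: assumes "f \<in> pal.span (inj_gens m i)" shows "alt i * f = f"
  using assms
  by (induction rule: pal.span_induct_alt)
    (auto simp: inj_gens_def distrib_left scl_mult_right simp flip: mult.assoc)

subsection \<open>The left kernel consists of radical morphisms\<close>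

text \<open>Linked targets give zero. If neither end has linked vertices, the diagram is a partial
  injection: in full rank \<open>i\<close> it is a generator up to sign, otherwise some target is
  isolated and \<open>alt i * bs \<pi>\<close> factors through \<open>al (i - 1)\<close>.\<close>

lemma alt_bs_cases:
  assumes \<pi>: "\<pi> \<in> diagrams m i"
  shows "alt i * bs \<pi> \<in> (rad m i :: 'f::field_char_0 pal set) \<or> alt i * bs \<pi> \<in> (pal.span (inj_gens m i) :: 'f pal set) \<or>
    (\<exists>a\<in>{1..m}. \<exists>b\<in>{1..m}. a \<noteq> b \<and> linked_in \<pi> (Src a) (Src b))"
proof (cases "(\<exists>a\<in>{1..m}. \<exists>b\<in>{1..m}. a \<noteq> b \<and> linked_in \<pi> (Src a) (Src b)) \<or>
    (\<exists>a\<in>{1..i}. \<exists>b\<in>{1..i}. a \<noteq> b \<and> linked_in \<pi> (Tgt a) (Tgt b))")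
  case True
  then show ?thesis
  proof
    assume "\<exists>a\<in>{1..i}. \<exists>b\<in>{1..i}. a \<noteq> b \<and> linked_in \<pi> (Tgt a) (Tgt b)"
    then obtain a b where "a \<in> {1..i}" "b \<in> {1..i}" "a \<noteq> b" "linked_in \<pi> (Tgt a) (Tgt b)" by blast
    then have "alt i * bs \<pi> = (0 :: 'f pal)" by (intro alt_bs_0'[OF \<pi>, of a b]) auto
    then show ?thesis by (simp add: rad_0)
  qed simp
next
  case False
  let ?B = "{j \<in> {1..i}. \<not> single \<pi> (Tgt j)}"
  obtain g where g: "g ` ?B = {j \<in> {1..m}. \<not> single \<pi> (Src j)}" "inj_on g ?B" "\<And>x z. fits \<pi> x z \<longleftrightarrow> (\<forall>j\<in>?B. z j = x (g j))"
    by (rule separated_diagram[OF \<pi>]) (use False in blast)+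
  have gB: "g ` ?B \<subseteq> {1..m}" using g(1) by auto
  from partial_injection_std[OF \<pi> _ g(2) gB g(3), where 'f='f] obtain \<sigma> \<tau> where st:
    "\<sigma> permutes {1..i}" "\<tau> permutes {1..m}"
    "bs \<pi> = (fn i i \<sigma> * bs (std m i (card ?B)) * fn m m \<tau> :: 'f pal)" by blast
  have eq: "alt i * bs \<pi> = scl (sg \<sigma>) (alt i * bs (std m i (card ?B)) * (fn m m \<tau> :: 'f pal))"
  proof -
    have "alt i * bs \<pi> = (alt i * fn i i \<sigma>) * bs (std m i (card ?B)) * (fn m m \<tau> :: 'f pal)"
      by (simp only: st(3) mult.assoc)
    then show ?thesis by (simp add: alt_fn[OF st(1)] scl_mult_left)
  qed
  have cm: "card ?B \<le> m" using card_inj_on_le[OF g(2) gB] by simp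
  have ci: "card ?B \<le> i" by (rule order_trans[OF card_mono[of "{1..i}" ?B]]) auto
  show ?thesis
  proof (cases "card ?B = i")
    case True
    have im: "{1..i} \<subseteq> {1..m}" using cm True by auto
    then have ti: "\<tau> \<in> {1..i} \<rightarrow> {1..m}" using permutes_Pi[OF st(2)] by auto
    have "bs (std m i i) * fn m m \<tau> = (fn m i (\<tau> \<circ> id) :: 'f pal)"
      unfolding fnd_id[symmetric] fn_def[symmetric]
      by (rule fn_mult[OF permutes_Pi[OF st(2)]]) (use im in auto)
    then have "alt i * bs \<pi> = scl (sg \<sigma>) (alt i * (fn m i \<tau> :: 'f pal))" using eq True by (simp add: mult.assoc)
    moreover have "alt i * fn m i \<tau> \<in> (inj_gens m i :: 'f pal set)"
      unfolding inj_gens_def using ti inj_on_subset[OF permutes_inj[OF st(2)] subset_UNIV] by blast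
    ultimately show ?thesis by (simp add: pal.span_scale pal.span_base)
  next
    case False
    then have lt: "card ?B \<le> i - 1" "1 \<le> i" using ci by auto
    have si: "Suc (i - 1) = i" using lt by simp
    have "bs (std (i - 1) i (i - 1)) * bs (std m (i - 1) (card ?B)) = (bs (std m i (min (card ?B) (i - 1))) :: 'f pal)"
      by (rule std_mult) (use lt cm in auto)
    then have "bs (std m i (card ?B)) = U (i - 1) * (bs (std m (i - 1) (card ?B)) :: 'f pal)"
      using lt unfolding U_def si by (simp add: min_def)
    then have "alt i * bs \<pi> = scl (sg \<sigma>) (al (i - 1) * (bs (std m (i - 1) (card ?B)) * (fn m m \<tau> :: 'f pal)))"
      unfolding eq al_eq si by (simp add: mult.assoc)
    moreover have "al (i - 1) * (bs (std m (i - 1) (card ?B)) * (fn m m \<tau> :: 'f pal)) \<in> rad m i"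
      by (rule rad_al[OF lt(2)]) (auto intro!: hm_mult[of _ m])
    ultimately show ?thesis by (simp add: rad_scl)
  qed
qed

text \<open>The cases of \<open>alt_bs_cases\<close>, with the diagrams that have linked sources
  collected in \<open>q\<close>. The vanishing is required after every permutation because
  \<open>Psi\<close> will stand between \<open>q\<close> and \<open>eps\<close>.\<close>

lemma alt_decompose:
  assumes \<phi>: "\<phi> \<in> hm m i" "alt i * \<phi> = (\<phi> :: 'f::field_char_0 pal)"
  obtains f r q where "\<phi> = f + r + q" "f \<in> pal.span (inj_gens m i)" "r \<in> rad m i" "q \<in> hm m i"
    "\<And>\<sigma>. \<sigma> permutes {1..m} \<Longrightarrow> q * fn m m \<sigma> * eps m m = 0"
proof -
  let ?P = "\<lambda>\<phi>. \<exists>f r q. \<phi> = f + r + q \<and> f \<in> pal.span (inj_gens m i) \<and> r \<in> rad m i \<and> q \<in> hm m i \<and>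
    (\<forall>\<sigma>. \<sigma> permutes {1..m} \<longrightarrow> q * fn m m \<sigma> * eps m m = (0 :: 'f pal))"
  have "?P (alt i * \<phi>)" using \<phi>(1)
  proof (induction rule: hm_induct)
    case zero
    show ?case by (intro exI[of _ 0]) (simp add: rad_0 pal.span_zero)
  next
    case (add a b)
    then obtain f r q f' r' q' where "alt i * a = f + r + q" "f \<in> pal.span (inj_gens m i)" "r \<in> rad m i" "q \<in> hm m i"
      "\<forall>\<sigma>. \<sigma> permutes {1..m} \<longrightarrow> q * fn m m \<sigma> * eps m m = 0"
      "alt i * b = f' + r' + q'" "f' \<in> pal.span (inj_gens m i)" "r' \<in> rad m i" "q' \<in> hm m i"
      "\<forall>\<sigma>. \<sigma> permutes {1..m} \<longrightarrow> q' * fn m m \<sigma> * eps m m = 0" by blast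
    then show ?case
      by (intro exI[of _ "f + f'"] exI[of _ "r + r'"] exI[of _ "q + q'"])
        (simp add: distrib_left distrib_right pal.span_add rad_add)
  next
    case (basis c \<pi>)
    from alt_bs_cases[OF basis, where 'f='f] show ?case
    proof (elim disjE)
      assume "alt i * bs \<pi> \<in> (rad m i :: 'f pal set)"
      then show ?thesis
        by (intro exI[of _ 0] exI[of _ "alt i * scl c (bs \<pi>)"])
          (simp add: scl_mult_right rad_scl pal.span_zero exI[of _ 0])
    next
      assume "alt i * bs \<pi> \<in> (pal.span (inj_gens m i) :: 'f pal set)"
      then show ?thesis
        by (intro exI[of _ "alt i * scl c (bs \<pi>)"] exI[of _ 0])
          (simp add: scl_mult_right rad_0 pal.span_scale)
    next
      assume "\<exists>a\<in>{1..m}. \<exists>b\<in>{1..m}. a \<noteq> b \<and> linked_in \<pi> (Src a) (Src b)"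
      then obtain a b where ab: "a \<in> {1..m}" "b \<in> {1..m}" "a \<noteq> b" "linked_in \<pi> (Src a) (Src b)" by blast
      have "alt i * scl c (bs \<pi>) * fn m m \<sigma> * eps m m = (0 :: 'f pal)" if "\<sigma> permutes {1..m}" for \<sigma>
        using linked_perm_eps[OF basis ab that, where 'f='f] by (simp add: scl_mult_left scl_mult_right mult.assoc)
      moreover have "alt i * scl c (bs \<pi>) \<in> (hm m i :: 'f pal set)"
        by (rule hm_mult[OF alt_in_hm]) (simp add: basis)
      ultimately show ?thesis
        by (intro exI[of _ 0] exI[of _ "alt i * scl c (bs \<pi>)"]) (simp add: rad_0 pal.span_zero)
    qed
  qed
  then show thesis using that unfolding \<phi>(2) by blast
qed

text \<open>Two merged strands count as one. This factorization feeds the induction on the number of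
  strands in \<open>left_ker_subset_rad\<close>.\<close>

lemma J_factor:
  assumes ab: "1 \<le> a" "a < b" "b \<le> m"
  shows "\<exists>g\<in>hm (m - 1) m. J m a b = g * tr (g :: 'f::field_char_0 pal)"
proof
  \<comment> \<open>\<open>?\<gamma>\<close> identifies \<open>b\<close> with \<open>a\<close> and
    hands the label \<open>b\<close>, now free, to the last strand, so that the labels
    \<open>1, ..., m - 1\<close> are all in use.\<close>
  let ?\<gamma> = "\<lambda>j. if j = b then a else if j = m then b else j"
  let ?g = "fnd (m - 1) m ?\<gamma>"
  have \<gamma>: "?\<gamma> \<in> {1..m} \<rightarrow> {1..m-1}" using ab by auto
  have abm: "a \<in> {1..m}" "b \<in> {1..m}" using ab by auto
  have surj: "\<exists>j\<in>{1..m}. ?\<gamma> j = i" if i: "i \<in> {1..m-1}" for i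
  proof (cases "i = b")
    case True
    then have "b \<noteq> m" using i by auto
    then show ?thesis using True ab by (intro bexI[of _ m]) auto
  next
    case False
    then show ?thesis using i by (intro bexI[of _ i]) auto
  qed
  have "bs ?g * bs (flipd ?g) = (bs (merged m a b) :: 'f pal)"
  proof (rule bs_multI[OF flipd_in[OF fnd_in] fnd_in merged_in])
    fix x z :: "nat \<Rightarrow> bool"
    have "x a = x b \<and> (\<forall>j\<in>{1..m}. z j = x j) \<longleftrightarrow>
        (\<exists>y. (\<forall>j\<in>{1..m}. x j = y (?\<gamma> j)) \<and> (\<forall>j\<in>{1..m}. z j = y (?\<gamma> j)))" (is "?l \<longleftrightarrow> (\<exists>y. ?r y)")
    proof
      assume l: ?l
      \<comment> \<open>After the relabelling it is strand \<open>m\<close> that carries the label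
        \<open>b\<close>.\<close>
      let ?y = "\<lambda>i. if i = b then x m else x i"
      have xy: "x j = ?y (?\<gamma> j)" for j
        using l ab by (cases "j = b"; cases "j = m") simp_all
      have zy: "z j = ?y (?\<gamma> j)" if "j \<in> {1..m}" for j
        by (rule trans[OF _ xy]) (use l that in blast)
      show "\<exists>y. ?r y" by (intro exI[of _ ?y] conjI ballI xy zy)
    next
      assume "\<exists>y. ?r y"
      then obtain y where y: "\<forall>j\<in>{1..m}. x j = y (?\<gamma> j)" "\<forall>j\<in>{1..m}. z j = y (?\<gamma> j)" by blast
      have "x a = x b" using y(1)[rule_format, OF abm(1)] y(1)[rule_format, OF abm(2)] ab by simp
      then show ?l using y by simp
    qed
    then show "fits (merged m a b) x z = (\<exists>y. fits (flipd ?g) x y \<and> fits ?g y z)"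
      unfolding fits_merged[OF abm] fits_flipd fits_fnd[OF \<gamma>] .
  next
    fix y i
    assume "fits (flipd ?g) (\<lambda>_. False) y" "fits ?g y (\<lambda>_. False)" "i \<in> {1..m-1}"
    then show "\<not> y i" using surj unfolding fits_flipd fits_fnd[OF \<gamma>] by metis
  qed
  then show "J m a b = fn (m - 1) m ?\<gamma> * tr (fn (m - 1) m ?\<gamma> :: 'f pal)"
    by (simp only: J_def fn_def tr_bs)
qed simp

lemma rad_left_ker_scl:
  assumes "r \<in> rad m i" "\<psi> \<in> hm i m" shows "\<exists>d. r * \<psi> * alt i = scl d (xi i)"
  by (rule rad_endo[OF rad_mult[OF assms]])

text \<open>Induction on the number of strands. Merges factor through one strand fewer, so modulo
  \<open>rad\<close> the morphism \<open>\<phi>\<close> may be multiplied by \<open>eps\<close>,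
  which removes the summand \<open>q\<close> of \<open>alt_decompose\<close>. For the summand
  \<open>f\<close>, pairing \<open>\<phi>\<close> with test morphisms gives
  \<open>cap * f = 0\<close>, and then \<open>be_hext_rad\<close> applies.\<close>

theorem left_ker_subset_rad: "left_ker m i \<subseteq> (rad m i :: 'f::field_char_0 pal set)"
proof (induction m)
  case 0
  show ?case
  proof
    fix \<phi> :: "'f pal" assume lk: "\<phi> \<in> left_ker 0 i"
    then have \<phi>: "\<phi> \<in> hm 0 i" "alt i * \<phi> = \<phi>" by (auto simp: left_ker_def)
    show "\<phi> \<in> rad 0 i"
    proof (cases "i = 0")
      case True
      have "\<exists>d. \<phi> * ident 0 * alt 0 = scl d (xi 0)"
        using lk ident_hm[of 0] unfolding left_ker_def True by blast
      then have "\<phi> * (ident 0 * alt 0) = 0" by (simp add: xi_def mult.assoc)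
      then have "\<phi> * ident 0 = 0" by (simp add: alt_0)
      then have "\<phi> = 0" using ident_right[OF \<phi>(1)] by simp
      then show ?thesis by (simp add: rad_0)
    next
      case False
      obtain f r q where d: "\<phi> = f + r + q" "f \<in> pal.span (inj_gens 0 i)" "r \<in> rad 0 i" "q \<in> hm 0 i"
        "\<And>\<sigma>. \<sigma> permutes {1..0} \<Longrightarrow> q * fn 0 0 \<sigma> * eps 0 0 = 0"
        by (rule alt_decompose[OF \<phi>]) (rule that)
      have "inj_gens 0 i = ({} :: 'f pal set)" using False by (auto simp: inj_gens_def Pi_iff intro: exI[of _ 1])
      then have "f = 0" using d(2) by simp
      moreover have "q = 0"
        using d(5)[OF permutes_id] ident_right[OF d(4)] by (simp add: ident_def[symmetric])
      ultimately show ?thesis using d by simp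
    qed
  qed
next
  case (Suc m')
  let ?m = "Suc m'"
  show ?case
  proof
    fix \<phi> :: "'f pal" assume lk: "\<phi> \<in> left_ker ?m i"
    then have \<phi>: "\<phi> \<in> hm ?m i" "alt i * \<phi> = \<phi>" by (auto simp: left_ker_def)
    have J: "\<phi> * J ?m a b \<in> rad ?m i" if ab: "1 \<le> a" "a < b" "b \<le> ?m" for a b
    proof -
      obtain g where g: "g \<in> hm m' ?m" "J ?m a b = g * tr (g :: 'f pal)" using J_factor[OF ab, where 'f='f] by auto
      have "\<phi> * g \<in> rad m' i" using left_ker_mult[OF lk g(1)] Suc.IH by blast
      from rad_mult[OF this tr_hm[OF g(1)]] show ?thesis by (simp add: g(2) mult.assoc)
    qed
    \<comment> \<open>Factors of \<open>eps\<close> are added on the left, next to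
      \<open>\<phi>\<close>, so each of them changes the product by terms that start with
      \<open>\<phi> * J\<close>.\<close>
    have eps: "\<phi> - \<phi> * eps ?m r \<in> rad ?m i" if "r \<le> ?m" for r
      using that
    proof (induction r)
      case 0
      then show ?case using ident_right[OF \<phi>(1)] by (simp add: rad_0)
    next
      case (Suc r)
      have "\<phi> - \<phi> * eps ?m (Suc r) = (\<phi> - \<phi> * eps ?m r) + (\<Sum>a\<in>{1..r}. \<phi> * J ?m a (Suc r)) * eps ?m r"
        by (simp add: left_diff_distrib right_diff_distrib sum_distrib_left sum_distrib_right mult.assoc)
      moreover have "(\<Sum>a\<in>{1..r}. \<phi> * J ?m a (Suc r)) * eps ?m r \<in> rad ?m i"
        by (rule rad_mult[OF rad_sum eps_hm]) (use J Suc.prems in auto)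
      moreover have "\<phi> - \<phi> * eps ?m r \<in> rad ?m i" using Suc by simp
      ultimately show ?case by (simp only: rad_add)
    qed
    obtain f r q where d: "\<phi> = f + r + q" "f \<in> pal.span (inj_gens ?m i)" "r \<in> rad ?m i" "q \<in> hm ?m i"
      and q: "\<And>\<sigma>. \<sigma> permutes {1..?m} \<Longrightarrow> q * fn ?m ?m \<sigma> * eps ?m ?m = 0"
      by (rule alt_decompose[OF \<phi>]) (rule that)
    have "f \<in> rad ?m i"
    proof (rule be_hext_rad[OF span_inj_gens_fn_span[OF d(2)] _ span_inj_gens_alt[OF d(2)]])
      show "i = 0 \<or> cap (i - 1) * f = 0"
      proof (cases i)
        case (Suc k)
        show ?thesis
        proof (cases "i \<le> ?m")
          case False
          have "inj_gens ?m i = ({} :: 'f pal set)"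
          proof -
            have False if "g \<in> {1..i} \<rightarrow> {1..?m}" "inj_on g {1..i}" for g
              using card_inj_on_le[OF that(2), of "{1..?m}"] that(1) False by auto
            then show ?thesis unfolding inj_gens_def by blast
          qed
          then show ?thesis using d(2) by simp
        next
          case True
          have coef0: "coef (cap k * f * fn ?m ?m \<tau>) (fnd ?m k id) = 0" if \<tau>: "\<tau> permutes {1..?m}" for \<tau>
          proof -
            \<comment> \<open>The test morphism: \<open>Psi\<close> reduces \<open>f\<close> to one
              coefficient, \<open>eps\<close> kills \<open>q\<close>, and with \<open>incl\<close>
              the outcome is a multiple of \<open>wt i ?m\<close>.\<close>
            let ?\<psi> = "Psi i ?m * eps ?m ?m * incl i ?m :: 'f pal"
            let ?t = "fn ?m ?m \<tau> :: 'f pal"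
            have \<psi>: "?t * ?\<psi> \<in> hm i ?m"
              by (rule hm_mult[OF fn_hm hm_mult[OF hm_mult[OF Psi_hm eps_hm] incl_hm]])
            let ?l = "fact (Suc k) * coef (cap k * (f * ?t)) (fnd ?m k id)"
            obtain d1 where d1: "\<phi> * (?t * ?\<psi>) * alt i = scl d1 (xi i)"
              using lk \<psi> unfolding left_ker_def by blast
            obtain d2 where d2: "r * (?t * ?\<psi>) * alt i = scl d2 (xi i)"
              using rad_left_ker_scl[OF d(3) \<psi>] by blast
            have q0: "q * (?t * ?\<psi>) * alt i = 0"
            proof -
              have "q * ?t * Psi i ?m * eps ?m ?m = 0"
              proof -
                have "q * (?t * fn ?m ?m \<sigma>) * eps ?m ?m = 0" if \<sigma>: "\<sigma> permutes {i..?m}" for \<sigma>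
                proof -
                  have \<sigma>': "\<sigma> permutes {1..?m}" by (rule permutes_interval[OF _ \<sigma>]) (use Suc in simp)
                  show ?thesis unfolding fn_perm_mult[OF \<tau> \<sigma>'] by (rule q[OF permutes_compose[OF \<tau> \<sigma>']])
                qed
                then show ?thesis by (simp add: Psi_def sum_distrib_left sum_distrib_right mult.assoc)
              qed
              then have "q * ?t * Psi i ?m * eps ?m ?m * (incl i ?m * alt i) = 0" by simp
              then show ?thesis by (simp only: mult.assoc)
            qed
            have "f * (?t * ?\<psi>) * alt i = (f * ?t * Psi i ?m) * (eps ?m ?m * incl i ?m * alt i)"
              by (simp only: mult.assoc)
            also have "f * ?t * Psi i ?m = scl ?l (alt i * fn ?m i id * Psi i ?m)"
              using span_inj_gens_Psi[OF span_inj_gens_perm[OF d(2) \<tau>, unfolded Suc]] unfolding Suc by simp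
            also have "alt i * fn ?m i id * Psi i ?m = scl (fact (?m - i)) (Xi i ?m)"
              by (rule alt_id_Psi) (use Suc True in auto)
            finally have "f * (?t * ?\<psi>) * alt i = scl (?l * fact (?m - i)) (wt i ?m)"
              by (simp only: scl_mult_left wt_def mult.assoc pal.scale_scale)
            moreover obtain c d' where c: "c \<noteq> 0" "wt i ?m = scl c (alt i) + scl d' (xi i :: 'f pal)"
              using wt_eq[of i ?m, where 'f='f] Suc True by auto
            ultimately have "scl (?l * fact (?m - i)) (scl c (alt i) + scl d' (xi i)) + scl d2 (xi i) = scl d1 (xi i)"
              using d1 d2 q0 unfolding d(1) by (simp add: distrib_right)
            \<comment> \<open>Multiplication by \<open>xi i\<close>, which squares to zero, isolates
              the coefficient at \<open>alt i\<close>.\<close>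
            then have "(scl (?l * fact (?m - i)) (scl c (alt i) + scl d' (xi i)) + scl d2 (xi i)) * xi i = scl d1 (xi i) * xi i"
              by simp
            then have "scl (?l * fact (?m - i) * c) (xi i) = (0 :: 'f pal)"
              by (simp only: distrib_right scl_mult_left alt_xi xi_xi pal.scale_zero_right add_0_right pal.scale_scale)
            then have "?l * fact (?m - i) * c = 0" using xi_Suc_neq_0[of k, where 'f='f] unfolding Suc by simp
            then show ?thesis using c(1) by (simp add: mult.assoc del: fact_Suc)
          qed
          have "cap k * f = 0"
            by (rule span_fn_coef_0[OF span_inj_gens_cap[OF d(2)[unfolded Suc]] coef0]) (use Suc True in auto)
          then show ?thesis using Suc by simp
        qed
      qed simp
    qed simp
    moreover have "\<phi> * eps ?m ?m = f * eps ?m ?m + r * eps ?m ?m"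
    proof -
      have "q * fn ?m ?m id * eps ?m ?m = 0" by (rule q[OF permutes_id])
      then have "q * eps ?m ?m = 0" using ident_right[OF d(4)] by (simp add: ident_def)
      then show ?thesis unfolding d(1) by (simp add: distrib_right)
    qed
    ultimately have "\<phi> * eps ?m ?m \<in> rad ?m i"
      by (simp only: rad_add[OF rad_mult[OF _ eps_hm] rad_mult[OF d(3) eps_hm]])
    from rad_add[OF eps[OF order_refl] this] show "\<phi> \<in> rad ?m i" by (simp only: diff_add_cancel)
  qed
qed

section \<open>Matrices with finite support\<close>

text \<open>As with \<open>pal\<close>, matrices of all formats are padded by zeros and live in one
  ring without unit; the format becomes the side condition \<open>HM\<close>.\<close>

typedef (overloaded) 'a fmat = "{f :: nat \<Rightarrow> nat \<Rightarrow> 'a::zero. \<exists>N. \<forall>j i. N \<le> j \<or> N \<le> i \<longrightarrow> f j i = 0}"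
  morphisms ent Fmat
  by (rule exI[of _ "\<lambda>_ _. 0"]) simp

setup_lifting type_definition_fmat

lemma ent_bound: obtains N where "\<And>j i. N \<le> j \<or> N \<le> i \<Longrightarrow> ent a j i = 0"
  using ent[of a] by auto

lemma fmat_eqI: "(\<And>j i. ent a j i = ent b j i) \<Longrightarrow> a = b"
  by (metis ent_inject ext)

instantiation fmat :: (ring) ab_group_add
begin

lift_definition zero_fmat :: "'a fmat" is "\<lambda>_ _. 0" by simp

lift_definition plus_fmat :: "'a fmat \<Rightarrow> 'a fmat \<Rightarrow> 'a fmat" is "\<lambda>f g j i. f j i + g j i"
proof -
  fix f g :: "nat \<Rightarrow> nat \<Rightarrow> 'a"
  assume "\<exists>N. \<forall>j i. N \<le> j \<or> N \<le> i \<longrightarrow> f j i = 0" "\<exists>N. \<forall>j i. N \<le> j \<or> N \<le> i \<longrightarrow> g j i = 0"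
  then obtain N M where "\<forall>j i. N \<le> j \<or> N \<le> i \<longrightarrow> f j i = 0" "\<forall>j i. M \<le> j \<or> M \<le> i \<longrightarrow> g j i = 0" by blast
  then show "\<exists>N. \<forall>j i. N \<le> j \<or> N \<le> i \<longrightarrow> f j i + g j i = 0" by (intro exI[of _ "max N M"]) auto
qed

lift_definition uminus_fmat :: "'a fmat \<Rightarrow> 'a fmat" is "\<lambda>f j i. - f j i" by simp

definition minus_fmat :: "'a fmat \<Rightarrow> 'a fmat \<Rightarrow> 'a fmat" where "minus_fmat a b = a + - b"

instance
proof
  have c: "ent 0 j i = 0" "ent (a + b) j i = ent a j i + ent b j i" "ent (- a) j i = - ent a j i"
    for a b :: "'a fmat" and j i by (transfer, simp)+
  fix a b c :: "'a fmat"
  show "a + b + c = a + (b + c)" by (rule fmat_eqI) (simp only: c add.assoc)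
  show "a + b = b + a" by (rule fmat_eqI) (simp only: c add.commute)
  show "0 + a = a" by (rule fmat_eqI) (simp only: c add_0_left)
  show "- a + a = 0" by (rule fmat_eqI) (simp only: c left_minus)
  show "a - b = a + - b" by (simp add: minus_fmat_def)
qed

end

lemma ent_zero [simp]: "ent 0 j i = 0" by transfer simp
lemma ent_add [simp]: "ent (a + b) j i = ent a j i + ent b j i" by transfer simp
lemma ent_uminus [simp]: "ent (- a) j i = - ent a j i" by transfer simp
lemma ent_diff [simp]: "ent (a - b) j i = ent a j i - ent b j i"
  unfolding minus_fmat_def ent_add ent_uminus by simp

instantiation fmat :: (ring) times
begin

lift_definition times_fmat :: "'a fmat \<Rightarrow> 'a fmat \<Rightarrow> 'a fmat" is
  "\<lambda>b a k i. \<Sum>j | a j i \<noteq> 0. b k j * a j i"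
proof -
  fix b a :: "nat \<Rightarrow> nat \<Rightarrow> 'a"
  assume "\<exists>N. \<forall>j i. N \<le> j \<or> N \<le> i \<longrightarrow> b j i = 0" "\<exists>N. \<forall>j i. N \<le> j \<or> N \<le> i \<longrightarrow> a j i = 0"
  then obtain N M where "\<forall>j i. N \<le> j \<or> N \<le> i \<longrightarrow> b j i = 0" "\<forall>j i. M \<le> j \<or> M \<le> i \<longrightarrow> a j i = 0" by blast
  then show "\<exists>N. \<forall>k i. N \<le> k \<or> N \<le> i \<longrightarrow> (\<Sum>j | a j i \<noteq> 0. b k j * a j i) = 0"
    by (intro exI[of _ "max N M"]) auto
qed

instance ..

end

text \<open>The defining sum runs over a support that depends on the column; any common bound
  \<open>N\<close> may replace it.\<close>

lemma ent_times:
  assumes "\<And>j. N \<le> j \<Longrightarrow> ent b k j = 0 \<or> ent a j i = 0"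
  shows "ent (b * a) k i = (\<Sum>j<N. ent b k j * ent a j i)"
proof -
  obtain M where M: "\<And>j i. M \<le> j \<or> M \<le> i \<Longrightarrow> ent a j i = 0" by (rule ent_bound[of a]) (rule that)
  have "ent (b * a) k i = (\<Sum>j | ent a j i \<noteq> 0. ent b k j * ent a j i)" by transfer simp
  also have "\<dots> = (\<Sum>j<max M N. ent b k j * ent a j i)"
    by (rule sum.mono_neutral_left) (use M in \<open>force simp: not_le[symmetric]\<close>)+
  also have "\<dots> = (\<Sum>j<N. ent b k j * ent a j i)"
  proof (rule sum.mono_neutral_right)
    show "\<forall>j\<in>{..<max M N} - {..<N}. ent b k j * ent a j i = 0"
    proof
      fix j assume "j \<in> {..<max M N} - {..<N}"
      then have "ent b k j = 0 \<or> ent a j i = 0" by (intro assms) simp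
      then show "ent b k j * ent a j i = 0" by auto
    qed
  qed auto
  finally show ?thesis .
qed

instance fmat :: (ring) ring
proof
  fix a b c :: "'a fmat"
  obtain A where A: "\<And>j i. A \<le> j \<or> A \<le> i \<Longrightarrow> ent a j i = 0" by (rule ent_bound[of a]) (rule that)
  obtain B where B: "\<And>j i. B \<le> j \<or> B \<le> i \<Longrightarrow> ent b j i = 0" by (rule ent_bound[of b]) (rule that)
  obtain C where C: "\<And>j i. C \<le> j \<or> C \<le> i \<Longrightarrow> ent c j i = 0" by (rule ent_bound[of c]) (rule that)
  show "(a + b) * c = a * c + b * c"
    by (rule fmat_eqI) (simp add: ent_times[where N=C] C distrib_right sum.distrib)
  show "a * (b + c) = a * b + a * c"
    by (rule fmat_eqI) (simp add: ent_times[where N=A] A distrib_left sum.distrib)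
  show "a * b * c = a * (b * c)"
  proof (rule fmat_eqI)
    fix k i
    have "ent (a * b * c) k i = (\<Sum>j<C. \<Sum>l<A. ent a k l * ent b l j * ent c j i)"
      by (simp add: ent_times[where N=C] ent_times[where N=A] A C sum_distrib_right)
    also have "\<dots> = (\<Sum>l<A. \<Sum>j<C. ent a k l * ent b l j * ent c j i)" by (rule sum.swap)
    also have "\<dots> = ent (a * (b * c)) k i"
      by (simp add: ent_times[where N=C] ent_times[where N=A] A C sum_distrib_left mult.assoc)
    finally show "ent (a * b * c) k i = ent (a * (b * c)) k i" .
  qed
qed

lift_definition mat :: "nat \<Rightarrow> nat \<Rightarrow> (nat \<Rightarrow> nat \<Rightarrow> 'a::zero) \<Rightarrow> 'a fmat" is
  "\<lambda>n m f j i. if j < m \<and> i < n then f j i else 0"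
proof -
  fix n m and f :: "nat \<Rightarrow> nat \<Rightarrow> 'a"
  show "\<exists>N. \<forall>j i. N \<le> j \<or> N \<le> i \<longrightarrow> (if j < m \<and> i < n then f j i else 0) = 0"
    by (intro exI[of _ "max n m"]) auto
qed

lemma ent_mat [simp]: "ent (mat n m f) j i = (if j < m \<and> i < n then f j i else 0)" by transfer simp

definition sm :: "'a::zero \<Rightarrow> 'a fmat" where "sm x = mat 1 1 (\<lambda>_ _. x)"

lemma ent_sm [simp]: "ent (sm x) j i = (if j = 0 \<and> i = 0 then x else 0)"
  by (auto simp: sm_def)

lemma sm_mult: "sm x * sm y = sm (x * y :: 'a::ring)"
  by (rule fmat_eqI) (simp add: ent_times[where N=1] One_nat_def)

lemma sm_mult_assoc: "sm x * (sm y * a) = sm (x * y :: 'a::ring) * a"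
  by (simp add: mult.assoc[symmetric] sm_mult)

lemma sm_add: "sm (x + y) = sm x + sm (y :: 'a::ring)" by (rule fmat_eqI) simp
lemma sm_0 [simp]: "sm 0 = (0 :: 'a::ring fmat)" by (rule fmat_eqI) simp

lemma sm_eq_iff [simp]: "sm x = sm y \<longleftrightarrow> x = y"
proof
  assume "sm x = sm y"
  then have "ent (sm x) 0 0 = ent (sm y) 0 0" by simp
  then show "x = y" by simp
qed simp

lemma sm_eq_0_iff [simp]: "sm x = 0 \<longleftrightarrow> x = (0 :: 'a::ring)"
  using sm_eq_iff[of x 0] by simp

section \<open>The Karoubian envelope in terms of matrices\<close>

definition HM :: "nat list \<Rightarrow> nat list \<Rightarrow> 'f::field_char_0 pal fmat set" where
  "HM xs ys = {a. \<forall>j i. if j < length ys \<and> i < length xs then ent a j i \<in> hm (xs ! i) (ys ! j) else ent a j i = 0}"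

lemma HM_0 [simp]: "0 \<in> HM xs ys" by (simp add: HM_def)
lemma HM_add [simp]: "a \<in> HM xs ys \<Longrightarrow> b \<in> HM xs ys \<Longrightarrow> a + b \<in> HM xs ys" by (auto simp: HM_def)
lemma HM_diff [simp]: "a \<in> HM xs ys \<Longrightarrow> b \<in> HM xs ys \<Longrightarrow> a - b \<in> HM xs ys" by (auto simp: HM_def)

lemma HM_ent: "a \<in> HM xs ys \<Longrightarrow> j < length ys \<Longrightarrow> i < length xs \<Longrightarrow> ent a j i \<in> hm (xs ! i) (ys ! j)"
  by (auto simp: HM_def)

lemma HM_ent_0: "a \<in> HM xs ys \<Longrightarrow> \<not> (j < length ys \<and> i < length xs) \<Longrightarrow> ent a j i = 0"
  by (auto simp: HM_def)

lemma HM_ent_times: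
  assumes "a \<in> HM xs ys"
  shows "ent (b * a) k i = (\<Sum>j<length ys. ent b k j * ent a j i)"
  by (rule ent_times) (use HM_ent_0[OF assms] in auto)

lemma HM_mult [intro]:
  assumes "b \<in> HM ys zs" "a \<in> HM xs ys" shows "b * a \<in> HM xs zs"
  unfolding HM_def
proof (clarify)
  fix k i
  show "if k < length zs \<and> i < length xs then ent (b * a) k i \<in> hm (xs ! i) (zs ! k) else ent (b * a) k i = 0"
  proof (cases "k < length zs \<and> i < length xs")
    case True
    have "(\<Sum>j<length ys. ent b k j * ent a j i) \<in> hm (xs ! i) (zs ! k)"
      by (intro hm_sum hm_mult) (use True HM_ent[OF assms(1)] HM_ent[OF assms(2)] in auto)
    then show ?thesis using True by (simp add: HM_ent_times[OF assms(2)])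
  next
    case False
    have "ent b k j * ent a j i = 0" for j
      using False HM_ent_0[OF assms(1), of k j] HM_ent_0[OF assms(2), of j i] by auto
    then show ?thesis using False by (simp add: HM_ent_times[OF assms(2)])
  qed
qed

lemma mat_HM:
  "(\<And>j i. j < length ys \<Longrightarrow> i < length xs \<Longrightarrow> f j i \<in> hm (xs ! i) (ys ! j)) \<Longrightarrow> mat (length xs) (length ys) f \<in> HM xs ys"
  by (simp add: HM_def)

lemma sm_HM [simp]: "sm x \<in> HM [n] [m] \<longleftrightarrow> x \<in> hm n m"
  by (auto simp: HM_def)

lemma HM_single:
  assumes "a \<in> HM [n] [m]" obtains x where "x \<in> hm n m" "a = sm x"
proof
  show "ent a 0 0 \<in> hm n m" using HM_ent[OF assms, of 0 0] by simp
  show "a = sm (ent a 0 0)"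
    by (rule fmat_eqI) (use HM_ent_0[OF assms] in auto)
qed

lift_definition smat :: "'f::field_char_0 \<Rightarrow> 'f pal fmat \<Rightarrow> 'f pal fmat" is "\<lambda>c f j i. scl c (f j i)"
proof -
  fix c and f :: "nat \<Rightarrow> nat \<Rightarrow> 'f pal"
  assume "\<exists>N. \<forall>j i. N \<le> j \<or> N \<le> i \<longrightarrow> f j i = 0"
  then show "\<exists>N. \<forall>j i. N \<le> j \<or> N \<le> i \<longrightarrow> scl c (f j i) = 0" by auto
qed

lemma ent_smat [simp]: "ent (smat c a) j i = scl c (ent a j i)" by transfer simp

lemma sm_scl: "sm (scl c x) = smat c (sm x)" by (rule fmat_eqI) simp

text \<open>Passes from padding by zeros to the padding by \<open>undefined\<close> used in
  \<open>mat_of\<close>.\<close>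

definition enc :: "nat list \<Rightarrow> nat list \<Rightarrow> 'f::field_char_0 pal fmat \<Rightarrow> 'f rep_mor" where
  "enc xs ys a = mat_of xs ys (\<lambda>j i. coef (ent a j i))"

lemma enc_inj:
  assumes "a \<in> HM xs ys" "b \<in> HM xs ys" "enc xs ys a = enc xs ys b" shows "a = b"
proof (rule fmat_eqI)
  fix j i
  show "ent a j i = ent b j i"
  proof (cases "j < length ys \<and> i < length xs")
    case True
    from assms(3) have "enc xs ys a j i = enc xs ys b j i" by simp
    then show ?thesis using True by (simp add: enc_def mat_of_def coef_inject)
  next
    case False
    then show ?thesis using HM_ent_0[OF assms(1)] HM_ent_0[OF assms(2)] by simp
  qed
qed

lemma Hom_rep0: "Hom (rep0 t) n m = coef ` hm n m"
proof
  show "coef ` hm n m \<subseteq> Hom (rep0 t) n m" by (auto simp: rep0_def hm_def)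
  show "Hom (rep0 t) n m \<subseteq> coef ` hm n m"
  proof
    fix f assume "f \<in> Hom (rep0 t) n m"
    then have f: "f \<pi> \<noteq> 0 \<Longrightarrow> \<pi> \<in> diagrams n m" for \<pi> by (auto simp: rep0_def)
    have "finite {\<pi>. f \<pi> \<noteq> 0}" by (rule finite_subset[OF _ finite_diagrams[of n m]]) (use f in auto)
    then have c: "coef (Pal f) = f" by (subst Pal_inverse) (auto intro: valid_diagrams[OF f])
    have "Pal f \<in> hm n m" by (simp add: hm_def c f)
    then show "f \<in> coef ` hm n m" by (rule rev_image_eqI) (simp add: c)
  qed
qed

text \<open>The scalar \<open>0 ^ loops \<mu> \<pi>\<close> is 1 or 0 according to whether
  \<open>pcomp \<mu> \<pi>\<close> is defined.\<close>

lemma Comp_rep0: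
  assumes "b \<in> hm m l" "a \<in> hm n m"
  shows "Comp (rep0 0) n m l (coef b) (coef a) = coef (b * a)"
proof
  fix \<rho>
  have "coef (b * a) \<rho> = (\<Sum>\<mu>\<in>diagrams m l. \<Sum>\<pi>\<in>diagrams n m. if pcomp \<mu> \<pi> = Some \<rho> then coef b \<mu> * coef a \<pi> else 0)"
    by (rule coef_times) (use assms in \<open>auto simp: hm_def\<close>)
  also have "\<dots> = (\<Sum>\<mu>\<in>diagrams m l. \<Sum>\<pi>\<in>diagrams n m. if diagram_comp \<mu> \<pi> = \<rho> then coef b \<mu> * coef a \<pi> * 0 ^ loops \<mu> \<pi> else 0)"
    by (intro sum.cong refl) (auto simp: pcomp_eq)
  finally show "Comp (rep0 0) n m l (coef b) (coef a) \<rho> = coef (b * a) \<rho>" by (simp add: rep0_def)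
qed

lemma Idn_rep0: "Idn (rep0 t) n = coef (ident n)"
  by (auto simp: rep0_def ident_def fn_def coef_bs id_diagram_eq valid_diagrams[OF fnd_in] fun_eq_iff)

lemma Zer_rep0: "Zer (rep0 t) n m = coef 0" and Pls_rep0: "Pls (rep0 t) n m (coef a) (coef b) = coef (a + b)"
  and Scal_rep0: "Scal (rep0 t) n m c (coef a) = coef (scl c a)"
  by (auto simp: rep0_def fun_eq_iff)

abbreviation AE :: "('f::field_char_0, nat list, 'f rep_mor) lincat" where "AE \<equiv> additive_env (rep0 0)"

lemma mat_of_eqI:
  "(\<And>j i. j < length ys \<Longrightarrow> i < length xs \<Longrightarrow> a j i = b j i) \<Longrightarrow> mat_of xs ys a = mat_of xs ys b"
  by (auto simp: mat_of_def fun_eq_iff)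

lemma enc_ent: "j < length ys \<Longrightarrow> i < length xs \<Longrightarrow> enc xs ys a j i = coef (ent a j i)"
  by (simp add: enc_def mat_of_def)

lemma Hom_AE: "Hom AE xs ys = enc xs ys ` (HM xs ys :: 'f::field_char_0 pal fmat set)"
proof
  show "enc xs ys ` (HM xs ys :: 'f pal fmat set) \<subseteq> Hom AE xs ys"
  proof (rule image_subsetI)
    fix a :: "'f pal fmat" assume a: "a \<in> HM xs ys"
    have "\<forall>j<length ys. \<forall>i<length xs. coef (ent a j i) \<in> Hom (rep0 0) (xs ! i) (ys ! j)"
      unfolding Hom_rep0 using HM_ent[OF a] by blast
    then show "enc xs ys a \<in> Hom AE xs ys" unfolding additive_env_def enc_def by auto
  qed
  show "Hom AE xs ys \<subseteq> enc xs ys ` (HM xs ys :: 'f pal fmat set)"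
  proof
    fix f :: "'f rep_mor" assume "f \<in> Hom AE xs ys"
    then obtain a where f: "f = mat_of xs ys a" and
      a: "\<And>j i. j < length ys \<Longrightarrow> i < length xs \<Longrightarrow> a j i \<in> Hom (rep0 0) (xs ! i) (ys ! j)"
      by (auto simp: additive_env_def)
    have "\<exists>b\<in>hm (xs ! i) (ys ! j). a j i = coef b" if "j < length ys" "i < length xs" for j i
      using a[OF that] unfolding Hom_rep0 by blast
    then obtain b where b: "\<And>j i. j < length ys \<Longrightarrow> i < length xs \<Longrightarrow> b j i \<in> hm (xs ! i) (ys ! j) \<and> a j i = coef (b j i)"
      by metis
    have "mat (length xs) (length ys) b \<in> HM xs ys" by (rule mat_HM) (use b in blast)
    moreover have "f = enc xs ys (mat (length xs) (length ys) b)"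
      unfolding f enc_def by (rule mat_of_eqI) (use b in simp)
    ultimately show "f \<in> enc xs ys ` HM xs ys" by blast
  qed
qed

lemma foldr_Pls:
  "foldr (\<lambda>j. Pls (rep0 t) n m (coef (f j))) js (Zer (rep0 t) n m) = coef (sum_list (map f js))"
  by (induction js) (simp_all add: Zer_rep0 Pls_rep0)

lemma foldr_cong_on: "(\<And>j. j \<in> set js \<Longrightarrow> f j = g j) \<Longrightarrow> foldr f js z = foldr g js z"
  by (induction js) auto

lemma Comp_AE:
  assumes b: "b \<in> HM ys zs" and a: "a \<in> HM xs ys"
  shows "Comp AE xs ys zs (enc ys zs b) (enc xs ys a) = enc xs zs (b * a)"
proof -
  have "Comp AE xs ys zs (enc ys zs b) (enc xs ys a) = mat_of xs zs (\<lambda>k i.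
     foldr (\<lambda>j. Pls (rep0 0) (xs ! i) (zs ! k) (Comp (rep0 0) (xs ! i) (ys ! j) (zs ! k) (enc ys zs b k j) (enc xs ys a j i)))
                [0..<length ys] (Zer (rep0 0) (xs ! i) (zs ! k)))"
    by (simp add: additive_env_def)
  also have "\<dots> = enc xs zs (b * a)"
    unfolding enc_def[of xs zs]
  proof (rule mat_of_eqI)
    fix k i assume ki: "k < length zs" "i < length xs"
    have "foldr (\<lambda>j. Pls (rep0 0) (xs ! i) (zs ! k) (Comp (rep0 0) (xs ! i) (ys ! j) (zs ! k) (enc ys zs b k j) (enc xs ys a j i)))
                [0..<length ys] (Zer (rep0 0) (xs ! i) (zs ! k)) =
        foldr (\<lambda>j. Pls (rep0 0) (xs ! i) (zs ! k) (coef (ent b k j * ent a j i))) [0..<length ys] (Zer (rep0 0) (xs ! i) (zs ! k))"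
      by (rule foldr_cong_on) (use ki in \<open>simp add: enc_ent Comp_rep0[OF HM_ent[OF b] HM_ent[OF a]]\<close>)
    also have "\<dots> = coef (\<Sum>j<length ys. ent b k j * ent a j i)"
      unfolding foldr_Pls by (simp add: interv_sum_list_conv_sum_set_nat atLeast0LessThan)
    finally show "foldr (\<lambda>j. Pls (rep0 0) (xs ! i) (zs ! k) (Comp (rep0 0) (xs ! i) (ys ! j) (zs ! k) (enc ys zs b k j) (enc xs ys a j i)))
                [0..<length ys] (Zer (rep0 0) (xs ! i) (zs ! k)) = coef (ent (b * a) k i)"
      by (simp add: HM_ent_times[OF a])
  qed
  finally show ?thesis .
qed

lemma Zer_AE: "Zer AE xs ys = enc xs ys 0"
  by (auto simp: additive_env_def enc_def Zer_rep0 intro!: mat_of_eqI)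

lemma Pls_AE: "Pls AE xs ys (enc xs ys a) (enc xs ys b) = enc xs ys (a + b)"
  by (auto simp: additive_env_def enc_def[of xs ys "a + b"] enc_ent Pls_rep0 intro!: mat_of_eqI)

lemma Scal_AE: "Scal AE xs ys c (enc xs ys a) = enc xs ys (smat c a)"
  by (auto simp: additive_env_def enc_def[of xs ys "smat c a"] enc_ent Scal_rep0 intro!: mat_of_eqI)

abbreviation K :: "('f::field_char_0, 'f rep_obj, 'f rep_mor) lincat" where "K \<equiv> rep_S 0"

definition ob :: "nat list \<Rightarrow> 'f::field_char_0 pal fmat \<Rightarrow> 'f rep_obj" where
  "ob xs e = (xs, enc xs xs e)"

definition idem :: "nat list \<Rightarrow> 'f::field_char_0 pal fmat \<Rightarrow> bool" where
  "idem xs e \<longleftrightarrow> e \<in> HM xs xs \<and> e * e = e"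

text \<open>For idempotents this is \<open>f * HM xs ys * e\<close>; in the fixed-point form,
  membership of sums and composites follows by rewriting.\<close>

definition hs :: "nat list \<Rightarrow> 'f::field_char_0 pal fmat \<Rightarrow> nat list \<Rightarrow> 'f pal fmat \<Rightarrow> 'f pal fmat set" where
  "hs xs e ys f = {a \<in> HM xs ys. f * a = a \<and> a * e = a}"

lemma Obj_K: "Obj K = {ob xs e |xs e. idem xs (e :: 'f::field_char_0 pal fmat)}"
proof -
  have "X \<in> Obj K \<longleftrightarrow> (\<exists>xs e. X = ob xs e \<and> idem xs e)" for X :: "'f rep_obj"
  proof
    assume "X \<in> Obj K"
    then obtain xs E where X: "X = (xs, E)" and E: "E \<in> Hom AE xs xs" "Comp AE xs xs xs E E = E"
      by (auto simp: rep_S_def karoubi_def)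
    then obtain e where e: "e \<in> HM xs xs" "E = enc xs xs e" unfolding Hom_AE by blast
    have "e * e = e" using E(2) unfolding e(2) Comp_AE[OF e(1) e(1)] by (intro enc_inj[of _ xs xs]) (use e in auto)
    with e X show "\<exists>xs e. X = ob xs e \<and> idem xs e" by (auto simp: ob_def idem_def)
  next
    assume "\<exists>xs e. X = ob xs e \<and> idem xs e"
    then obtain xs e where X: "X = ob xs e" "e \<in> HM xs xs" "e * e = e" by (auto simp: idem_def)
    have "xs \<in> Obj AE" by (simp add: additive_env_def rep0_def)
    then show "X \<in> Obj K" using X Comp_AE[OF X(2,2)] by (auto simp: rep_S_def karoubi_def ob_def Hom_AE)
  qed
  then show ?thesis by blast
qed

lemma ob_Obj [simp]: "idem xs e \<Longrightarrow> ob xs e \<in> Obj K"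
  unfolding Obj_K by blast

lemma Hom_K:
  fixes e f :: "'f::field_char_0 pal fmat"
  assumes "idem xs e" "idem ys f"
  shows "Hom K (ob xs e) (ob ys f) = enc xs ys ` hs xs e ys f"
proof -
  have e: "e \<in> HM xs xs" "e * e = e" and f: "f \<in> HM ys ys" "f * f = f" using assms by (auto simp: idem_def)
  have "Hom K (ob xs e) (ob ys f) = {enc xs ys (f * (h * e)) |h. h \<in> HM xs ys}"
    using Comp_AE[OF _ e(1)] Comp_AE[OF f(1)] HM_mult[OF _ e(1)]
    by (auto simp: rep_S_def karoubi_def ob_def Hom_AE) (metis imageI)+
  also have "\<dots> = enc xs ys ` hs xs e ys f"
  proof
    show "{enc xs ys (f * (h * e)) |h. h \<in> HM xs ys} \<subseteq> enc xs ys ` hs xs e ys f"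
    proof clarify
      fix h :: "'f pal fmat" assume h: "h \<in> HM xs ys"
      have "f * (h * e) \<in> HM xs ys" using h e f by blast
      moreover have "f * (f * (h * e)) = f * (h * e)" using f by (simp flip: mult.assoc)
      moreover have "f * (h * e) * e = f * (h * e)" using e by (simp add: mult.assoc)
      ultimately show "enc xs ys (f * (h * e)) \<in> enc xs ys ` hs xs e ys f" by (simp add: hs_def)
    qed
    show "enc xs ys ` hs xs e ys f \<subseteq> {enc xs ys (f * (h * e)) |h. h \<in> HM xs ys}"
      by (auto simp: hs_def) metis
  qed
  finally show ?thesis .
qed

lemma Comp_K: "Comp K (ob xs e) (ob ys f) (ob zs g) = Comp AE xs ys zs"
  and Idn_K: "Idn K (ob xs e) = enc xs xs e"
  and Zer_K: "Zer K (ob xs e) (ob ys f) = enc xs ys 0"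
  and Pls_K: "Pls K (ob xs e) (ob ys f) = Pls AE xs ys"
  and Scal_K: "Scal K (ob xs e) (ob ys f) = Scal AE xs ys"
  by (simp_all add: rep_S_def karoubi_def ob_def Zer_AE)

lemma hs_HM: "a \<in> hs xs e ys f \<Longrightarrow> a \<in> HM xs ys" by (simp add: hs_def)

lemma hs_mult: "b \<in> hs ys f zs g \<Longrightarrow> a \<in> hs xs e ys f \<Longrightarrow> b * a \<in> hs xs e zs g"
  unfolding hs_def by (auto simp: mult.assoc) (simp flip: mult.assoc)

lemma idem_hs: "idem xs e \<Longrightarrow> e \<in> hs xs e xs e" by (simp add: idem_def hs_def)

lemma isomorphic_K:
  assumes "idem xs e" "idem ys f"
  shows "isomorphic K (ob xs e) (ob ys f) \<longleftrightarrow>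
    (\<exists>a\<in>hs xs e ys f. \<exists>b\<in>hs ys f xs e. b * a = e \<and> a * b = f)"
proof -
  have e: "e \<in> HM xs xs" and f: "f \<in> HM ys ys" using assms by (auto simp: idem_def)
  have "Comp AE xs ys xs (enc ys xs b) (enc xs ys a) = enc xs xs e \<longleftrightarrow> b * a = e"
    "Comp AE ys xs ys (enc xs ys a) (enc ys xs b) = enc ys ys f \<longleftrightarrow> a * b = f"
    if "a \<in> hs xs e ys f" "b \<in> hs ys f xs e" for a b
    using that[THEN hs_HM] e f enc_inj HM_mult Comp_AE by metis+
  then show ?thesis
    unfolding isomorphic_def Hom_K[OF assms] Hom_K[OF assms(2,1)] Comp_K Idn_K by blast
qed

lemma isomorphic_ob_sym:
  assumes "idem xs e" "idem ys f" "isomorphic K (ob xs e) (ob ys f)"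
  shows "isomorphic K (ob ys f) (ob xs e)"
  using assms(3) unfolding isomorphic_K[OF assms(1,2)] isomorphic_K[OF assms(2,1)] by blast

lemma isomorphic_ob_trans:
  assumes "idem xs e" "idem ys f" "idem zs g" "isomorphic K (ob xs e) (ob ys f)" "isomorphic K (ob ys f) (ob zs g)"
  shows "isomorphic K (ob xs e) (ob zs g)"
proof -
  obtain a b where ab: "a \<in> hs xs e ys f" "b \<in> hs ys f xs e" "b * a = e" "a * b = f"
    using assms(4) unfolding isomorphic_K[OF assms(1,2)] by blast
  obtain c d where cd: "c \<in> hs ys f zs g" "d \<in> hs zs g ys f" "d * c = f" "c * d = g"
    using assms(5) unfolding isomorphic_K[OF assms(2,3)] by blast
  have "b * d * (c * a) = b * (d * c) * a" "c * a * (b * d) = c * (a * b) * d" by (simp_all only: mult.assoc)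
  then have "b * d * (c * a) = e" "c * a * (b * d) = g"
    using ab cd by (simp_all add: hs_def mult.assoc)
  then show ?thesis unfolding isomorphic_K[OF assms(1,3)]
    using hs_mult[OF cd(1) ab(1)] hs_mult[OF ab(2) cd(2)] by blast
qed

lemma isomorphic_ob_refl: "idem xs e \<Longrightarrow> isomorphic K (ob xs e) (ob xs e)"
  using idem_hs[of xs e] by (auto simp: isomorphic_K idem_def)

lemma zero_object_K: "idem xs e \<Longrightarrow> zero_object K (ob xs e) \<longleftrightarrow> e = 0"
  unfolding zero_object_def Idn_K Zer_K using enc_inj[of e xs xs 0] by (auto simp: idem_def)

lemma is_direct_sum_K:
  fixes e f g :: "'f::field_char_0 pal fmat"
  assumes "idem zs g" "idem xs e" "idem ys f"
  shows "is_direct_sum K (ob zs g) (ob xs e) (ob ys f) \<longleftrightarrow>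
    (\<exists>i\<in>hs xs e zs g. \<exists>j\<in>hs ys f zs g. \<exists>p\<in>hs zs g xs e. \<exists>q\<in>hs zs g ys f.
      p * i = e \<and> q * j = f \<and> p * j = 0 \<and> q * i = 0 \<and> i * p + j * q = g)"
proof -
  have e: "e \<in> HM xs xs" and f: "f \<in> HM ys ys" and g: "g \<in> HM zs zs" using assms by (auto simp: idem_def)
  have C: "Comp AE us vs ws (enc vs ws b) (enc us vs a) = enc us ws c \<longleftrightarrow> b * a = c"
    if "b \<in> HM vs ws" "a \<in> HM us vs" "c \<in> HM us ws" for us vs ws and a b c :: "'f pal fmat"
    using that enc_inj[OF HM_mult[OF that(1,2)] that(3)] Comp_AE[OF that(1,2)] by metis
  have "Pls AE zs zs (Comp AE zs xs zs (enc xs zs i) (enc zs xs p)) (Comp AE zs ys zs (enc ys zs j) (enc zs ys q)) = enc zs zs g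
     \<longleftrightarrow> i * p + j * q = g"
    if "i \<in> HM xs zs" "p \<in> HM zs xs" "j \<in> HM ys zs" "q \<in> HM zs ys" for i j p q :: "'f pal fmat"
    unfolding Comp_AE[OF that(1,2)] Comp_AE[OF that(3,4)] Pls_AE
    using enc_inj[OF HM_add[OF HM_mult[OF that(1,2)] HM_mult[OF that(3,4)]] g] by blast
  then have "(Comp AE xs zs xs (enc zs xs p) (enc xs zs i) = enc xs xs e \<and> Comp AE ys zs ys (enc zs ys q) (enc ys zs j) = enc ys ys f \<and>
        Comp AE ys zs xs (enc zs xs p) (enc ys zs j) = enc ys xs 0 \<and> Comp AE xs zs ys (enc zs ys q) (enc xs zs i) = enc xs ys 0 \<and>
        Pls AE zs zs (Comp AE zs xs zs (enc xs zs i) (enc zs xs p)) (Comp AE zs ys zs (enc ys zs j) (enc zs ys q)) = enc zs zs g) \<longleftrightarrow>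
      (p * i = e \<and> q * j = f \<and> p * j = 0 \<and> q * i = 0 \<and> i * p + j * q = g)"
    if "i \<in> hs xs e zs g" "p \<in> hs zs g xs e" "j \<in> hs ys f zs g" "q \<in> hs zs g ys f" for i j p q
    using that[THEN hs_HM] e f by (simp add: C)
  then show ?thesis
    unfolding is_direct_sum_def Hom_K[OF assms(1,2)] Hom_K[OF assms(1,3)] Hom_K[OF assms(2,1)] Hom_K[OF assms(3,1)]
      Comp_K Idn_K Zer_K Pls_K by (simp only: bex_simps image_iff Bex_def[symmetric]) (auto; blast)
qed

subsection \<open>The block of the exterior powers\<close>

abbreviation La :: "nat \<Rightarrow> 'f::field_char_0 pal fmat" where "La n \<equiv> sm (alt n)"
abbreviation Lam :: "nat \<Rightarrow> 'f::field_char_0 rep_obj" where "Lam n \<equiv> ob [n] (La n)"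

lemma idem_La [simp]: "idem [n] (La n)"
  by (simp add: idem_def sm_mult)

lemma alt_neq_0 [simp]: "alt n \<noteq> (0 :: 'f::field_char_0 pal)"
proof (cases n)
  case 0
  have "coef (alt 0 :: 'f pal) (fnd 0 0 id) = 1"
    by (simp add: alt_0 ident_def fn_def coef_bs valid_diagrams[OF fnd_in])
  then show ?thesis using 0 by auto
next
  case (Suc k)
  show ?thesis
  proof
    assume a: "alt n = (0 :: 'f pal)"
    have "xi n = alt n * (xi n :: 'f pal)" by simp
    also have "\<dots> = 0" unfolding a by simp
    finally show False using Suc xi_Suc_neq_0[of k, where 'f='f] by simp
  qed
qed

text \<open>Multiplying by \<open>xi n\<close> kills the second summand, as \<open>xi n\<close>
  squares to zero, and turns the first one into \<open>scl c (xi n)\<close>.\<close>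

lemma alt_xi_independent:
  assumes "scl c (alt n) + scl d (xi n) = (0 :: 'f::field_char_0 pal)"
  shows "c = 0" "scl d (xi n) = 0"
proof -
  show c: "c = 0"
  proof (cases n)
    case 0
    then show ?thesis using assms by (simp add: xi_def)
  next
    case (Suc k)
    have "(scl c (alt n) + scl d (xi n)) * xi n = (0 :: 'f pal)" using assms by simp
    then have "scl c (xi n) = (0 :: 'f pal)" by (simp add: distrib_right scl_mult_left)
    then show ?thesis using Suc xi_Suc_neq_0[of k, where 'f='f] by simp
  qed
  show "scl d (xi n) = 0" using assms c by simp
qed

lemma hs_La:
  assumes "a \<in> hs [n] (La n) [m] (La m)"
  obtains x where "a = sm x" "x \<in> hom_span n m" "x \<in> hm n m" "alt m * x = x" "x * alt n = x"
proof -
  from assms have a: "a \<in> HM [n] [m]" "La m * a = a" "a * La n = a" by (auto simp: hs_def)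
  from HM_single[OF a(1)] obtain x where x: "x \<in> hm n m" "a = sm x" by blast
  have "alt m * x = x" "x * alt n = x" using a(2,3) unfolding x(2) sm_mult by simp_all
  moreover have "alt m * x * alt n \<in> hom_span n m" by (rule alt_mult_alt_in_span[OF x(1)])
  ultimately show thesis using that x by metis
qed

text \<open>\<open>\<psi> * \<phi>\<close> is an idempotent that splits off a copy of
  \<open>Lam i\<close>; the complement \<open>e - \<psi> * \<phi>\<close> vanishes by
  indecomposability.\<close>

lemma summand_iso:
  fixes e :: "'f::field_char_0 pal fmat"
  assumes e: "idem xs e" and ind: "indecomposable K (ob xs e)"
    and \<phi>: "\<phi> \<in> hs xs e [i] (La i)" and \<psi>: "\<psi> \<in> hs [i] (La i) xs e" and one: "\<phi> * \<psi> = La i"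
  shows "isomorphic K (ob xs e) (Lam i)"
proof -
  let ?p = "\<psi> * \<phi>"
  have p: "?p \<in> HM xs xs" "e * ?p = ?p" "?p * e = ?p" using hs_mult[OF \<psi> \<phi>] by (auto simp: hs_def)
  have \<phi>': "\<phi> * e = \<phi>" "La i * \<phi> = \<phi>" "\<phi> \<in> HM xs [i]" and \<psi>': "e * \<psi> = \<psi>" "\<psi> * La i = \<psi>" "\<psi> \<in> HM [i] xs"
    using \<phi> \<psi> by (auto simp: hs_def)
  have \<phi>\<psi>\<phi>: "\<phi> * ?p = \<phi>" by (simp add: one \<phi>' flip: mult.assoc)
  have \<psi>\<phi>\<psi>: "?p * \<psi> = \<psi>" by (simp add: one \<psi>' mult.assoc)
  have pp: "?p * ?p = ?p" by (simp add: mult.assoc \<phi>\<psi>\<phi>)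
  have ee: "e * e = e" "e \<in> HM xs xs" using e by (auto simp: idem_def)
  let ?q = "e - ?p"
  have q: "idem xs ?q" using p ee pp by (simp add: idem_def left_diff_distrib right_diff_distrib)
  have qq: "?q * ?q = ?q" "e * ?q = ?q" "?q * e = ?q" "?q \<in> HM xs xs"
    using q p ee by (simp_all add: idem_def left_diff_distrib right_diff_distrib)
  have "is_direct_sum K (ob xs e) (Lam i) (ob xs ?q)"
    unfolding is_direct_sum_K[OF e idem_La q]
  proof (rule bexI[OF _ \<psi>], rule bexI[of _ ?q], rule bexI[OF _ \<phi>], rule bexI[of _ ?q], intro conjI)
    show "\<phi> * ?q = 0" by (simp add: right_diff_distrib \<phi>' \<phi>\<psi>\<phi>)
    show "?q * \<psi> = 0" by (simp add: left_diff_distrib \<psi>' \<psi>\<phi>\<psi>)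
  qed (use one qq in \<open>simp_all add: hs_def\<close>)
  then have "zero_object K (Lam i :: 'f rep_obj) \<or> zero_object K (ob xs ?q)"
    using ind ob_Obj[OF idem_La] ob_Obj[OF q] unfolding indecomposable_def by blast
  then have "e = ?p" by (simp add: zero_object_K q)
  then show ?thesis unfolding isomorphic_K[OF e idem_La] using \<phi> \<psi> one by metis
qed

text \<open>Every \<open>\<psi>\<close> into one summand extends by zero to all of
  \<open>xs\<close>. If its composite with \<open>\<phi>\<close> had a nonzero coefficient at
  \<open>alt i\<close>, the composite would be invertible and \<open>Lam i\<close> would split
  off.\<close>

lemma hs_to_La_left_ker:
  fixes e :: "'f::field_char_0 pal fmat"
  assumes e: "idem xs e" and ind: "indecomposable K (ob xs e)"
    and niso: "\<And>j. \<not> isomorphic K (ob xs e) (Lam j)"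
    and \<phi>: "\<phi> \<in> hs xs e [i] (La i)" and j: "j < length xs"
  shows "ent \<phi> 0 j \<in> left_ker (xs ! j) i"
proof -
  let ?\<phi>j = "ent \<phi> 0 j"
  have \<phi>': "\<phi> \<in> HM xs [i]" "La i * \<phi> = \<phi>" "\<phi> * e = \<phi>" using \<phi> by (auto simp: hs_def)
  have e': "e \<in> HM xs xs" "e * e = e" using e by (auto simp: idem_def)
  have hmj: "?\<phi>j \<in> hm (xs ! j) i" using HM_ent[OF \<phi>'(1), of 0 j] j by simp
  have altj: "alt i * ?\<phi>j = ?\<phi>j"
  proof -
    have "ent (La i * \<phi>) 0 j = alt i * ?\<phi>j" by (simp add: HM_ent_times[OF \<phi>'(1)])
    then show ?thesis by (simp add: \<phi>'(2))
  qed
  have "\<exists>d. ?\<phi>j * \<psi> * alt i = scl d (xi i)" if \<psi>: "\<psi> \<in> hm i (xs ! j)" for \<psi>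
  proof -
    let ?\<Psi> = "mat 1 (length xs) (\<lambda>k _. if k = j then \<psi> else 0)"
    have \<Psi>: "?\<Psi> \<in> HM [i] xs" using mat_HM[of xs "[i]" "\<lambda>k _. if k = j then \<psi> else 0"] \<psi> by (auto simp: One_nat_def)
    let ?\<psi>' = "e * ?\<Psi> * La i"
    have \<psi>': "?\<psi>' \<in> hs [i] (La i) xs e"
      using HM_mult[OF HM_mult[OF e'(1) \<Psi>], of "La i" "[i]"] e'(2)
      by (simp add: hs_def mult.assoc sm_mult) (simp flip: mult.assoc)
    have "\<phi> * ?\<Psi> = sm (?\<phi>j * \<psi>)"
    proof (rule fmat_eqI)
      fix a b
      have "ent (\<phi> * ?\<Psi>) a b = (\<Sum>k<length xs. if k = j then (if b = 0 then ent \<phi> a j * \<psi> else 0) else 0)"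
        unfolding HM_ent_times[OF \<Psi>] by (intro sum.cong refl) auto
      also have "\<dots> = (if b = 0 then ent \<phi> a j * \<psi> else 0)" using j by (simp add: sum.delta)
      also have "\<dots> = ent (sm (?\<phi>j * \<psi>)) a b" using HM_ent_0[OF \<phi>'(1), of a j] by auto
      finally show "ent (\<phi> * ?\<Psi>) a b = ent (sm (?\<phi>j * \<psi>)) a b" .
    qed
    then have comp: "\<phi> * ?\<psi>' = sm (?\<phi>j * \<psi> * alt i)"
      using \<phi>'(3) by (simp add: sm_mult flip: mult.assoc)
    have "alt i * (?\<phi>j * \<psi>) * alt i \<in> hom_span i i" by (rule alt_mult_alt_in_span[OF hm_mult[OF hmj \<psi>]])
    then have "?\<phi>j * \<psi> * alt i \<in> hom_span i i" using altj by (simp flip: mult.assoc)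
    then obtain c d where cd: "?\<phi>j * \<psi> * alt i = scl c (alt i) + scl d (xi i)" by (auto simp: hom_span_def)
    have "c = 0"
    proof (rule ccontr)
      assume c: "c \<noteq> 0"
      \<comment> \<open>The inverse of \<open>c + d * xi\<close>, as
        \<open>xi * xi = 0\<close>.\<close>
      let ?v = "scl (1 / c) (alt i) - scl (d / (c * c)) (xi i) :: 'f pal"
      have "(scl c (alt i) + scl d (xi i)) * ?v = alt i"
        using c by (simp add: distrib_right right_diff_distrib scl_mult_left scl_mult_right pal.scale_right_distrib)
      then have "\<phi> * (?\<psi>' * sm ?v) = La i"
        using comp cd by (simp add: sm_mult flip: mult.assoc)
      moreover have "sm ?v \<in> hs [i] (La i) [i] (La i)"
        by (simp add: hs_def sm_mult distrib_right distrib_left right_diff_distrib left_diff_distrib scl_mult_left scl_mult_right)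
      ultimately have "isomorphic K (ob xs e) (Lam i)"
        by (intro summand_iso[OF e ind \<phi> hs_mult[OF \<psi>']])
      with niso show False by blast
    qed
    with cd show ?thesis by auto
  qed
  then show ?thesis unfolding left_ker_def using hmj altj by blast
qed

text \<open>The factorizations of the entries are assembled into row matrices and then cut down by
  \<open>e\<close> and the antisymmetrizers. The two cofactors are thereby morphisms from the same
  object, so that they can be factored again.\<close>

lemma hs_to_La_rad:
  fixes e :: "'f::field_char_0 pal fmat"
  assumes e: "idem xs e" and ind: "indecomposable K (ob xs e)"
    and niso: "\<And>j. \<not> isomorphic K (ob xs e) (Lam j)"
    and \<phi>: "\<phi> \<in> hs xs e [i] (La i)"
  shows "\<exists>A\<in>hs xs e [i - 1] (La (i - 1)). \<exists>B\<in>hs xs e [Suc i] (La (Suc i)).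
    \<phi> = (if i = 0 then 0 else sm (al (i - 1)) * A) + sm (be i) * B"
proof -
  have \<phi>': "\<phi> \<in> HM xs [i]" "\<phi> * e = \<phi>" using \<phi> by (auto simp: hs_def)
  have e': "e \<in> HM xs xs" "e * e = e" using e by (auto simp: idem_def)
  have "\<forall>j\<in>{..<length xs}. \<exists>a b. a \<in> hm (xs ! j) (i - 1) \<and> b \<in> hm (xs ! j) (Suc i) \<and>
      ent \<phi> 0 j = (if i = 0 then 0 else al (i - 1) * a) + be i * b"
  proof
    fix j assume "j \<in> {..<length xs}"
    then have "ent \<phi> 0 j \<in> rad (xs ! j) i"
      using hs_to_La_left_ker[OF e ind niso \<phi>] left_ker_subset_rad by blast
    then show "\<exists>a b. a \<in> hm (xs ! j) (i - 1) \<and> b \<in> hm (xs ! j) (Suc i) \<and>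
        ent \<phi> 0 j = (if i = 0 then 0 else al (i - 1) * a) + be i * b"
      unfolding rad_def by blast
  qed
  then obtain a b where ab: "\<And>j. j < length xs \<Longrightarrow> a j \<in> hm (xs ! j) (i - 1) \<and> b j \<in> hm (xs ! j) (Suc i) \<and>
      ent \<phi> 0 j = (if i = 0 then 0 else al (i - 1) * a j) + be i * b j"
    unfolding bchoice_iff by auto
  let ?A = "mat (length xs) 1 (\<lambda>_ j. a j)" and ?B = "mat (length xs) 1 (\<lambda>_ j. b j)"
  have A: "?A \<in> HM xs [i - 1]" using mat_HM[of "[i - 1]" xs "\<lambda>_ j. a j"] ab by (simp add: One_nat_def)
  have B: "?B \<in> HM xs [Suc i]" using mat_HM[of "[Suc i]" xs "\<lambda>_ j. b j"] ab by (simp add: One_nat_def)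
  have "\<phi> = (if i = 0 then 0 else sm (al (i - 1)) * ?A) + sm (be i) * ?B"
  proof (rule fmat_eqI)
    fix k j
    show "ent \<phi> k j = ent ((if i = 0 then 0 else sm (al (i - 1)) * ?A) + sm (be i) * ?B) k j"
      using ab[of j] HM_ent_0[OF \<phi>'(1), of k j]
      by (cases "k = 0 \<and> j < length xs") (auto simp: HM_ent_times[OF A] HM_ent_times[OF B])
  qed
  then have "\<phi> * e = (if i = 0 then 0 else sm (al (i - 1)) * (La (i - 1) * ?A * e)) + sm (be i) * (La (Suc i) * ?B * e)"
    by (simp add: distrib_right mult.assoc sm_mult_assoc)
  moreover have "La (i - 1) * ?A * e \<in> hs xs e [i - 1] (La (i - 1))"
    using HM_mult[OF HM_mult[OF _ A] e'(1), of "La (i - 1)" "[i - 1]"] e'(2)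
    by (simp add: hs_def mult.assoc sm_mult_assoc)
  moreover have "La (Suc i) * ?B * e \<in> hs xs e [Suc i] (La (Suc i))"
    using HM_mult[OF HM_mult[OF _ B] e'(1), of "La (Suc i)" "[Suc i]"] e'(2)
    by (simp add: hs_def mult.assoc sm_mult_assoc)
  ultimately show ?thesis using \<phi>'(2) by metis
qed

text \<open>
  The previous lemma factors \<open>\<phi>\<close> through the radical of the algebra of the exterior powers; iterating it
  kills \<open>\<phi>\<close>, because the cube of that radical is zero.
\<close>

lemma no_hom_to_La:
  fixes e :: "'f::field_char_0 pal fmat"
  assumes e: "idem xs e" and ind: "indecomposable K (ob xs e)"
    and niso: "\<And>j. \<not> isomorphic K (ob xs e) (Lam j)"
    and \<phi>: "\<phi> \<in> hs xs e [i] (La i)"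
  shows "\<phi> = 0"
proof -
  note rad = hs_to_La_rad[OF e ind niso]
  have al_be_al: "al i * be i * al i = (0 :: 'f pal)" for i by (simp add: mult.assoc be_al scl_mult_right)
  \<comment> \<open>Because of \<open>al * al = 0\<close> only \<open>al * be * B\<close> remains;
    factoring \<open>B\<close> once more produces \<open>al * be * al = 0\<close> and
    \<open>be * be = 0\<close>.\<close>
  have N1: "sm (al i) * \<phi> = 0" if \<phi>: "\<phi> \<in> hs xs e [i] (La i)" for i and \<phi> :: "'f pal fmat"
  proof -
    obtain A B where AB: "A \<in> hs xs e [i - 1] (La (i - 1))" "B \<in> hs xs e [Suc i] (La (Suc i))"
      "\<phi> = (if i = 0 then 0 else sm (al (i - 1)) * A) + sm (be i) * B" using rad[OF \<phi>] by blast
    have "i = 0 \<or> al i * al (i - 1) = (0 :: 'f pal)" by (cases i) simp_all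
    then have 1: "sm (al i) * \<phi> = sm (al i * be i) * B"
      unfolding AB(3) by (auto simp: distrib_left sm_mult_assoc)
    obtain C D where "B = (if Suc i = 0 then 0 else sm (al (Suc i - 1)) * C) + sm (be (Suc i)) * D"
      using rad[OF AB(2)] by blast
    then show ?thesis unfolding 1 by (simp add: distrib_left sm_mult_assoc al_be_al mult.assoc[of "al i" "be i" "be (Suc i)"])
  qed
  have N2: "sm (be i) * \<phi> = 0" if \<phi>: "\<phi> \<in> hs xs e [Suc i] (La (Suc i))" for i and \<phi> :: "'f pal fmat"
  proof -
    obtain A B where AB: "A \<in> hs xs e [i] (La i)"
      "\<phi> = sm (al i) * A + sm (be (Suc i)) * B" using rad[OF \<phi>] by auto
    then show ?thesis using N1[OF AB(1)] by (simp add: distrib_left sm_mult_assoc)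
  qed
  obtain A B where AB: "A \<in> hs xs e [i - 1] (La (i - 1))" "B \<in> hs xs e [Suc i] (La (Suc i))"
    "\<phi> = (if i = 0 then 0 else sm (al (i - 1)) * A) + sm (be i) * B" using rad[OF \<phi>] by blast
  then show ?thesis using N1[OF AB(1)] N2[OF AB(2)] by simp
qed

section \<open>Duality by transposition of matrices\<close>

lift_definition trm :: "'f::field_char_0 pal fmat \<Rightarrow> 'f pal fmat" is "\<lambda>f j i. tr (f i j)"
proof -
  fix f :: "nat \<Rightarrow> nat \<Rightarrow> 'f pal"
  assume "\<exists>N. \<forall>j i. N \<le> j \<or> N \<le> i \<longrightarrow> f j i = 0"
  then obtain N where "\<forall>j i. N \<le> j \<or> N \<le> i \<longrightarrow> f j i = 0" by blast
  then show "\<exists>N. \<forall>j i. N \<le> j \<or> N \<le> i \<longrightarrow> tr (f i j) = 0" by (intro exI[of _ N]) auto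
qed

lemma ent_trm [simp]: "ent (trm a) j i = tr (ent a i j)" by transfer simp

lemma trm_trm [simp]: "trm (trm a) = a" by (rule fmat_eqI) simp
lemma trm_add: "trm (a + b) = trm a + trm b" by (rule fmat_eqI) simp
lemma trm_0 [simp]: "trm 0 = 0" by (rule fmat_eqI) simp
lemma trm_sm [simp]: "trm (sm x) = sm (tr x)" by (rule fmat_eqI) auto
lemma trm_eq_0 [simp]: "trm a = 0 \<longleftrightarrow> a = 0" by (metis trm_trm trm_0)

lemma trm_mult: "trm (b * a) = trm a * trm b"
proof (rule fmat_eqI)
  fix k i
  obtain N where N: "\<And>j i. N \<le> j \<or> N \<le> i \<Longrightarrow> ent a j i = 0" by (rule ent_bound[of a]) (rule that)
  show "ent (trm (b * a)) k i = ent (trm a * trm b) k i"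
    by (simp add: ent_times[where N=N] N tr_mult)
qed

lemma trm_HM [simp]: assumes "a \<in> HM xs ys" shows "trm a \<in> HM ys xs"
  unfolding HM_def mem_Collect_eq
proof (intro allI)
  fix j i
  show "if j < length xs \<and> i < length ys then ent (trm a) j i \<in> hm (ys ! i) (xs ! j) else ent (trm a) j i = 0"
    using HM_ent[OF assms, of i j] HM_ent_0[OF assms, of i j]
    by (cases "i < length ys"; cases "j < length xs") simp_all
qed

lemma trm_idem [simp]: "idem xs e \<Longrightarrow> idem xs (trm e)"
  by (simp add: idem_def flip: trm_mult)

lemma trm_hs: "a \<in> hs xs e ys f \<Longrightarrow> trm a \<in> hs ys (trm f) xs (trm e)"
  by (simp add: hs_def flip: trm_mult)

lemma isomorphic_trm:
  assumes "idem xs e" "idem ys f" "isomorphic K (ob xs e) (ob ys f)"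
  shows "isomorphic K (ob xs (trm e)) (ob ys (trm f))"
proof -
  obtain a b where ab: "a \<in> hs xs e ys f" "b \<in> hs ys f xs e" "b * a = e" "a * b = f"
    using assms(3) unfolding isomorphic_K[OF assms(1,2)] by blast
  then have "trm a * trm b = trm e" "trm b * trm a = trm f" by (simp_all flip: trm_mult)
  then show ?thesis unfolding isomorphic_K[OF trm_idem[OF assms(1)] trm_idem[OF assms(2)]]
    using trm_hs[OF ab(1)] trm_hs[OF ab(2)] by blast
qed

lemma indecomposable_K:
  assumes e: "idem xs e"
  shows "indecomposable K (ob xs e) \<longleftrightarrow> e \<noteq> 0 \<and>
    (\<forall>ys f zs g. idem ys f \<and> idem zs g \<and> is_direct_sum K (ob xs e) (ob ys f) (ob zs g) \<longrightarrow> f = 0 \<or> g = 0)"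
proof -
  have "(\<forall>X\<in>Obj K. \<forall>Y\<in>Obj K. is_direct_sum K (ob xs e) X Y \<longrightarrow> zero_object K X \<or> zero_object K Y) \<longleftrightarrow>
    (\<forall>ys f zs g. idem ys f \<and> idem zs g \<and> is_direct_sum K (ob xs e) (ob ys f) (ob zs g) \<longrightarrow> f = 0 \<or> g = 0)" (is "?l \<longleftrightarrow> ?r")
  proof
    assume l: ?l
    show ?r
    proof (intro allI impI, elim conjE)
      fix ys f zs g assume f: "idem ys f" and g: "idem zs g" and ds: "is_direct_sum K (ob xs e) (ob ys f) (ob zs g)"
      from l[rule_format, OF ob_Obj[OF f] ob_Obj[OF g] ds] show "f = 0 \<or> g = 0"
        unfolding zero_object_K[OF f] zero_object_K[OF g] .
    qed
  next
    assume r: ?r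
    show ?l
    proof (intro ballI impI)
      fix X Y assume "X \<in> Obj K" "Y \<in> Obj K" and ds: "is_direct_sum K (ob xs e) X Y"
      then obtain ys f zs g where X: "X = ob ys f" "idem ys f" and Y: "Y = ob zs g" "idem zs g" unfolding Obj_K by blast
      from r ds X Y have "f = 0 \<or> g = 0" by blast
      then show "zero_object K X \<or> zero_object K Y"
        unfolding X(1) Y(1) zero_object_K[OF X(2)] zero_object_K[OF Y(2)] .
    qed
  qed
  then show ?thesis unfolding indecomposable_def zero_object_K[OF e] using ob_Obj[OF e] by blast
qed

lemma indecomposable_trm:
  assumes e: "idem xs e" and ind: "indecomposable K (ob xs e)"
  shows "indecomposable K (ob xs (trm e))"
  unfolding indecomposable_K[OF trm_idem[OF e]]
proof (intro conjI allI impI)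
  show "trm e \<noteq> 0" using ind unfolding indecomposable_K[OF e] by simp
next
  fix ys f zs g assume "idem ys f \<and> idem zs g \<and> is_direct_sum K (ob xs (trm e)) (ob ys f) (ob zs g)"
  then have f: "idem ys f" and g: "idem zs g" and ds: "is_direct_sum K (ob xs (trm e)) (ob ys f) (ob zs g)" by auto
  from ds obtain i j p q where h: "i \<in> hs ys f xs (trm e)" "j \<in> hs zs g xs (trm e)" "p \<in> hs xs (trm e) ys f" "q \<in> hs xs (trm e) zs g"
    and eq: "p * i = f" "q * j = g" "p * j = 0" "q * i = 0" "i * p + j * q = trm e"
    unfolding is_direct_sum_K[OF trm_idem[OF e] f g] by blast
  have h': "trm p \<in> hs ys (trm f) xs e" "trm q \<in> hs zs (trm g) xs e" "trm i \<in> hs xs e ys (trm f)" "trm j \<in> hs xs e zs (trm g)"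
    using h[THEN trm_hs] by simp_all
  have "trm i * trm p = trm f" "trm j * trm q = trm g" "trm i * trm q = 0" "trm j * trm p = 0"
    "trm p * trm i + trm q * trm j = e"
    using eq by (simp_all flip: trm_mult trm_add)
  then have "is_direct_sum K (ob xs e) (ob ys (trm f)) (ob zs (trm g))"
    unfolding is_direct_sum_K[OF e trm_idem[OF f] trm_idem[OF g]] using h' by blast
  then have "trm f = 0 \<or> trm g = 0"
    using ind trm_idem[OF f] trm_idem[OF g] unfolding indecomposable_K[OF e] by blast
  then show "f = 0 \<or> g = 0" by simp
qed

lemma no_hom_from_La:
  fixes e :: "'f::field_char_0 pal fmat"
  assumes e: "idem xs e" and ind: "indecomposable K (ob xs e)"
    and niso: "\<And>j. \<not> isomorphic K (ob xs e) (Lam j)"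
    and \<phi>: "\<phi> \<in> hs [i] (La i) xs e"
  shows "\<phi> = 0"
proof -
  have "\<not> isomorphic K (ob xs (trm e)) (Lam j)" for j
    using isomorphic_trm[OF trm_idem[OF e] idem_La, of j] niso[of j] by auto
  moreover have "trm \<phi> \<in> hs xs (trm e) [i] (La i)" using trm_hs[OF \<phi>] by simp
  ultimately have "trm \<phi> = 0"
    using no_hom_to_La[OF trm_idem[OF e] indecomposable_trm[OF e ind]] by blast
  then show ?thesis by simp
qed

text \<open>The endomorphisms \<open>c * alt + d * xi\<close> form a local ring: for an idempotent
  \<open>c * c = c\<close> and \<open>(2 * c - 1) * d * xi = 0\<close>, so it is zero or the
  identity.\<close>

lemma indecomposable_Lam: "indecomposable K (Lam n :: 'f::field_char_0 rep_obj)"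
  unfolding indecomposable_K[OF idem_La]
proof (intro conjI allI impI)
  show "La n \<noteq> (0 :: 'f pal fmat)" by simp
next
  fix ys zs and f g :: "'f pal fmat"
  assume "idem ys f \<and> idem zs g \<and> is_direct_sum K (Lam n) (ob ys f) (ob zs g)"
  then have f: "idem ys f" and g: "idem zs g" and ds: "is_direct_sum K (Lam n) (ob ys f) (ob zs g)" by auto
  from ds obtain i j p q where h: "i \<in> hs ys f [n] (La n)" "j \<in> hs zs g [n] (La n)" "p \<in> hs [n] (La n) ys f" "q \<in> hs [n] (La n) zs g"
    and eq: "p * i = f" "q * j = g" "p * j = 0" "q * i = 0" "i * p + j * q = La n"
    unfolding is_direct_sum_K[OF idem_La f g] by blast
  from hs_La[OF hs_mult[OF h(1,3)]] obtain x where x: "i * p = sm x" "x \<in> hom_span n n" by blast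
  then obtain c d where cd: "x = scl c (alt n) + scl d (xi n)" by (auto simp: hom_span_def)
  have "i * p * (i * p) = i * f * p" by (simp add: mult.assoc[symmetric]) (simp add: mult.assoc eq(1))
  also have "i * f = i" using h(1) by (simp add: hs_def)
  finally have "x * x = x" unfolding x sm_mult by simp
  moreover have "x * x = scl (c * c) (alt n) + (scl (c * d) (xi n) + scl (d * c) (xi n))"
    by (simp only: cd distrib_left distrib_right scl_mult_left scl_mult_right pal.scale_right_distrib
        pal.scale_scale alt_alt_in alt_xi xi_alt xi_xi order_refl pal.scale_zero_right add_0_right add.assoc)
  ultimately have "scl (c * c) (alt n) + (scl (c * d) (xi n) + scl (d * c) (xi n)) - (scl c (alt n) + scl d (xi n)) = 0"
    using cd by simp
  then have "scl (c * c - c) (alt n) + scl (c * d + d * c - d) (xi n) = 0"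
    by (simp only: pal.scale_left_diff_distrib pal.scale_left_distrib) (simp add: algebra_simps)
  from alt_xi_independent[OF this] have c: "c * c = c" and d: "scl (c * d + d * c - d) (xi n) = (0 :: 'f pal)" by simp_all
  have xc: "x = scl c (alt n)"
  proof -
    have "c = 0 \<or> c = 1" using c by simp
    then have "scl d (xi n) = (0 :: 'f pal)" using d by (auto simp: algebra_simps)
    then show ?thesis using cd by simp
  qed
  have "c = 0 \<or> c = 1" using c by simp
  then show "f = 0 \<or> g = 0"
  proof
    assume "c = 0"
    then have ip: "i * p = 0" using x xc by simp
    have "f = f * f" using f by (simp add: idem_def)
    also have "\<dots> = p * (i * p) * i" by (simp add: eq(1)[symmetric] mult.assoc)
    finally show ?thesis by (simp add: ip)
  next
    assume "c = 1"
    then have "i * p = La n" using x xc by simp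
    then have jq: "j * q = 0" using eq(5) by simp
    have "g = g * g" using g by (simp add: idem_def)
    also have "\<dots> = q * (j * q) * j" by (simp add: eq(2)[symmetric] mult.assoc)
    finally show ?thesis by (simp add: jq)
  qed
qed

text \<open>A composite through a different exterior power is a multiple of some \<open>xi\<close>,
  hence nilpotent and not an identity.\<close>

lemma Lam_not_iso:
  assumes "isomorphic K (Lam n) (Lam m :: 'f::field_char_0 rep_obj)" shows "n = m"
proof (rule ccontr)
  assume nm: "n \<noteq> m"
  obtain a b :: "'f pal fmat" where ab: "a \<in> hs [n] (La n) [m] (La m)" "b \<in> hs [m] (La m) [n] (La n)" "b * a = La n" "a * b = La m"
    using assms unfolding isomorphic_K[OF idem_La idem_La] by blast
  obtain x where x: "a = sm x" "x \<in> hom_span n m" using hs_La[OF ab(1)] by blast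
  obtain y where y: "b = sm y" "y \<in> hom_span m n" using hs_La[OF ab(2)] by blast
  have xy: "x * y = alt m" "y * x = alt n" using ab(3,4) unfolding x y sm_mult by simp_all
  have no: False if "\<exists>c. alt k = scl c (xi k :: 'f pal)" for k
  proof -
    from that obtain c where c: "alt k = scl c (xi k :: 'f pal)" by blast
    have "alt k = alt k * (alt k :: 'f pal)" by simp
    also have "\<dots> = scl c (xi k) * scl c (xi k)" by (simp only: c)
    also have "\<dots> = 0" by (simp add: scl_mult_left scl_mult_right)
    finally show False by simp
  qed
  consider "m = Suc n" | "n = Suc m" | "m \<noteq> Suc n" "n \<noteq> Suc m" by blast
  then show False
  proof cases
    case 1
    then obtain c d where "x = scl c (al n)" "y = scl d (be n)" using x(2) y(2) by (auto simp: hom_span_def)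
    then have "alt m = scl (d * c) (xi m)" using xy(1) 1 by (simp add: scl_mult_left scl_mult_right xi_def)
    then show False using no by blast
  next
    case 2
    then obtain c d where "x = scl c (be m)" "y = scl d (al m)" using x(2) y(2) by (auto simp: hom_span_def)
    then have "alt n = scl (c * d) (xi n)" using xy(2) 2 by (simp add: scl_mult_left scl_mult_right xi_def)
    then show False using no by blast
  next
    case 3
    then have "x = 0" using x(2) nm by (auto simp: hom_span_def)
    then show False using xy(1) by simp
  qed
qed

lemma iso_class_eq:
  assumes "X \<in> Obj K" "Y \<in> Obj K" "isomorphic K X Y" shows "iso_class K X = iso_class K Y"
proof -
  obtain xs e ys f where X: "X = ob xs e" "idem xs e" and Y: "Y = ob ys f" "idem ys f"
    using assms(1,2) unfolding Obj_K by blast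
  have "isomorphic K X Z \<longleftrightarrow> isomorphic K Y Z" if ZO: "Z \<in> Obj K" for Z
  proof -
    obtain zs g where Z: "Z = ob zs g" "idem zs g" using ZO unfolding Obj_K by blast
    show ?thesis
      using assms(3) isomorphic_ob_trans[OF X(2) Y(2) Z(2)] isomorphic_ob_trans[OF Y(2) X(2) Z(2)]
        isomorphic_ob_sym[OF X(2) Y(2)] unfolding X(1) Y(1) Z(1) by blast
  qed
  then show ?thesis unfolding iso_class_def by blast
qed

lemma iso_class_self: "X \<in> Obj K \<Longrightarrow> X \<in> iso_class K X"
  unfolding iso_class_def Obj_K using isomorphic_ob_refl by auto

text \<open>Links are defined by arbitrary members of two isomorphism classes; this carries a
  nonzero morphism over to chosen representatives.\<close>

lemma hom_transport:
  assumes xx: "idem xs e" "idem xs' e'" and yy: "idem ys f" "idem ys' f'"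
    and ix: "isomorphic K (ob xs e) (ob xs' e')" and iy: "isomorphic K (ob ys f) (ob ys' f')"
    and a: "a \<in> hs xs' e' ys' f'" "a \<noteq> 0"
  shows "\<exists>b\<in>hs xs e ys f. b \<noteq> 0"
proof -
  obtain u u' where u: "u \<in> hs xs e xs' e'" "u' \<in> hs xs' e' xs e" "u * u' = e'"
    using ix unfolding isomorphic_K[OF xx] by blast
  obtain v v' where v: "v \<in> hs ys f ys' f'" "v' \<in> hs ys' f' ys f" "v * v' = f'"
    using iy unfolding isomorphic_K[OF yy] by blast
  have "v * (v' * a * u) * u' = (v * v') * a * (u * u')" by (simp only: mult.assoc)
  also have "\<dots> = a" using a(1) u(3) v(3) by (simp add: hs_def)
  finally have "v' * a * u \<noteq> 0" using a(2) by auto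
  then show ?thesis using hs_mult[OF hs_mult[OF v(2) a(1)] u(1)] by blast
qed

definition blk :: "'f::field_char_0 rep_obj set set" where "blk = range (\<lambda>n. iso_class K (Lam n))"

lemma Lam_Obj [simp]: "Lam n \<in> Obj K" by (rule ob_Obj[OF idem_La])

lemma blk_subset: "blk \<subseteq> indec_classes K"
  unfolding blk_def indec_classes_def using indecomposable_Lam by blast

lemma linked_blk:
  assumes "(X, Y) \<in> linked (K :: ('f::field_char_0, 'f rep_obj, 'f rep_mor) lincat)" shows "X \<in> blk \<longleftrightarrow> Y \<in> blk"
proof -
  from assms obtain x0 y0 :: "'f rep_obj" and x y h where
    X: "X = iso_class K x0" "indecomposable K x0" "x \<in> X" and
    Y: "Y = iso_class K y0" "indecomposable K y0" "y \<in> Y" and h: "h \<in> Hom K x y" "h \<noteq> Zer K x y"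
    unfolding linked_def indec_classes_def by blast
  have "x0 \<in> Obj K" "y0 \<in> Obj K" using X(2) Y(2) by (auto simp: indecomposable_def)
  then obtain xs0 e0 ys0 f0 where x0: "x0 = ob xs0 e0" "idem xs0 e0" and y0: "y0 = ob ys0 f0" "idem ys0 f0"
    unfolding Obj_K by blast
  have "x \<in> Obj K" "y \<in> Obj K" and i: "isomorphic K x0 x" "isomorphic K y0 y" using X Y by (auto simp: iso_class_def)
  then obtain xs e ys f where x: "x = ob xs e" "idem xs e" and y: "y = ob ys f" "idem ys f"
    unfolding Obj_K by blast
  obtain a where a: "a \<in> hs xs e ys f" "a \<noteq> 0" using h unfolding x y Hom_K[OF x(2) y(2)] Zer_K by blast
  have in_blk: "iso_class K (ob zs g) \<in> blk" if "isomorphic K (ob zs g) (Lam j)" "idem zs g" for zs j and g :: "'f pal fmat"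
    using iso_class_eq[OF ob_Obj[OF that(2)] Lam_Obj that(1)] by (auto simp: blk_def)
  have iso_Lam: "\<exists>j. isomorphic K z0 (Lam j)" if "iso_class K z0 \<in> blk" "z0 \<in> Obj K" for z0 :: "'f rep_obj"
  proof -
    from that obtain j where "iso_class K z0 = iso_class K (Lam j)" by (auto simp: blk_def)
    then have "Lam j \<in> iso_class K z0" using iso_class_self[OF Lam_Obj] by auto
    then show ?thesis by (auto simp: iso_class_def)
  qed
  show ?thesis
  proof
    assume "X \<in> blk"
    then obtain j where j: "isomorphic K (ob xs0 e0) (Lam j)"
      using iso_Lam[of x0] ob_Obj[OF x0(2)] unfolding X(1) x0(1) by blast
    have "isomorphic K (Lam j) (ob xs e)"
      using isomorphic_ob_trans[OF idem_La x0(2) x(2) isomorphic_ob_sym[OF x0(2) idem_La j]] i(1) unfolding x0 x by blast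
    from hom_transport[OF idem_La x(2) y0(2) y(2) this _ a] i(2)
    obtain b where "b \<in> hs [j] (La j) ys0 f0" "b \<noteq> 0" unfolding y0 y by blast
    then obtain k where "isomorphic K (ob ys0 f0) (Lam k)"
      using no_hom_from_La[OF y0(2)] Y(2) unfolding y0(1) by blast
    then show "Y \<in> blk" unfolding Y(1) y0(1) by (rule in_blk[OF _ y0(2)])
  next
    assume "Y \<in> blk"
    then obtain j where j: "isomorphic K (ob ys0 f0) (Lam j)"
      using iso_Lam[of y0] ob_Obj[OF y0(2)] unfolding Y(1) y0(1) by blast
    have "isomorphic K (Lam j) (ob ys f)"
      using isomorphic_ob_trans[OF idem_La y0(2) y(2) isomorphic_ob_sym[OF y0(2) idem_La j]] i(2) unfolding y0 y by blast
    from hom_transport[OF x0(2) x(2) idem_La y(2) _ this a] i(1)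
    obtain b where "b \<in> hs xs0 e0 [j] (La j)" "b \<noteq> 0" unfolding x0 x by blast
    then obtain k where "isomorphic K (ob xs0 e0) (Lam k)"
      using no_hom_to_La[OF x0(2)] X(2) unfolding x0(1) by blast
    then show "X \<in> blk" unfolding X(1) x0(1) by (rule in_blk[OF _ x0(2)])
  qed
qed

lemma linked_Lam_Suc: "(iso_class K (Lam n), iso_class K (Lam (Suc n))) \<in> linked (K :: ('f::field_char_0, 'f rep_obj, 'f rep_mor) lincat)"
proof -
  have "al n \<noteq> (0 :: 'f pal)" using xi_Suc_neq_0[of n, where 'f='f] by (auto simp: xi_def)
  moreover have "sm (al n) \<in> (hs [n] (La n) [Suc n] (La (Suc n)) :: 'f pal fmat set)" by (simp add: hs_def sm_mult)
  ultimately have "enc [n] [Suc n] (sm (al n)) \<in> Hom K (Lam n) (Lam (Suc n) :: 'f rep_obj)"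
    "enc [n] [Suc n] (sm (al n)) \<noteq> Zer K (Lam n) (Lam (Suc n) :: 'f rep_obj)"
    using enc_inj[of "sm (al n :: 'f pal)" "[n]" "[Suc n]" 0]
    unfolding Hom_K[OF idem_La idem_La] Zer_K by auto
  then show ?thesis
    unfolding linked_def using blk_subset iso_class_self[OF Lam_Obj] by (auto simp: blk_def) blast
qed

lemma blk_is_block: "is_block K (blk :: 'f::field_char_0 rep_obj set set)"
proof -
  let ?K = "K :: ('f, 'f rep_obj, 'f rep_mor) lincat"
  let ?I = "indec_classes ?K" and ?E = "block_equiv ?K" and ?c = "\<lambda>n. iso_class K (Lam n :: 'f rep_obj)"
  \<comment> \<open>Consecutive exterior powers are linked by \<open>al\<close>, so every
    equivalence relation containing the links has \<open>blk\<close> inside one class.\<close>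
  have "(?c 0, ?c n) \<in> R" if R: "equiv ?I R" "linked ?K \<subseteq> R" for R n
  proof (induction n)
    case 0
    show ?case using R(1) blk_subset by (auto simp: blk_def equiv_def refl_on_def)
  next
    case (Suc n)
    have "(?c n, ?c (Suc n)) \<in> R" using linked_Lam_Suc R(2) by blast
    with Suc R(1) show ?case unfolding equiv_def trans_def by blast
  qed
  then have 1: "blk \<subseteq> ?E `` {?c 0}" unfolding block_equiv_def blk_def by blast
  \<comment> \<open>The equivalence relation that separates \<open>blk\<close> from its complement
    contains all links, so the block of \<open>?c 0\<close> cannot leave \<open>blk\<close>.\<close>
  let ?R = "{(X, Y). X \<in> ?I \<and> Y \<in> ?I \<and> (X \<in> blk \<longleftrightarrow> Y \<in> blk)}"
  have "equiv ?I ?R" by (rule equivI) (auto simp: refl_on_def sym_def trans_def)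
  moreover have "linked ?K \<subseteq> ?R"
  proof
    fix p assume p: "p \<in> linked ?K"
    obtain X Y where XY: "p = (X, Y)" by (cases p)
    have "X \<in> ?I" "Y \<in> ?I" using p unfolding XY linked_def by blast+
    then show "p \<in> ?R" using linked_blk[of X Y] p unfolding XY by blast
  qed
  ultimately have "?E \<subseteq> ?R" unfolding block_equiv_def by blast
  moreover have "?c 0 \<in> blk" by (simp add: blk_def)
  ultimately have "?E `` {?c 0} \<subseteq> blk" by blast
  with 1 have "blk = ?E `` {?c 0}" by blast
  moreover have "?c 0 \<in> ?I" using blk_subset by (auto simp: blk_def)
  ultimately show ?thesis unfolding is_block_def quotient_def by blast
qed

lemma blk_bij: "bij_betw (\<lambda>n. iso_class K (Lam n)) UNIV (blk :: 'f::field_char_0 rep_obj set set)"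
  unfolding bij_betw_def blk_def
proof
  show "inj (\<lambda>n. iso_class K (Lam n :: 'f rep_obj))"
  proof (rule injI)
    fix n m assume "iso_class K (Lam n :: 'f rep_obj) = iso_class K (Lam m)"
    then have "(Lam m :: 'f rep_obj) \<in> iso_class K (Lam n)" using iso_class_self[OF Lam_Obj] by blast
    then show "n = m" using Lam_not_iso by (auto simp: iso_class_def)
  qed
qed simp

text \<open>A trivial block has a single class, whereas \<open>Lam 0\<close> and
  \<open>Lam 1\<close> are not isomorphic.\<close>

lemma blk_nontrivial: "nontrivial_block K (blk :: 'f::field_char_0 rep_obj set set)"
proof -
  have "iso_class K (Lam 0 :: 'f rep_obj) \<noteq> iso_class K (Lam 1)"
  proof
    assume "iso_class K (Lam 0 :: 'f rep_obj) = iso_class K (Lam 1)"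
    from injD[OF bij_betw_imp_inj_on[OF blk_bij] this] show False by simp
  qed
  moreover have "iso_class K (Lam 0 :: 'f rep_obj) \<in> blk" "iso_class K (Lam 1 :: 'f rep_obj) \<in> blk" by (auto simp: blk_def)
  ultimately have "\<not> (\<exists>x. (blk :: 'f rep_obj set set) = {x})" by auto
  then show ?thesis using blk_is_block unfolding nontrivial_block_def trivial_block_def by blast
qed

section \<open>The idempotents of the sign representations\<close>

lemma box_of_column:
  assumes "i \<in> {1..n}" shows "box_of (replicate n 1) i = (i - 1, 0)"
  unfolding box_of_def
proof (rule the_equality)
  show "case (i - 1, 0) of (r, c) \<Rightarrow> r < length (replicate n 1) \<and> c < replicate n 1 ! r \<and>
      i = sum_list (take r (replicate n 1)) + c + (1::nat)"
    using assms by (auto simp: sum_list_replicate)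
next
  fix p assume "case p of (r, c) \<Rightarrow> r < length (replicate n 1) \<and> c < replicate n 1 ! r \<and>
      i = sum_list (take r (replicate n 1)) + c + (1::nat)"
  then show "p = (i - 1, 0)"
    by (cases p) (auto simp: sum_list_replicate)
qed

lemma row_group_column: "row_group (replicate n 1) = {id}"
proof -
  have "\<sigma> = id" if \<sigma>: "\<sigma> permutes {1..n}"
    and eq: "\<forall>i\<in>{1..n}. fst (box_of (replicate n 1) (\<sigma> i)) = fst (box_of (replicate n 1) i)" for \<sigma>
  proof
    fix i
    show "\<sigma> i = id i"
    proof (cases "i \<in> {1..n}")
      case True
      then have si: "\<sigma> i \<in> {1..n}" using permutes_in_image[OF \<sigma>] by blast
      have "fst (box_of (replicate n 1) (\<sigma> i)) = fst (box_of (replicate n 1) i)" using eq True by blast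
      then have "\<sigma> i - 1 = i - 1" unfolding box_of_column[OF si] box_of_column[OF True] fst_conv .
      then show ?thesis using si True by auto
    qed (simp add: permutes_not_in[OF \<sigma>])
  qed
  then show ?thesis by (auto simp: row_group_def sum_list_replicate permutes_id)
qed

lemma column_group_column: "column_group (replicate n 1) = {\<sigma>. \<sigma> permutes {1..n}}"
proof -
  have "snd (box_of (replicate n 1) (\<sigma> i)) = snd (box_of (replicate n 1) i)"
    if "\<sigma> permutes {1..n}" "i \<in> {1..n}" for \<sigma> i
    using that permutes_in_image[OF that(1)] by (simp add: box_of_column)
  then show ?thesis by (auto simp: column_group_def sum_list_replicate)
qed

context
  fixes n :: nat
begin

abbreviation ga :: "((nat \<Rightarrow> nat) \<Rightarrow> 'f::field_char_0) ring" where "ga \<equiv> group_algebra n"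

lemma carrier_ga: "x \<in> carrier ga \<longleftrightarrow> (\<forall>\<sigma>. x \<sigma> \<noteq> 0 \<longrightarrow> \<sigma> permutes {1..n})"
  by (simp add: group_algebra_def)

lemma ga_mult:
  assumes y: "y \<in> carrier ga"
  shows "(x \<otimes>\<^bsub>ga\<^esub> y) \<rho> = (\<Sum>\<sigma> | \<sigma> permutes {1..n}. x \<sigma> * (y (pinv \<sigma> \<circ> \<rho>) :: 'f::field_char_0))"
proof -
  have "(\<Sum>\<tau> | \<tau> permutes {1..n}. if \<sigma> \<circ> \<tau> = \<rho> then x \<sigma> * y \<tau> else 0) = x \<sigma> * y (pinv \<sigma> \<circ> \<rho>)"
    if \<sigma>: "\<sigma> permutes {1..n}" for \<sigma>
  proof -
    have iff: "\<sigma> \<circ> \<tau> = \<rho> \<longleftrightarrow> \<tau> = pinv \<sigma> \<circ> \<rho>" for \<tau>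
    proof
      assume "\<sigma> \<circ> \<tau> = \<rho>"
      then show "\<tau> = pinv \<sigma> \<circ> \<rho>" by (simp add: comp_assoc[symmetric] permutes_inv_o[OF \<sigma>] flip: \<open>\<sigma> \<circ> \<tau> = \<rho>\<close>)
    qed (simp add: comp_assoc[symmetric] permutes_inv_o[OF \<sigma>])
    have "(\<Sum>\<tau> | \<tau> permutes {1..n}. if \<sigma> \<circ> \<tau> = \<rho> then x \<sigma> * y \<tau> else 0) =
        (\<Sum>\<tau> | \<tau> permutes {1..n}. if \<tau> = pinv \<sigma> \<circ> \<rho> then x \<sigma> * y (pinv \<sigma> \<circ> \<rho>) else 0)"
      unfolding iff by (intro sum.cong refl) auto
    also have "\<dots> = x \<sigma> * y (pinv \<sigma> \<circ> \<rho>)"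
      using y[unfolded carrier_ga, rule_format, of "pinv \<sigma> \<circ> \<rho>"] by (auto simp: sum.delta finite_permutations)
    finally show ?thesis .
  qed
  then show ?thesis by (simp add: group_algebra_def)
qed

lemma gd_mult:
  assumes \<sigma>: "\<sigma> permutes {1..n}" and y: "y \<in> carrier ga"
  shows "((\<lambda>\<rho>. if \<rho> = \<sigma> then c else 0) \<otimes>\<^bsub>ga\<^esub> y) \<rho> = c * (y (pinv \<sigma> \<circ> \<rho>) :: 'f::field_char_0)"
proof -
  have "((\<lambda>\<rho>. if \<rho> = \<sigma> then c else 0) \<otimes>\<^bsub>ga\<^esub> y) \<rho> =
      (\<Sum>\<sigma>' | \<sigma>' permutes {1..n}. if \<sigma>' = \<sigma> then c * y (pinv \<sigma> \<circ> \<rho>) else 0)"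
    unfolding ga_mult[OF y] by (intro sum.cong refl) auto
  then show ?thesis using \<sigma> by (simp add: sum.delta finite_permutations)
qed

definition ysym :: "(nat \<Rightarrow> nat) \<Rightarrow> 'f::field_char_0" where
  "ysym \<sigma> = (if \<sigma> permutes {1..n} then sg \<sigma> else 0)"

lemma ysym_carrier: "ysym \<in> carrier ga" by (simp add: carrier_ga ysym_def)

lemma young_symmetrizer_column: "young_symmetrizer (replicate n 1) = (ysym :: _ \<Rightarrow> 'f::field_char_0)"
proof
  fix \<rho>
  have y: "(\<lambda>\<sigma>. if \<sigma> \<in> {\<sigma>. \<sigma> permutes {1..n}} then of_int (sign \<sigma>) else 0) = (ysym :: _ \<Rightarrow> 'f)"
    by (rule ext) (simp add: ysym_def sg_def)
  have n: "sum_list (replicate n (1::nat)) = n" by (simp add: sum_list_replicate)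
  have "young_symmetrizer (replicate n 1) = (\<lambda>\<sigma>. if \<sigma> = id then 1 else 0) \<otimes>\<^bsub>ga\<^esub> (ysym :: _ \<Rightarrow> 'f)"
    unfolding young_symmetrizer_def row_group_column column_group_column y n singleton_iff ..
  then show "young_symmetrizer (replicate n 1) \<rho> = (ysym \<rho> :: 'f)"
    by (simp only: gd_mult[OF permutes_id ysym_carrier]) simp
qed

text \<open>Permutations act on the alternating element through their sign, so the left ideal it
  generates consists of its scalar multiples.\<close>

lemma left_ideal_ysym:
  assumes "z \<in> left_ideal ga (ysym :: _ \<Rightarrow> 'f::field_char_0)"
  shows "\<exists>k. z = (\<lambda>\<rho>. k * ysym \<rho>)"
proof -
  from assms obtain r where z: "z = r \<otimes>\<^bsub>ga\<^esub> ysym" by (auto simp: left_ideal_def)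
  have "z \<rho> = (\<Sum>\<sigma> | \<sigma> permutes {1..n}. r \<sigma> * sg \<sigma>) * ysym \<rho>" for \<rho>
  proof -
    have "r \<sigma> * ysym (pinv \<sigma> \<circ> \<rho>) = r \<sigma> * sg \<sigma> * (ysym \<rho> :: 'f)" if \<sigma>: "\<sigma> permutes {1..n}" for \<sigma>
    proof (cases "\<rho> permutes {1..n}")
      case True
      have "pinv \<sigma> \<circ> \<rho> permutes {1..n}" by (rule permutes_compose[OF True permutes_inv[OF \<sigma>]])
      then show ?thesis using True by (simp add: ysym_def sg_comp[OF permutes_inv[OF \<sigma>] True] sg_inv[OF \<sigma>])
    next
      case False
      have "\<not> pinv \<sigma> \<circ> \<rho> permutes {1..n}"
      proof
        assume "pinv \<sigma> \<circ> \<rho> permutes {1..n}"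
        from permutes_compose[OF this \<sigma>] have "\<rho> permutes {1..n}"
          by (simp add: comp_assoc[symmetric] permutes_inv_o[OF \<sigma>])
        with False show False ..
      qed
      then show ?thesis using False by (simp add: ysym_def)
    qed
    then show ?thesis unfolding z ga_mult[OF ysym_carrier] sum_distrib_right by (intro sum.cong refl) auto
  qed
  then show ?thesis by blast
qed

text \<open>The isomorphism transports the sign action, \<open>\<tau> * e = sg \<tau> * e\<close>.
  So all coefficients are determined by \<open>e id\<close>, and idempotency gives
  \<open>e id = n! * (e id)^2\<close> with \<open>e id\<close> nonzero.\<close>

lemma sign_idempotent_coeffs:
  assumes e: "primitive_idempotent ga e"
    and iso: "left_module_iso ga (left_ideal ga e) (left_ideal ga (young_symmetrizer (replicate n 1)))"
    and \<sigma>: "\<sigma> permutes {1..n}"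
  shows "e \<sigma> = sg \<sigma> / (fact n :: 'f::field_char_0)"
proof -
  have ec: "e \<in> carrier ga" and ee: "e \<otimes>\<^bsub>ga\<^esub> e = e" and e0: "e \<noteq> \<zero>\<^bsub>ga\<^esub>"
    using e by (auto simp: primitive_idempotent_def idempotent_def)
  obtain \<phi> where bij: "bij_betw \<phi> (left_ideal ga e) (left_ideal ga ysym)"
    and hom: "\<And>r x. r \<in> carrier ga \<Longrightarrow> x \<in> left_ideal ga e \<Longrightarrow> \<phi> (r \<otimes>\<^bsub>ga\<^esub> x) = r \<otimes>\<^bsub>ga\<^esub> \<phi> x"
    using iso unfolding left_module_iso_def young_symmetrizer_column by blast
  have e_in: "e \<in> left_ideal ga e" unfolding left_ideal_def using ec ee by force
  from bij_betwE[OF bij] e_in have "\<phi> e \<in> left_ideal ga ysym" by blast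
  then obtain k where k: "\<phi> e = (\<lambda>\<rho>. k * ysym \<rho>)" using left_ideal_ysym by blast
  have \<phi>c: "\<phi> e \<in> carrier ga" unfolding k carrier_ga by (simp add: ysym_def)
  have e_sg: "e \<tau> = sg \<tau> * e id" if \<tau>: "\<tau> permutes {1..n}" for \<tau>
  proof -
    \<comment> \<open>\<open>?d\<close> is the group element \<open>\<tau>\<close>,
      \<open>?s\<close> is its sign as a scalar. They act equally on \<open>\<phi> e\<close>, and
      injectivity of \<open>\<phi>\<close> brings this back to \<open>e\<close>.\<close>
    let ?d = "\<lambda>\<rho>. if \<rho> = \<tau> then 1 else 0 :: 'f" and ?s = "\<lambda>\<rho>. if \<rho> = id then sg \<tau> else 0 :: 'f"
    have d: "?d \<in> carrier ga" and s: "?s \<in> carrier ga" using \<tau> by (auto simp: carrier_ga permutes_id)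
    have "?d \<otimes>\<^bsub>ga\<^esub> \<phi> e = ?s \<otimes>\<^bsub>ga\<^esub> \<phi> e"
    proof
      fix \<rho>
      have "k * ysym (pinv \<tau> \<circ> \<rho>) = sg \<tau> * (k * (ysym \<rho> :: 'f))"
      proof (cases "\<rho> permutes {1..n}")
        case True
        have "pinv \<tau> \<circ> \<rho> permutes {1..n}" by (rule permutes_compose[OF True permutes_inv[OF \<tau>]])
        then show ?thesis using True by (simp add: ysym_def sg_comp[OF permutes_inv[OF \<tau>] True] sg_inv[OF \<tau>])
      next
        case False
        have "\<not> pinv \<tau> \<circ> \<rho> permutes {1..n}"
        proof
          assume "pinv \<tau> \<circ> \<rho> permutes {1..n}"
          from permutes_compose[OF this \<tau>] have "\<rho> permutes {1..n}"
            by (simp add: comp_assoc[symmetric] permutes_inv_o[OF \<tau>])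
          with False show False ..
        qed
        then show ?thesis using False by (simp add: ysym_def)
      qed
      then show "(?d \<otimes>\<^bsub>ga\<^esub> \<phi> e) \<rho> = (?s \<otimes>\<^bsub>ga\<^esub> \<phi> e) \<rho>"
        unfolding gd_mult[OF \<tau> \<phi>c] gd_mult[OF permutes_id \<phi>c] by (simp add: k)
    qed
    then have "\<phi> (?d \<otimes>\<^bsub>ga\<^esub> e) = \<phi> (?s \<otimes>\<^bsub>ga\<^esub> e)" using hom[OF d e_in] hom[OF s e_in] by simp
    moreover have "?d \<otimes>\<^bsub>ga\<^esub> e \<in> left_ideal ga e" "?s \<otimes>\<^bsub>ga\<^esub> e \<in> left_ideal ga e"
      using d s unfolding left_ideal_def by blast+
    ultimately have "?d \<otimes>\<^bsub>ga\<^esub> e = ?s \<otimes>\<^bsub>ga\<^esub> e"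
      by (rule inj_onD[OF bij_betw_imp_inj_on[OF bij]])
    then have "(?d \<otimes>\<^bsub>ga\<^esub> e) \<tau> = (?s \<otimes>\<^bsub>ga\<^esub> e) \<tau>" by simp
    then have "e id = sg \<tau> * e \<tau>"
      unfolding gd_mult[OF \<tau> ec] gd_mult[OF permutes_id ec] by (simp add: permutes_inv_o[OF \<tau>])
    then have "sg \<tau> * e id = (sg \<tau> * sg \<tau>) * e \<tau>" by (simp only: mult.assoc)
    then show ?thesis by simp
  qed
  have "e id = (\<Sum>\<tau> | \<tau> permutes {1..n}. e \<tau> * e (pinv \<tau> \<circ> id))"
    using ga_mult[OF ec, of e id] unfolding ee .
  also have "\<dots> = (\<Sum>\<tau> | \<tau> permutes {1..n}. e id * e id)"
  proof (rule sum.cong[OF refl])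
    fix \<tau> assume "\<tau> \<in> {\<tau>. \<tau> permutes {1..n}}"
    then have \<tau>: "\<tau> permutes {1..n}" by simp
    have "e \<tau> * e (pinv \<tau>) = (sg \<tau> * sg \<tau>) * (e id * e id)"
      by (simp only: e_sg[OF \<tau>] e_sg[OF permutes_inv[OF \<tau>]] sg_inv[OF \<tau>] ac_simps)
    then show "e \<tau> * e (pinv \<tau> \<circ> id) = e id * e id" by simp
  qed
  finally have sq: "e id = fact n * (e id * e id)" by simp
  have "e id \<noteq> 0"
  proof
    assume "e id = 0"
    then have "e \<tau> = 0" for \<tau> using e_sg[of \<tau>] ec[unfolded carrier_ga] by (cases "\<tau> permutes {1..n}") auto
    then have "e = \<zero>\<^bsub>ga\<^esub>" by (auto simp: group_algebra_def)
    with e0 show False ..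
  qed
  then have "e id = 1 / fact n" using sq by (simp add: field_simps)
  then show ?thesis using e_sg[OF \<sigma>] by simp
qed

end

text \<open>The inverse occurs because \<open>perm_diagram\<close> follows strands from source to
  target, while \<open>fnd\<close> reads them from target to source.\<close>

lemma perm_diagram_eq:
  assumes \<sigma>: "\<sigma> permutes {1..n}" shows "perm_diagram n \<sigma> = fnd n n (pinv \<sigma>)"
proof (rule diagram_eqI)
  have inj: "\<sigma> i = \<sigma> j \<longleftrightarrow> i = j" for i j using permutes_inj[OF \<sigma>] by (auto dest: injD)
  have im: "\<sigma> ` {1..n} = {1..n}" by (rule permutes_image[OF \<sigma>])
  have "\<Union> (perm_diagram n \<sigma>) = Src ` {1..n} \<union> Tgt ` (\<sigma> ` {1..n})" by (auto simp: perm_diagram_def)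
  then show "perm_diagram n \<sigma> \<in> diagrams n n"
    unfolding diagrams_iff im
    by (intro partition_onI) (auto simp: verts_of_def perm_diagram_def disjnt_def inj)
  show "fnd n n (pinv \<sigma>) \<in> diagrams n n" by simp
  fix x z :: "nat \<Rightarrow> bool"
  have "fits (perm_diagram n \<sigma>) x z \<longleftrightarrow> (\<forall>i\<in>{1..n}. x i = z (\<sigma> i))" by (auto simp: fits_def perm_diagram_def)
  also have "\<dots> \<longleftrightarrow> (\<forall>j\<in>{1..n}. z j = x (pinv \<sigma> j))"
    using permutes_in_image[OF \<sigma>] permutes_in_image[OF permutes_inv[OF \<sigma>]] permutes_inverses[OF \<sigma>] by metis
  finally show "fits (perm_diagram n \<sigma>) x z = fits (fnd n n (pinv \<sigma>)) x z"
    unfolding fits_perm[OF permutes_inv[OF \<sigma>]] .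
qed

text \<open>Each of the \<open>n!\<close> permutations contributes \<open>alt n / n!\<close>, since
  its sign occurs twice; all other diagrams contribute multiples of \<open>xi n\<close>.\<close>

lemma alt_mult_alt_of_coeffs:
  assumes x: "x \<in> hm n n" and c: "\<And>\<sigma>. \<sigma> permutes {1..n} \<Longrightarrow> coef x (fnd n n \<sigma>) = sg \<sigma> / fact n"
  shows "\<exists>d. alt n * x * alt n = alt n + scl d (xi n :: 'f::field_char_0 pal)"
proof -
  let ?S = "fnd n n ` {\<sigma>. \<sigma> permutes {1..n}}" and ?D = "diagrams n n"
  let ?t = "\<lambda>\<pi>. scl (coef x \<pi>) (alt n * bs \<pi> * alt n :: 'f pal)"
  have "alt n * x * alt n = (\<Sum>\<pi>\<in>?D. ?t \<pi>)"
    by (subst hm_expand[OF x]) (simp add: sum_distrib_left sum_distrib_right scl_mult_left scl_mult_right)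
  also have "\<dots> = (\<Sum>\<pi>\<in>?D - ?S. ?t \<pi>) + (\<Sum>\<pi>\<in>?S. ?t \<pi>)"
    by (rule sum.subset_diff) auto
  also have "(\<Sum>\<pi>\<in>?S. ?t \<pi>) = (\<Sum>\<sigma> | \<sigma> permutes {1..n}. ?t (fnd n n \<sigma>))"
  proof (rule sum.reindex_cong[OF _ refl refl])
    show "inj_on (fnd n n) {\<sigma>. \<sigma> permutes {1..n}}"
    proof (rule inj_onI, rule ext)
      fix \<sigma> \<tau> i assume "\<sigma> \<in> {\<sigma>. \<sigma> permutes {1..n}}" "\<tau> \<in> {\<sigma>. \<sigma> permutes {1..n}}" and eq: "fnd n n \<sigma> = fnd n n \<tau>"
      then have p: "\<sigma> permutes {1..n}" "\<tau> permutes {1..n}" by auto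
      show "\<sigma> i = \<tau> i"
        using fnd_inj[OF permutes_Pi[OF p(1)] permutes_Pi[OF p(2)] eq, of i] permutes_not_in[OF p(1), of i] permutes_not_in[OF p(2), of i]
        by (cases "i \<in> {1..n}") auto
    qed
  qed
  also have "\<dots> = (\<Sum>\<sigma> | \<sigma> permutes {1..n}. scl (1 / fact n) (alt n))"
  proof (rule sum.cong[OF refl])
    fix \<sigma> assume "\<sigma> \<in> {\<sigma>. \<sigma> permutes {1..n}}"
    then have \<sigma>: "\<sigma> permutes {1..n}" by simp
    have "alt n * bs (fnd n n \<sigma>) * alt n = scl (sg \<sigma>) (alt n :: 'f pal)"
      using alt_fn[OF \<sigma>, where 'a='f] by (simp add: fn_def scl_mult_left)
    then show "?t (fnd n n \<sigma>) = scl (1 / fact n) (alt n)" by (simp add: c[OF \<sigma>])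
  qed
  also have "\<dots> = alt n" by (simp add: pal.sum_constant_scale)
  finally have eq: "alt n * x * alt n = (\<Sum>\<pi>\<in>?D - ?S. ?t \<pi>) + alt n" .
  have "\<exists>d. (\<Sum>\<pi>\<in>?D - ?S. ?t \<pi>) = scl d (xi n)"
  proof -
    have "\<forall>\<pi>\<in>?D - ?S. \<exists>d. alt n * bs \<pi> * alt n = scl d (xi n :: 'f pal)"
      by (intro ballI alt_nonperm_alt) auto
    then obtain d where d: "\<And>\<pi>. \<pi> \<in> ?D - ?S \<Longrightarrow> alt n * bs \<pi> * alt n = scl (d \<pi>) (xi n :: 'f pal)"
      unfolding bchoice_iff by blast
    have "(\<Sum>\<pi>\<in>?D - ?S. ?t \<pi>) = (\<Sum>\<pi>\<in>?D - ?S. scl (coef x \<pi> * d \<pi>) (xi n))"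
      by (rule sum.cong[OF refl]) (simp add: d)
    then show ?thesis by (metis pal.scale_sum_left)
  qed
  then show ?thesis unfolding eq by (metis add.commute)
qed

lemma obj_of_eq: "obj_of n (coef x) = ob [n] (sm x)"
  unfolding obj_of_def ob_def enc_def by (intro arg_cong2[where f=Pair] refl mat_of_eqI) simp

text \<open>\<open>alt n * x * alt n = alt n + d * xi n\<close> is invertible on the exterior power,
  with inverse \<open>?a = alt n - d * xi n\<close>. Inserting this inverse gives
  \<open>?u * ?v = alt n\<close>; then \<open>?v * ?u\<close> is a nonzero idempotent fixed by
  \<open>x\<close> on both sides, and equals \<open>x\<close> by primitivity.\<close>

lemma is_L_column:
  assumes L: "is_L (0 :: 'f::field_char_0) (replicate n 1) X"
  obtains x u v where "X = ob [n] (sm x)" "idem [n] (sm x)" "u \<in> hm n n" "v \<in> hm n n"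
    "alt n * u = u" "u * x = u" "x * v = v" "v * alt n = v" "u * v = alt n" "v * u = (x :: 'f pal)"
proof (cases n)
  case 0
  then have "X = obj_of 0 (coef (alt 0 :: 'f pal))" using L by (simp add: is_L_def Idn_rep0 alt_0)
  then have "X = ob [n] (sm (alt n))" using 0 by (simp add: obj_of_eq)
  then show thesis by (rule that[of "alt n" "alt n" "alt n"]) simp_all
next
  case (Suc k)
  have ne: "replicate n (1::nat) \<noteq> []" using Suc by simp
  have sl: "sum_list (replicate n (1::nat)) = n" by (simp add: sum_list_replicate)
  obtain e where e: "is_e 0 (replicate n 1) e" and X: "X = obj_of n e"
    using L unfolding is_L_def sl by (simp only: ne if_False) blast
  let ?R = "end_ring (rep0 (0::'f)) n"
  have prim: "primitive_idempotent ?R e" and prim': "primitive_idempotent (group_algebra n) (to_group_algebra n e)"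
    and iso: "left_module_iso (group_algebra n) (left_ideal (group_algebra n) (to_group_algebra n e))
      (left_ideal (group_algebra n) (young_symmetrizer (replicate n 1)))"
    using e by (auto simp: is_e_def Let_def sum_list_replicate)
  have "e \<in> Hom (rep0 0) n n" using prim by (simp add: primitive_idempotent_def idempotent_def end_ring_def)
  then obtain x where x: "x \<in> hm n n" "e = coef x" unfolding Hom_rep0 by blast
  have idem_iff: "idempotent ?R (coef y) \<longleftrightarrow> y * y = y" if "y \<in> hm n n" for y
    using that by (auto simp: idempotent_def end_ring_def Hom_rep0 Comp_rep0 coef_inject)
  have mult: "coef y \<otimes>\<^bsub>?R\<^esub> coef z = coef (y * z)" if "y \<in> hm n n" "z \<in> hm n n" for y z
    using that by (simp add: end_ring_def Comp_rep0)
  have zero: "\<zero>\<^bsub>?R\<^esub> = coef 0" and add: "coef y \<oplus>\<^bsub>?R\<^esub> coef z = coef (y + z)" for y z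
    by (simp_all add: end_ring_def Zer_rep0 Pls_rep0)
  have xx: "x * x = x" using prim idem_iff[OF x(1)] unfolding x(2) by (simp add: primitive_idempotent_def)
  have prim_x: "y = 0 \<or> z = 0"
    if "y \<in> hm n n" "z \<in> hm n n" "y * y = y" "z * z = z" "y * z = 0" "z * y = 0" "x = y + z" for y z
  proof -
    have "coef y = \<zero>\<^bsub>?R\<^esub> \<or> coef z = \<zero>\<^bsub>?R\<^esub>"
      using prim that unfolding primitive_idempotent_def x(2)
      by (simp add: idem_iff mult zero add)
    then show ?thesis by (simp add: zero coef_inject)
  qed
  have "coef x (fnd n n \<sigma>) = sg \<sigma> / fact n" if \<sigma>: "\<sigma> permutes {1..n}" for \<sigma>
  proof -
    have i: "pinv \<sigma> permutes {1..n}" by (rule permutes_inv[OF \<sigma>])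
    have "to_group_algebra n e (pinv \<sigma>) = sg (pinv \<sigma>) / fact n"
      by (rule sign_idempotent_coeffs[OF prim' iso i])
    then show ?thesis
      using i by (simp add: to_group_algebra_def x(2) perm_diagram_eq[OF i] permutes_inv_inv[OF \<sigma>] sg_inv[OF \<sigma>])
  qed
  from alt_mult_alt_of_coeffs[OF x(1) this] obtain d where d: "alt n * x * alt n = alt n + scl d (xi n)" by blast
  let ?a = "alt n - scl d (xi n)"
  let ?u = "alt n * x" and ?v = "x * ?a"
  have uv: "?u * ?v = alt n"
  proof -
    have a: "alt n * ?a = ?a" by (simp add: right_diff_distrib scl_mult_right)
    have "?u * ?v = alt n * (x * x) * ?a" by (simp only: mult.assoc)
    also have "\<dots> = alt n * x * alt n * ?a" by (simp only: xx mult.assoc a)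
    also have "\<dots> = alt n"
      unfolding d by (simp add: distrib_right right_diff_distrib scl_mult_left scl_mult_right)
    finally show ?thesis .
  qed
  have hmu: "?u \<in> hm n n" and hmv: "?v \<in> hm n n" using hm_mult[OF alt_in_hm x(1)] hm_mult[OF x(1), of ?a] by simp_all
  have u: "alt n * ?u = ?u" "?u * x = ?u" by (simp_all add: xx mult.assoc)
  have v: "x * ?v = ?v" "?v * alt n = ?v"
    by (simp add: xx flip: mult.assoc) (simp add: mult.assoc left_diff_distrib scl_mult_left)
  have vu: "?v * ?u = x"
  proof -
    let ?p = "?v * ?u"
    have pp: "?p * ?p = ?p"
    proof -
      have "?p * ?p = ?v * (?u * ?v) * ?u" by (simp only: mult.assoc)
      then show ?thesis unfolding uv v(2) .
    qed
    have px: "?p * x = ?p" "x * ?p = ?p"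
      using u(2) v(1) by (simp_all add: mult.assoc) (simp flip: mult.assoc)
    \<comment> \<open>Primitivity applied to the orthogonal decomposition
      \<open>x = p + (x - p)\<close>.\<close>
    have gen: "p = 0 \<or> x - p = 0" if "p \<in> hm n n" "p * p = p" "p * x = p" "x * p = p" for p
      by (rule prim_x) (use that x xx in \<open>simp_all add: left_diff_distrib right_diff_distrib\<close>)
    have "?p = 0 \<or> x - ?p = 0" by (rule gen[OF hm_mult[OF hmv hmu] pp px])
    moreover have "?p \<noteq> 0"
    proof
      assume 0: "?p = 0"
      have "alt n = (?u * ?v) * (?u * ?v)" by (simp add: uv)
      also have "\<dots> = ?u * ?p * ?v" by (simp only: mult.assoc)
      finally show False using 0 by simp
    qed
    ultimately show ?thesis by simp
  qed
  have "X = ob [n] (sm x)" unfolding X x(2) by (rule obj_of_eq)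
  moreover have "idem [n] (sm x)" using x xx by (simp add: idem_def sm_mult)
  ultimately show thesis by (rule that[OF _ _ hmu hmv u v uv vu])
qed

section \<open>The path category of the line quiver\<close>

abbreviation PC :: "('f::field_char_0, nat, arrow list \<Rightarrow> 'f) lincat" where "PC \<equiv> path_cat line_quiver"
abbreviation pth :: "nat \<Rightarrow> arrow list \<Rightarrow> nat \<Rightarrow> bool" where "pth \<equiv> is_path line_quiver"
abbreviation LI :: "nat \<Rightarrow> nat \<Rightarrow> (arrow list \<Rightarrow> 'f::field_char_0) \<Rightarrow> bool" where
  "LI \<equiv> ideal_gen PC line_relations"

lemma line_quiver_sel [simp]:
  "verts line_quiver = UNIV" "arrows line_quiver = UNIV"
  "source line_quiver (Alpha n) = n" "source line_quiver (Beta n) = Suc n"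
  "target line_quiver (Alpha n) = Suc n" "target line_quiver (Beta n) = n"
  by (simp_all add: line_quiver_def)

lemma pth_append: "pth u q v \<Longrightarrow> pth v p w \<Longrightarrow> pth u (p @ q) w"
  by (induction p arbitrary: w) auto

lemma Hom_PC: "f \<in> Hom PC u v \<longleftrightarrow> finite {p. f p \<noteq> 0} \<and> (\<forall>p. f p \<noteq> 0 \<longrightarrow> pth u p v)"
  and Obj_PC [simp]: "Obj PC = UNIV"
  and Comp_PC: "Comp PC u v w g f = (\<lambda>p. \<Sum>k\<le>length p. g (take k p) * f (drop k p))"
  and Idn_PC: "Idn PC u = path_elem []"
  and Zer_PC: "Zer PC u v = (\<lambda>p. 0)"
  and Pls_PC: "Pls PC u v f g = (\<lambda>p. f p + g p)"
  and Scal_PC: "Scal PC u v c f = (\<lambda>p. c * f p)"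
  by (auto simp: path_cat_def path_elem_def)

lemma Hom_PC_zero [simp]: "(\<lambda>p. 0) \<in> Hom PC u v" by (simp add: Hom_PC)

lemma Hom_PC_path [simp]: "pth u p v \<Longrightarrow> path_elem p \<in> Hom PC u v"
  by (simp add: Hom_PC path_elem_def)

lemma Hom_PC_add [simp]: "f \<in> Hom PC u v \<Longrightarrow> g \<in> Hom PC u v \<Longrightarrow> (\<lambda>p. f p + g p) \<in> Hom PC u v"
  unfolding Hom_PC
proof (intro conjI allI impI; elim conjE)
  assume "finite {p. f p \<noteq> 0}" "finite {p. g p \<noteq> 0}"
  then show "finite {p. f p + g p \<noteq> 0}"
    by (rule finite_subset[rotated, OF finite_UnI]) auto
next
  fix p assume "\<forall>p. f p \<noteq> 0 \<longrightarrow> pth u p v" "\<forall>p. g p \<noteq> 0 \<longrightarrow> pth u p v" "f p + g p \<noteq> 0"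
  then show "pth u p v" by (cases "f p = 0") auto
qed

lemma Hom_PC_scale [simp]: "f \<in> Hom PC u v \<Longrightarrow> (\<lambda>p. c * f p) \<in> Hom PC u v"
  by (auto simp: Hom_PC elim: finite_subset[rotated])

lemma Hom_PC_diff [simp]: "f \<in> Hom PC u v \<Longrightarrow> g \<in> Hom PC u v \<Longrightarrow> (\<lambda>p. f p - g p) \<in> Hom PC u v"
  using Hom_PC_add[of f u v "\<lambda>p. -1 * g p"] Hom_PC_scale[of g u v "-1"] by simp

lemma Hom_PC_induct [consumes 1, case_names zero add scale path]:
  assumes f: "f \<in> Hom PC u v"
    and zero: "P (\<lambda>p. 0)" and add: "\<And>f g. f \<in> Hom PC u v \<Longrightarrow> g \<in> Hom PC u v \<Longrightarrow> P f \<Longrightarrow> P g \<Longrightarrow> P (\<lambda>p. f p + g p)"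
    and scale: "\<And>c f. f \<in> Hom PC u v \<Longrightarrow> P f \<Longrightarrow> P (\<lambda>p. c * f p)"
    and path: "\<And>p. pth u p v \<Longrightarrow> P (path_elem p)"
  shows "P f"
proof -
  have "P f" if "finite S" "{p. f p \<noteq> 0} = S" "f \<in> Hom PC u v" for S f
    using that
  proof (induction S arbitrary: f)
    case empty
    then have "f = (\<lambda>p. 0)" by auto
    then show ?case using zero by simp
  next
    case (insert q S)
    then have fq: "f q \<noteq> 0" by auto
    then have q: "pth u q v" using insert.prems(2) by (auto simp: Hom_PC)
    let ?g = "\<lambda>p. if p = q then 0 else f p"
    have s: "{p. ?g p \<noteq> 0} = S" using insert.prems(1) insert.hyps by auto
    have g: "?g \<in> Hom PC u v" unfolding Hom_PC s using insert by (auto simp: Hom_PC)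
    have "f = (\<lambda>p. ?g p + f q * path_elem q p)" by (auto simp: path_elem_def)
    moreover have "P (\<lambda>p. ?g p + f q * path_elem q p)"
      using add[OF g Hom_PC_scale[OF Hom_PC_path[OF q]] insert.IH[OF s g] scale[OF Hom_PC_path[OF q] path[OF q]]] .
    ultimately show ?case by simp
  qed
  then show ?thesis using f by (auto simp: Hom_PC)
qed

lemma Comp_PC_add_left: "Comp PC u v w (\<lambda>p. g p + g' p) f = (\<lambda>p. Comp PC u v w g f p + Comp PC u v w g' f p)"
  and Comp_PC_add_right: "Comp PC u v w g (\<lambda>p. f p + f' p) = (\<lambda>p. Comp PC u v w g f p + Comp PC u v w g f' p)"
  and Comp_PC_scale_left: "Comp PC u v w (\<lambda>p. c * g p) f = (\<lambda>p. c * Comp PC u v w g f p)"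
  and Comp_PC_scale_right: "Comp PC u v w g (\<lambda>p. c * f p) = (\<lambda>p. c * Comp PC u v w g f p)"
  and Comp_PC_diff_left: "Comp PC u v w (\<lambda>p. g p - g' p) f = (\<lambda>p. Comp PC u v w g f p - Comp PC u v w g' f p)"
  and Comp_PC_diff_right: "Comp PC u v w g (\<lambda>p. f p - f' p) = (\<lambda>p. Comp PC u v w g f p - Comp PC u v w g f' p)"
  and Comp_PC_zero_left: "Comp PC u v w (\<lambda>p. 0) f = (\<lambda>p. 0)"
  and Comp_PC_zero_right: "Comp PC u v w g (\<lambda>p. 0) = (\<lambda>p. 0)"
  by (simp_all add: Comp_PC algebra_simps sum.distrib sum_distrib_left sum_subtractf)

text \<open>A path \<open>r\<close> splits as \<open>p @ q\<close> in one place only, after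
  \<open>length p\<close> arrows.\<close>

lemma Comp_PC_path: "Comp PC u v w (path_elem p) (path_elem q) = path_elem (p @ q)"
proof
  fix r
  have "Comp PC u v w (path_elem p) (path_elem q) r =
      (\<Sum>k\<le>length r. if k = length p then if r = p @ q then 1 else 0 else 0)"
    unfolding Comp_PC
  proof (rule sum.cong[OF refl])
    fix k assume k: "k \<in> {..length r}"
    have "take k r = p \<and> drop k r = q \<longleftrightarrow> k = length p \<and> r = p @ q"
    proof (intro iffI conjI; elim conjE)
      assume "take k r = p" "drop k r = q"
      then show "k = length p" "r = p @ q" using k append_take_drop_id[of k r] by auto
    qed auto
    moreover have "path_elem p (take k r) * path_elem q (drop k r) = (if take k r = p \<and> drop k r = q then 1 else 0)"
      by (simp add: path_elem_def)
    ultimately show "path_elem p (take k r) * path_elem q (drop k r) = (if k = length p then if r = p @ q then 1 else 0 else 0)"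
      by (simp only: if_if_eq_conj)
  qed
  also have "\<dots> = path_elem (p @ q) r" by (auto simp: path_elem_def)
  finally show "Comp PC u v w (path_elem p) (path_elem q) r = path_elem (p @ q) r" .
qed

lemma Hom_PC_Comp:
  assumes g: "g \<in> Hom PC v w" and f: "f \<in> Hom PC u v" shows "Comp PC u v w g f \<in> Hom PC u w"
  using g
proof (induction rule: Hom_PC_induct)
  case (path p)
  note p = path
  show ?case using f
  proof (induction rule: Hom_PC_induct)
    case (path q)
    show ?case unfolding Comp_PC_path by (rule Hom_PC_path[OF pth_append[OF path p]])
  qed (simp_all add: Comp_PC_add_right Comp_PC_scale_right Comp_PC_zero_right)
qed (simp_all add: Comp_PC_add_left Comp_PC_scale_left Comp_PC_zero_left)

section \<open>Evaluation of paths in Deligne's category\<close>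

text \<open>The scalars turn \<open>be_al\<close> into the commutation relation of the quiver.\<close>

definition bb :: "nat \<Rightarrow> 'f::field_char_0 pal" where "bb n = scl ((- 1) ^ n * of_nat (Suc n)) (be n)"

lemma bb_hm [simp]: "bb n \<in> hm (Suc n) n" by (simp add: bb_def)

lemma al_bb: "al n * bb n = scl ((- 1) ^ n * of_nat (Suc n)) (xi (Suc n) :: 'f::field_char_0 pal)"
  by (simp add: bb_def xi_def scl_mult_right)

lemma bb_al: "bb n * al n = scl ((- 1) ^ Suc n * of_nat n) (xi n :: 'f::field_char_0 pal)"
proof -
  have "(of_nat (Suc n) :: 'f) \<noteq> 0" by (rule of_nat_neq_0)
  then show ?thesis by (simp add: bb_def scl_mult_left be_al del: of_nat_Suc)
qed

text \<open>The scalars \<open>c n = (-1)^n * (n + 1)\<close> in \<open>bb\<close> solve the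
  recursion \<open>c (n + 1) * (n + 1) / (n + 2) = - c n\<close> imposed by
  \<open>be_al\<close>.\<close>

lemma bb_al_comm: "bb (Suc n) * al (Suc n) = (al n * bb n :: 'f::field_char_0 pal)"
  unfolding al_bb bb_al by simp

lemma alt_bb [simp]: "alt n * bb n = bb n" and bb_alt [simp]: "bb n * alt (Suc n) = bb n"
  by (simp_all add: bb_def scl_mult_left scl_mult_right)

lemma bb_bb [simp]: "bb n * bb (Suc n) = (0 :: 'f::field_char_0 pal)"
  by (simp add: bb_def scl_mult_left scl_mult_right)

definition la :: "nat \<Rightarrow> nat \<Rightarrow> 'f::field_char_0 pal set" where
  "la n m = {a \<in> hm n m. alt m * a = a \<and> a * alt n = a}"

lemma la_simps [simp]: "alt n \<in> la n n" "al n \<in> la n (Suc n)" "bb n \<in> la (Suc n) n"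
  by (simp_all add: la_def)

lemma la_0 [simp]: "0 \<in> la n m"
  and la_add: "a \<in> la n m \<Longrightarrow> b \<in> la n m \<Longrightarrow> a + b \<in> la n m"
  and la_scl: "a \<in> la n m \<Longrightarrow> scl c a \<in> la n m"
  and la_mult: "b \<in> la m l \<Longrightarrow> a \<in> la n m \<Longrightarrow> b * a \<in> la n l"
  by (auto simp: la_def distrib_left distrib_right scl_mult_left scl_mult_right hm_mult mult.assoc)
    (simp flip: mult.assoc)

lemma la_hom_span: "a \<in> la n m \<Longrightarrow> a \<in> hom_span n m"
  using alt_mult_alt_in_span[of a n m] by (simp add: la_def)

fun arr :: "arrow \<Rightarrow> 'f::field_char_0 pal" where
  "arr (Alpha n) = al n"
| "arr (Beta n) = bb n"

text \<open>The source \<open>n\<close> is an argument because the empty path does not determine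
  it.\<close>

fun pv :: "nat \<Rightarrow> arrow list \<Rightarrow> 'f::field_char_0 pal" where
  "pv n [] = alt n"
| "pv n (a # p) = arr a * pv n p"

lemma arr_la: "(arr a :: 'a::field_char_0 pal) \<in> la (source line_quiver a) (target line_quiver a)" by (cases a) auto

lemma pv_la: "pth n p m \<Longrightarrow> (pv n p :: 'f::field_char_0 pal) \<in> la n m"
proof (induction p arbitrary: m)
  case (Cons a p)
  then have "(arr a :: 'f pal) \<in> la (source line_quiver a) m" "(pv n p :: 'f pal) \<in> la n (source line_quiver a)"
    using arr_la[of a, where 'a='f] by auto
  then show ?case by (simp add: la_mult)
qed simp

lemma pv_append: "pth n q m \<Longrightarrow> pv n (p @ q) = pv m p * (pv n q :: 'f::field_char_0 pal)"
  using pv_la[of n q m, where 'f='f] by (induction p) (auto simp: la_def mult.assoc)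

definition pval :: "nat \<Rightarrow> (arrow list \<Rightarrow> 'f::field_char_0) \<Rightarrow> 'f pal" where
  "pval n f = (\<Sum>p | f p \<noteq> 0. scl (f p) (pv n p))"

lemma pval_superset: "finite S \<Longrightarrow> {p. f p \<noteq> 0} \<subseteq> S \<Longrightarrow> pval n f = (\<Sum>p\<in>S. scl (f p) (pv n p))"
  unfolding pval_def by (rule sum.mono_neutral_left) auto

lemma pval_zero [simp]: "pval n (\<lambda>p. 0) = 0" by (simp add: pval_def)

lemma pval_path [simp]: "pval n (path_elem p) = (pv n p :: 'f::field_char_0 pal)"
  using pval_superset[of "{p}" "path_elem p :: arrow list \<Rightarrow> 'f" n] by (auto simp: path_elem_def)

lemma pval_add:
  assumes "f \<in> Hom PC n m" "g \<in> Hom PC n m" shows "pval n (\<lambda>p. f p + g p) = pval n f + pval n g"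
proof -
  let ?S = "{p. f p \<noteq> 0} \<union> {p. g p \<noteq> 0}"
  have S: "finite ?S" using assms by (auto simp: Hom_PC)
  have "pval n (\<lambda>p. f p + g p) = (\<Sum>p\<in>?S. scl (f p + g p) (pv n p))"
    "pval n f = (\<Sum>p\<in>?S. scl (f p) (pv n p))" "pval n g = (\<Sum>p\<in>?S. scl (g p) (pv n p))"
    by (rule pval_superset[OF S]; auto)+
  then show ?thesis by (simp add: pal.scale_left_distrib sum.distrib)
qed

lemma pval_scale:
  assumes "f \<in> Hom PC n m" shows "pval n (\<lambda>p. c * f p) = scl c (pval n f)"
proof -
  have S: "finite {p. f p \<noteq> 0}" using assms by (auto simp: Hom_PC)
  have "pval n (\<lambda>p. c * f p) = (\<Sum>p | f p \<noteq> 0. scl (c * f p) (pv n p))" by (rule pval_superset[OF S]) auto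
  then show ?thesis by (simp add: pval_def pal.scale_sum_right)
qed

lemma pval_diff:
  assumes "f \<in> Hom PC n m" "g \<in> Hom PC n m" shows "pval n (\<lambda>p. f p - g p) = pval n f - pval n g"
  using pval_add[OF assms(1) Hom_PC_scale[OF assms(2), of "-1"]] pval_scale[OF assms(2), of "-1"] by simp

lemma pval_la: "f \<in> Hom PC n m \<Longrightarrow> pval n f \<in> la n m"
  by (induction rule: Hom_PC_induct) (simp_all add: pval_add pval_scale la_add la_scl pv_la)

lemma pval_Comp:
  assumes g: "g \<in> Hom PC m l" and f: "f \<in> Hom PC n m"
  shows "pval n (Comp PC n m l g f) = pval m g * pval n f"
  using g
proof (induction rule: Hom_PC_induct)
  case (path p)
  show ?case using f
  proof (induction rule: Hom_PC_induct)
    case (path q)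
    then show ?case unfolding Comp_PC_path by (simp add: pv_append)
  next
    case (add f f')
    then show ?case
      by (simp add: Comp_PC_add_right pval_add[OF Hom_PC_Comp Hom_PC_Comp] pval_add path distrib_left)
  next
    case (scale c f)
    then show ?case
      by (simp add: Comp_PC_scale_right pval_scale[OF Hom_PC_Comp] pval_scale path scl_mult_right)
  qed (simp add: Comp_PC_zero_right)
next
  case (add g g')
  then show ?case by (simp add: Comp_PC_add_left pval_add[OF Hom_PC_Comp[OF _ f] Hom_PC_Comp[OF _ f]] pval_add distrib_right)
next
  case (scale c g)
  then show ?case by (simp add: Comp_PC_scale_left pval_scale[OF Hom_PC_Comp[OF _ f]] pval_scale scl_mult_left)
qed (simp add: Comp_PC_zero_left)

section \<open>The relations generate the kernel of the evaluation\<close>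

lemma LI_relations:
  "LI 0 0 (path_elem [Beta 0, Alpha 0])"
  "LI n (Suc (Suc n)) (path_elem [Alpha (Suc n), Alpha n])"
  "LI (Suc (Suc n)) n (path_elem [Beta n, Beta (Suc n)])"
  "LI (Suc n) (Suc n) (\<lambda>p. path_elem [Beta (Suc n), Alpha (Suc n)] p - path_elem [Alpha n, Beta n] p)"
  by (rule ideal_gen.gen; force simp: line_relations_def)+

lemma LI_zero: "LI n m (\<lambda>p. 0)" using ideal_gen.zer[of n PC m] by (simp add: Zer_PC)
lemma LI_add: "LI n m f \<Longrightarrow> LI n m g \<Longrightarrow> LI n m (\<lambda>p. f p + g p)" using ideal_gen.pls[of PC _ n m f g] by (simp add: Pls_PC)
lemma LI_scale: "LI n m f \<Longrightarrow> LI n m (\<lambda>p. c * f p)" using ideal_gen.scal[of PC _ n m f c] by (simp add: Scal_PC)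
lemma LI_left: "LI n m f \<Longrightarrow> g \<in> Hom PC m l \<Longrightarrow> LI n l (Comp PC n m l g f)" by (rule ideal_gen.left) auto
lemma LI_right: "LI m l g \<Longrightarrow> f \<in> Hom PC n m \<Longrightarrow> LI n l (Comp PC n m l g f)" by (rule ideal_gen.right) auto

lemma LI_kernel: "LI n m f \<Longrightarrow> f \<in> Hom PC n m \<and> pval n f = 0"
proof (induction rule: ideal_gen.induct)
  case (gen n m r)
  then consider "n = 0" "m = 0" "r = path_elem [Beta 0, Alpha 0]"
    | k where "n = k" "m = Suc (Suc k)" "r = path_elem [Alpha (Suc k), Alpha k]"
    | k where "n = Suc (Suc k)" "m = k" "r = path_elem [Beta k, Beta (Suc k)]"
    | k where "n = Suc k" "m = Suc k"
      "r = (\<lambda>p. path_elem [Beta (Suc k), Alpha (Suc k)] p - path_elem [Alpha k, Beta k] p)"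
    unfolding line_relations_def by (auto simp: gr0_conv_Suc)
  then show ?case
  proof cases
    case 1
    then show ?thesis by (simp add: bb_def scl_mult_left flip: mult.assoc)
  next
    case 2
    then show ?thesis by (simp flip: mult.assoc)
  next
    case 3
    then show ?thesis by (simp flip: mult.assoc)
  next
    case 4
    then show ?thesis by (simp add: pval_diff[where m="Suc k"] bb_al_comm)
  qed
next
  case (pls n m f g)
  then show ?case by (simp add: Pls_PC pval_add[where m=m])
next
  case (scal n m f c)
  then show ?case by (simp add: Scal_PC pval_scale[where m=m])
next
  case (left n m f l g)
  then show ?case by (simp add: Hom_PC_Comp pval_Comp)
next
  case (right m l f n g)
  then show ?case by (simp add: Hom_PC_Comp pval_Comp)
qed (simp add: Zer_PC)

section \<open>Normal forms of paths modulo the relations\<close>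

definition NF :: "nat \<Rightarrow> nat \<Rightarrow> (arrow list \<Rightarrow> 'f::field_char_0) set" where
  "NF n m = (if n = m then
      if n = 0 then {\<lambda>p. c * path_elem [] p |c. True}
      else {\<lambda>p. c * path_elem [] p + d * path_elem [Alpha (n - 1), Beta (n - 1)] p |c d. True}
    else if m = Suc n then {\<lambda>p. c * path_elem [Alpha n] p |c. True}
    else if n = Suc m then {\<lambda>p. c * path_elem [Beta m] p |c. True} else {\<lambda>p. 0})"

lemma NF_diag: "(\<lambda>p. c * path_elem [] p + d * path_elem [Alpha n, Beta n] p) \<in> NF (Suc n) (Suc n)"
  unfolding NF_def by auto

lemma NF_socle: "path_elem [Alpha n, Beta n] \<in> NF (Suc n) (Suc n)" using NF_diag[of 0 1 n] by simp

lemma NF_beta: "(\<lambda>p. c * path_elem [Beta n] p) \<in> NF (Suc n) n" unfolding NF_def by auto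

lemma NF_unit: "path_elem [] \<in> NF n n"
  using NF_diag[of 1 0] by (cases n) (auto simp: NF_def intro: exI[of _ 1])

lemma NF_zero: "(\<lambda>p. 0) \<in> NF n m"
proof (cases "m = n \<and> n \<noteq> 0")
  case True
  then obtain k where "n = Suc k" "m = Suc k" by (cases n) auto
  then show ?thesis using NF_diag[of 0 0 k] by simp
qed (auto simp: NF_def intro: exI[of _ 0])

lemma NF_scale: "f \<in> NF n m \<Longrightarrow> (\<lambda>p. c * f p) \<in> NF n m"
  by (auto simp: NF_def distrib_left mult.assoc[symmetric] split: if_splits) blast

lemma NF_add: "f \<in> NF n m \<Longrightarrow> g \<in> NF n m \<Longrightarrow> (\<lambda>p. f p + g p) \<in> NF n m"
proof -
  have 1: "\<exists>e. (\<lambda>p. c * h p + d * h p) = (\<lambda>p. e * h p)" for c d and h :: "arrow list \<Rightarrow> 'a"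
    by (rule exI[of _ "c + d"]) (simp add: distrib_right)
  have 2: "\<exists>e e'. (\<lambda>p. c * h p + c' * h' p + (d * h p + d' * h' p)) = (\<lambda>p. e * h p + e' * h' p)"
    for c d c' d' and h h' :: "arrow list \<Rightarrow> 'a"
    by (rule exI[of _ "c + d"], rule exI[of _ "c' + d'"]) (simp add: algebra_simps)
  show "f \<in> NF n m \<Longrightarrow> g \<in> NF n m \<Longrightarrow> (\<lambda>p. f p + g p) \<in> NF n m"
    unfolding NF_def by (auto simp: 1 2 split: if_splits)
qed

lemma NF_Hom: "f \<in> NF n m \<Longrightarrow> f \<in> Hom PC n m"
  by (auto simp: NF_def gr0_conv_Suc split: if_splits)

definition red :: "nat \<Rightarrow> nat \<Rightarrow> (arrow list \<Rightarrow> 'f::field_char_0) \<Rightarrow> bool" where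
  "red n m f \<longleftrightarrow> (\<exists>g\<in>NF n m. LI n m (\<lambda>p. f p - g p))"

lemma red_NF: "f \<in> NF n m \<Longrightarrow> red n m f"
  unfolding red_def by (rule bexI[of _ f]) (simp_all add: LI_zero)

lemma red_LI: "LI n m f \<Longrightarrow> red n m f"
  unfolding red_def by (rule bexI[OF _ NF_zero]) simp

lemma red_add:
  assumes "red n m f" "red n m g" shows "red n m (\<lambda>p. f p + g p)"
proof -
  from assms obtain f' g' where fg: "f' \<in> NF n m" "g' \<in> NF n m" "LI n m (\<lambda>p. f p - f' p)" "LI n m (\<lambda>p. g p - g' p)"
    unfolding red_def by blast
  have "(\<lambda>p. f p + g p - (f' p + g' p)) = (\<lambda>p. (f p - f' p) + (g p - g' p))" by (simp add: algebra_simps)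
  then show ?thesis unfolding red_def using NF_add[OF fg(1,2)] LI_add[OF fg(3,4)] by (intro bexI) simp_all
qed

lemma red_scale:
  assumes "red n m f" shows "red n m (\<lambda>p. c * f p)"
proof -
  from assms obtain f' where f: "f' \<in> NF n m" "LI n m (\<lambda>p. f p - f' p)" unfolding red_def by blast
  show ?thesis unfolding red_def
    using NF_scale[OF f(1), of c] LI_scale[OF f(2), of c] by (intro bexI) (simp_all add: right_diff_distrib)
qed

lemma red_shift:
  assumes "LI n m (\<lambda>p. f p - g p)" "red n m g" shows "red n m f"
  using red_add[OF red_LI[OF assms(1)] assms(2)] by simp

lemma red_arrow: "red (source line_quiver a) (target line_quiver a) (path_elem [a] :: _ \<Rightarrow> 'f::field_char_0)"
  by (rule red_NF) (cases a; auto simp: NF_def intro: exI[of _ 1])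

text \<open>A composable pair of arrows lies in the ideal, is the normal form
  \<open>[Alpha n, Beta n]\<close>, or is \<open>[Beta n, Alpha n]\<close>. The last is rewritten to
  a normal form by the commutation relation, except at the vertex 0, where it is itself a
  relation.\<close>

lemma red_two:
  assumes "source line_quiver a = target line_quiver b"
  shows "red (source line_quiver b) (target line_quiver a) (path_elem [a, b] :: _ \<Rightarrow> 'f::field_char_0)"
proof -
  consider n where "b = Alpha n" "a = Alpha (Suc n)" | n where "b = Beta (Suc n)" "a = Beta n"
    | n where "b = Beta n" "a = Alpha n" | n where "b = Alpha n" "a = Beta n"
    using assms by (cases a; cases b) auto
  then show ?thesis
  proof cases
    case 1
    then show ?thesis using red_LI[OF LI_relations(2)] by simp
  next
    case 2
    then show ?thesis using red_LI[OF LI_relations(3)] by simp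
  next
    case 3
    then show ?thesis using red_NF[OF NF_socle] by simp
  next
    case (4 n)
    show ?thesis
    proof (cases n)
      case 0
      then show ?thesis using 4 red_LI[OF LI_relations(1)] by simp
    next
      case (Suc k)
      then show ?thesis using 4 red_shift[OF LI_relations(4) red_NF[OF NF_socle]] by simp
    qed
  qed
qed

text \<open>After the socle path, a further \<open>Alpha\<close> meets an \<open>Alpha\<close>. A
  further \<open>Beta\<close> is commuted past, so that two \<open>Beta\<close> meet; at the vertex
  1 the relation \<open>[Beta 0, Alpha 0]\<close> applies directly.\<close>

lemma LI_arrow_socle:
  assumes "source line_quiver a = Suc n"
  shows "LI (Suc n) (target line_quiver a) (path_elem [a, Alpha n, Beta n] :: _ \<Rightarrow> 'f::field_char_0)"
proof -
  have b: "path_elem [Beta n] \<in> (Hom PC (Suc n) n :: (_ \<Rightarrow> 'f) set)" by (rule Hom_PC_path) simp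
  show ?thesis
  proof (cases a)
    case (Alpha k)
    then show ?thesis using LI_right[OF LI_relations(2) b] assms by (simp add: Comp_PC_path)
  next
    case (Beta k)
    then have a: "a = Beta n" using assms by simp
    show ?thesis
    proof (cases n)
      case 0
      then show ?thesis using LI_right[OF LI_relations(1) b[unfolded 0]] unfolding a by (simp add: Comp_PC_path)
    next
      case (Suc k)
      have "LI (Suc n) n (\<lambda>p. path_elem [Beta n, Alpha n, Beta n] p - path_elem [Alpha k, Beta k, Beta n] p :: 'f)"
        using LI_right[OF LI_relations(4)[of k] b[unfolded Suc]] unfolding Suc by (simp add: Comp_PC_diff_left Comp_PC_path)
      moreover have "LI (Suc n) n (path_elem [Alpha k, Beta k, Beta n] :: _ \<Rightarrow> 'f)"
        using LI_left[OF LI_relations(3)[of k] Hom_PC_path[of k "[Alpha k]" "Suc k"]] unfolding Suc by (simp add: Comp_PC_path)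
      ultimately show ?thesis unfolding a using LI_add by fastforce
    qed
  qed
qed

text \<open>Induction along the path: normal forms involve at most two arrows, so composing with one
  more arrow is covered by \<open>red_arrow\<close>, \<open>red_two\<close> and
  \<open>LI_arrow_socle\<close>.\<close>

lemma red_path: "pth n p m \<Longrightarrow> red n m (path_elem p :: _ \<Rightarrow> 'f::field_char_0)"
proof (induction p arbitrary: m)
  case Nil
  then show ?case using red_NF[OF NF_unit] by auto
next
  case (Cons a p)
  let ?k = "source line_quiver a"
  have m: "m = target line_quiver a" using Cons.prems by simp
  obtain g :: "_ \<Rightarrow> 'f" where g: "g \<in> NF n ?k" "LI n ?k (\<lambda>q. path_elem p q - g q)"
    using Cons unfolding red_def by auto
  have a: "path_elem [a] \<in> (Hom PC ?k m :: (_ \<Rightarrow> 'f) set)" by (simp add: m)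
  let ?C = "Comp PC n ?k m (path_elem [a])"
  have sh: "LI n m (\<lambda>q. path_elem (a # p) q - ?C g q)"
    using LI_left[OF g(2) a] by (simp add: Comp_PC_diff_right Comp_PC_path)
  have "red n m (?C g)"
  proof -
    consider "n = ?k" | "?k = Suc n" | "n = Suc ?k" | "g = (\<lambda>p. 0)" using g(1) unfolding NF_def by (auto split: if_splits)
    then show ?thesis
    proof cases
      case 1
      note r = red_arrow[of a, folded m 1, where 'f='f]
      show ?thesis
      proof (cases n)
        case 0
        then obtain c where "g = (\<lambda>p. c * path_elem [] p)" using g(1) 1 by (auto simp: NF_def)
        then show ?thesis using red_scale[OF r] by (simp add: Comp_PC_scale_right Comp_PC_path)
      next
        case (Suc j)
        then obtain c d where "g = (\<lambda>p. c * path_elem [] p + d * path_elem [Alpha j, Beta j] p)"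
          using g(1) 1 by (auto simp: NF_def)
        moreover have "red n m (path_elem [a, Alpha j, Beta j] :: _ \<Rightarrow> 'f)"
          unfolding Suc m by (rule red_LI[OF LI_arrow_socle]) (use 1 Suc in simp)
        ultimately show ?thesis using red_add[OF red_scale[OF r] red_scale]
          by (simp add: Comp_PC_add_right Comp_PC_scale_right Comp_PC_path)
      qed
    next
      case 2
      then obtain c where "g = (\<lambda>p. c * path_elem [Alpha n] p)" using g(1) by (auto simp: NF_def)
      then show ?thesis using red_scale[OF red_two[of a "Alpha n"]] 2 m by (simp add: Comp_PC_scale_right Comp_PC_path)
    next
      case 3
      then obtain c where "g = (\<lambda>p. c * path_elem [Beta ?k] p)" using g(1) by (auto simp: NF_def)
      then show ?thesis using red_scale[OF red_two[of a "Beta ?k"]] 3 m by (simp add: Comp_PC_scale_right Comp_PC_path)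
    next
      case 4
      then show ?thesis by (simp add: Comp_PC_zero_right red_NF[OF NF_zero])
    qed
  qed
  from red_shift[OF sh this] show ?case .
qed

lemma red_Hom: "f \<in> Hom PC n m \<Longrightarrow> red n m f"
  by (induction rule: Hom_PC_induct) (simp_all add: red_NF NF_zero red_add red_scale red_path)

lemma al_neq_0 [simp]: "al n \<noteq> (0 :: 'f::field_char_0 pal)" and bb_neq_0 [simp]: "bb n \<noteq> (0 :: 'f pal)"
proof -
  have xi: "al n * be n \<noteq> (0 :: 'f pal)" using xi_Suc_neq_0[of n, where 'f='f] by (simp add: xi_def)
  then show "al n \<noteq> (0 :: 'f pal)" by auto
  have "be n \<noteq> (0 :: 'f pal)" using xi by auto
  moreover have "(of_nat (Suc n) :: 'f) \<noteq> 0" by (rule of_nat_neq_0)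
  ultimately show "bb n \<noteq> (0 :: 'f pal)" by (simp add: bb_def del: of_nat_Suc)
qed

lemma pval_NF_diag:
  "pval (Suc n) (\<lambda>p. c * path_elem [] p + d * path_elem [Alpha n, Beta n] p) =
    scl c (alt (Suc n)) + scl (d * ((- 1) ^ n * of_nat (Suc n))) (xi (Suc n) :: 'f::field_char_0 pal)"
proof -
  have "(path_elem [Alpha n, Beta n] :: _ \<Rightarrow> 'f) \<in> Hom PC (Suc n) (Suc n)" by (rule Hom_PC_path) simp
  moreover have "(path_elem [] :: _ \<Rightarrow> 'f) \<in> Hom PC (Suc n) (Suc n)" by (rule Hom_PC_path) simp
  ultimately show ?thesis by (simp add: pval_add[where m="Suc n"] pval_scale[where m="Suc n"] al_bb del: of_nat_Suc)
qed

lemma pval_NF_single: "pth n q m \<Longrightarrow> pval n (\<lambda>p. c * path_elem q p) = scl c (pv n q)"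
  using pval_scale[OF Hom_PC_path] by simp

lemma pv_arrow: "pv n [Alpha n] = al n" "pv (Suc n) [Beta n] = (bb n :: 'f::field_char_0 pal)"
  by simp_all

text \<open>Up to nonzero scalars the basic normal forms evaluate to \<open>alt\<close>,
  \<open>xi\<close>, \<open>al\<close> and \<open>bb\<close>, which are linearly independent in each
  hom space.\<close>

lemma pval_NF_eq_0:
  assumes g: "g \<in> NF n m" and 0: "pval n g = (0 :: 'f::field_char_0 pal)"
  shows "g = (\<lambda>p. 0)"
proof -
  consider "n = 0" "m = 0" | k where "n = Suc k" "m = Suc k" | "m = Suc n" | "n = Suc m" | "g = (\<lambda>p. 0)"
    using g unfolding NF_def by (cases n) (auto split: if_splits)
  then show ?thesis
  proof cases
    case 1
    then obtain c where c: "g = (\<lambda>p. c * path_elem [] p)" using g by (auto simp: NF_def)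
    have "scl c (alt 0 :: 'f pal) = 0" using 0 pval_NF_single[of 0 "[]" 0 c] 1 c by simp
    then show ?thesis using c by simp
  next
    case (2 k)
    then obtain c d where c: "g = (\<lambda>p. c * path_elem [] p + d * path_elem [Alpha k, Beta k] p)" using g by (auto simp: NF_def)
    have e: "scl c (alt (Suc k)) + scl (d * ((- 1) ^ k * of_nat (Suc k))) (xi (Suc k)) = (0 :: 'f pal)"
      using 0 unfolding c 2 pval_NF_diag .
    have "(of_nat (Suc k) :: 'f) \<noteq> 0" by (rule of_nat_neq_0)
    then have "c = 0" "d = 0" using alt_xi_independent[OF e] xi_Suc_neq_0[of k, where 'f='f] by (simp_all del: of_nat_Suc)
    then show ?thesis using c by simp
  next
    case 3
    then obtain c where c: "g = (\<lambda>p. c * path_elem [Alpha n] p)" using g by (auto simp: NF_def)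
    have "scl c (al n :: 'f pal) = 0" using 0 pval_NF_single[of n "[Alpha n]" "Suc n" c] c unfolding pv_arrow by simp
    then show ?thesis using c by simp
  next
    case 4
    then obtain c where c: "g = (\<lambda>p. c * path_elem [Beta m] p)" using g by (auto simp: NF_def)
    have "scl c (bb m :: 'f pal) = 0" using 0 pval_NF_single[of "Suc m" "[Beta m]" m c] c 4 unfolding pv_arrow by simp
    then show ?thesis using c by simp
  qed
qed

text \<open>Modulo the ideal, which evaluates to zero, every morphism is a normal form, and on
  normal forms evaluation is injective.\<close>

lemma LI_iff: "LI n m f \<longleftrightarrow> f \<in> Hom PC n m \<and> pval n f = (0 :: 'f::field_char_0 pal)"
proof
  assume f: "f \<in> Hom PC n m \<and> pval n f = 0"
  then obtain g where g: "g \<in> NF n m" "LI n m (\<lambda>p. f p - g p)" using red_Hom unfolding red_def by blast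
  have "pval n f - pval n g = 0"
    using LI_kernel[OF g(2)] pval_diff[of f n m g] f NF_Hom[OF g(1)] by simp
  then have "g = (\<lambda>p. 0)" using f pval_NF_eq_0[OF g(1)] by simp
  then show "LI n m f" using g(2) by simp
qed (rule LI_kernel)

text \<open>The normal forms reach the spanning elements \<open>alt\<close>, \<open>xi\<close>,
  \<open>al\<close> and \<open>be\<close> once the nonzero scalars \<open>(-1)^k * (k + 1)\<close>
  are divided out.\<close>

lemma pval_surj:
  assumes "a \<in> la n m" obtains f where "f \<in> Hom PC n m" "pval n f = (a :: 'f::field_char_0 pal)"
proof -
  have "\<exists>f\<in>NF n m. pval n f = a"
  proof -
    consider "n = 0" "m = 0" | k where "n = Suc k" "m = Suc k" | "m = Suc n" | "n = Suc m" | "a = 0"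
      using la_hom_span[OF assms] unfolding hom_span_def by (cases n) (auto split: if_splits)
    then show ?thesis
    proof cases
      case 1
      then obtain c where a: "a = scl c (alt 0)" using la_hom_span[OF assms] by (auto simp: hom_span_def xi_def)
      have "(\<lambda>p. c * path_elem [] p) \<in> NF n m" using 1 by (auto simp: NF_def)
      moreover have "pval n (\<lambda>p. c * path_elem [] p) = a" using pval_NF_single[of 0 "[]" 0 c] 1 a by simp
      ultimately show ?thesis by blast
    next
      case (2 k)
      then obtain c d where a: "a = scl c (alt n) + scl d (xi n)" using la_hom_span[OF assms] by (auto simp: hom_span_def)
      let ?e = "(- 1) ^ k * of_nat (Suc k) :: 'f"
      let ?f = "\<lambda>p. c * path_elem [] p + d / ?e * path_elem [Alpha k, Beta k] p"
      have "?e \<noteq> 0" using of_nat_neq_0[of k, where 'a='f] by (simp del: of_nat_Suc)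
      then have "pval n ?f = a" unfolding a 2 pval_NF_diag by simp
      moreover have "?f \<in> NF n m" unfolding 2 by (rule NF_diag)
      ultimately show ?thesis by blast
    next
      case 3
      then obtain c where a: "a = scl c (al n)" using la_hom_span[OF assms] by (auto simp: hom_span_def)
      have "(\<lambda>p. c * path_elem [Alpha n] p) \<in> NF n m" using 3 by (auto simp: NF_def)
      moreover have "pval n (\<lambda>p. c * path_elem [Alpha n] p) = a"
        using pval_NF_single[of n "[Alpha n]" "Suc n" c] a unfolding pv_arrow by simp
      ultimately show ?thesis by blast
    next
      case 4
      then obtain c where a: "a = scl c (be m)" using la_hom_span[OF assms] by (auto simp: hom_span_def)
      let ?e = "(- 1) ^ m * of_nat (Suc m) :: 'f"
      have "?e \<noteq> 0" using of_nat_neq_0[of m, where 'a='f] by (simp del: of_nat_Suc)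
      then have "scl (c / ?e) (bb m) = a" unfolding a bb_def by (simp del: of_nat_Suc)
      then have "pval n (\<lambda>p. c / ?e * path_elem [Beta m] p) = a"
        using pval_NF_single[of "Suc m" "[Beta m]" m "c / ?e"] 4 unfolding pv_arrow by simp
      moreover have "(\<lambda>p. c / ?e * path_elem [Beta m] p) \<in> NF n m" unfolding 4 by (rule NF_beta)
      ultimately show ?thesis by blast
    next
      case 5
      then show ?thesis using NF_zero[of n m] by (intro bexI) simp_all
    qed
  qed
  then show thesis using NF_Hom that by blast
qed

text \<open>The morphisms of \<open>quiver_cat line_quiver line_relations\<close> are the fibres of \<open>pval\<close>.\<close>

definition fib :: "nat \<Rightarrow> nat \<Rightarrow> 'f::field_char_0 pal \<Rightarrow> (arrow list \<Rightarrow> 'f) set" where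
  "fib n m a = {f \<in> Hom PC n m. pval n f = a}"

abbreviation QC :: "('f::field_char_0, nat, (arrow list \<Rightarrow> 'f) set) lincat" where
  "QC \<equiv> quiver_cat line_quiver line_relations"

lemma fib_nonempty: "(a :: 'f::field_char_0 pal) \<in> la n m \<Longrightarrow> fib n m a \<noteq> {}"
  by (rule pval_surj[of a n m]) (auto simp: fib_def)

lemma coset_fib: "f \<in> Hom PC n m \<Longrightarrow> coset PC LI n m f = fib n m (pval n f :: 'f::field_char_0 pal)"
proof (intro subset_antisym subsetI)
  fix h assume f: "f \<in> Hom PC n m" and "h \<in> coset PC LI n m f"
  then obtain k where k: "h = (\<lambda>p. f p + k p)" "LI n m k" by (auto simp: coset_def Pls_PC)
  then show "h \<in> fib n m (pval n f)" using f LI_kernel[OF k(2)] by (simp add: fib_def pval_add)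
next
  fix h assume f: "f \<in> Hom PC n m" and h: "h \<in> fib n m (pval n f)"
  then have "LI n m (\<lambda>p. h p - f p)" by (simp add: LI_iff fib_def pval_diff[where m=m])
  moreover have "h = Pls PC n m f (\<lambda>p. h p - f p)" by (simp add: Pls_PC)
  ultimately show "h \<in> coset PC LI n m f" unfolding coset_def by blast
qed

lemma Obj_QC: "Obj QC = UNIV"
  and Hom_QC: "Hom QC n m = fib n m ` (la n m :: 'f::field_char_0 pal set)"
  and Idn_QC: "Idn QC n = fib n n (alt n :: 'f pal)"
  and Comp_QC: "b \<in> la m l \<Longrightarrow> a \<in> la n m \<Longrightarrow> Comp QC n m l (fib m l b) (fib n m a) = fib n l (b * a :: 'f pal)"
  and Pls_QC: "a \<in> la n m \<Longrightarrow> a' \<in> la n m \<Longrightarrow> Pls QC n m (fib n m a) (fib n m a') = fib n m (a + a' :: 'f pal)"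
  and Scal_QC: "a \<in> la n m \<Longrightarrow> Scal QC n m c (fib n m a) = fib n m (scl c a :: 'f pal)"
proof -
  show "Obj QC = UNIV" by (simp add: quiver_cat_def quotient_cat_def)
  have "Hom QC n m = coset PC LI n m ` Hom PC n m" by (simp add: quiver_cat_def quotient_cat_def)
  also have "\<dots> = (\<lambda>f. fib n m (pval n f :: 'f pal)) ` Hom PC n m" by (rule image_cong[OF refl coset_fib])
  also have "\<dots> = fib n m ` (pval n ` Hom PC n m)" by (simp add: image_image)
  also have "pval n ` Hom PC n m = (la n m :: 'f pal set)"
    using pval_la pval_surj by (metis (no_types, lifting) image_eqI image_subsetI subsetI subset_antisym)
  finally show "Hom QC n m = fib n m ` (la n m :: 'f pal set)" .
  have "coset PC LI n n (path_elem [] :: _ \<Rightarrow> 'f) = fib n n (pval n (path_elem []))"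
    by (rule coset_fib[OF Hom_PC_path]) simp
  then show "Idn QC n = fib n n (alt n :: 'f pal)" by (simp add: quiver_cat_def quotient_cat_def Idn_PC)
  show "Comp QC n m l (fib m l b) (fib n m a) = fib n l (b * a :: 'f pal)" if "b \<in> la m l" "a \<in> la n m"
  proof -
    have "coset PC LI n l (Comp PC n m l g f) = fib n l (b * a)" if "g \<in> fib m l b" "f \<in> fib n m a" for g f
      using that by (simp add: coset_fib fib_def Hom_PC_Comp pval_Comp)
    then show ?thesis using fib_nonempty[OF that(1)] fib_nonempty[OF that(2)]
      by (simp add: quiver_cat_def quotient_cat_def)
  qed
  show "Pls QC n m (fib n m a) (fib n m a') = fib n m (a + a' :: 'f pal)" if "a \<in> la n m" "a' \<in> la n m"
  proof -
    have "coset PC LI n m (Pls PC n m f g) = fib n m (a + a')" if "f \<in> fib n m a" "g \<in> fib n m a'" for g f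
      using that by (simp add: coset_fib fib_def Pls_PC pval_add[where m=m])
    then show ?thesis using fib_nonempty[OF that(1)] fib_nonempty[OF that(2)]
      by (simp add: quiver_cat_def quotient_cat_def)
  qed
  show "Scal QC n m c (fib n m a) = fib n m (scl c a :: 'f pal)" if "a \<in> la n m"
  proof -
    have "coset PC LI n m (Scal PC n m c f) = fib n m (scl c a)" if "f \<in> fib n m a" for f
      using that by (simp add: coset_fib fib_def Scal_PC pval_scale[where m=m])
    then show ?thesis using fib_nonempty[OF that] by (simp add: quiver_cat_def quotient_cat_def)
  qed
qed

text \<open>Evaluation is constant on a fibre, so the choice of the representative does not
  matter.\<close>

definition fib_val :: "nat \<Rightarrow> (arrow list \<Rightarrow> 'f::field_char_0) set \<Rightarrow> 'f pal" where
  "fib_val n F = pval n (SOME f. f \<in> F)"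

lemma fib_val: "(a :: 'f::field_char_0 pal) \<in> la n m \<Longrightarrow> fib_val n (fib n m a) = a"
  using someI_ex[of "\<lambda>f. f \<in> fib n m a"] fib_nonempty[of a n m] unfolding fib_val_def by (auto simp: fib_def)

theorem theorem6p4:
  fixes L :: "nat \<Rightarrow> 'f::field_char_0 rep_obj"
  assumes "\<And>n. is_L 0 (replicate n 1) (L n)"
  shows "\<exists>B. nontrivial_block (rep_S (0::'f)) B \<and>
             described_by (rep_S (0::'f)) B L line_quiver line_relations"
proof -
  have "\<exists>x u v. L n = ob [n] (sm x) \<and> idem [n] (sm x) \<and> u \<in> hm n n \<and> v \<in> hm n n \<and>
      alt n * u = u \<and> u * x = u \<and> x * v = v \<and> v * alt n = v \<and> u * v = alt n \<and> v * u = x" for n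
    by (rule is_L_column[OF assms]) blast
  then obtain x u v where L: "L n = ob [n] (sm (x n))" and idem: "idem [n] (sm (x n))"
    and hm: "u n \<in> hm n n" "v n \<in> hm n n"
    and u: "alt n * u n = u n" "u n * x n = u n" and v: "x n * v n = v n" "v n * alt n = v n"
    and uv: "u n * v n = alt n" and vu: "v n * u n = x n" for n
    by metis
  \<comment> \<open>Conjugation by the isomorphisms between \<open>L n\<close> and
    \<open>Lam n\<close>.\<close>
  let ?f = "\<lambda>n m a. v m * a * u n"
  have iso: "iso_class K (L n) = iso_class K (Lam n)" for n
  proof (rule iso_class_eq)
    show "L n \<in> Obj K" unfolding L by (rule ob_Obj[OF idem])
    have "sm (u n) \<in> hs [n] (sm (x n)) [n] (La n)" "sm (v n) \<in> hs [n] (La n) [n] (sm (x n))"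
      by (simp_all add: hs_def sm_mult hm u v)
    moreover have "sm (v n) * sm (u n) = sm (x n)" "sm (u n) * sm (v n) = La n" by (simp_all add: sm_mult uv vu)
    ultimately show "isomorphic K (L n) (Lam n)"
      unfolding L isomorphic_K[OF idem idem_La] by blast
  qed simp
  have bij: "bij_betw (\<lambda>n. iso_class K (L n)) (verts line_quiver) blk" unfolding iso using blk_bij by simp
  \<comment> \<open>The underlying lists \<open>[n]\<close> already distinguish the objects.\<close>
  have inj: "inj L" by (rule injI) (simp add: L ob_def)
  have f_in: "?f n m a \<in> hm n m" if "a \<in> la n m" for n m a
    using that hm_mult[OF hm_mult[OF hm(2)] hm(1)] by (auto simp: la_def)
  have f_mult: "?f m l b * ?f n m a = ?f n l (b * a)" if "a \<in> la n m" for n m l a b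
  proof -
    have "?f m l b * ?f n m a = v l * b * ((u m * v m) * a) * u n" by (simp only: mult.assoc)
    also have "(u m * v m) * a = a" using that unfolding uv by (simp add: la_def)
    finally show ?thesis by (simp only: mult.assoc)
  qed
  have f_inj: "a = b" if "a \<in> la n m" "b \<in> la n m" "?f n m a = ?f n m b" for n m a b
  proof -
    have "u m * ?f n m c * v n = c" if "c \<in> la n m" for c
    proof -
      have "u m * ?f n m c * v n = (u m * v m) * c * (u n * v n)" by (simp only: mult.assoc)
      then show ?thesis using that unfolding uv by (simp add: la_def)
    qed
    then show ?thesis using that by metis
  qed
  have f_hs: "(\<lambda>a. sm (?f n m a)) ` la n m = hs [n] (sm (x n)) [m] (sm (x m))" for n m
  proof (intro subset_antisym subsetI)
    fix y assume "y \<in> (\<lambda>a. sm (?f n m a)) ` la n m"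
    then obtain a where a: "a \<in> la n m" "y = sm (?f n m a)" by blast
    have "x m * ?f n m a = (x m * v m) * a * u n" "?f n m a * x n = v m * a * (u n * x n)" by (simp_all only: mult.assoc)
    then show "y \<in> hs [n] (sm (x n)) [m] (sm (x m))" unfolding a u v by (simp add: hs_def sm_mult f_in[OF a(1)])
  next
    fix y assume y: "y \<in> hs [n] (sm (x n)) [m] (sm (x m))"
    obtain z where z: "z \<in> hm n m" "y = sm z" by (rule HM_single[OF hs_HM[OF y]]) (rule that)
    have zx: "x m * z = z" "z * x n = z" using y by (simp_all add: z(2) hs_def sm_mult)
    have "alt m * (u m * z * v n) = (alt m * u m) * z * v n" "(u m * z * v n) * alt n = u m * z * (v n * alt n)"
      by (simp_all only: mult.assoc)
    then have "u m * z * v n \<in> la n m" unfolding u v by (simp add: la_def hm_mult[OF hm_mult[OF hm(1) z(1)] hm(2)])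
    moreover have "?f n m (u m * z * v n) = z"
    proof -
      have "?f n m (u m * z * v n) = (v m * u m) * z * (v n * u n)" by (simp only: mult.assoc)
      then show ?thesis unfolding vu by (simp add: zx)
    qed
    ultimately show "y \<in> (\<lambda>a. sm (?f n m a)) ` la n m" unfolding z(2) by force
  qed
  let ?E = "\<lambda>n m a. enc [n] [m] (sm (?f n m a))"
  let ?\<Phi> = "\<lambda>n m F. ?E n m (fib_val n F)"
  have HomL: "Hom K (L n) (L m) = ?E n m ` la n m" for n m
    unfolding L Hom_K[OF idem idem] f_hs[symmetric] by (simp add: image_image)
  have E_inj: "inj_on (?E n m) (la n m)" for n m
  proof (rule inj_onI)
    fix a b assume ab: "a \<in> la n m" "b \<in> la n m" "?E n m a = ?E n m b"
    have "sm (?f n m a) = sm (?f n m b)" by (rule enc_inj[OF _ _ ab(3)]) (simp_all add: f_in ab)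
    then show "a = b" using f_inj[OF ab(1,2)] by simp
  qed
  let ?D = "full_subcat K (range L)"
  have D: "Obj ?D = range L" "Hom ?D = Hom K" "Comp ?D = Comp K" "Idn ?D = Idn K" "Pls ?D = Pls K" "Scal ?D = Scal K"
    by (simp_all add: full_subcat_def)
  have "lincat_iso QC ?D L ?\<Phi>"
    unfolding lincat_iso_def Obj_QC D
  proof (intro conjI ballI allI)
    show "bij_betw L UNIV (range L)" using inj by (simp add: bij_betw_def)
    fix n
    show "?\<Phi> n n (Idn QC n) = Idn K (L n)"
      unfolding Idn_QC L Idn_K by (simp add: fib_val[where m=n] v vu)
    fix m
    show "bij_betw (?\<Phi> n m) (Hom QC n m) (Hom K (L n) (L m))"
      unfolding bij_betw_def Hom_QC HomL
    proof
      show "inj_on (?\<Phi> n m) (fib n m ` la n m)"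
        using E_inj[of n m] by (auto simp: inj_on_def fib_val)
      show "?\<Phi> n m ` fib n m ` la n m = ?E n m ` la n m"
        unfolding image_image by (rule image_cong[OF refl]) (simp add: fib_val)
    qed
    fix F :: "(arrow list \<Rightarrow> 'f) set" assume "F \<in> Hom QC n m"
    then obtain a where a: "a \<in> la n m" "F = fib n m a" by (auto simp: Hom_QC)
    show "?\<Phi> n m (Scal QC n m c F) = Scal K (L n) (L m) c (?\<Phi> n m F)" for c
      unfolding a(2) Scal_QC[OF a(1)] fib_val[OF la_scl[OF a(1)]] fib_val[OF a(1)] L Scal_K Scal_AE sm_scl[symmetric]
      by (simp add: scl_mult_left scl_mult_right)
    show "?\<Phi> n m (Pls QC n m F G) = Pls K (L n) (L m) (?\<Phi> n m F) (?\<Phi> n m G)" if "G \<in> Hom QC n m" for G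
    proof -
      obtain b where b: "b \<in> la n m" "G = fib n m b" using \<open>G \<in> Hom QC n m\<close> by (auto simp: Hom_QC)
      show ?thesis
        unfolding a(2) b(2) Pls_QC[OF a(1) b(1)] fib_val[OF la_add[OF a(1) b(1)]] fib_val[OF a(1)] fib_val[OF b(1)]
          L Pls_K Pls_AE sm_add[symmetric]
        by (simp add: distrib_left distrib_right)
    qed
    fix l and G :: "(arrow list \<Rightarrow> 'f) set" assume "G \<in> Hom QC m l"
    then obtain b where b: "b \<in> la m l" "G = fib m l b" by (auto simp: Hom_QC)
    have "Comp AE [n] [m] [l] (?E m l b) (?E n m a) = enc [n] [l] (sm (?f m l b) * sm (?f n m a))"
      by (rule Comp_AE) (simp_all add: f_in a b)
    then show "?\<Phi> n l (Comp QC n m l G F) = Comp K (L n) (L m) (L l) (?\<Phi> m l G) (?\<Phi> n m F)"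
      unfolding a(2) b(2) Comp_QC[OF b(1) a(1)] fib_val[OF la_mult[OF b(1) a(1)]] fib_val[OF a(1)] fib_val[OF b(1)]
        L Comp_K sm_mult f_mult[OF a(1)] by simp
  qed
  then have "described_by K blk L line_quiver line_relations"
    unfolding described_by_def using bij by auto
  then show ?thesis using blk_nontrivial by blast
qed

end
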